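(* Let $(\mathcal{M},\otimes,\mathbf{1},\sigma)$ be an abelian symmetric monoidal category that satisfies the faithful coflatness condition and the faithful flatness condition. Then the category $\mathsf{Hopf}_{\mathrm{coc}}(\mathcal{M})$ of cocommutative Hopf monoids in $\mathcal{M}$ is (Barr-)exact and homological. As a consequence, if $\mathsf{Hopf}_{\mathrm{coc}}(\mathcal{M})$ has binary coproducts, then it is a semi-abelian category.
   Context: Associativity and unit constraints are suppressed. An abelian symmetric monoidal category is a symmetric monoidal category $(\mathcal{M},\otimes,\mathbf{1},\sigma)$ such that $\mathcal{M}$ is abelian and, for every object $M$, the functors $M\otimes(-)$ and $(-)\otimes M$ are additive and exact. $\mathsf{Hopf}_{\mathrm{coc}}(\mathcal{M})$: objects are Hopf monoids $(A,m_A,u_A,\Delta_A,\varepsilon_A,S_A)$ in $\mathcal{M}$ with $\sigma_{A,A}\Delta_A=\Delta_A$; morphisms are morphisms of Hopf monoids (equivalently, of bimonoids). For $A$ in $\mathsf{Hopf}_{\mathrm{coc}}(\mathcal{M})$, the category $\mathsf{Comon}_{\mathrm{coc}}({}_A\mathcal{M})$ has as objects the cocommutative comonoids $Q$ in $\mathcal{M}$ with a left $A$-action $\mu_Q:A\otimes Q\to Q$ such that $\Delta_Q,\varepsilon_Q$ are left $A$-linear, where $Q\otimes Q$ has action $(\mu_Q\otimes\mu_Q)(\mathrm{Id}_A\otimes\sigma_{A,Q}\otimes\mathrm{Id}_Q)(\Delta_A\otimes\mathrm{Id}_{Q\otimes Q})$ and $\mathbf{1}$ has action $\varepsilon_A$;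 morphisms are the left $A$-linear comonoid morphisms. $A$ is an object of it via $m_A$. Cotensor product: for a right $Q$-comodule $(V,\rho_V)$ and a left $Q$-comodule $(W,\lambda_W)$, $V\square_Q W$ is the equalizer in $\mathcal{M}$ of $\rho_V\otimes\mathrm{Id}_W,\ \mathrm{Id}_V\otimes\lambda_W: V\otimes W\to V\otimes Q\otimes W$. This gives functors $(-)\square_Q W:\mathcal{M}^Q\to\mathcal{M}$, where $\mathcal{M}^Q$ is the category of right $Q$-comodules. Balanced tensor product: for a monoid $K$, a right $K$-module $(M,\nu_M)$ and a left $K$-module $(X,\mu_X)$, $M\otimes_K X$ is the coequalizer in $\mathcal{M}$ of $\nu_M\otimes\mathrm{Id}_X,\ \mathrm{Id}_M\otimes\mu_X:M\otimes K\otimes X\to M\otimes X$. This gives functors $(-)\otimes_K X:\mathcal{M}_K\to\mathcal{M}$, where $\mathcal{M}_K$ is the category of right $K$-modules. Faithful coflatness condition: for any $A$ in $\mathsf{Hopf}_{\mathrm{coc}}(\mathcal{M})$ and any morphism $\pi:A\to Q$ in $\mathsf{Comon}_{\mathrm{coc}}({}_A\mathcal{M})$ which is an epimorphism in $\mathcal{M}$, the functor $(-)\square_Q A$ preserves and reflects epimorphisms, where $A$ is a left $Q$-comodule via $(\pi\otimes\mathrm{Id}_A)\Delta_A$. Faithful flatness condition: for any $A$ in $\mathsf{Hopf}_{\mathrm{coc}}(\mathcal{M})$ and any morphism $i:K\to A$ in $\mathsf{Hopf}_{\mathrm{coc}}(\mathcal{M})$ which is a monomorphism in $\mathcal{M}$,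 the functor $(-)\otimes_K A$ preserves and reflects monomorphisms, where $A$ is a left $K$-module via $m_A(i\otimes\mathrm{Id}_A)$. A category is regular if it has finite limits, every morphism factors as a regular epimorphism followed by a monomorphism, and regular epimorphisms are stable under pullbacks. It is (Barr-)exact if it is regular and every equivalence relation is a kernel pair. A pointed finitely complete category is (Bourn-)protomodular iff the Split Short Five Lemma holds in it. A category is homological if it is pointed, regular and protomodular; it is semi-abelian if it is pointed, exact, protomodular and has binary coproducts. *)

theory Defs
  imports "HOL-Algebra.Group"
begin

no_notation monoid.mult (infixl "\<otimes>\<index>" 70)

section \<open>Categories\<close>

text \<open>
  Hom-sets of distinct pairs of objects are allowed, but not required, to overlap. Every category
  can be presented with pairwise disjoint hom-sets, so nothing is lost by letting composition (and
  below addition and the tensor product of morphisms) not take the objects as arguments; overlaps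
  occur for categories of structured objects, whose morphisms are morphisms of the base category.
  Only the values of \<open>Hom\<close>, \<open>Ident\<close>, etc. on members of \<open>Obj\<close> are meaningful.
\<close>

record ('o, 'm) category =
  Obj :: "'o set"
  Hom :: "'o \<Rightarrow> 'o \<Rightarrow> 'm set"
  Ident :: "'o \<Rightarrow> 'm"
  Comp :: "'m \<Rightarrow> 'm \<Rightarrow> 'm" (infixl "\<cdot>\<index>" 70)

locale category =
  fixes C :: "('o, 'm, 'z) category_scheme" (structure)
  assumes ident_in_hom: "a \<in> Obj C \<Longrightarrow> Ident C a \<in> Hom C a a"
    and comp_in_hom: "\<lbrakk>a \<in> Obj C; b \<in> Obj C; c \<in> Obj C; f \<in> Hom C a b; g \<in> Hom C b c\<rbrakk>
      \<Longrightarrow> g \<cdot> f \<in> Hom C a c"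
    and comp_ident_left: "\<lbrakk>a \<in> Obj C; b \<in> Obj C; f \<in> Hom C a b\<rbrakk> \<Longrightarrow> Ident C b \<cdot> f = f"
    and comp_ident_right: "\<lbrakk>a \<in> Obj C; b \<in> Obj C; f \<in> Hom C a b\<rbrakk> \<Longrightarrow> f \<cdot> Ident C a = f"
    and comp_assoc: "\<lbrakk>a \<in> Obj C; b \<in> Obj C; c \<in> Obj C; d \<in> Obj C;
        f \<in> Hom C a b; g \<in> Hom C b c; h \<in> Hom C c d\<rbrakk> \<Longrightarrow> (h \<cdot> g) \<cdot> f = h \<cdot> (g \<cdot> f)"

context
  fixes C :: "('o, 'm, 'z) category_scheme" (structure)
begin

definition is_mono :: "'o \<Rightarrow> 'o \<Rightarrow> 'm \<Rightarrow> bool" where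
  "is_mono a b f \<longleftrightarrow> f \<in> Hom C a b \<and>
     (\<forall>x\<in>Obj C. \<forall>g\<in>Hom C x a. \<forall>h\<in>Hom C x a. f \<cdot> g = f \<cdot> h \<longrightarrow> g = h)"

definition is_epi :: "'o \<Rightarrow> 'o \<Rightarrow> 'm \<Rightarrow> bool" where
  "is_epi a b f \<longleftrightarrow> f \<in> Hom C a b \<and>
     (\<forall>x\<in>Obj C. \<forall>g\<in>Hom C b x. \<forall>h\<in>Hom C b x. g \<cdot> f = h \<cdot> f \<longrightarrow> g = h)"

definition is_inverse :: "'o \<Rightarrow> 'o \<Rightarrow> 'm \<Rightarrow> 'm \<Rightarrow> bool" where
  "is_inverse a b f g \<longleftrightarrow> g \<in> Hom C b a \<and> g \<cdot> f = Ident C a \<and> f \<cdot> g = Ident C b"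

definition is_iso :: "'o \<Rightarrow> 'o \<Rightarrow> 'm \<Rightarrow> bool" where
  "is_iso a b f \<longleftrightarrow> f \<in> Hom C a b \<and> (\<exists>g. is_inverse a b f g)"

definition inverse_mor :: "'o \<Rightarrow> 'o \<Rightarrow> 'm \<Rightarrow> 'm" where
  "inverse_mor a b f = (THE g. is_inverse a b f g)"

definition is_terminal :: "'o \<Rightarrow> bool" where
  "is_terminal t \<longleftrightarrow> t \<in> Obj C \<and> (\<forall>x\<in>Obj C. \<exists>!f. f \<in> Hom C x t)"

definition is_initial :: "'o \<Rightarrow> bool" where
  "is_initial t \<longleftrightarrow> t \<in> Obj C \<and> (\<forall>x\<in>Obj C. \<exists>!f. f \<in> Hom C t x)"

definition is_zero_object :: "'o \<Rightarrow> bool" where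
  "is_zero_object z \<longleftrightarrow> is_initial z \<and> is_terminal z"

definition pointed :: bool where
  "pointed \<longleftrightarrow> (\<exists>z. is_zero_object z)"

definition is_zero_mor :: "'o \<Rightarrow> 'o \<Rightarrow> 'm \<Rightarrow> bool" where
  "is_zero_mor a b f \<longleftrightarrow>
     (\<exists>z g h. is_zero_object z \<and> g \<in> Hom C a z \<and> h \<in> Hom C z b \<and> f = h \<cdot> g)"

text \<open>In the following predicates the candidate universal object and its structure morphisms
  come first, followed by the diagram.\<close>

definition is_kernel :: "'o \<Rightarrow> 'm \<Rightarrow> 'o \<Rightarrow> 'o \<Rightarrow> 'm \<Rightarrow> bool" where
  "is_kernel K k a b f \<longleftrightarrow> K \<in> Obj C \<and> a \<in> Obj C \<and> b \<in> Obj C \<and> f \<in> Hom C a b \<and>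
     k \<in> Hom C K a \<and> is_zero_mor K b (f \<cdot> k) \<and>
     (\<forall>x\<in>Obj C. \<forall>h\<in>Hom C x a. is_zero_mor x b (f \<cdot> h) \<longrightarrow>
        (\<exists>!h'. h' \<in> Hom C x K \<and> k \<cdot> h' = h))"

definition is_cokernel :: "'o \<Rightarrow> 'm \<Rightarrow> 'o \<Rightarrow> 'o \<Rightarrow> 'm \<Rightarrow> bool" where
  "is_cokernel Q q a b f \<longleftrightarrow> Q \<in> Obj C \<and> a \<in> Obj C \<and> b \<in> Obj C \<and> f \<in> Hom C a b \<and>
     q \<in> Hom C b Q \<and> is_zero_mor a Q (q \<cdot> f) \<and>
     (\<forall>x\<in>Obj C. \<forall>h\<in>Hom C b x. is_zero_mor a x (h \<cdot> f) \<longrightarrow>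
        (\<exists>!h'. h' \<in> Hom C Q x \<and> h' \<cdot> q = h))"

definition is_equalizer :: "'o \<Rightarrow> 'm \<Rightarrow> 'o \<Rightarrow> 'o \<Rightarrow> 'm \<Rightarrow> 'm \<Rightarrow> bool" where
  "is_equalizer E e a b f g \<longleftrightarrow> E \<in> Obj C \<and> a \<in> Obj C \<and> b \<in> Obj C \<and>
     f \<in> Hom C a b \<and> g \<in> Hom C a b \<and> e \<in> Hom C E a \<and> f \<cdot> e = g \<cdot> e \<and>
     (\<forall>x\<in>Obj C. \<forall>h\<in>Hom C x a. f \<cdot> h = g \<cdot> h \<longrightarrow> (\<exists>!h'. h' \<in> Hom C x E \<and> e \<cdot> h' = h))"

definition is_coequalizer :: "'o \<Rightarrow> 'm \<Rightarrow> 'o \<Rightarrow> 'o \<Rightarrow> 'm \<Rightarrow> 'm \<Rightarrow> bool" where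
  "is_coequalizer Q q a b f g \<longleftrightarrow> Q \<in> Obj C \<and> a \<in> Obj C \<and> b \<in> Obj C \<and>
     f \<in> Hom C a b \<and> g \<in> Hom C a b \<and> q \<in> Hom C b Q \<and> q \<cdot> f = q \<cdot> g \<and>
     (\<forall>x\<in>Obj C. \<forall>h\<in>Hom C b x. h \<cdot> f = h \<cdot> g \<longrightarrow> (\<exists>!h'. h' \<in> Hom C Q x \<and> h' \<cdot> q = h))"

definition is_pullback :: "'o \<Rightarrow> 'm \<Rightarrow> 'm \<Rightarrow> 'o \<Rightarrow> 'o \<Rightarrow> 'o \<Rightarrow> 'm \<Rightarrow> 'm \<Rightarrow> bool" where
  "is_pullback P p q a b c f g \<longleftrightarrow> P \<in> Obj C \<and> a \<in> Obj C \<and> b \<in> Obj C \<and> c \<in> Obj C \<and>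
     f \<in> Hom C a c \<and> g \<in> Hom C b c \<and> p \<in> Hom C P a \<and> q \<in> Hom C P b \<and> f \<cdot> p = g \<cdot> q \<and>
     (\<forall>x\<in>Obj C. \<forall>h\<in>Hom C x a. \<forall>k\<in>Hom C x b. f \<cdot> h = g \<cdot> k \<longrightarrow>
        (\<exists>!l. l \<in> Hom C x P \<and> p \<cdot> l = h \<and> q \<cdot> l = k))"

definition is_coproduct :: "'o \<Rightarrow> 'm \<Rightarrow> 'm \<Rightarrow> 'o \<Rightarrow> 'o \<Rightarrow> bool" where
  "is_coproduct S i j a b \<longleftrightarrow> S \<in> Obj C \<and> a \<in> Obj C \<and> b \<in> Obj C \<and>
     i \<in> Hom C a S \<and> j \<in> Hom C b S \<and>
     (\<forall>x\<in>Obj C. \<forall>h\<in>Hom C a x. \<forall>k\<in>Hom C b x.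
        (\<exists>!l. l \<in> Hom C S x \<and> l \<cdot> i = h \<and> l \<cdot> j = k))"

definition has_binary_coproducts :: bool where
  "has_binary_coproducts \<longleftrightarrow> (\<forall>a\<in>Obj C. \<forall>b\<in>Obj C. \<exists>S i j. is_coproduct S i j a b)"

definition is_regular_epi :: "'o \<Rightarrow> 'o \<Rightarrow> 'm \<Rightarrow> bool" where
  "is_regular_epi a b f \<longleftrightarrow> (\<exists>r g h. is_coequalizer b f r a g h)"

definition is_short_exact :: "'o \<Rightarrow> 'm \<Rightarrow> 'o \<Rightarrow> 'm \<Rightarrow> 'o \<Rightarrow> bool" where
  "is_short_exact a f b g c \<longleftrightarrow> is_kernel a f b c g \<and> is_cokernel c g a b f"

end


section \<open>Functors and finite limits\<close>

text \<open>The action on morphisms takes source and target as arguments since hom-sets may overlap.\<close>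

record ('o, 'm, 'p, 'n) functor_data =
  ObMap :: "'o \<Rightarrow> 'p"
  ArMap :: "'o \<Rightarrow> 'o \<Rightarrow> 'm \<Rightarrow> 'n"

definition is_functor ::
    "('o, 'm, 'y) category_scheme \<Rightarrow> ('p, 'n, 'z) category_scheme \<Rightarrow> ('o, 'm, 'p, 'n) functor_data \<Rightarrow> bool"
  where
  "is_functor C D F \<longleftrightarrow> category C \<and> category D \<and>
     (\<forall>a\<in>Obj C. ObMap F a \<in> Obj D) \<and>
     (\<forall>a\<in>Obj C. \<forall>b\<in>Obj C. \<forall>f\<in>Hom C a b. ArMap F a b f \<in> Hom D (ObMap F a) (ObMap F b)) \<and>
     (\<forall>a\<in>Obj C. ArMap F a a (Ident C a) = Ident D (ObMap F a)) \<and>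
     (\<forall>a\<in>Obj C. \<forall>b\<in>Obj C. \<forall>c\<in>Obj C. \<forall>f\<in>Hom C a b. \<forall>g\<in>Hom C b c.
        ArMap F a c (g \<cdot>\<^bsub>C\<^esub> f) = ArMap F b c g \<cdot>\<^bsub>D\<^esub> ArMap F a b f)"

definition preserves_epis where
  "preserves_epis C D F \<longleftrightarrow> (\<forall>a\<in>Obj C. \<forall>b\<in>Obj C. \<forall>f\<in>Hom C a b.
     is_epi C a b f \<longrightarrow> is_epi D (ObMap F a) (ObMap F b) (ArMap F a b f))"

definition reflects_epis where
  "reflects_epis C D F \<longleftrightarrow> (\<forall>a\<in>Obj C. \<forall>b\<in>Obj C. \<forall>f\<in>Hom C a b.
     is_epi D (ObMap F a) (ObMap F b) (ArMap F a b f) \<longrightarrow> is_epi C a b f)"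

definition preserves_monos where
  "preserves_monos C D F \<longleftrightarrow> (\<forall>a\<in>Obj C. \<forall>b\<in>Obj C. \<forall>f\<in>Hom C a b.
     is_mono C a b f \<longrightarrow> is_mono D (ObMap F a) (ObMap F b) (ArMap F a b f))"

definition reflects_monos where
  "reflects_monos C D F \<longleftrightarrow> (\<forall>a\<in>Obj C. \<forall>b\<in>Obj C. \<forall>f\<in>Hom C a b.
     is_mono D (ObMap F a) (ObMap F b) (ArMap F a b f) \<longrightarrow> is_mono C a b f)"

definition is_cone where
  "is_cone J C F L l \<longleftrightarrow> L \<in> Obj C \<and> (\<forall>j\<in>Obj J. l j \<in> Hom C L (ObMap F j)) \<and>
     (\<forall>i\<in>Obj J. \<forall>j\<in>Obj J. \<forall>u\<in>Hom J i j. ArMap F i j u \<cdot>\<^bsub>C\<^esub> l i = l j)"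

definition is_limit where
  "is_limit J C F L l \<longleftrightarrow> is_cone J C F L l \<and>
     (\<forall>X x. is_cone J C F X x \<longrightarrow> (\<exists>!h. h \<in> Hom C X L \<and> (\<forall>j\<in>Obj J. l j \<cdot>\<^bsub>C\<^esub> h = x j)))"

definition finite_category where
  "finite_category J \<longleftrightarrow> category J \<and> finite (Obj J) \<and>
     (\<forall>i\<in>Obj J. \<forall>j\<in>Obj J. finite (Hom J i j))"

text \<open>Every finite category is isomorphic to one whose objects and morphisms are natural numbers.\<close>

definition has_finite_limits where
  "has_finite_limits C \<longleftrightarrow> (\<forall>(J :: (nat, nat) category) F.
     finite_category J \<and> is_functor J C F \<longrightarrow> (\<exists>L l. is_limit J C F L l))"


section \<open>Regular, exact, homological and semi-abelian categories\<close>

definition is_regular_category :: "('o, 'm, 'z) category_scheme \<Rightarrow> bool" where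
  "is_regular_category C \<longleftrightarrow> category C \<and> has_finite_limits C \<and>
     (\<forall>a\<in>Obj C. \<forall>b\<in>Obj C. \<forall>f\<in>Hom C a b.
        \<exists>c\<in>Obj C. \<exists>e m. is_regular_epi C a c e \<and> is_mono C c b m \<and> f = m \<cdot>\<^bsub>C\<^esub> e) \<and>
     (\<forall>P p q a b c f g. is_pullback C P p q a b c f g \<and> is_regular_epi C a c f
        \<longrightarrow> is_regular_epi C P b q)"

definition is_equivalence_relation ::
    "('o, 'm, 'z) category_scheme \<Rightarrow> 'o \<Rightarrow> 'm \<Rightarrow> 'm \<Rightarrow> 'o \<Rightarrow> bool" where
  "is_equivalence_relation C R r s x \<longleftrightarrow>
     R \<in> Obj C \<and> x \<in> Obj C \<and> r \<in> Hom C R x \<and> s \<in> Hom C R x \<and>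
     (\<forall>t\<in>Obj C. \<forall>g\<in>Hom C t R. \<forall>h\<in>Hom C t R.
        r \<cdot>\<^bsub>C\<^esub> g = r \<cdot>\<^bsub>C\<^esub> h \<and> s \<cdot>\<^bsub>C\<^esub> g = s \<cdot>\<^bsub>C\<^esub> h \<longrightarrow> g = h) \<and>
     (\<exists>d\<in>Hom C x R. r \<cdot>\<^bsub>C\<^esub> d = Ident C x \<and> s \<cdot>\<^bsub>C\<^esub> d = Ident C x) \<and>
     (\<exists>v\<in>Hom C R R. r \<cdot>\<^bsub>C\<^esub> v = s \<and> s \<cdot>\<^bsub>C\<^esub> v = r) \<and>
     (\<forall>P p q. is_pullback C P p q R R x s r \<longrightarrow>
        (\<exists>t\<in>Hom C P R. r \<cdot>\<^bsub>C\<^esub> t = r \<cdot>\<^bsub>C\<^esub> p \<and> s \<cdot>\<^bsub>C\<^esub> t = s \<cdot>\<^bsub>C\<^esub> q))"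

definition is_exact_category :: "('o, 'm, 'z) category_scheme \<Rightarrow> bool" where
  "is_exact_category C \<longleftrightarrow> is_regular_category C \<and>
     (\<forall>R r s x. is_equivalence_relation C R r s x \<longrightarrow>
        (\<exists>y f. is_pullback C R r s x x y f f))"

definition split_short_five_lemma :: "('o, 'm, 'z) category_scheme \<Rightarrow> bool" where
  "split_short_five_lemma C \<longleftrightarrow>
     (\<forall>K k a f s b K' k' a' f' s' b' u v w.
        is_kernel C K k a b f \<and> s \<in> Hom C b a \<and> f \<cdot>\<^bsub>C\<^esub> s = Ident C b \<and>
        is_kernel C K' k' a' b' f' \<and> s' \<in> Hom C b' a' \<and> f' \<cdot>\<^bsub>C\<^esub> s' = Ident C b' \<and>
        u \<in> Hom C K K' \<and> v \<in> Hom C a a' \<and> w \<in> Hom C b b' \<and>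
        v \<cdot>\<^bsub>C\<^esub> k = k' \<cdot>\<^bsub>C\<^esub> u \<and> w \<cdot>\<^bsub>C\<^esub> f = f' \<cdot>\<^bsub>C\<^esub> v \<and> v \<cdot>\<^bsub>C\<^esub> s = s' \<cdot>\<^bsub>C\<^esub> w \<and>
        is_iso C K K' u \<and> is_iso C b b' w \<longrightarrow> is_iso C a a' v)"

definition is_pointed_protomodular :: "('o, 'm, 'z) category_scheme \<Rightarrow> bool" where
  "is_pointed_protomodular C \<longleftrightarrow>
     category C \<and> pointed C \<and> has_finite_limits C \<and> split_short_five_lemma C"

definition is_homological :: "('o, 'm, 'z) category_scheme \<Rightarrow> bool" where
  "is_homological C \<longleftrightarrow> pointed C \<and> is_regular_category C \<and> is_pointed_protomodular C"

definition is_semi_abelian :: "('o, 'm, 'z) category_scheme \<Rightarrow> bool" where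
  "is_semi_abelian C \<longleftrightarrow>
     pointed C \<and> is_exact_category C \<and> is_pointed_protomodular C \<and> has_binary_coproducts C"


section \<open>Abelian categories\<close>

record ('o, 'm) preadditive_category = "('o, 'm) category" +
  Add :: "'m \<Rightarrow> 'm \<Rightarrow> 'm"
  Zero :: "'o \<Rightarrow> 'o \<Rightarrow> 'm"

locale preadditive_category = category C
  for C :: "('o, 'm, 'z) preadditive_category_scheme" (structure) +
  assumes hom_comm_group: "\<lbrakk>a \<in> Obj C; b \<in> Obj C\<rbrakk>
      \<Longrightarrow> comm_group \<lparr>carrier = Hom C a b, monoid.mult = Add C, one = Zero C a b\<rparr>"
    and comp_add_left: "\<lbrakk>a \<in> Obj C; b \<in> Obj C; c \<in> Obj C;
        f \<in> Hom C a b; g \<in> Hom C b c; h \<in> Hom C b c\<rbrakk>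
      \<Longrightarrow> Add C g h \<cdot> f = Add C (g \<cdot> f) (h \<cdot> f)"
    and comp_add_right: "\<lbrakk>a \<in> Obj C; b \<in> Obj C; c \<in> Obj C;
        f \<in> Hom C a b; g \<in> Hom C a b; h \<in> Hom C b c\<rbrakk>
      \<Longrightarrow> h \<cdot> Add C f g = Add C (h \<cdot> f) (h \<cdot> g)"

definition is_biproduct ::
    "('o, 'm, 'z) preadditive_category_scheme \<Rightarrow> 'o \<Rightarrow> 'm \<Rightarrow> 'm \<Rightarrow> 'm \<Rightarrow> 'm \<Rightarrow> 'o \<Rightarrow> 'o \<Rightarrow> bool" where
  "is_biproduct C S i j p q a b \<longleftrightarrow> S \<in> Obj C \<and>
     i \<in> Hom C a S \<and> j \<in> Hom C b S \<and> p \<in> Hom C S a \<and> q \<in> Hom C S b \<and>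
     p \<cdot>\<^bsub>C\<^esub> i = Ident C a \<and> q \<cdot>\<^bsub>C\<^esub> j = Ident C b \<and>
     p \<cdot>\<^bsub>C\<^esub> j = Zero C b a \<and> q \<cdot>\<^bsub>C\<^esub> i = Zero C a b \<and>
     Add C (i \<cdot>\<^bsub>C\<^esub> p) (j \<cdot>\<^bsub>C\<^esub> q) = Ident C S"

locale abelian_category = preadditive_category C
  for C :: "('o, 'm, 'z) preadditive_category_scheme" (structure) +
  assumes zero_object: "pointed C"
    and biproducts: "\<lbrakk>a \<in> Obj C; b \<in> Obj C\<rbrakk> \<Longrightarrow> \<exists>S i j p q. is_biproduct C S i j p q a b"
    and kernels: "\<lbrakk>a \<in> Obj C; b \<in> Obj C; f \<in> Hom C a b\<rbrakk> \<Longrightarrow> \<exists>K k. is_kernel C K k a b f"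
    and cokernels: "\<lbrakk>a \<in> Obj C; b \<in> Obj C; f \<in> Hom C a b\<rbrakk> \<Longrightarrow> \<exists>Q q. is_cokernel C Q q a b f"
    and mono_normal: "\<lbrakk>a \<in> Obj C; b \<in> Obj C; is_mono C a b f\<rbrakk> \<Longrightarrow> \<exists>c g. is_kernel C a f b c g"
    and epi_normal: "\<lbrakk>a \<in> Obj C; b \<in> Obj C; is_epi C a b f\<rbrakk> \<Longrightarrow> \<exists>c g. is_cokernel C b f c a g"

definition is_additive_functor where
  "is_additive_functor C D F \<longleftrightarrow> is_functor C D F \<and>
     (\<forall>a\<in>Obj C. \<forall>b\<in>Obj C. \<forall>f\<in>Hom C a b. \<forall>g\<in>Hom C a b.
        ArMap F a b (Add C f g) = Add D (ArMap F a b f) (ArMap F a b g))"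

definition is_exact_functor where
  "is_exact_functor C D F \<longleftrightarrow> is_functor C D F \<and>
     (\<forall>a f b g c. is_short_exact C a f b g c \<longrightarrow>
        is_short_exact D (ObMap F a) (ArMap F a b f) (ObMap F b) (ArMap F b c g) (ObMap F c))"


section \<open>Abelian symmetric monoidal categories\<close>

text \<open>
  The associativity and unit constraints are kept explicit, so that the monoidal category need not
  be strict: \<open>Assoc M a b c\<close> goes from \<open>(a \<boxtimes> b) \<boxtimes> c\<close> to \<open>a \<boxtimes> (b \<boxtimes> c)\<close>, \<open>LUnit M a\<close> from
  \<open>Unit M \<boxtimes> a\<close> to \<open>a\<close>, and \<open>RUnit M a\<close> from \<open>a \<boxtimes> Unit M\<close> to \<open>a\<close>. The tensor product is written
  \<open>\<boxtimes>\<close> on objects and \<open>\<otimes>\<close> on morphisms.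
\<close>

record ('o, 'm) monoidal_category = "('o, 'm) preadditive_category" +
  TensorObj :: "'o \<Rightarrow> 'o \<Rightarrow> 'o" (infixr "\<boxtimes>\<index>" 75)
  TensorMor :: "'m \<Rightarrow> 'm \<Rightarrow> 'm" (infixr "\<otimes>\<index>" 75)
  Unit :: "'o"
  Assoc :: "'o \<Rightarrow> 'o \<Rightarrow> 'o \<Rightarrow> 'm"
  LUnit :: "'o \<Rightarrow> 'm"
  RUnit :: "'o \<Rightarrow> 'm"
  Braid :: "'o \<Rightarrow> 'o \<Rightarrow> 'm"

locale symmetric_monoidal_category = category M
  for M :: "('o, 'm, 'z) monoidal_category_scheme" (structure) +
  assumes tensor_obj: "\<lbrakk>a \<in> Obj M; b \<in> Obj M\<rbrakk> \<Longrightarrow> a \<boxtimes> b \<in> Obj M"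
    and tensor_in_hom: "\<lbrakk>a \<in> Obj M; b \<in> Obj M; a' \<in> Obj M; b' \<in> Obj M;
        f \<in> Hom M a b; f' \<in> Hom M a' b'\<rbrakk> \<Longrightarrow> f \<otimes> f' \<in> Hom M (a \<boxtimes> a') (b \<boxtimes> b')"
    and tensor_ident: "\<lbrakk>a \<in> Obj M; b \<in> Obj M\<rbrakk> \<Longrightarrow> Ident M a \<otimes> Ident M b = Ident M (a \<boxtimes> b)"
    and tensor_comp: "\<lbrakk>a \<in> Obj M; b \<in> Obj M; c \<in> Obj M; a' \<in> Obj M; b' \<in> Obj M; c' \<in> Obj M;
        f \<in> Hom M a b; g \<in> Hom M b c; f' \<in> Hom M a' b'; g' \<in> Hom M b' c'\<rbrakk>
      \<Longrightarrow> (g \<cdot> f) \<otimes> (g' \<cdot> f') = (g \<otimes> g') \<cdot> (f \<otimes> f')"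
    and unit_obj: "Unit M \<in> Obj M"
    and assoc_iso: "\<lbrakk>a \<in> Obj M; b \<in> Obj M; c \<in> Obj M\<rbrakk>
      \<Longrightarrow> is_iso M ((a \<boxtimes> b) \<boxtimes> c) (a \<boxtimes> (b \<boxtimes> c)) (Assoc M a b c)"
    and assoc_natural: "\<lbrakk>a \<in> Obj M; b \<in> Obj M; c \<in> Obj M; a' \<in> Obj M; b' \<in> Obj M; c' \<in> Obj M;
        f \<in> Hom M a a'; g \<in> Hom M b b'; h \<in> Hom M c c'\<rbrakk>
      \<Longrightarrow> Assoc M a' b' c' \<cdot> ((f \<otimes> g) \<otimes> h) = (f \<otimes> (g \<otimes> h)) \<cdot> Assoc M a b c"
    and lunit_iso: "a \<in> Obj M \<Longrightarrow> is_iso M (Unit M \<boxtimes> a) a (LUnit M a)"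
    and lunit_natural: "\<lbrakk>a \<in> Obj M; b \<in> Obj M; f \<in> Hom M a b\<rbrakk>
      \<Longrightarrow> LUnit M b \<cdot> (Ident M (Unit M) \<otimes> f) = f \<cdot> LUnit M a"
    and runit_iso: "a \<in> Obj M \<Longrightarrow> is_iso M (a \<boxtimes> Unit M) a (RUnit M a)"
    and runit_natural: "\<lbrakk>a \<in> Obj M; b \<in> Obj M; f \<in> Hom M a b\<rbrakk>
      \<Longrightarrow> RUnit M b \<cdot> (f \<otimes> Ident M (Unit M)) = f \<cdot> RUnit M a"
    and pentagon: "\<lbrakk>a \<in> Obj M; b \<in> Obj M; c \<in> Obj M; d \<in> Obj M\<rbrakk>
      \<Longrightarrow> (Ident M a \<otimes> Assoc M b c d) \<cdot> Assoc M a (b \<boxtimes> c) d \<cdot> (Assoc M a b c \<otimes> Ident M d)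
        = Assoc M a b (c \<boxtimes> d) \<cdot> Assoc M (a \<boxtimes> b) c d"
    and triangle: "\<lbrakk>a \<in> Obj M; b \<in> Obj M\<rbrakk>
      \<Longrightarrow> (Ident M a \<otimes> LUnit M b) \<cdot> Assoc M a (Unit M) b = RUnit M a \<otimes> Ident M b"
    and braid_in_hom: "\<lbrakk>a \<in> Obj M; b \<in> Obj M\<rbrakk> \<Longrightarrow> Braid M a b \<in> Hom M (a \<boxtimes> b) (b \<boxtimes> a)"
    and braid_natural: "\<lbrakk>a \<in> Obj M; b \<in> Obj M; a' \<in> Obj M; b' \<in> Obj M;
        f \<in> Hom M a a'; g \<in> Hom M b b'\<rbrakk>
      \<Longrightarrow> Braid M a' b' \<cdot> (f \<otimes> g) = (g \<otimes> f) \<cdot> Braid M a b"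
    and braid_symmetric: "\<lbrakk>a \<in> Obj M; b \<in> Obj M\<rbrakk>
      \<Longrightarrow> Braid M b a \<cdot> Braid M a b = Ident M (a \<boxtimes> b)"
    and hexagon: "\<lbrakk>a \<in> Obj M; b \<in> Obj M; c \<in> Obj M\<rbrakk>
      \<Longrightarrow> Assoc M b c a \<cdot> Braid M a (b \<boxtimes> c) \<cdot> Assoc M a b c
        = (Ident M b \<otimes> Braid M a c) \<cdot> Assoc M b a c \<cdot> (Braid M a b \<otimes> Ident M c)"

definition tensor_left where
  "tensor_left M x = \<lparr>ObMap = (\<lambda>a. x \<boxtimes>\<^bsub>M\<^esub> a), ArMap = (\<lambda>a b f. Ident M x \<otimes>\<^bsub>M\<^esub> f)\<rparr>"

definition tensor_right where
  "tensor_right M x = \<lparr>ObMap = (\<lambda>a. a \<boxtimes>\<^bsub>M\<^esub> x), ArMap = (\<lambda>a b f. f \<otimes>\<^bsub>M\<^esub> Ident M x)\<rparr>"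

locale abelian_symmetric_monoidal_category =
  abelian_category M + symmetric_monoidal_category M
  for M :: "('o, 'm, 'z) monoidal_category_scheme" (structure) +
  assumes tensor_left_additive: "x \<in> Obj M \<Longrightarrow> is_additive_functor M M (tensor_left M x)"
    and tensor_left_exact: "x \<in> Obj M \<Longrightarrow> is_exact_functor M M (tensor_left M x)"
    and tensor_right_additive: "x \<in> Obj M \<Longrightarrow> is_additive_functor M M (tensor_right M x)"
    and tensor_right_exact: "x \<in> Obj M \<Longrightarrow> is_exact_functor M M (tensor_right M x)"


section \<open>Monoids, comonoids and Hopf monoids\<close>

record ('o, 'm) comonoid_data =
  Car :: "'o"
  Comult :: "'m"
  Counit :: "'m"

record ('o, 'm) hopf_data = "('o, 'm) comonoid_data" +
  Mult :: "'m"
  One :: "'m"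
  Antipode :: "'m"

record ('o, 'm) acted_comonoid_data = "('o, 'm) comonoid_data" +
  Act :: "'m"

context
  fixes M :: "('o, 'm, 'z) monoidal_category_scheme" (structure)
begin

definition AssocInv :: "'o \<Rightarrow> 'o \<Rightarrow> 'o \<Rightarrow> 'm" where
  "AssocInv a b c = inverse_mor M ((a \<boxtimes> b) \<boxtimes> c) (a \<boxtimes> (b \<boxtimes> c)) (Assoc M a b c)"

definition LUnitInv :: "'o \<Rightarrow> 'm" where
  "LUnitInv a = inverse_mor M (Unit M \<boxtimes> a) a (LUnit M a)"

text \<open>The morphism \<open>Id \<otimes> \<sigma> \<otimes> Id\<close> from \<open>(a \<boxtimes> b) \<boxtimes> (c \<boxtimes> d)\<close> to \<open>(a \<boxtimes> c) \<boxtimes> (b \<boxtimes> d)\<close>,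
  with the associativity constraints inserted.\<close>

definition Interchange :: "'o \<Rightarrow> 'o \<Rightarrow> 'o \<Rightarrow> 'o \<Rightarrow> 'm" where
  "Interchange a b c d =
     AssocInv a c (b \<boxtimes> d) \<cdot>
     (Ident M a \<otimes> (Assoc M c b d \<cdot> (Braid M b c \<otimes> Ident M d) \<cdot> AssocInv b c d)) \<cdot>
     Assoc M a b (c \<boxtimes> d)"

definition is_monoid :: "'o \<Rightarrow> 'm \<Rightarrow> 'm \<Rightarrow> bool" where
  "is_monoid a m u \<longleftrightarrow> a \<in> Obj M \<and> m \<in> Hom M (a \<boxtimes> a) a \<and> u \<in> Hom M (Unit M) a \<and>
     m \<cdot> (m \<otimes> Ident M a) = m \<cdot> (Ident M a \<otimes> m) \<cdot> Assoc M a a a \<and>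
     m \<cdot> (u \<otimes> Ident M a) = LUnit M a \<and>
     m \<cdot> (Ident M a \<otimes> u) = RUnit M a"

definition is_comonoid :: "('o, 'm, 'y) comonoid_data_scheme \<Rightarrow> bool" where
  "is_comonoid Q \<longleftrightarrow> Car Q \<in> Obj M \<and>
     Comult Q \<in> Hom M (Car Q) (Car Q \<boxtimes> Car Q) \<and> Counit Q \<in> Hom M (Car Q) (Unit M) \<and>
     Assoc M (Car Q) (Car Q) (Car Q) \<cdot> (Comult Q \<otimes> Ident M (Car Q)) \<cdot> Comult Q
       = (Ident M (Car Q) \<otimes> Comult Q) \<cdot> Comult Q \<and>
     LUnit M (Car Q) \<cdot> (Counit Q \<otimes> Ident M (Car Q)) \<cdot> Comult Q = Ident M (Car Q) \<and>
     RUnit M (Car Q) \<cdot> (Ident M (Car Q) \<otimes> Counit Q) \<cdot> Comult Q = Ident M (Car Q)"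

definition is_cocommutative :: "('o, 'm, 'y) comonoid_data_scheme \<Rightarrow> bool" where
  "is_cocommutative Q \<longleftrightarrow> Braid M (Car Q) (Car Q) \<cdot> Comult Q = Comult Q"

definition is_comonoid_morphism ::
    "('o, 'm, 'x) comonoid_data_scheme \<Rightarrow> ('o, 'm, 'y) comonoid_data_scheme \<Rightarrow> 'm \<Rightarrow> bool" where
  "is_comonoid_morphism P Q f \<longleftrightarrow> f \<in> Hom M (Car P) (Car Q) \<and>
     Comult Q \<cdot> f = (f \<otimes> f) \<cdot> Comult P \<and> Counit Q \<cdot> f = Counit P"

definition is_bimonoid :: "('o, 'm, 'y) hopf_data_scheme \<Rightarrow> bool" where
  "is_bimonoid A \<longleftrightarrow> is_monoid (Car A) (Mult A) (One A) \<and> is_comonoid A \<and>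
     Comult A \<cdot> Mult A =
       (Mult A \<otimes> Mult A) \<cdot> Interchange (Car A) (Car A) (Car A) (Car A) \<cdot> (Comult A \<otimes> Comult A) \<and>
     Comult A \<cdot> One A = (One A \<otimes> One A) \<cdot> LUnitInv (Unit M) \<and>
     Counit A \<cdot> Mult A = LUnit M (Unit M) \<cdot> (Counit A \<otimes> Counit A) \<and>
     Counit A \<cdot> One A = Ident M (Unit M)"

definition is_hopf_monoid :: "('o, 'm, 'y) hopf_data_scheme \<Rightarrow> bool" where
  "is_hopf_monoid A \<longleftrightarrow> is_bimonoid A \<and> Antipode A \<in> Hom M (Car A) (Car A) \<and>
     Mult A \<cdot> (Antipode A \<otimes> Ident M (Car A)) \<cdot> Comult A = One A \<cdot> Counit A \<and>
     Mult A \<cdot> (Ident M (Car A) \<otimes> Antipode A) \<cdot> Comult A = One A \<cdot> Counit A"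

definition is_hopf_morphism :: "('o, 'm) hopf_data \<Rightarrow> ('o, 'm) hopf_data \<Rightarrow> 'm \<Rightarrow> bool" where
  "is_hopf_morphism A B f \<longleftrightarrow> is_comonoid_morphism A B f \<and>
     f \<cdot> Mult A = Mult B \<cdot> (f \<otimes> f) \<and> f \<cdot> One A = One B \<and>
     f \<cdot> Antipode A = Antipode B \<cdot> f"

definition Hopf_coc :: "(('o, 'm) hopf_data, 'm) category" where
  "Hopf_coc = \<lparr>Obj = {A. is_hopf_monoid A \<and> is_cocommutative A},
     Hom = (\<lambda>A B. {f. is_hopf_morphism A B f}),
     Ident = (\<lambda>A. Ident M (Car A)),
     Comp = Comp M\<rparr>"


section \<open>Modules and comodules\<close>

definition is_left_action :: "'o \<Rightarrow> 'm \<Rightarrow> 'm \<Rightarrow> 'o \<Rightarrow> 'm \<Rightarrow> bool" where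
  "is_left_action a m u x \<mu> \<longleftrightarrow> x \<in> Obj M \<and> \<mu> \<in> Hom M (a \<boxtimes> x) x \<and>
     \<mu> \<cdot> (m \<otimes> Ident M x) = \<mu> \<cdot> (Ident M a \<otimes> \<mu>) \<cdot> Assoc M a a x \<and>
     \<mu> \<cdot> (u \<otimes> Ident M x) = LUnit M x"

definition is_acted_comonoid :: "('o, 'm) hopf_data \<Rightarrow> ('o, 'm) acted_comonoid_data \<Rightarrow> bool" where
  "is_acted_comonoid A Q \<longleftrightarrow> is_comonoid Q \<and> is_cocommutative Q \<and>
     is_left_action (Car A) (Mult A) (One A) (Car Q) (Act Q) \<and>
     Comult Q \<cdot> Act Q =
       ((Act Q \<otimes> Act Q) \<cdot> Interchange (Car A) (Car A) (Car Q) (Car Q)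
          \<cdot> (Comult A \<otimes> Ident M (Car Q \<boxtimes> Car Q)))
       \<cdot> (Ident M (Car A) \<otimes> Comult Q) \<and>
     Counit Q \<cdot> Act Q = (Counit A \<cdot> RUnit M (Car A)) \<cdot> (Ident M (Car A) \<otimes> Counit Q)"

definition Comon_coc ::
    "('o, 'm) hopf_data \<Rightarrow> (('o, 'm) acted_comonoid_data, 'm) category" where
  "Comon_coc A = \<lparr>Obj = {Q. is_acted_comonoid A Q},
     Hom = (\<lambda>P Q. {f. is_comonoid_morphism P Q f \<and>
       f \<cdot> Act P = Act Q \<cdot> (Ident M (Car A) \<otimes> f)}),
     Ident = (\<lambda>Q. Ident M (Car Q)),
     Comp = Comp M\<rparr>"

definition regular_acted_comonoid :: "('o, 'm) hopf_data \<Rightarrow> ('o, 'm) acted_comonoid_data" where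
  "regular_acted_comonoid A =
     \<lparr>Car = Car A, Comult = Comult A, Counit = Counit A, Act = Mult A\<rparr>"

text \<open>Objects of \<open>M\<close> with a (co)action are pairs.\<close>

definition right_comodules :: "('o, 'm, 'y) comonoid_data_scheme \<Rightarrow> ('o \<times> 'm, 'm) category" where
  "right_comodules Q = \<lparr>Obj = {(V, \<rho>). V \<in> Obj M \<and> \<rho> \<in> Hom M V (V \<boxtimes> Car Q) \<and>
       Assoc M V (Car Q) (Car Q) \<cdot> (\<rho> \<otimes> Ident M (Car Q)) \<cdot> \<rho> = (Ident M V \<otimes> Comult Q) \<cdot> \<rho> \<and>
       RUnit M V \<cdot> (Ident M V \<otimes> Counit Q) \<cdot> \<rho> = Ident M V},
     Hom = (\<lambda>(V, \<rho>) (V', \<rho>'). {f \<in> Hom M V V'. (f \<otimes> Ident M (Car Q)) \<cdot> \<rho> = \<rho>' \<cdot> f}),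
     Ident = (\<lambda>(V, \<rho>). Ident M V),
     Comp = Comp M\<rparr>"

definition right_modules :: "'o \<Rightarrow> 'm \<Rightarrow> 'm \<Rightarrow> ('o \<times> 'm, 'm) category" where
  "right_modules k m u = \<lparr>Obj = {(N, \<nu>). N \<in> Obj M \<and> \<nu> \<in> Hom M (N \<boxtimes> k) N \<and>
       \<nu> \<cdot> (\<nu> \<otimes> Ident M k) = \<nu> \<cdot> (Ident M N \<otimes> m) \<cdot> Assoc M N k k \<and>
       \<nu> \<cdot> (Ident M N \<otimes> u) = RUnit M N},
     Hom = (\<lambda>(N, \<nu>) (N', \<nu>'). {f \<in> Hom M N N'. f \<cdot> \<nu> = \<nu>' \<cdot> (f \<otimes> Ident M k)}),
     Ident = (\<lambda>(N, \<nu>). Ident M N),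
     Comp = Comp M\<rparr>"


section \<open>Cotensor product and balanced tensor product\<close>

text \<open>
  Both are defined by a choice of (co)equalizer, and on morphisms by its universal property; the
  associator turns the common (co)domain of the parallel pairs into \<open>V \<boxtimes> (Q \<boxtimes> W)\<close> and
  \<open>(N \<boxtimes> K) \<boxtimes> X\<close>, respectively.
\<close>

definition cotensor :: "'o \<Rightarrow> 'o \<times> 'm \<Rightarrow> 'o \<times> 'm \<Rightarrow> 'o \<times> 'm" where
  "cotensor q = (\<lambda>(W, l) (V, r). SOME (E, e).
     is_equalizer M E e (V \<boxtimes> W) (V \<boxtimes> (q \<boxtimes> W))
       (Assoc M V q W \<cdot> (r \<otimes> Ident M W)) (Ident M V \<otimes> l))"

definition cotensor_functor :: "'o \<Rightarrow> 'o \<times> 'm \<Rightarrow> ('o \<times> 'm, 'm, 'o, 'm) functor_data" where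
  "cotensor_functor q W = \<lparr>ObMap = (\<lambda>V. fst (cotensor q W V)),
     ArMap = (\<lambda>V V' f. THE g. g \<in> Hom M (fst (cotensor q W V)) (fst (cotensor q W V')) \<and>
       snd (cotensor q W V') \<cdot> g = (f \<otimes> Ident M (fst W)) \<cdot> snd (cotensor q W V))\<rparr>"

definition balanced_tensor :: "'o \<Rightarrow> 'o \<times> 'm \<Rightarrow> 'o \<times> 'm \<Rightarrow> 'o \<times> 'm" where
  "balanced_tensor k = (\<lambda>(X, l) (N, r). SOME (T, t).
     is_coequalizer M T t ((N \<boxtimes> k) \<boxtimes> X) (N \<boxtimes> X)
       (r \<otimes> Ident M X) ((Ident M N \<otimes> l) \<cdot> Assoc M N k X))"

definition balanced_tensor_functor :: "'o \<Rightarrow> 'o \<times> 'm \<Rightarrow> ('o \<times> 'm, 'm, 'o, 'm) functor_data" where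
  "balanced_tensor_functor k X = \<lparr>ObMap = (\<lambda>N. fst (balanced_tensor k X N)),
     ArMap = (\<lambda>N N' f. THE g.
       g \<in> Hom M (fst (balanced_tensor k X N)) (fst (balanced_tensor k X N')) \<and>
       g \<cdot> snd (balanced_tensor k X N) = snd (balanced_tensor k X N') \<cdot> (f \<otimes> Ident M (fst X)))\<rparr>"

definition faithful_coflatness :: bool where
  "faithful_coflatness \<longleftrightarrow>
     (\<forall>A\<in>Obj Hopf_coc. \<forall>Q\<in>Obj (Comon_coc A).
      \<forall>\<pi>\<in>Hom (Comon_coc A) (regular_acted_comonoid A) Q.
        is_epi M (Car A) (Car Q) \<pi> \<longrightarrow>
        (let F = cotensor_functor (Car Q) (Car A, (\<pi> \<otimes> Ident M (Car A)) \<cdot> Comult A)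
         in preserves_epis (right_comodules Q) M F \<and> reflects_epis (right_comodules Q) M F))"

definition faithful_flatness :: bool where
  "faithful_flatness \<longleftrightarrow>
     (\<forall>A\<in>Obj Hopf_coc. \<forall>K\<in>Obj Hopf_coc. \<forall>i\<in>Hom Hopf_coc K A.
        is_mono M (Car K) (Car A) i \<longrightarrow>
        (let F = balanced_tensor_functor (Car K) (Car A, Mult A \<cdot> (i \<otimes> Ident M (Car A)))
         in preserves_monos (right_modules (Car K) (Mult K) (One K)) M F \<and>
            reflects_monos (right_modules (Car K) (Mult K) (One K)) M F))"

end

end

theory Submission
  imports Defs
begin

text \<open>
  Cocommutative comonoids form a category with finite products, the product being the tensor product,
  and cocommutative Hopf monoids are the groups in it; identities can therefore be checked on
  generalized elements, multiplied by convolution. Subobjects, images and quotients by reflexive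
  relations are computed in \<open>M\<close>. Coflatness shows that the Hopf morphisms which are epimorphisms in
  \<open>M\<close> are stable under pullback and are the coequalizers of their kernel pairs, so they are the regular
  epimorphisms; it also shows that a morphism with trivial kernel is a monomorphism in \<open>M\<close>. Flatness
  identifies a normal subobject with the kernel of the quotient by it, so that equivalence relations
  are effective. The Split Short Five Lemma is the usual computation with group elements.
\<close>

section \<open>Arrows with source and target\<close>

text \<open>The cotensor product of two comonoids over \<open>Q\<close> is their pullback, computed
  as an equalizer in \<open>M\<close>; this is why a condition on cotensor products controls
  regularity. A pullback of \<open>\<pi>\<close>, cotensored with \<open>A\<close> once more,
  acquires a section, and reflection of epimorphisms then acts as descent. On the other side,
  balanced tensor products over a normal subobject \<open>N\<close> compare \<open>N\<close> with
  the kernel of the quotient.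

  Two mismatches shape the development. Universal properties among Hopf monoids are tested on Hopf
  monoids, while the conditions on \<open>M\<close> speak of modules and comodules, so kernels and
  cokernels in \<open>M\<close> have to be given actions and coactions. And maps such as
  \<open>(x, y) \<mapsto> x y^{-1}\<close> are morphisms of comonoids but not of Hopf monoids, so
  that pullbacks and kernels are needed with a universal property for all comonoid morphisms.

  As the constraints of \<open>M\<close> are explicit, coherence is settled once, for the
  interchange map; afterwards the constraints merely permute the components of a pairing.\<close>

text \<open>Arrows know their source and target, and composition and tensor are total: \<open>None\<close> marks a
  junk arrow, so that the equations for \<open>src\<close> and \<open>trg\<close> hold without side conditions.\<close>

datatype ('o, 'm) arrow = Arrow (src: 'o) (trg: 'o) (raw: "'m option")

context symmetric_monoidal_category
begin

definition arr :: "('o, 'm) arrow \<Rightarrow> bool" where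
  "arr f \<longleftrightarrow> (\<exists>a\<in>Obj M. \<exists>b\<in>Obj M. \<exists>m\<in>Hom M a b. f = Arrow a b (Some m))"

definition mk :: "'o \<Rightarrow> 'o \<Rightarrow> 'm \<Rightarrow> ('o, 'm) arrow" where
  "mk a b m = Arrow a b (if a \<in> Obj M \<and> b \<in> Obj M \<and> m \<in> Hom M a b then Some m else None)"

definition cmp :: "('o, 'm) arrow \<Rightarrow> ('o, 'm) arrow \<Rightarrow> ('o, 'm) arrow" (infixr "\<bullet>" 70) where
  "g \<bullet> f = Arrow (src f) (trg g)
     (if arr f \<and> arr g \<and> trg f = src g then Some (the (raw g) \<cdot> the (raw f)) else None)"

definition tens :: "('o, 'm) arrow \<Rightarrow> ('o, 'm) arrow \<Rightarrow> ('o, 'm) arrow" (infixr "\<odot>" 75) where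
  "f \<odot> g = Arrow (src f \<boxtimes> src g) (trg f \<boxtimes> trg g)
     (if arr f \<and> arr g then Some (the (raw f) \<otimes> the (raw g)) else None)"

definition idt :: "'o \<Rightarrow> ('o, 'm) arrow" where
  "idt a = mk a a (Ident M a)"

definition asc :: "'o \<Rightarrow> 'o \<Rightarrow> 'o \<Rightarrow> ('o, 'm) arrow" where
  "asc a b c = mk ((a \<boxtimes> b) \<boxtimes> c) (a \<boxtimes> (b \<boxtimes> c)) (Assoc M a b c)"

definition asci :: "'o \<Rightarrow> 'o \<Rightarrow> 'o \<Rightarrow> ('o, 'm) arrow" where
  "asci a b c = mk (a \<boxtimes> (b \<boxtimes> c)) ((a \<boxtimes> b) \<boxtimes> c) (AssocInv M a b c)"

definition lu :: "'o \<Rightarrow> ('o, 'm) arrow" where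
  "lu a = mk (Unit M \<boxtimes> a) a (LUnit M a)"

definition lui :: "'o \<Rightarrow> ('o, 'm) arrow" where
  "lui a = mk a (Unit M \<boxtimes> a) (LUnitInv M a)"

definition ru :: "'o \<Rightarrow> ('o, 'm) arrow" where
  "ru a = mk (a \<boxtimes> Unit M) a (RUnit M a)"

definition rui :: "'o \<Rightarrow> ('o, 'm) arrow" where
  "rui a = mk a (a \<boxtimes> Unit M) (inverse_mor M (a \<boxtimes> Unit M) a (RUnit M a))"

definition brd :: "'o \<Rightarrow> 'o \<Rightarrow> ('o, 'm) arrow" where
  "brd a b = mk (a \<boxtimes> b) (b \<boxtimes> a) (Braid M a b)"

section \<open>Endpoints and well-formedness of arrows\<close>

lemma src_trg_mk [simp]: "src (mk a b m) = a" "trg (mk a b m) = b"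
  by (simp_all add: mk_def)

lemma arr_mk [simp]: "arr (mk a b m) \<longleftrightarrow> a \<in> Obj M \<and> b \<in> Obj M \<and> m \<in> Hom M a b"
  by (auto simp: mk_def arr_def)

lemma raw_mk [simp]: "\<lbrakk>a \<in> Obj M; b \<in> Obj M; m \<in> Hom M a b\<rbrakk> \<Longrightarrow> raw (mk a b m) = Some m"
  by (simp add: mk_def)

lemma arr_ex: "arr f \<Longrightarrow> \<exists>a\<in>Obj M. \<exists>b\<in>Obj M. \<exists>m\<in>Hom M a b. f = mk a b m"
  by (auto simp: arr_def mk_def)

lemma mk_eq_iff: "\<lbrakk>a \<in> Obj M; b \<in> Obj M; f \<in> Hom M a b; g \<in> Hom M a b\<rbrakk>
    \<Longrightarrow> mk a b f = mk a b g \<longleftrightarrow> f = g"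
  by (auto simp: mk_def)

lemma arr_obj [simp]: "arr f \<Longrightarrow> src f \<in> Obj M" "arr f \<Longrightarrow> trg f \<in> Obj M"
  by (auto simp: arr_def)

lemma src_trg_cmp [simp]: "src (g \<bullet> f) = src f" "trg (g \<bullet> f) = trg g"
  by (simp_all add: cmp_def)

lemma src_trg_tens [simp]: "src (g \<odot> f) = src g \<boxtimes> src f" "trg (g \<odot> f) = trg g \<boxtimes> trg f"
  by (simp_all add: tens_def)

lemma arr_cmp [simp]: "arr (g \<bullet> f) \<longleftrightarrow> arr f \<and> arr g \<and> trg f = src g"
  by (auto simp: cmp_def arr_def intro: comp_in_hom)

lemma arr_tens [simp]: "arr (g \<odot> f) \<longleftrightarrow> arr g \<and> arr f"
  by (auto simp: tens_def arr_def intro: tensor_obj tensor_in_hom)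

lemma src_trg_str [simp]:
  "src (idt a) = a" "trg (idt a) = a"
  "src (asc a b c) = (a \<boxtimes> b) \<boxtimes> c" "trg (asc a b c) = a \<boxtimes> (b \<boxtimes> c)"
  "trg (asci a b c) = (a \<boxtimes> b) \<boxtimes> c" "src (asci a b c) = a \<boxtimes> (b \<boxtimes> c)"
  "src (lu a) = Unit M \<boxtimes> a" "trg (lu a) = a" "trg (lui a) = Unit M \<boxtimes> a" "src (lui a) = a"
  "src (ru a) = a \<boxtimes> Unit M" "trg (ru a) = a" "trg (rui a) = a \<boxtimes> Unit M" "src (rui a) = a"
  "src (brd a b) = a \<boxtimes> b" "trg (brd a b) = b \<boxtimes> a"
  by (simp_all add: idt_def asc_def asci_def lu_def lui_def ru_def rui_def brd_def)

declare tensor_obj [simp] unit_obj [simp]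

text \<open>Two inverses of \<open>f\<close> agree, \<open>h = h (f g) = (h f) g = g\<close>, so the
  definite description in \<open>inverse_mor\<close> really denotes the inverse. The inverses of the
  associators and unitors are obtained in this way.\<close>

lemma is_inverse_inverse_mor:
  assumes "is_iso M a b f" "a \<in> Obj M" "b \<in> Obj M"
  shows "is_inverse M a b f (inverse_mor M a b f)"
proof -
  obtain g where g: "is_inverse M a b f g" and f: "f \<in> Hom M a b"
    using assms by (auto simp: is_iso_def)
  have "h = g" if h: "is_inverse M a b f h" for h
  proof -
    have "(h \<cdot> f) \<cdot> g = h \<cdot> (f \<cdot> g)"
      using assms f g h by (intro comp_assoc[of b a b a]) (auto simp: is_inverse_def)
    then show ?thesis
      using assms g h by (simp add: is_inverse_def comp_ident_left comp_ident_right)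
  qed
  then show ?thesis unfolding inverse_mor_def using g by (metis theI)
qed

lemma inverse_mor_in_hom: "\<lbrakk>is_iso M a b f; a \<in> Obj M; b \<in> Obj M\<rbrakk> \<Longrightarrow> inverse_mor M a b f \<in> Hom M b a"
  using is_inverse_inverse_mor by (auto simp: is_inverse_def)

lemma iso_hom: "is_iso M a b f \<Longrightarrow> f \<in> Hom M a b"
  by (simp add: is_iso_def)

lemma arr_str [simp]:
  "arr (idt a) \<longleftrightarrow> a \<in> Obj M"
  "\<lbrakk>a \<in> Obj M; b \<in> Obj M; c \<in> Obj M\<rbrakk> \<Longrightarrow> arr (asc a b c)"
  "\<lbrakk>a \<in> Obj M; b \<in> Obj M; c \<in> Obj M\<rbrakk> \<Longrightarrow> arr (asci a b c)"
  "a \<in> Obj M \<Longrightarrow> arr (lu a)" "a \<in> Obj M \<Longrightarrow> arr (lui a)"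
  "a \<in> Obj M \<Longrightarrow> arr (ru a)" "a \<in> Obj M \<Longrightarrow> arr (rui a)"
  "\<lbrakk>a \<in> Obj M; b \<in> Obj M\<rbrakk> \<Longrightarrow> arr (brd a b)"
  using ident_in_hom[of a]
  by (auto simp: idt_def asc_def asci_def lu_def lui_def ru_def rui_def brd_def AssocInv_def LUnitInv_def
      intro!: inverse_mor_in_hom assoc_iso lunit_iso runit_iso iso_hom[OF assoc_iso] iso_hom[OF lunit_iso]
      iso_hom[OF runit_iso] braid_in_hom ident_in_hom)

lemma mk_cmp: "\<lbrakk>a \<in> Obj M; b \<in> Obj M; c \<in> Obj M; f \<in> Hom M a b; g \<in> Hom M b c\<rbrakk>
    \<Longrightarrow> mk a c (g \<cdot> f) = mk b c g \<bullet> mk a b f"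
  by (simp add: cmp_def mk_def arr_def comp_in_hom)

lemma mk_tens: "\<lbrakk>a \<in> Obj M; b \<in> Obj M; c \<in> Obj M; d \<in> Obj M; f \<in> Hom M a b; g \<in> Hom M c d\<rbrakk>
    \<Longrightarrow> mk (a \<boxtimes> c) (b \<boxtimes> d) (f \<otimes> g) = mk a b f \<odot> mk c d g"
  by (simp add: tens_def mk_def arr_def tensor_in_hom)

text \<open>No typing hypothesis: if some pair fails to compose, both bracketings are the junk arrow
  with the same endpoints. This lets the simplifier keep all composites nested to the right.\<close>

lemma cmp_assoc [simp]: "(h \<bullet> g) \<bullet> f = h \<bullet> (g \<bullet> f)"
proof (cases "arr f \<and> arr g \<and> arr h \<and> trg f = src g \<and> trg g = src h")
  case True
  then show ?thesis by (auto dest!: arr_ex simp: comp_in_hom comp_assoc simp flip: mk_cmp)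
next
  case False
  then have "\<not> (arr f \<and> arr (h \<bullet> g) \<and> trg f = src (h \<bullet> g))" "\<not> (arr (g \<bullet> f) \<and> arr h \<and> trg (g \<bullet> f) = src h)"
    by auto
  then show ?thesis unfolding cmp_def[of "h \<bullet> g"] cmp_def[of h "g \<bullet> f"] by (simp only: if_False) simp
qed

lemma cmp_idt [simp]:
  "\<lbrakk>arr f; trg f = b\<rbrakk> \<Longrightarrow> idt b \<bullet> f = f"
  "\<lbrakk>arr f; src f = a\<rbrakk> \<Longrightarrow> f \<bullet> idt a = f"
  by (auto dest!: arr_ex simp: idt_def ident_in_hom comp_ident_left comp_ident_right simp flip: mk_cmp)

lemma reduce: "g \<bullet> f = k \<Longrightarrow> g \<bullet> (f \<bullet> r) = k \<bullet> r"
  by (metis cmp_assoc)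

lemma tens_idt [simp]: "\<lbrakk>a \<in> Obj M; b \<in> Obj M\<rbrakk> \<Longrightarrow> idt a \<odot> idt b = idt (a \<boxtimes> b)"
  by (simp add: idt_def ident_in_hom flip: mk_tens) (simp add: tensor_ident)

text \<open>Matching endpoints suffice: if one of the four arrows is junk, then so are both sides,
  with equal endpoints.\<close>

lemma tens_cmp:
  assumes "trg f = src g" "trg f' = src g'"
  shows "(g \<odot> g') \<bullet> (f \<odot> f') = (g \<bullet> f) \<odot> (g' \<bullet> f')"
proof (cases "arr f \<and> arr g \<and> arr f' \<and> arr g'")
  case True
  then show ?thesis using assms
    by (auto dest!: arr_ex simp: comp_in_hom tensor_in_hom tensor_comp simp flip: mk_cmp mk_tens)
next
  case False
  then have 1: "\<not> (arr (f \<odot> f') \<and> arr (g \<odot> g') \<and> trg (f \<odot> f') = src (g \<odot> g'))"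
    "\<not> (arr (g \<bullet> f) \<and> arr (g' \<bullet> f'))" by auto
  show ?thesis
    unfolding cmp_def[of "g \<odot> g'"] tens_def[of "g \<bullet> f"] if_not_P[OF 1(1)] if_not_P[OF 1(2)] by simp
qed

lemmas merge = tens_cmp tens_cmp[THEN reduce]

section \<open>Naturality and coherence axioms for arrows\<close>

lemma nat_asc: "\<lbrakk>arr f; arr g; arr h; trg f = a; trg g = b; trg h = c\<rbrakk> \<Longrightarrow>
    asc a b c \<bullet> ((f \<odot> g) \<odot> h) = (f \<odot> (g \<odot> h)) \<bullet> asc (src f) (src g) (src h)"
  by (auto dest!: arr_ex simp: asc_def iso_hom[OF assoc_iso] tensor_in_hom assoc_natural simp flip: mk_cmp mk_tens)

lemma asc_inv [simp]: "\<lbrakk>a \<in> Obj M; b \<in> Obj M; c \<in> Obj M\<rbrakk> \<Longrightarrow> asc a b c \<bullet> asci a b c = idt (a \<boxtimes> (b \<boxtimes> c))"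
  "\<lbrakk>a \<in> Obj M; b \<in> Obj M; c \<in> Obj M\<rbrakk> \<Longrightarrow> asci a b c \<bullet> asc a b c = idt ((a \<boxtimes> b) \<boxtimes> c)"
  using is_inverse_inverse_mor[OF assoc_iso, of a b c] iso_hom[OF assoc_iso, of a b c]
  by (simp_all add: asc_def asci_def AssocInv_def idt_def is_inverse_def flip: mk_cmp)

lemma lu_inv [simp]: "a \<in> Obj M \<Longrightarrow> lu a \<bullet> lui a = idt a"
  "a \<in> Obj M \<Longrightarrow> lui a \<bullet> lu a = idt (Unit M \<boxtimes> a)"
  using is_inverse_inverse_mor[OF lunit_iso, of a] iso_hom[OF lunit_iso, of a]
  by (simp_all add: lu_def lui_def LUnitInv_def idt_def is_inverse_def flip: mk_cmp)

lemma ru_inv [simp]: "a \<in> Obj M \<Longrightarrow> ru a \<bullet> rui a = idt a"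
  "a \<in> Obj M \<Longrightarrow> rui a \<bullet> ru a = idt (a \<boxtimes> Unit M)"
  using is_inverse_inverse_mor[OF runit_iso, of a] iso_hom[OF runit_iso, of a]
  by (simp_all add: ru_def rui_def idt_def is_inverse_def flip: mk_cmp)

lemma brd_inv [simp]: "\<lbrakk>a \<in> Obj M; b \<in> Obj M\<rbrakk> \<Longrightarrow> brd b a \<bullet> brd a b = idt (a \<boxtimes> b)"
  by (simp add: brd_def idt_def braid_in_hom braid_symmetric flip: mk_cmp)

lemma inv_reduce [simp]:
  "\<lbrakk>a \<in> Obj M; b \<in> Obj M; c \<in> Obj M; arr f; trg f = a \<boxtimes> (b \<boxtimes> c)\<rbrakk> \<Longrightarrow> asc a b c \<bullet> (asci a b c \<bullet> f) = f"
  "\<lbrakk>a \<in> Obj M; b \<in> Obj M; c \<in> Obj M; arr f; trg f = (a \<boxtimes> b) \<boxtimes> c\<rbrakk> \<Longrightarrow> asci a b c \<bullet> (asc a b c \<bullet> f) = f"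
  "\<lbrakk>a \<in> Obj M; arr f; trg f = a\<rbrakk> \<Longrightarrow> lu a \<bullet> (lui a \<bullet> f) = f"
  "\<lbrakk>a \<in> Obj M; arr f; trg f = Unit M \<boxtimes> a\<rbrakk> \<Longrightarrow> lui a \<bullet> (lu a \<bullet> f) = f"
  "\<lbrakk>a \<in> Obj M; arr f; trg f = a\<rbrakk> \<Longrightarrow> ru a \<bullet> (rui a \<bullet> f) = f"
  "\<lbrakk>a \<in> Obj M; arr f; trg f = a \<boxtimes> Unit M\<rbrakk> \<Longrightarrow> rui a \<bullet> (ru a \<bullet> f) = f"
  "\<lbrakk>a \<in> Obj M; b \<in> Obj M; arr f; trg f = a \<boxtimes> b\<rbrakk> \<Longrightarrow> brd b a \<bullet> (brd a b \<bullet> f) = f"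
  by (simp_all flip: cmp_assoc)

lemma nat_lu: "\<lbrakk>arr f; trg f = b\<rbrakk> \<Longrightarrow> lu b \<bullet> (idt (Unit M) \<odot> f) = f \<bullet> lu (src f)"
  by (auto dest!: arr_ex simp: lu_def idt_def ident_in_hom iso_hom[OF lunit_iso] tensor_in_hom lunit_natural
      simp flip: mk_cmp mk_tens)

lemma nat_ru: "\<lbrakk>arr f; trg f = b\<rbrakk> \<Longrightarrow> ru b \<bullet> (f \<odot> idt (Unit M)) = f \<bullet> ru (src f)"
  by (auto dest!: arr_ex simp: ru_def idt_def ident_in_hom iso_hom[OF runit_iso] tensor_in_hom runit_natural
      simp flip: mk_cmp mk_tens)

lemma nat_brd: "\<lbrakk>arr f; arr g; trg f = a; trg g = b\<rbrakk> \<Longrightarrow> brd a b \<bullet> (f \<odot> g) = (g \<odot> f) \<bullet> brd (src f) (src g)"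
  by (auto dest!: arr_ex simp: brd_def braid_in_hom tensor_in_hom braid_natural simp flip: mk_cmp mk_tens)

lemma nat_asci: assumes "arr f" "arr g" "arr h" "trg f = a" "trg g = b" "trg h = c"
  shows "asci a b c \<bullet> (f \<odot> (g \<odot> h)) = ((f \<odot> g) \<odot> h) \<bullet> asci (src f) (src g) (src h)"
proof -
  have "asci a b c \<bullet> (f \<odot> (g \<odot> h)) = asci a b c \<bullet> ((f \<odot> (g \<odot> h)) \<bullet> asc (src f) (src g) (src h)) \<bullet> asci (src f) (src g) (src h)"
    using assms by auto
  also have "\<dots> = ((f \<odot> g) \<odot> h) \<bullet> asci (src f) (src g) (src h)"
    using assms by (auto simp flip: nat_asc)
  finally show ?thesis .
qed

lemma pent: "\<lbrakk>a \<in> Obj M; b \<in> Obj M; c \<in> Obj M; d \<in> Obj M\<rbrakk> \<Longrightarrow>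
   (idt a \<odot> asc b c d) \<bullet> asc a (b \<boxtimes> c) d \<bullet> (asc a b c \<odot> idt d) = asc a b (c \<boxtimes> d) \<bullet> asc (a \<boxtimes> b) c d"
  using pentagon[of a b c d] iso_hom[OF assoc_iso]
    comp_in_hom[OF _ _ _ iso_hom[OF assoc_iso] tensor_in_hom[OF _ _ _ _ ident_in_hom iso_hom[OF assoc_iso]]]
  unfolding cmp_assoc[symmetric]
  by (simp add: asc_def idt_def ident_in_hom tensor_in_hom del: cmp_assoc flip: mk_tens mk_cmp)

lemma tri: "\<lbrakk>a \<in> Obj M; b \<in> Obj M\<rbrakk> \<Longrightarrow> (idt a \<odot> lu b) \<bullet> asc a (Unit M) b = ru a \<odot> idt b"
  using triangle[of a b] iso_hom[OF assoc_iso] iso_hom[OF lunit_iso] iso_hom[OF runit_iso]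
  by (simp add: asc_def lu_def ru_def idt_def ident_in_hom tensor_in_hom flip: mk_tens mk_cmp)

lemma hex: "\<lbrakk>a \<in> Obj M; b \<in> Obj M; c \<in> Obj M\<rbrakk> \<Longrightarrow>
   asc b c a \<bullet> brd a (b \<boxtimes> c) \<bullet> asc a b c = (idt b \<odot> brd a c) \<bullet> asc b a c \<bullet> (brd a b \<odot> idt c)"
  using hexagon[of a b c] iso_hom[OF assoc_iso] braid_in_hom
    comp_in_hom[OF _ _ _ iso_hom[OF assoc_iso] tensor_in_hom[OF _ _ _ _ ident_in_hom braid_in_hom]]
    comp_in_hom[OF _ _ _ braid_in_hom iso_hom[OF assoc_iso]]
  unfolding cmp_assoc[symmetric]
  by (simp add: asc_def brd_def idt_def ident_in_hom tensor_in_hom del: cmp_assoc flip: mk_tens mk_cmp)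

lemmas nat = nat_asc nat_asc[THEN reduce] nat_lu nat_lu[THEN reduce] nat_ru nat_ru[THEN reduce]
  nat_brd nat_brd[THEN reduce]


section \<open>The interchange morphism\<close>

lemma tens_l: "\<lbrakk>trg f = src g; a \<in> Obj M\<rbrakk> \<Longrightarrow> idt a \<odot> (g \<bullet> f) = (idt a \<odot> g) \<bullet> (idt a \<odot> f)"
  by (simp add: tens_cmp)

lemma tens_r: "\<lbrakk>trg f = src g; a \<in> Obj M\<rbrakk> \<Longrightarrow> (g \<bullet> f) \<odot> idt a = (g \<odot> idt a) \<bullet> (f \<odot> idt a)"
  by (simp add: tens_cmp)

lemma nat_asc_l: "\<lbrakk>arr h; trg h = c; a \<in> Obj M; b \<in> Obj M\<rbrakk> \<Longrightarrow>
    asc a b c \<bullet> (idt (a \<boxtimes> b) \<odot> h) = (idt a \<odot> (idt b \<odot> h)) \<bullet> asc a b (src h)"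
  by (simp flip: tens_idt add: nat_asc)

lemma nat_asc_r: "\<lbrakk>arr h; trg h = a; b \<in> Obj M; c \<in> Obj M\<rbrakk> \<Longrightarrow>
    asc a b c \<bullet> ((h \<odot> idt b) \<odot> idt c) = (h \<odot> idt (b \<boxtimes> c)) \<bullet> asc (src h) b c"
  by (simp add: nat_asc)

lemma epi_cancel: "\<lbrakk>f \<bullet> e = g \<bullet> e; e \<bullet> d = idt b; arr f; arr g; src f = b; src g = b\<rbrakk> \<Longrightarrow> f = g"
  by (metis cmp_assoc cmp_idt(2))

lemma mono_cancel: "\<lbrakk>e \<bullet> f = e \<bullet> g; d \<bullet> e = idt b; arr f; arr g; trg f = b; trg g = b\<rbrakk> \<Longrightarrow> f = g"
  by (metis cmp_assoc cmp_idt(1))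

text \<open>Naturality of \<open>lu\<close> turns \<open>idt (Unit M) \<odot> f\<close> into
  \<open>f\<close> up to invertible factors, so tensoring with the unit object is faithful.
  Coherence identities can thus be proved after such a tensoring, where the triangle axiom
  applies.\<close>

lemma unit_tens_cancel:
  assumes "idt (Unit M) \<odot> f = idt (Unit M) \<odot> g" "arr f" "arr g" "src f = src g" "trg f = trg g"
  shows "f = g"
proof -
  have "f \<bullet> lu (src f) = g \<bullet> lu (src f)"
    using assms nat_lu[of f] nat_lu[of g] by simp
  then show ?thesis by (rule epi_cancel[where d = "lui (src f)"]) (use assms in auto)
qed

lemma tens_unit_cancel:
  assumes "f \<odot> idt (Unit M) = g \<odot> idt (Unit M)" "arr f" "arr g" "src f = src g" "trg f = trg g"
  shows "f = g"
proof -
  have "f \<bullet> ru (src f) = g \<bullet> ru (src f)"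
    using assms nat_ru[of f] nat_ru[of g] by simp
  then show ?thesis by (rule epi_cancel[where d = "rui (src f)"]) (use assms in auto)
qed

text \<open>Kelly's argument: after tensoring with the unit object and composing with the invertible
  \<open>?e\<close>, the pentagon and the triangle reduce both sides to the same arrow.\<close>

lemma lu_tens:
  assumes [simp]: "a \<in> Obj M" "b \<in> Obj M"
  shows "lu (a \<boxtimes> b) \<bullet> asc (Unit M) a b = lu a \<odot> idt b"
proof (rule unit_tens_cancel)
  let ?I = "Unit M"
  let ?e = "asc ?I (?I \<boxtimes> a) b \<bullet> (asc ?I ?I a \<odot> idt b)"
  have "(idt ?I \<odot> (lu (a \<boxtimes> b) \<bullet> asc ?I a b)) \<bullet> ?e
      = (idt ?I \<odot> lu (a \<boxtimes> b)) \<bullet> asc ?I ?I (a \<boxtimes> b) \<bullet> asc (?I \<boxtimes> ?I) a b"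
    by (simp add: tens_l pent)
  also have "\<dots> = (ru ?I \<odot> idt (a \<boxtimes> b)) \<bullet> asc (?I \<boxtimes> ?I) a b"
    by (simp add: tri tri[THEN reduce])
  also have "\<dots> = asc ?I a b \<bullet> ((ru ?I \<odot> idt a) \<odot> idt b)"
    by (simp add: nat_asc)
  also have "\<dots> = (idt ?I \<odot> (lu a \<odot> idt b)) \<bullet> ?e"
    by (simp flip: tri add: tens_r nat_asc[THEN reduce])
  finally show "idt (Unit M) \<odot> (lu (a \<boxtimes> b) \<bullet> asc (Unit M) a b) = idt (Unit M) \<odot> (lu a \<odot> idt b)"
    by (rule epi_cancel[where d = "(asci (Unit M) (Unit M) a \<odot> idt b) \<bullet> asci (Unit M) (Unit M \<boxtimes> a) b"]) (simp_all add: merge)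
qed auto

text \<open>Naturality of \<open>lu\<close> at itself gives
  \<open>lu (I \<boxtimes> I) = idt I \<odot> lu I\<close> for the unit object \<open>I\<close>.
  Then the triangle and \<open>lu_tens\<close> present \<open>ru I\<close> and \<open>lu I\<close>,
  each tensored with the identity, as the same arrow.\<close>

lemma lu_ru_unit: "lu (Unit M) = ru (Unit M)"
proof -
  let ?I = "Unit M"
  have "lu ?I \<bullet> lu (?I \<boxtimes> ?I) = lu ?I \<bullet> (idt ?I \<odot> lu ?I)"
    by (simp add: nat_lu)
  then have 1: "lu (?I \<boxtimes> ?I) = idt ?I \<odot> lu ?I"
    by (rule mono_cancel[where d = "lui (Unit M)"]) auto
  have "lu ?I \<odot> idt ?I = ru ?I \<odot> idt ?I"
    using lu_tens[of ?I ?I] tri[of ?I ?I] by (simp add: 1)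
  then show ?thesis by (rule tens_unit_cancel) auto
qed

text \<open>The transposition of two adjacent factors of a right-nested tensor product, with
  \<open>x\<close> standing for everything behind them. Braidings and interchange maps are expressed
  through it, so that coherence becomes a computation with adjacent transpositions.\<close>

definition swp :: "'o \<Rightarrow> 'o \<Rightarrow> 'o \<Rightarrow> ('o, 'm) arrow" where
  "swp a b x = asc b a x \<bullet> (brd a b \<odot> idt x) \<bullet> asci a b x"

lemma swp_simps [simp]: "src (swp a b x) = a \<boxtimes> (b \<boxtimes> x)" "trg (swp a b x) = b \<boxtimes> (a \<boxtimes> x)"
  "\<lbrakk>a \<in> Obj M; b \<in> Obj M; x \<in> Obj M\<rbrakk> \<Longrightarrow> arr (swp a b x)"
  by (simp_all add: swp_def)

lemma swp_asc: "\<lbrakk>a \<in> Obj M; b \<in> Obj M; x \<in> Obj M\<rbrakk> \<Longrightarrow> swp a b x \<bullet> asc a b x = asc b a x \<bullet> (brd a b \<odot> idt x)"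
  by (simp add: swp_def)

lemma swp_inv: "\<lbrakk>a \<in> Obj M; b \<in> Obj M; x \<in> Obj M\<rbrakk> \<Longrightarrow> swp b a x \<bullet> swp a b x = idt (a \<boxtimes> (b \<boxtimes> x))"
  by (simp add: swp_def merge)

lemma nat_swp:
  assumes [simp]: "arr f" "arr g" "arr h" and t [simp]: "trg f = a" "trg g = b" "trg h = c"
  shows "swp a b c \<bullet> (f \<odot> (g \<odot> h)) = (g \<odot> (f \<odot> h)) \<bullet> swp (src f) (src g) (src h)"
proof -
  have 1: "asci a b c \<bullet> (f \<odot> (g \<odot> h)) = ((f \<odot> g) \<odot> h) \<bullet> asci (src f) (src g) (src h)"
    by (simp add: nat_asci)
  have 2: "(brd a b \<odot> idt c) \<bullet> ((f \<odot> g) \<odot> h) = ((g \<odot> f) \<odot> h) \<bullet> (brd (src f) (src g) \<odot> idt (src h))"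
    using arr_obj(2)[OF assms(3)] by (simp add: tens_cmp nat_brd)
  have 3: "asc b a c \<bullet> ((g \<odot> f) \<odot> h) = (g \<odot> (f \<odot> h)) \<bullet> asc (src g) (src f) (src h)"
    by (simp add: nat_asc)
  show ?thesis
    by (simp only: swp_def cmp_assoc 1 2[THEN reduce] 3[THEN reduce])
qed

lemma swp_tens:
  assumes [simp]: "a \<in> Obj M" "b \<in> Obj M" "x \<in> Obj M" "y \<in> Obj M"
  shows "(idt b \<odot> asc a x y) \<bullet> asc b (a \<boxtimes> x) y \<bullet> (swp a b x \<odot> idt y)
    = swp a b (x \<boxtimes> y) \<bullet> (idt a \<odot> asc b x y) \<bullet> asc a (b \<boxtimes> x) y"
proof -
  have "(idt b \<odot> asc a x y) \<bullet> asc b (a \<boxtimes> x) y \<bullet> (swp a b x \<odot> idt y)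
     = asc b a (x \<boxtimes> y) \<bullet> asc (b \<boxtimes> a) x y \<bullet> ((brd a b \<odot> idt x) \<odot> idt y) \<bullet> (asci a b x \<odot> idt y)"
    by (simp add: swp_def tens_r pent[THEN reduce, simplified])
  also have "\<dots> = swp a b (x \<boxtimes> y) \<bullet> asc a b (x \<boxtimes> y) \<bullet> asc (a \<boxtimes> b) x y \<bullet> (asci a b x \<odot> idt y)"
    by (simp add: nat_asc[THEN reduce] swp_asc[THEN reduce])
  also have "asc a b (x \<boxtimes> y) \<bullet> asc (a \<boxtimes> b) x y \<bullet> (asci a b x \<odot> idt y)
     = (idt a \<odot> asc b x y) \<bullet> asc a (b \<boxtimes> x) y"
    by (simp add: pent[symmetric, THEN reduce] tens_cmp)
  finally show ?thesis .
qed

lemma brd_tens: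
  assumes [simp]: "a \<in> Obj M" "b \<in> Obj M" "c \<in> Obj M"
  shows "asc b c a \<bullet> brd a (b \<boxtimes> c) = (idt b \<odot> brd a c) \<bullet> swp a b c"
proof -
  have "(asc b c a \<bullet> brd a (b \<boxtimes> c)) \<bullet> asc a b c = ((idt b \<odot> brd a c) \<bullet> swp a b c) \<bullet> asc a b c"
    by (simp add: hex swp_def)
  then show ?thesis by (rule epi_cancel[where d = "asci a b c"]) simp_all
qed

text \<open>The second hexagon, obtained by inverting the first: in a symmetric category
  \<open>brd c (a \<boxtimes> b)\<close> is the inverse of
  \<open>brd (a \<boxtimes> b) c\<close>.\<close>

lemma tens_brd:
  assumes [simp]: "a \<in> Obj M" "b \<in> Obj M" "c \<in> Obj M"
  shows "brd (a \<boxtimes> b) c = swp a c b \<bullet> (idt a \<odot> brd b c) \<bullet> asc a b c"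
proof -
  have "(asc a b c \<bullet> brd c (a \<boxtimes> b)) \<bullet> brd (a \<boxtimes> b) c = asc a b c"
    by simp
  then have "swp a c b \<bullet> (idt a \<odot> brd b c) \<bullet> (idt a \<odot> brd c b) \<bullet> swp c a b \<bullet> brd (a \<boxtimes> b) c
      = swp a c b \<bullet> (idt a \<odot> brd b c) \<bullet> asc a b c"
    by (simp add: brd_tens)
  then show ?thesis by (simp add: merge swp_inv[THEN reduce] tens_cmp[THEN reduce])
qed

lemma swp_asc_right:
  assumes [simp]: "a \<in> Obj M" "b \<in> Obj M" "c \<in> Obj M" "x \<in> Obj M"
  shows "asc b c (a \<boxtimes> x) \<bullet> swp a (b \<boxtimes> c) x
    = (idt b \<odot> swp a c x) \<bullet> swp a b (c \<boxtimes> x) \<bullet> (idt a \<odot> asc b c x)"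
proof -
  have "(asc b c (a \<boxtimes> x) \<bullet> swp a (b \<boxtimes> c) x) \<bullet> asc a (b \<boxtimes> c) x
      = (idt b \<odot> asc c a x) \<bullet> asc b (c \<boxtimes> a) x \<bullet> (asc b c a \<odot> idt x) \<bullet> (brd a (b \<boxtimes> c) \<odot> idt x)"
    by (simp add: swp_def pent[THEN reduce, simplified])
  also have "\<dots> = (idt b \<odot> asc c a x) \<bullet> asc b (c \<boxtimes> a) x \<bullet> ((idt b \<odot> brd a c) \<odot> idt x) \<bullet> (swp a b c \<odot> idt x)"
    by (simp add: tens_cmp brd_tens)
  also have "\<dots> = (idt b \<odot> asc c a x) \<bullet> (idt b \<odot> (brd a c \<odot> idt x)) \<bullet> asc b (a \<boxtimes> c) x \<bullet> (swp a b c \<odot> idt x)"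
    by (simp add: nat_asc[THEN reduce])
  also have "\<dots> = (idt b \<odot> swp a c x) \<bullet> (idt b \<odot> asc a c x) \<bullet> asc b (a \<boxtimes> c) x \<bullet> (swp a b c \<odot> idt x)"
    by (simp add: tens_cmp[THEN reduce] swp_asc)
  also have "\<dots> = ((idt b \<odot> swp a c x) \<bullet> swp a b (c \<boxtimes> x) \<bullet> (idt a \<odot> asc b c x)) \<bullet> asc a (b \<boxtimes> c) x"
    by (simp add: swp_tens)
  finally show ?thesis by (rule epi_cancel[where d = "asci a (b \<boxtimes> c) x"]) simp_all
qed

text \<open>The inverse of \<open>swp_asc_right\<close>, since \<open>swp\<close> is inverted by
  \<open>swp\<close> with its first two arguments exchanged.\<close>

lemma swp_asc_left:
  assumes [simp]: "a \<in> Obj M" "b \<in> Obj M" "c \<in> Obj M" "x \<in> Obj M"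
  shows "(idt c \<odot> asc a b x) \<bullet> swp (a \<boxtimes> b) c x
    = swp a c (b \<boxtimes> x) \<bullet> (idt a \<odot> swp b c x) \<bullet> asc a b (c \<boxtimes> x)"
proof -
  have "swp a c (b \<boxtimes> x) \<bullet> (idt a \<odot> swp b c x) \<bullet> (asc a b (c \<boxtimes> x) \<bullet> swp c (a \<boxtimes> b) x) \<bullet> swp (a \<boxtimes> b) c x
     = (idt c \<odot> asc a b x) \<bullet> swp (a \<boxtimes> b) c x"
    unfolding swp_asc_right[OF assms(3,1,2,4)] by (simp add: merge swp_inv swp_inv[THEN reduce])
  then show ?thesis by (simp add: swp_inv)
qed

section \<open>The interchange map and its coherence\<close>

definition itc :: "'o \<Rightarrow> 'o \<Rightarrow> 'o \<Rightarrow> 'o \<Rightarrow> ('o, 'm) arrow" where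
  "itc a b c d = asci a c (b \<boxtimes> d) \<bullet> (idt a \<odot> swp b c d) \<bullet> asc a b (c \<boxtimes> d)"

lemma itc_simps [simp]: "src (itc a b c d) = (a \<boxtimes> b) \<boxtimes> (c \<boxtimes> d)" "trg (itc a b c d) = (a \<boxtimes> c) \<boxtimes> (b \<boxtimes> d)"
  "\<lbrakk>a \<in> Obj M; b \<in> Obj M; c \<in> Obj M; d \<in> Obj M\<rbrakk> \<Longrightarrow> arr (itc a b c d)"
  by (simp_all add: itc_def)

text \<open>The composite in \<open>Interchange\<close> is bracketed to the left and untyped, so
  each partial composite has to be placed in a hom-set before it can be identified with a part of
  \<open>itc\<close>.\<close>

lemma mk_Interchange:
  assumes [simp]: "a \<in> Obj M" "b \<in> Obj M" "c \<in> Obj M" "d \<in> Obj M"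
  shows "mk ((a \<boxtimes> b) \<boxtimes> (c \<boxtimes> d)) ((a \<boxtimes> c) \<boxtimes> (b \<boxtimes> d)) (Interchange M a b c d) = itc a b c d"
    and "Interchange M a b c d \<in> Hom M ((a \<boxtimes> b) \<boxtimes> (c \<boxtimes> d)) ((a \<boxtimes> c) \<boxtimes> (b \<boxtimes> d))"
proof -
  have "arr (itc a b c d)" by simp
  have *: "Assoc M x y z \<in> Hom M ((x \<boxtimes> y) \<boxtimes> z) (x \<boxtimes> (y \<boxtimes> z))"
    "AssocInv M x y z \<in> Hom M (x \<boxtimes> (y \<boxtimes> z)) ((x \<boxtimes> y) \<boxtimes> z)"
    if "x \<in> Obj M" "y \<in> Obj M" "z \<in> Obj M" for x y z
    using that arr_str(2,3)[of x y z] by (simp_all add: asc_def asci_def)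
  note [simp] = tensor_in_hom ident_in_hom braid_in_hom *
    and [intro] = comp_in_hom
  let ?s = "Assoc M c b d \<cdot> (Braid M b c \<otimes> Ident M d) \<cdot> AssocInv M b c d"
  have 1: "Assoc M c b d \<cdot> (Braid M b c \<otimes> Ident M d) \<in> Hom M ((b \<boxtimes> c) \<boxtimes> d) (c \<boxtimes> (b \<boxtimes> d))"
    by (rule comp_in_hom[of _ "(c \<boxtimes> b) \<boxtimes> d"]) simp_all
  then have 2 [simp]: "?s \<in> Hom M (b \<boxtimes> (c \<boxtimes> d)) (c \<boxtimes> (b \<boxtimes> d))"
    by (rule comp_in_hom[rotated 4]) simp_all
  have 3: "mk (b \<boxtimes> (c \<boxtimes> d)) (c \<boxtimes> (b \<boxtimes> d)) ?s = swp b c d"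
    using 1 by (simp add: swp_def asc_def asci_def brd_def idt_def comp_assoc[of "b \<boxtimes> (c \<boxtimes> d)" "(b \<boxtimes> c) \<boxtimes> d" "(c \<boxtimes> b) \<boxtimes> d" "c \<boxtimes> (b \<boxtimes> d)"]
        comp_in_hom[of "b \<boxtimes> (c \<boxtimes> d)" "(b \<boxtimes> c) \<boxtimes> d" "(c \<boxtimes> b) \<boxtimes> d"] flip: mk_cmp mk_tens)
  have 4: "AssocInv M a c (b \<boxtimes> d) \<cdot> (Ident M a \<otimes> ?s) \<in> Hom M (a \<boxtimes> (b \<boxtimes> (c \<boxtimes> d))) ((a \<boxtimes> c) \<boxtimes> (b \<boxtimes> d))"
    by (rule comp_in_hom[of _ "a \<boxtimes> (c \<boxtimes> (b \<boxtimes> d))"]) simp_all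
  then show "Interchange M a b c d \<in> Hom M ((a \<boxtimes> b) \<boxtimes> (c \<boxtimes> d)) ((a \<boxtimes> c) \<boxtimes> (b \<boxtimes> d))"
    unfolding Interchange_def by (rule comp_in_hom[rotated 4]) simp_all
  have "itc a b c d = (asci a c (b \<boxtimes> d) \<bullet> (idt a \<odot> swp b c d)) \<bullet> asc a b (c \<boxtimes> d)"
    by (simp add: itc_def)
  also have "\<dots> = mk ((a \<boxtimes> b) \<boxtimes> (c \<boxtimes> d)) ((a \<boxtimes> c) \<boxtimes> (b \<boxtimes> d)) (Interchange M a b c d)"
    unfolding Interchange_def using 4
    by (simp del: cmp_assoc add: 3[symmetric] asc_def asci_def idt_def flip: mk_cmp mk_tens)
  finally show "mk ((a \<boxtimes> b) \<boxtimes> (c \<boxtimes> d)) ((a \<boxtimes> c) \<boxtimes> (b \<boxtimes> d)) (Interchange M a b c d) = itc a b c d" by simp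
qed

lemma asc_itc: "\<lbrakk>a \<in> Obj M; b \<in> Obj M; c \<in> Obj M; d \<in> Obj M\<rbrakk> \<Longrightarrow>
    asc a c (b \<boxtimes> d) \<bullet> itc a b c d = (idt a \<odot> swp b c d) \<bullet> asc a b (c \<boxtimes> d)"
  by (simp add: itc_def)

lemma nat_itc:
  assumes [simp]: "arr f" "arr g" "arr h" "arr k" and t [simp]: "trg f = a" "trg g = b" "trg h = c" "trg k = d"
  shows "itc a b c d \<bullet> ((f \<odot> g) \<odot> (h \<odot> k)) = ((f \<odot> h) \<odot> (g \<odot> k)) \<bullet> itc (src f) (src g) (src h) (src k)"
proof -
  have [simp]: "a \<in> Obj M" "b \<in> Obj M" "c \<in> Obj M" "d \<in> Obj M"
    using assms arr_obj(2) by blast+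
  have 1: "asc a b (c \<boxtimes> d) \<bullet> ((f \<odot> g) \<odot> (h \<odot> k)) = (f \<odot> (g \<odot> (h \<odot> k))) \<bullet> asc (src f) (src g) (src h \<boxtimes> src k)"
    by (simp add: nat_asc)
  have 2: "(idt a \<odot> swp b c d) \<bullet> (f \<odot> (g \<odot> (h \<odot> k)))
      = (f \<odot> (h \<odot> (g \<odot> k))) \<bullet> (idt (src f) \<odot> swp (src g) (src h) (src k))"
    by (simp add: tens_cmp nat_swp)
  have 3: "asci a c (b \<boxtimes> d) \<bullet> (f \<odot> (h \<odot> (g \<odot> k))) = ((f \<odot> h) \<odot> (g \<odot> k)) \<bullet> asci (src f) (src h) (src g \<boxtimes> src k)"
    by (simp add: nat_asci)
  show ?thesis
    by (simp only: itc_def cmp_assoc 1 2[THEN reduce] 3[THEN reduce])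
qed

lemma itc_inv: "\<lbrakk>a \<in> Obj M; b \<in> Obj M; c \<in> Obj M; d \<in> Obj M\<rbrakk> \<Longrightarrow>
    itc a c b d \<bullet> itc a b c d = idt ((a \<boxtimes> b) \<boxtimes> (c \<boxtimes> d))"
  by (simp add: itc_def tens_cmp tens_cmp[THEN reduce] swp_inv)

text \<open>Both sides are compared after reassociating their common target to
  \<open>a \<boxtimes> (b \<boxtimes> (a' \<boxtimes> (b' \<boxtimes> _)))\<close>, where they consist of transpositions of adjacent factors.\<close>

lemma asc_itc_tens:
  assumes [simp]: "a \<in> Obj M" "a' \<in> Obj M" "b \<in> Obj M" "b' \<in> Obj M" "x \<in> Obj M"
  shows "(idt a \<odot> (idt b \<odot> asc a' b' x)) \<bullet> asc a b ((a' \<boxtimes> b') \<boxtimes> x) \<bullet> asc (a \<boxtimes> b) (a' \<boxtimes> b') x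
      \<bullet> (itc a a' b b' \<odot> idt x)
    = (idt a \<odot> swp a' b (b' \<boxtimes> x)) \<bullet> (idt a \<odot> (idt a' \<odot> asc b b' x))
      \<bullet> asc a a' ((b \<boxtimes> b') \<boxtimes> x) \<bullet> asc (a \<boxtimes> a') (b \<boxtimes> b') x"
proof -
  have "(idt a \<odot> (idt b \<odot> asc a' b' x)) \<bullet> asc a b ((a' \<boxtimes> b') \<boxtimes> x) \<bullet> asc (a \<boxtimes> b) (a' \<boxtimes> b') x
      \<bullet> (itc a a' b b' \<odot> idt x)
    = (idt a \<odot> (idt b \<odot> asc a' b' x)) \<bullet> (idt a \<odot> asc b (a' \<boxtimes> b') x) \<bullet> asc a (b \<boxtimes> (a' \<boxtimes> b')) x
      \<bullet> ((asc a b (a' \<boxtimes> b') \<bullet> itc a a' b b') \<odot> idt x)"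
    by (simp add: tens_r pent[symmetric, THEN reduce])
  also have "\<dots> = (idt a \<odot> (idt b \<odot> asc a' b' x)) \<bullet> (idt a \<odot> asc b (a' \<boxtimes> b') x)
      \<bullet> (idt a \<odot> (swp a' b b' \<odot> idt x)) \<bullet> asc a (a' \<boxtimes> (b \<boxtimes> b')) x \<bullet> (asc a a' (b \<boxtimes> b') \<odot> idt x)"
    by (simp add: asc_itc tens_r nat_asc[THEN reduce])
  also have "\<dots> = (idt a \<odot> (swp a' b (b' \<boxtimes> x) \<bullet> (idt a' \<odot> asc b b' x) \<bullet> asc a' (b \<boxtimes> b') x))
      \<bullet> asc a (a' \<boxtimes> (b \<boxtimes> b')) x \<bullet> (asc a a' (b \<boxtimes> b') \<odot> idt x)"
    by (simp add: swp_tens tens_cmp[THEN reduce])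
  also have "\<dots> = (idt a \<odot> swp a' b (b' \<boxtimes> x)) \<bullet> (idt a \<odot> (idt a' \<odot> asc b b' x))
      \<bullet> asc a a' ((b \<boxtimes> b') \<boxtimes> x) \<bullet> asc (a \<boxtimes> a') (b \<boxtimes> b') x"
    by (simp add: tens_l pent)
  finally show ?thesis .
qed

lemma itc_assoc:
  assumes [simp]: "a \<in> Obj M" "a' \<in> Obj M" "a'' \<in> Obj M" "b \<in> Obj M" "b' \<in> Obj M" "b'' \<in> Obj M"
  shows "asc (a \<boxtimes> b) (a' \<boxtimes> b') (a'' \<boxtimes> b'') \<bullet> (itc a a' b b' \<odot> idt (a'' \<boxtimes> b'')) \<bullet> itc (a \<boxtimes> a') a'' (b \<boxtimes> b') b''
    = (idt (a \<boxtimes> b) \<odot> itc a' a'' b' b'') \<bullet> itc a (a' \<boxtimes> a'') b (b' \<boxtimes> b'') \<bullet> (asc a a' a'' \<odot> asc b b' b'')"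
    (is "?l = ?r")
proof -
  let ?x = "a'' \<boxtimes> b''"
  let ?F = "(idt a \<odot> (idt b \<odot> asc a' b' ?x)) \<bullet> asc a b ((a' \<boxtimes> b') \<boxtimes> ?x)"
  \<comment> \<open>The common normal form: \<open>a a' a'' b b' b''\<close> becomes
    \<open>a b a' b' a'' b''\<close> by moving \<open>a''\<close> past \<open>b\<close>, then
    \<open>a'\<close> past \<open>b\<close>, then \<open>a''\<close> past \<open>b'\<close>.\<close>
  let ?G = "(idt a \<odot> (idt b \<odot> (idt a' \<odot> swp a'' b' b''))) \<bullet> (idt a \<odot> swp a' b (a'' \<boxtimes> (b' \<boxtimes> b'')))
       \<bullet> (idt a \<odot> (idt a' \<odot> swp a'' b (b' \<boxtimes> b'')))"
  have n1: "swp a' b (b' \<boxtimes> ?x) \<bullet> (idt a' \<odot> (idt b \<odot> swp a'' b' b''))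
      = (idt b \<odot> (idt a' \<odot> swp a'' b' b'')) \<bullet> swp a' b (a'' \<boxtimes> (b' \<boxtimes> b''))"
    by (simp add: nat_swp)
  have "?F \<bullet> ?l = (idt a \<odot> swp a' b (b' \<boxtimes> ?x)) \<bullet> (idt a \<odot> (idt a' \<odot> asc b b' ?x))
      \<bullet> asc a a' ((b \<boxtimes> b') \<boxtimes> ?x) \<bullet> asc (a \<boxtimes> a') (b \<boxtimes> b') ?x \<bullet> itc (a \<boxtimes> a') a'' (b \<boxtimes> b') b''"
    using asc_itc_tens[of a a' b b' ?x, THEN reduce] by simp
  also have "\<dots> = (idt a \<odot> swp a' b (b' \<boxtimes> ?x)) \<bullet> (idt a \<odot> (idt a' \<odot> asc b b' ?x))
      \<bullet> (idt a \<odot> (idt a' \<odot> swp a'' (b \<boxtimes> b') b'')) \<bullet> asc a a' (a'' \<boxtimes> ((b \<boxtimes> b') \<boxtimes> b'')) \<bullet> asc (a \<boxtimes> a') a'' ((b \<boxtimes> b') \<boxtimes> b'')"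
    by (simp add: asc_itc nat_asc_l[THEN reduce])
  also have "\<dots> = (idt a \<odot> (swp a' b (b' \<boxtimes> ?x) \<bullet> (idt a' \<odot> (asc b b' ?x \<bullet> swp a'' (b \<boxtimes> b') b''))))
      \<bullet> asc a a' (a'' \<boxtimes> ((b \<boxtimes> b') \<boxtimes> b'')) \<bullet> asc (a \<boxtimes> a') a'' ((b \<boxtimes> b') \<boxtimes> b'')"
    by (simp add: tens_cmp tens_cmp[THEN reduce])
  also have "\<dots> = (idt a \<odot> (swp a' b (b' \<boxtimes> ?x) \<bullet> (idt a' \<odot> (idt b \<odot> swp a'' b' b'')) \<bullet> (idt a' \<odot> swp a'' b (b' \<boxtimes> b''))
        \<bullet> (idt a' \<odot> (idt a'' \<odot> asc b b' b''))))
      \<bullet> asc a a' (a'' \<boxtimes> ((b \<boxtimes> b') \<boxtimes> b'')) \<bullet> asc (a \<boxtimes> a') a'' ((b \<boxtimes> b') \<boxtimes> b'')"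
    by (simp add: swp_asc_right tens_l)
  also have "\<dots> = ?G \<bullet> (idt a \<odot> (idt a' \<odot> (idt a'' \<odot> asc b b' b'')))
      \<bullet> asc a a' (a'' \<boxtimes> ((b \<boxtimes> b') \<boxtimes> b'')) \<bullet> asc (a \<boxtimes> a') a'' ((b \<boxtimes> b') \<boxtimes> b'')"
    by (simp add: n1[THEN reduce] tens_l)
  finally have l: "?F \<bullet> ?l = ?G \<bullet> (idt a \<odot> (idt a' \<odot> (idt a'' \<odot> asc b b' b'')))
      \<bullet> asc a a' (a'' \<boxtimes> ((b \<boxtimes> b') \<boxtimes> b'')) \<bullet> asc (a \<boxtimes> a') a'' ((b \<boxtimes> b') \<boxtimes> b'')" .
  have "?F \<bullet> ?r = (idt a \<odot> (idt b \<odot> asc a' b' ?x)) \<bullet> (idt a \<odot> (idt b \<odot> itc a' a'' b' b''))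
      \<bullet> asc a b ((a' \<boxtimes> a'') \<boxtimes> (b' \<boxtimes> b'')) \<bullet> itc a (a' \<boxtimes> a'') b (b' \<boxtimes> b'') \<bullet> (asc a a' a'' \<odot> asc b b' b'')"
    by (simp add: nat_asc_l[THEN reduce])
  also have "\<dots> = (idt a \<odot> ((idt b \<odot> (idt a' \<odot> swp a'' b' b'')) \<bullet> ((idt b \<odot> asc a' a'' (b' \<boxtimes> b'')) \<bullet> swp (a' \<boxtimes> a'') b (b' \<boxtimes> b''))))
      \<bullet> asc a (a' \<boxtimes> a'') (b \<boxtimes> (b' \<boxtimes> b'')) \<bullet> (asc a a' a'' \<odot> asc b b' b'')"
    by (simp add: asc_itc asc_itc[THEN reduce] tens_cmp[THEN reduce])
  also have "\<dots> = ?G \<bullet> (idt a \<odot> asc a' a'' (b \<boxtimes> (b' \<boxtimes> b''))) \<bullet> asc a (a' \<boxtimes> a'') (b \<boxtimes> (b' \<boxtimes> b''))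
      \<bullet> (asc a a' a'' \<odot> asc b b' b'')"
    by (simp add: swp_asc_left tens_l)
  also have "(idt a \<odot> asc a' a'' (b \<boxtimes> (b' \<boxtimes> b''))) \<bullet> asc a (a' \<boxtimes> a'') (b \<boxtimes> (b' \<boxtimes> b'')) \<bullet> (asc a a' a'' \<odot> asc b b' b'')
      = (idt a \<odot> asc a' a'' (b \<boxtimes> (b' \<boxtimes> b''))) \<bullet> asc a (a' \<boxtimes> a'') (b \<boxtimes> (b' \<boxtimes> b'')) \<bullet> (asc a a' a'' \<odot> idt (b \<boxtimes> (b' \<boxtimes> b'')))
        \<bullet> (idt ((a \<boxtimes> a') \<boxtimes> a'') \<odot> asc b b' b'')"
    by (simp add: tens_cmp)
  also have "\<dots> = asc a a' (a'' \<boxtimes> (b \<boxtimes> (b' \<boxtimes> b''))) \<bullet> asc (a \<boxtimes> a') a'' (b \<boxtimes> (b' \<boxtimes> b'')) \<bullet> (idt ((a \<boxtimes> a') \<boxtimes> a'') \<odot> asc b b' b'')"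
    by (simp add: pent[THEN reduce, simplified])
  also have "\<dots> = (idt a \<odot> (idt a' \<odot> (idt a'' \<odot> asc b b' b'')))
      \<bullet> asc a a' (a'' \<boxtimes> ((b \<boxtimes> b') \<boxtimes> b'')) \<bullet> asc (a \<boxtimes> a') a'' ((b \<boxtimes> b') \<boxtimes> b'')"
    by (simp add: nat_asc_l nat_asc_l[THEN reduce])
  finally have "?F \<bullet> ?l = ?F \<bullet> ?r" using l by simp
  then show ?thesis
    by (rule mono_cancel[where d = "asci a b ((a' \<boxtimes> b') \<boxtimes> (a'' \<boxtimes> b'')) \<bullet> (idt a \<odot> (idt b \<odot> asci a' b' (a'' \<boxtimes> b'')))"])
      (simp_all add: merge)
qed

text \<open>This yields cocommutativity of a tensor product of comonoids. Both sides are reduced to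
  adjacent transpositions after composing with the invertible
  \<open>asc c d (a \<boxtimes> b)\<close>.\<close>

lemma brd_itc:
  assumes [simp]: "a \<in> Obj M" "b \<in> Obj M" "c \<in> Obj M" "d \<in> Obj M"
  shows "brd (a \<boxtimes> b) (c \<boxtimes> d) \<bullet> itc a c b d = itc c a d b \<bullet> (brd a c \<odot> brd b d)"
proof -
  have "asc c d (a \<boxtimes> b) \<bullet> brd (a \<boxtimes> b) (c \<boxtimes> d) = (idt c \<odot> brd (a \<boxtimes> b) d) \<bullet> swp (a \<boxtimes> b) c d"
    by (simp add: brd_tens)
  also have "\<dots> = (idt c \<odot> swp a d b) \<bullet> (idt c \<odot> (idt a \<odot> brd b d)) \<bullet> (idt c \<odot> asc a b d) \<bullet> swp (a \<boxtimes> b) c d"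
    by (simp add: tens_brd tens_l)
  also have "\<dots> = (idt c \<odot> swp a d b) \<bullet> (idt c \<odot> (idt a \<odot> brd b d)) \<bullet> swp a c (b \<boxtimes> d) \<bullet> (idt a \<odot> swp b c d) \<bullet> asc a b (c \<boxtimes> d)"
    by (simp add: swp_asc_left)
  finally have *: "asc c d (a \<boxtimes> b) \<bullet> brd (a \<boxtimes> b) (c \<boxtimes> d) = \<dots>" .
  have "asc c d (a \<boxtimes> b) \<bullet> brd (a \<boxtimes> b) (c \<boxtimes> d) \<bullet> itc a c b d
    = (idt c \<odot> swp a d b) \<bullet> (idt c \<odot> (idt a \<odot> brd b d)) \<bullet> swp a c (b \<boxtimes> d) \<bullet> asc a c (b \<boxtimes> d)"
    by (simp add: *[THEN reduce] itc_def tens_cmp[THEN reduce] swp_inv)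
  moreover have E: "(idt c \<odot> (idt a \<odot> brd b d)) \<bullet> asc c a (b \<boxtimes> d) = asc c a (d \<boxtimes> b) \<bullet> (idt (c \<boxtimes> a) \<odot> brd b d)"
    by (simp add: nat_asc_l)
  have "(idt c \<odot> swp a d b) \<bullet> (idt c \<odot> (idt a \<odot> brd b d)) \<bullet> swp a c (b \<boxtimes> d) \<bullet> asc a c (b \<boxtimes> d)
    = (idt c \<odot> swp a d b) \<bullet> asc c a (d \<boxtimes> b) \<bullet> (brd a c \<odot> brd b d)"
    by (simp add: swp_asc tens_cmp E[THEN reduce])
  moreover have "\<dots> = asc c d (a \<boxtimes> b) \<bullet> itc c a d b \<bullet> (brd a c \<odot> brd b d)"
    by (simp add: asc_itc asc_itc[THEN reduce])
  ultimately have "asc c d (a \<boxtimes> b) \<bullet> brd (a \<boxtimes> b) (c \<boxtimes> d) \<bullet> itc a c b d = asc c d (a \<boxtimes> b) \<bullet> itc c a d b \<bullet> (brd a c \<odot> brd b d)"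
    by (simp only:)
  then show ?thesis
    by (rule mono_cancel[where d = "asci c d (a \<boxtimes> b)"]) simp_all
qed

text \<open>The hexagon at \<open>a\<close>, \<open>I\<close>, \<open>I\<close>, with
  \<open>I\<close> the unit object, combined with naturality of the braiding at \<open>lu I\<close>
  gives the identity tensored with \<open>I\<close>, once the braiding of \<open>a\<close> with
  \<open>I\<close> has been cancelled on the left.\<close>

lemma lu_brd:
  assumes [simp]: "a \<in> Obj M"
  shows "lu a \<bullet> brd a (Unit M) = ru a"
proof (rule tens_unit_cancel)
  let ?I = "Unit M"
  have "brd a ?I \<bullet> (idt a \<odot> lu ?I) = (lu ?I \<odot> idt a) \<bullet> brd a (?I \<boxtimes> ?I)"
    by (simp add: nat_brd)
  also have "\<dots> = lu (?I \<boxtimes> a) \<bullet> asc ?I ?I a \<bullet> brd a (?I \<boxtimes> ?I)"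
    by (simp add: lu_tens[THEN reduce])
  also have "\<dots> = brd a ?I \<bullet> lu (a \<boxtimes> ?I) \<bullet> swp a ?I ?I"
    by (simp add: brd_tens nat_lu[THEN reduce])
  also have "\<dots> = brd a ?I \<bullet> ((lu a \<bullet> brd a ?I) \<odot> idt ?I) \<bullet> asci a ?I ?I"
    by (simp add: swp_def lu_tens[THEN reduce] tens_cmp[THEN reduce])
  finally have "idt a \<odot> lu ?I = ((lu a \<bullet> brd a ?I) \<odot> idt ?I) \<bullet> asci a ?I ?I"
    by (rule mono_cancel[where e = "brd a (Unit M)" and d = "brd (Unit M) a"]) simp_all
  then have "(idt a \<odot> lu ?I) \<bullet> asc a ?I ?I = (lu a \<bullet> brd a ?I) \<odot> idt ?I"
    by simp
  then show "(lu a \<bullet> brd a (Unit M)) \<odot> idt (Unit M) = ru a \<odot> idt (Unit M)"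
    by (simp add: tri)
qed simp_all

lemma brd_unit: "brd (Unit M) (Unit M) = idt (Unit M \<boxtimes> Unit M)"
  by (rule mono_cancel[where e = "lu (Unit M)" and d = "lui (Unit M)"]) (simp_all add: lu_brd lu_ru_unit[symmetric])

lemma itc_unit_mid: "\<lbrakk>a \<in> Obj M; b \<in> Obj M\<rbrakk> \<Longrightarrow> itc a (Unit M) (Unit M) b = idt ((a \<boxtimes> Unit M) \<boxtimes> (Unit M \<boxtimes> b))"
  by (simp add: itc_def swp_def brd_unit merge)

lemma lu_swp:
  assumes [simp]: "b \<in> Obj M" "x \<in> Obj M"
  shows "(idt b \<odot> lu x) \<bullet> swp (Unit M) b x = lu (b \<boxtimes> x)"
proof -
  have 1: "ru b \<bullet> brd (Unit M) b = lu b"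
    by (simp flip: lu_brd)
  have "(idt b \<odot> lu x) \<bullet> swp (Unit M) b x = (lu b \<odot> idt x) \<bullet> asci (Unit M) b x"
    by (simp add: swp_def tri[THEN reduce] tens_cmp[THEN reduce] 1)
  then show ?thesis by (simp flip: lu_tens)
qed

lemma lu_itc:
  assumes [simp]: "a \<in> Obj M" "b \<in> Obj M"
  shows "(lu a \<odot> lu b) \<bullet> itc (Unit M) (Unit M) a b = lu (a \<boxtimes> b) \<bullet> (lu (Unit M) \<odot> idt (a \<boxtimes> b))"
proof -
  have "(lu a \<odot> lu b) \<bullet> asci (Unit M) a (Unit M \<boxtimes> b) = (lu a \<odot> idt b) \<bullet> (idt (Unit M \<boxtimes> a) \<odot> lu b) \<bullet> asci (Unit M) a (Unit M \<boxtimes> b)"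
    by (simp add: merge)
  also have "\<dots> = lu (a \<boxtimes> b) \<bullet> (idt (Unit M) \<odot> (idt a \<odot> lu b))"
    by (simp add: lu_tens[symmetric] nat_asc_l[THEN reduce])
  finally have *: "(lu a \<odot> lu b) \<bullet> asci (Unit M) a (Unit M \<boxtimes> b) = \<dots>" .
  have "(lu a \<odot> lu b) \<bullet> itc (Unit M) (Unit M) a b
      = lu (a \<boxtimes> b) \<bullet> (idt (Unit M) \<odot> ((idt a \<odot> lu b) \<bullet> swp (Unit M) a b)) \<bullet> asc (Unit M) (Unit M) (a \<boxtimes> b)"
    by (simp add: itc_def *[THEN reduce] tens_l)
  then show ?thesis by (simp add: lu_swp tri lu_ru_unit)
qed

text \<open>Reduced to \<open>lu_itc\<close> by inserting braidings: \<open>lu_brd\<close> turns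
  right unitors into left ones, and \<open>brd_itc\<close> carries the braidings through the
  interchange map.\<close>

lemma ru_itc:
  assumes [simp]: "a \<in> Obj M" "b \<in> Obj M"
  shows "(ru a \<odot> ru b) \<bullet> itc a b (Unit M) (Unit M) = ru (a \<boxtimes> b) \<bullet> (idt (a \<boxtimes> b) \<odot> lu (Unit M))"
proof -
  let ?I = "Unit M"
  have "(ru a \<odot> ru b) \<bullet> itc a b ?I ?I = (lu a \<odot> lu b) \<bullet> (brd a ?I \<odot> brd b ?I) \<bullet> itc a b ?I ?I"
    by (simp add: merge lu_brd)
  also have "(brd a ?I \<odot> brd b ?I) \<bullet> itc a b ?I ?I = itc ?I ?I a b \<bullet> (itc ?I a ?I b \<bullet> (brd a ?I \<odot> brd b ?I)) \<bullet> itc a b ?I ?I"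
    by (simp add: itc_inv[THEN reduce])
  also have "\<dots> = itc ?I ?I a b \<bullet> brd (a \<boxtimes> b) (?I \<boxtimes> ?I)"
    by (simp add: brd_itc[symmetric, THEN reduce] itc_inv)
  also have "(lu a \<odot> lu b) \<bullet> \<dots> = lu (a \<boxtimes> b) \<bullet> (lu ?I \<odot> idt (a \<boxtimes> b)) \<bullet> brd (a \<boxtimes> b) (?I \<boxtimes> ?I)"
    by (simp add: lu_itc[THEN reduce])
  also have "\<dots> = lu (a \<boxtimes> b) \<bullet> brd (a \<boxtimes> b) ?I \<bullet> (idt (a \<boxtimes> b) \<odot> lu ?I)"
    by (simp add: nat_brd)
  finally show ?thesis by (simp add: lu_brd[THEN reduce])
qed


section \<open>Cocommutative comonoids\<close>

definition rw :: "('o, 'm) arrow \<Rightarrow> 'm" where "rw f = the (raw f)"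

lemma mk_rw [simp]: "\<lbrakk>arr f; src f = a; trg f = b\<rbrakk> \<Longrightarrow> mk a b (rw f) = f"
  by (auto simp: rw_def mk_def arr_def)

lemma rw_mk [simp]: "\<lbrakk>a \<in> Obj M; b \<in> Obj M; m \<in> Hom M a b\<rbrakk> \<Longrightarrow> rw (mk a b m) = m"
  by (simp add: rw_def)

lemma rw_in_hom: "\<lbrakk>arr f; src f = a; trg f = b\<rbrakk> \<Longrightarrow> rw f \<in> Hom M a b"
  by (auto simp: rw_def arr_def)

definition dl :: "('o, 'm, 'x) comonoid_data_scheme \<Rightarrow> ('o, 'm) arrow" where
  "dl X = mk (Car X) (Car X \<boxtimes> Car X) (Comult X)"

definition ep :: "('o, 'm, 'x) comonoid_data_scheme \<Rightarrow> ('o, 'm) arrow" where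
  "ep X = mk (Car X) (Unit M) (Counit X)"

lemma dl_ep_simps [simp]: "src (dl X) = Car X" "trg (dl X) = Car X \<boxtimes> Car X" "src (ep X) = Car X" "trg (ep X) = Unit M"
  by (simp_all add: dl_def ep_def)

definition coc :: "('o, 'm, 'x) comonoid_data_scheme \<Rightarrow> bool" where
  "coc X \<longleftrightarrow> Car X \<in> Obj M \<and> arr (dl X) \<and> arr (ep X) \<and>
     asc (Car X) (Car X) (Car X) \<bullet> (dl X \<odot> idt (Car X)) \<bullet> dl X = (idt (Car X) \<odot> dl X) \<bullet> dl X \<and>
     lu (Car X) \<bullet> (ep X \<odot> idt (Car X)) \<bullet> dl X = idt (Car X) \<and>
     brd (Car X) (Car X) \<bullet> dl X = dl X"

lemma cocI:
  "\<lbrakk>asc (Car X) (Car X) (Car X) \<bullet> (dl X \<odot> idt (Car X)) \<bullet> dl X = (idt (Car X) \<odot> dl X) \<bullet> dl X;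
    lu (Car X) \<bullet> (ep X \<odot> idt (Car X)) \<bullet> dl X = idt (Car X); brd (Car X) (Car X) \<bullet> dl X = dl X;
    Car X \<in> Obj M; arr (dl X); arr (ep X)\<rbrakk> \<Longrightarrow> coc X"
  by (simp only: coc_def simp_thms)

lemma coc_simps [simp]: assumes "coc X"
  shows "Car X \<in> Obj M" "arr (dl X)" "arr (ep X)" "brd (Car X) (Car X) \<bullet> dl X = dl X"
    "lu (Car X) \<bullet> (ep X \<odot> idt (Car X)) \<bullet> dl X = idt (Car X)"
    "asc (Car X) (Car X) (Car X) \<bullet> (dl X \<odot> idt (Car X)) \<bullet> dl X = (idt (Car X) \<odot> dl X) \<bullet> dl X"
  using assms by (simp_all add: coc_def)

text \<open>Braiding exchanges the two counit laws, and \<open>dl X\<close> is invariant under the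
  braiding.\<close>

lemma coc_counit_right: assumes [simp]: "coc X"
  shows "ru (Car X) \<bullet> (idt (Car X) \<odot> ep X) \<bullet> dl X = idt (Car X)"
proof -
  let ?c = "Car X"
  have "ru ?c \<bullet> (idt ?c \<odot> ep X) \<bullet> dl X = lu ?c \<bullet> (brd ?c (Unit M) \<bullet> (idt ?c \<odot> ep X)) \<bullet> dl X"
    by (simp flip: lu_brd)
  also have "\<dots> = lu ?c \<bullet> (ep X \<odot> idt ?c) \<bullet> brd ?c ?c \<bullet> dl X"
    by (simp add: nat_brd)
  finally show ?thesis by simp
qed

lemma coc_iff: "coc X \<longleftrightarrow> is_comonoid M X \<and> is_cocommutative M X"
proof -
  let ?c = "Car X"
  have a: "Assoc M ?c ?c ?c \<in> Hom M ((?c \<boxtimes> ?c) \<boxtimes> ?c) (?c \<boxtimes> (?c \<boxtimes> ?c))" if "?c \<in> Obj M"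
    using iso_hom[OF assoc_iso] that by simp
  have l: "LUnit M ?c \<in> Hom M (Unit M \<boxtimes> ?c) ?c" "RUnit M ?c \<in> Hom M (?c \<boxtimes> Unit M) ?c" if "?c \<in> Obj M"
    using iso_hom[OF lunit_iso] iso_hom[OF runit_iso] that by simp_all
  show ?thesis
  proof (cases "?c \<in> Obj M \<and> Comult X \<in> Hom M ?c (?c \<boxtimes> ?c) \<and> Counit X \<in> Hom M ?c (Unit M)")
    case True
    note [simp] = True[THEN conjunct1] True[THEN conjunct2, THEN conjunct1] True[THEN conjunct2, THEN conjunct2]
      a l tensor_in_hom ident_in_hom braid_in_hom mk_eq_iff
    have c: "Assoc M ?c ?c ?c \<cdot> (Comult X \<otimes> Ident M ?c) \<in> Hom M (?c \<boxtimes> ?c) (?c \<boxtimes> (?c \<boxtimes> ?c))"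
      by (rule comp_in_hom[of _ "(?c \<boxtimes> ?c) \<boxtimes> ?c"]) simp_all
    have d: "LUnit M ?c \<cdot> (Counit X \<otimes> Ident M ?c) \<in> Hom M (?c \<boxtimes> ?c) ?c"
      by (rule comp_in_hom[of _ "Unit M \<boxtimes> ?c"]) simp_all
    have e: "RUnit M ?c \<cdot> (Ident M ?c \<otimes> Counit X) \<in> Hom M (?c \<boxtimes> ?c) ?c"
      by (rule comp_in_hom[of _ "?c \<boxtimes> Unit M"]) simp_all
    have 1: "asc ?c ?c ?c \<bullet> (dl X \<odot> idt ?c) \<bullet> dl X = (idt ?c \<odot> dl X) \<bullet> dl X \<longleftrightarrow>
       Assoc M ?c ?c ?c \<cdot> (Comult X \<otimes> Ident M ?c) \<cdot> Comult X = (Ident M ?c \<otimes> Comult X) \<cdot> Comult X"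
      unfolding cmp_assoc[symmetric] using c
      by (simp add: asc_def dl_def idt_def comp_in_hom[OF _ _ _ _ c] comp_in_hom[of ?c "?c \<boxtimes> ?c" "?c \<boxtimes> (?c \<boxtimes> ?c)"]
          del: cmp_assoc flip: mk_cmp mk_tens)
    have 2: "lu ?c \<bullet> (ep X \<odot> idt ?c) \<bullet> dl X = idt ?c \<longleftrightarrow> LUnit M ?c \<cdot> (Counit X \<otimes> Ident M ?c) \<cdot> Comult X = Ident M ?c"
      unfolding cmp_assoc[symmetric] using d
      by (simp add: lu_def dl_def ep_def idt_def comp_in_hom[OF _ _ _ _ d] del: cmp_assoc flip: mk_cmp mk_tens)
    have 3: "ru ?c \<bullet> (idt ?c \<odot> ep X) \<bullet> dl X = idt ?c \<longleftrightarrow> RUnit M ?c \<cdot> (Ident M ?c \<otimes> Counit X) \<cdot> Comult X = Ident M ?c"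
      unfolding cmp_assoc[symmetric] using e
      by (simp add: ru_def dl_def ep_def idt_def comp_in_hom[OF _ _ _ _ e] del: cmp_assoc flip: mk_cmp mk_tens)
    have 4: "brd ?c ?c \<bullet> dl X = dl X \<longleftrightarrow> Braid M ?c ?c \<cdot> Comult X = Comult X"
      by (simp add: brd_def dl_def comp_in_hom[of ?c "?c \<boxtimes> ?c" "?c \<boxtimes> ?c"] flip: mk_cmp)
    have "is_comonoid M X \<and> is_cocommutative M X \<longleftrightarrow>
        asc ?c ?c ?c \<bullet> (dl X \<odot> idt ?c) \<bullet> dl X = (idt ?c \<odot> dl X) \<bullet> dl X \<and> lu ?c \<bullet> (ep X \<odot> idt ?c) \<bullet> dl X = idt ?c \<and>
        ru ?c \<bullet> (idt ?c \<odot> ep X) \<bullet> dl X = idt ?c \<and> brd ?c ?c \<bullet> dl X = dl X"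
      unfolding is_comonoid_def is_cocommutative_def 1 2 3 4 using True by blast
    moreover have "coc X \<longleftrightarrow>
        asc ?c ?c ?c \<bullet> (dl X \<odot> idt ?c) \<bullet> dl X = (idt ?c \<odot> dl X) \<bullet> dl X \<and> lu ?c \<bullet> (ep X \<odot> idt ?c) \<bullet> dl X = idt ?c \<and>
        brd ?c ?c \<bullet> dl X = dl X"
      unfolding coc_def using True by (simp only: dl_def ep_def arr_mk tensor_obj unit_obj) blast
    ultimately show ?thesis using coc_counit_right[of X] by blast
  next
    case False
    then show ?thesis by (simp only: coc_def is_comonoid_def dl_def ep_def arr_mk) blast
  qed
qed

text \<open>Below, \<open>cm\<close> and \<open>hm\<close> are the morphisms of cocommutative comonoids and of cocommutative Hopf
  monoids, \<open>mu X A\<close> is the convolution product, and \<open>e1 X A\<close> the neutral element, of morphisms \<open>X \<rightarrow> A\<close>.\<close>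

definition cm :: "('o, 'm, 'x) comonoid_data_scheme \<Rightarrow> ('o, 'm, 'y) comonoid_data_scheme \<Rightarrow> ('o, 'm) arrow \<Rightarrow> bool" where
  "cm X Y f \<longleftrightarrow> coc X \<and> coc Y \<and> arr f \<and> src f = Car X \<and> trg f = Car Y \<and>
     dl Y \<bullet> f = (f \<odot> f) \<bullet> dl X \<and> ep Y \<bullet> f = ep X"

lemma cmD: assumes "cm X Y f"
  shows "coc X" "coc Y" "arr f" "src f = Car X" "trg f = Car Y" "dl Y \<bullet> f = (f \<odot> f) \<bullet> dl X" "ep Y \<bullet> f = ep X"
  using assms by (simp_all add: cm_def)

lemma cm_idt: "coc X \<Longrightarrow> cm X X (idt (Car X))"
  by (simp add: cm_def)

lemma cm_cmp: assumes "cm X Y f" "cm Y Z g" shows "cm X Z (g \<bullet> f)"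
proof -
  note [simp] = cmD[OF assms(1)] cmD[OF assms(2)]
  have "dl Z \<bullet> g \<bullet> f = (g \<odot> g) \<bullet> (f \<odot> f) \<bullet> dl X"
    using cmD(6)[OF assms(2), THEN reduce, of f] by simp
  moreover have "ep Z \<bullet> g \<bullet> f = ep X"
    using cmD(7)[OF assms(2), THEN reduce, of f] by simp
  ultimately show ?thesis by (simp add: cm_def tens_cmp tens_cmp[THEN reduce])
qed

text \<open>The arrow \<open>x \<mapsto> (f x, g x)\<close> on generalized elements. Rules such as
  \<open>asc_pair\<close> and \<open>brd_pair\<close> hold for arbitrary arrows \<open>f\<close> and
  \<open>g\<close>; a comonoid morphism is required in \<open>pair_cmp\<close>, where an element is
  duplicated before \<open>h\<close> instead of after it.\<close>

definition pair :: "('o, 'm, 'x) comonoid_data_scheme \<Rightarrow> ('o, 'm) arrow \<Rightarrow> ('o, 'm) arrow \<Rightarrow> ('o, 'm) arrow" where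
  "pair X f g = (f \<odot> g) \<bullet> dl X"

lemma pair_simps [simp]: "src (pair X f g) = Car X" "trg (pair X f g) = trg f \<boxtimes> trg g"
  "\<lbrakk>coc X; arr f; arr g; src f = Car X; src g = Car X\<rbrakk> \<Longrightarrow> arr (pair X f g)"
  by (simp_all add: pair_def)

lemma tens_pair: "\<lbrakk>trg f = src u; trg g = src v\<rbrakk> \<Longrightarrow> (u \<odot> v) \<bullet> pair X f g = pair X (u \<bullet> f) (v \<bullet> g)"
  by (simp add: pair_def tens_cmp[THEN reduce])

lemma pair_cmp: "\<lbrakk>cm X Y h; src f = Car Y; src g = Car Y\<rbrakk> \<Longrightarrow> pair Y f g \<bullet> h = pair X (f \<bullet> h) (g \<bullet> h)"
  by (simp add: pair_def cmD tens_cmp[THEN reduce])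

lemma asc_pair:
  assumes [simp]: "coc X" "arr f" "arr g" "arr h" "src f = Car X" "src g = Car X" "src h = Car X"
    and [simp]: "trg f = a" "trg g = b" "trg h = c"
  shows "asc a b c \<bullet> pair X (pair X f g) h = pair X f (pair X g h)"
proof -
  let ?c = "Car X"
  have "pair X (pair X f g) h = ((f \<odot> g) \<odot> h) \<bullet> (dl X \<odot> idt ?c) \<bullet> dl X"
    by (simp add: pair_def tens_cmp[THEN reduce])
  then have "asc a b c \<bullet> pair X (pair X f g) h = (f \<odot> (g \<odot> h)) \<bullet> asc ?c ?c ?c \<bullet> (dl X \<odot> idt ?c) \<bullet> dl X"
    by (simp add: nat_asc[THEN reduce])
  then show ?thesis by (simp add: pair_def tens_cmp[THEN reduce])
qed

lemma asci_pair:
  assumes [simp]: "coc X" "arr f" "arr g" "arr h" "src f = Car X" "src g = Car X" "src h = Car X"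
    and t [simp]: "trg f = a" "trg g = b" "trg h = c"
  shows "asci a b c \<bullet> pair X f (pair X g h) = pair X (pair X f g) h"
proof -
  have "a \<in> Obj M" "b \<in> Obj M" "c \<in> Obj M"
    using assms(2-4) t arr_obj(2) by blast+
  then show ?thesis by (simp flip: asc_pair[OF assms])
qed

lemma brd_pair:
  assumes [simp]: "coc X" "arr f" "arr g" "src f = Car X" "src g = Car X" "trg f = a" "trg g = b"
  shows "brd a b \<bullet> pair X f g = pair X g f"
  by (simp add: pair_def nat_brd[THEN reduce])

lemma lu_pair:
  assumes [simp]: "coc X" "arr f" "src f = Car X" "trg f = b"
  shows "lu b \<bullet> pair X (ep X) f = f"
proof -
  have "pair X (ep X) f = (idt (Unit M) \<odot> f) \<bullet> (ep X \<odot> idt (Car X)) \<bullet> dl X"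
    by (simp add: pair_def tens_cmp[THEN reduce])
  then show ?thesis by (simp add: nat_lu[THEN reduce])
qed

lemma ru_pair:
  assumes [simp]: "coc X" "arr f" "src f = Car X" "trg f = b"
  shows "ru b \<bullet> pair X f (ep X) = f"
proof -
  have "pair X f (ep X) = (f \<odot> idt (Unit M)) \<bullet> (idt (Car X) \<odot> ep X) \<bullet> dl X"
    by (simp add: pair_def tens_cmp[THEN reduce])
  then show ?thesis by (simp add: nat_ru[THEN reduce] coc_counit_right)
qed

lemma dl_eq_pair: "coc X \<Longrightarrow> dl X = pair X (idt (Car X)) (idt (Car X))"
  by (simp add: pair_def)

lemma cm_dl: "cm X Y f \<Longrightarrow> dl Y \<bullet> f = pair X f f"
  by (simp add: cmD pair_def)

lemma swp_pair:
  assumes [simp]: "coc X" "arr f" "arr g" "arr h" "src f = Car X" "src g = Car X" "src h = Car X"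
    and t [simp]: "trg f = a" "trg g = b" "trg h = c"
  shows "swp a b c \<bullet> pair X f (pair X g h) = pair X g (pair X f h)"
proof -
  have [simp]: "a \<in> Obj M" "b \<in> Obj M" "c \<in> Obj M"
    using assms(2-4) t arr_obj(2) by blast+
  show ?thesis by (simp add: swp_def asci_pair tens_pair brd_pair asc_pair)
qed

text \<open>Exchanging the two middle components is where cocommutativity of \<open>X\<close>
  enters, by way of \<open>swp_pair\<close> and \<open>brd_pair\<close>.\<close>

lemma itc_pair:
  assumes [simp]: "coc X" "arr f" "arr g" "arr h" "arr k" "src f = Car X" "src g = Car X" "src h = Car X" "src k = Car X"
    and t [simp]: "trg f = a" "trg g = b" "trg h = c" "trg k = d"
  shows "itc a b c d \<bullet> pair X (pair X f g) (pair X h k) = pair X (pair X f h) (pair X g k)"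
proof -
  have [simp]: "a \<in> Obj M" "b \<in> Obj M" "c \<in> Obj M" "d \<in> Obj M"
    using assms(2-5) t arr_obj(2) by blast+
  show ?thesis by (simp add: itc_def asci_pair tens_pair swp_pair asc_pair)
qed

section \<open>Products of cocommutative comonoids\<close>

definition prodc :: "('o, 'm, 'x) comonoid_data_scheme \<Rightarrow> ('o, 'm, 'y) comonoid_data_scheme \<Rightarrow> ('o, 'm) comonoid_data" where
  "prodc X Y = \<lparr>Car = Car X \<boxtimes> Car Y,
     Comult = rw (itc (Car X) (Car X) (Car Y) (Car Y) \<bullet> (dl X \<odot> dl Y)),
     Counit = rw (lu (Unit M) \<bullet> (ep X \<odot> ep Y))\<rparr>"

lemma Car_prodc [simp]: "Car (prodc X Y) = Car X \<boxtimes> Car Y"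
  by (simp add: prodc_def)

lemma dl_prodc: "\<lbrakk>coc X; coc Y\<rbrakk> \<Longrightarrow> dl (prodc X Y) = itc (Car X) (Car X) (Car Y) (Car Y) \<bullet> (dl X \<odot> dl Y)"
  by (simp add: dl_def[of "prodc X Y"]) (simp add: prodc_def)

lemma ep_prodc: "\<lbrakk>coc X; coc Y\<rbrakk> \<Longrightarrow> ep (prodc X Y) = lu (Unit M) \<bullet> (ep X \<odot> ep Y)"
  by (simp add: ep_def[of "prodc X Y"]) (simp add: prodc_def)

lemma coc_prodc [simp]:
  assumes [simp]: "coc X" "coc Y"
  shows "coc (prodc X Y)"
proof -
  let ?c = "Car X" and ?d = "Car Y" and ?I = "Unit M"
  let ?W = "Car X \<boxtimes> Car Y"
  \<comment> \<open>Naturality moves the comultiplications and counits of the factors through the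
    interchange map. What remains are \<open>itc_assoc\<close>, \<open>lu_itc\<close> and
    \<open>brd_itc\<close>, followed by the axioms of \<open>X\<close> and \<open>Y\<close>.\<close>
  have n1: "(dl X \<odot> dl Y) \<odot> idt ?W \<bullet> itc ?c ?c ?d ?d = itc (?c \<boxtimes> ?c) ?c (?d \<boxtimes> ?d) ?d \<bullet> ((dl X \<odot> idt ?c) \<odot> (dl Y \<odot> idt ?d))"
    by (simp add: nat_itc)
  have n2: "idt ?W \<odot> (dl X \<odot> dl Y) \<bullet> itc ?c ?c ?d ?d = itc ?c (?c \<boxtimes> ?c) ?d (?d \<boxtimes> ?d) \<bullet> ((idt ?c \<odot> dl X) \<odot> (idt ?d \<odot> dl Y))"
    by (simp add: nat_itc)
  have n3: "(ep X \<odot> ep Y) \<odot> idt ?W \<bullet> itc ?c ?c ?d ?d = itc ?I ?c ?I ?d \<bullet> ((ep X \<odot> idt ?c) \<odot> (ep Y \<odot> idt ?d))"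
    by (simp add: nat_itc)
  have "asc ?W ?W ?W \<bullet> (dl (prodc X Y) \<odot> idt ?W) \<bullet> dl (prodc X Y)
    = asc ?W ?W ?W \<bullet> (itc ?c ?c ?d ?d \<odot> idt ?W) \<bullet> (((dl X \<odot> dl Y) \<odot> idt ?W) \<bullet> itc ?c ?c ?d ?d) \<bullet> (dl X \<odot> dl Y)"
    by (simp add: dl_prodc tens_r)
  also have "\<dots> = (asc ?W ?W ?W \<bullet> (itc ?c ?c ?d ?d \<odot> idt ?W) \<bullet> itc (?c \<boxtimes> ?c) ?c (?d \<boxtimes> ?d) ?d)
      \<bullet> ((dl X \<odot> idt ?c) \<bullet> dl X) \<odot> ((dl Y \<odot> idt ?d) \<bullet> dl Y)"
    by (simp add: n1 tens_cmp)
  also have "\<dots> = (idt ?W \<odot> itc ?c ?c ?d ?d) \<bullet> itc ?c (?c \<boxtimes> ?c) ?d (?d \<boxtimes> ?d)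
      \<bullet> ((asc ?c ?c ?c \<bullet> (dl X \<odot> idt ?c) \<bullet> dl X) \<odot> (asc ?d ?d ?d \<bullet> (dl Y \<odot> idt ?d) \<bullet> dl Y))"
    by (subst itc_assoc) (simp_all add: tens_cmp)
  also have "\<dots> = (idt ?W \<odot> itc ?c ?c ?d ?d) \<bullet> (itc ?c (?c \<boxtimes> ?c) ?d (?d \<boxtimes> ?d) \<bullet> ((idt ?c \<odot> dl X) \<odot> (idt ?d \<odot> dl Y))) \<bullet> (dl X \<odot> dl Y)"
    by (simp add: tens_cmp)
  also have "\<dots> = (idt ?W \<odot> dl (prodc X Y)) \<bullet> dl (prodc X Y)"
    unfolding n2[symmetric] by (simp add: dl_prodc tens_l)
  finally have 1: "asc ?W ?W ?W \<bullet> (dl (prodc X Y) \<odot> idt ?W) \<bullet> dl (prodc X Y) = (idt ?W \<odot> dl (prodc X Y)) \<bullet> dl (prodc X Y)" .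
  have "lu ?W \<bullet> (ep (prodc X Y) \<odot> idt ?W) \<bullet> dl (prodc X Y)
      = lu ?W \<bullet> (lu ?I \<odot> idt ?W) \<bullet> (((ep X \<odot> ep Y) \<odot> idt ?W) \<bullet> itc ?c ?c ?d ?d) \<bullet> (dl X \<odot> dl Y)"
    by (simp add: dl_prodc ep_prodc tens_r)
  also have "\<dots> = (lu ?W \<bullet> (lu ?I \<odot> idt ?W)) \<bullet> itc ?I ?c ?I ?d \<bullet> (((ep X \<odot> idt ?c) \<bullet> dl X) \<odot> ((ep Y \<odot> idt ?d) \<bullet> dl Y))"
    by (simp add: n3 tens_cmp)
  also have "\<dots> = idt ?W"
    by (simp add: lu_itc[symmetric] itc_inv[THEN reduce] tens_cmp)
  finally have 2: "lu ?W \<bullet> (ep (prodc X Y) \<odot> idt ?W) \<bullet> dl (prodc X Y) = idt ?W" .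
  have 3: "brd ?W ?W \<bullet> dl (prodc X Y) = dl (prodc X Y)"
    by (simp add: dl_prodc brd_itc[THEN reduce] tens_cmp)
  show ?thesis
    by (rule cocI) (use 1 2 3 in \<open>simp_all only: Car_prodc\<close>, simp_all add: dl_prodc ep_prodc)
qed

definition p1 :: "('o, 'm, 'x) comonoid_data_scheme \<Rightarrow> ('o, 'm, 'y) comonoid_data_scheme \<Rightarrow> ('o, 'm) arrow" where
  "p1 X Y = ru (Car X) \<bullet> (idt (Car X) \<odot> ep Y)"

definition p2 :: "('o, 'm, 'x) comonoid_data_scheme \<Rightarrow> ('o, 'm, 'y) comonoid_data_scheme \<Rightarrow> ('o, 'm) arrow" where
  "p2 X Y = lu (Car Y) \<bullet> (ep X \<odot> idt (Car Y))"

lemma p_simps [simp]: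
  "src (p1 X Y) = Car X \<boxtimes> Car Y" "src (p2 X Y) = Car X \<boxtimes> Car Y" "trg (p1 X Y) = Car X" "trg (p2 X Y) = Car Y"
  "\<lbrakk>coc X; coc Y\<rbrakk> \<Longrightarrow> arr (p1 X Y)" "\<lbrakk>coc X; coc Y\<rbrakk> \<Longrightarrow> arr (p2 X Y)"
  by (simp_all add: p1_def p2_def)

lemma ep_ep_dl:
  assumes [simp]: "coc X" shows "lu (Unit M) \<bullet> (ep X \<odot> ep X) \<bullet> dl X = ep X"
  using lu_pair[of X "ep X"] by (simp add: pair_def)

lemma cm_p1 [simp]:
  assumes [simp]: "coc X" "coc Y" shows "cm (prodc X Y) X (p1 X Y)"
proof -
  let ?c = "Car X" and ?d = "Car Y" and ?I = "Unit M"
  have n: "((idt ?c \<odot> ep Y) \<odot> (idt ?c \<odot> ep Y)) \<bullet> itc ?c ?c ?d ?d = itc ?c ?c ?I ?I \<bullet> (idt (?c \<boxtimes> ?c) \<odot> (ep Y \<odot> ep Y))"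
    using nat_itc[of "idt ?c" "idt ?c" "ep Y" "ep Y" ?c ?c ?I ?I] by simp
  have "(p1 X Y \<odot> p1 X Y) \<bullet> dl (prodc X Y)
      = (ru ?c \<odot> ru ?c) \<bullet> (((idt ?c \<odot> ep Y) \<odot> (idt ?c \<odot> ep Y)) \<bullet> itc ?c ?c ?d ?d) \<bullet> (dl X \<odot> dl Y)"
    by (simp add: p1_def dl_prodc tens_cmp[THEN reduce])
  also have "\<dots> = ru (?c \<boxtimes> ?c) \<bullet> (dl X \<odot> (lu ?I \<bullet> (ep Y \<odot> ep Y) \<bullet> dl Y))"
    unfolding n by (simp add: ru_itc[THEN reduce] tens_cmp tens_cmp[THEN reduce])
  also have "\<dots> = ru (?c \<boxtimes> ?c) \<bullet> (dl X \<odot> idt ?I) \<bullet> (idt ?c \<odot> ep Y)"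
    by (simp add: ep_ep_dl tens_cmp)
  also have "\<dots> = dl X \<bullet> p1 X Y"
    by (simp add: nat_ru[THEN reduce] p1_def)
  finally have 1: "dl X \<bullet> p1 X Y = (p1 X Y \<odot> p1 X Y) \<bullet> dl (prodc X Y)" by simp
  have "ep X \<bullet> p1 X Y = ru ?I \<bullet> (ep X \<odot> idt ?I) \<bullet> (idt ?c \<odot> ep Y)"
    by (simp add: p1_def nat_ru[THEN reduce])
  then have "ep X \<bullet> p1 X Y = ep (prodc X Y)"
    by (simp add: ep_prodc tens_cmp lu_ru_unit)
  with 1 show ?thesis by (simp add: cm_def)
qed

lemma cm_p2 [simp]:
  assumes [simp]: "coc X" "coc Y" shows "cm (prodc X Y) Y (p2 X Y)"
proof -
  let ?c = "Car X" and ?d = "Car Y" and ?I = "Unit M"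
  have n: "((ep X \<odot> idt ?d) \<odot> (ep X \<odot> idt ?d)) \<bullet> itc ?c ?c ?d ?d = itc ?I ?I ?d ?d \<bullet> ((ep X \<odot> ep X) \<odot> idt (?d \<boxtimes> ?d))"
    using nat_itc[of "ep X" "ep X" "idt ?d" "idt ?d" ?I ?I ?d ?d] by simp
  have "(p2 X Y \<odot> p2 X Y) \<bullet> dl (prodc X Y)
      = (lu ?d \<odot> lu ?d) \<bullet> (((ep X \<odot> idt ?d) \<odot> (ep X \<odot> idt ?d)) \<bullet> itc ?c ?c ?d ?d) \<bullet> (dl X \<odot> dl Y)"
    by (simp add: p2_def dl_prodc tens_cmp[THEN reduce])
  also have "\<dots> = lu (?d \<boxtimes> ?d) \<bullet> ((lu ?I \<bullet> (ep X \<odot> ep X) \<bullet> dl X) \<odot> dl Y)"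
    unfolding n by (simp add: lu_itc[THEN reduce] tens_cmp tens_cmp[THEN reduce])
  also have "\<dots> = lu (?d \<boxtimes> ?d) \<bullet> (idt ?I \<odot> dl Y) \<bullet> (ep X \<odot> idt ?d)"
    by (simp add: ep_ep_dl tens_cmp)
  also have "\<dots> = dl Y \<bullet> p2 X Y"
    by (simp add: nat_lu[THEN reduce] p2_def)
  finally have 1: "dl Y \<bullet> p2 X Y = (p2 X Y \<odot> p2 X Y) \<bullet> dl (prodc X Y)" by simp
  have "ep Y \<bullet> p2 X Y = lu ?I \<bullet> (idt ?I \<odot> ep Y) \<bullet> (ep X \<odot> idt ?d)"
    by (simp add: p2_def nat_lu[THEN reduce])
  then have "ep Y \<bullet> p2 X Y = ep (prodc X Y)"
    by (simp add: ep_prodc tens_cmp)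
  with 1 show ?thesis by (simp add: cm_def)
qed

text \<open>Comparing the comultiplications means reordering four copies of one element, which
  \<open>itc_pair\<close> does because \<open>X\<close> is cocommutative. This makes the tensor
  product the categorical product.\<close>

lemma cm_pair:
  assumes f: "cm X Y f" and g: "cm X Z g"
  shows "cm X (prodc Y Z) (pair X f g)"
proof -
  note [simp] = cmD[OF f] cmD[OF g] and [simp del] = cmD(6)[OF f] cmD(6)[OF g]
  have "dl (prodc Y Z) \<bullet> pair X f g = pair X (pair X f g) (pair X f g)"
    by (simp add: dl_prodc tens_pair cm_dl[OF f] cm_dl[OF g] itc_pair)
  moreover have "ep (prodc Y Z) \<bullet> pair X f g = ep X"
    by (simp add: ep_prodc tens_pair lu_pair)
  ultimately show ?thesis
    by (simp add: cm_def) (simp add: pair_def)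
qed

text \<open>The projection kills the second component by the counit, and \<open>g\<close> preserves
  counits. The first component may be any arrow; the mirror image \<open>p2_pair\<close> is used
  like this in \<open>cm_an\<close>, for an antipode whose compatibility with the comultiplications
  is still to be proved.\<close>

lemma p1_pair:
  assumes "cm X Z g" "arr f" "src f = Car X" "trg f = Car Y"
  shows "p1 Y Z \<bullet> pair X f g = f"
proof -
  note [simp] = cmD[OF assms(1)] assms arr_obj(2)[OF assms(2), unfolded assms]
  show ?thesis by (simp add: p1_def tens_pair ru_pair)
qed

lemma p2_pair:
  assumes "cm X Y f" "arr g" "src g = Car X" "trg g = Car Z"
  shows "p2 Y Z \<bullet> pair X f g = g"
proof -
  note [simp] = cmD[OF assms(1)] assms arr_obj(2)[OF assms(2), unfolded assms]
  show ?thesis by (simp add: p2_def tens_pair lu_pair)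
qed

text \<open>The comultiplication of the product makes four copies, of which the counits cancel the
  two middle ones. As a consequence, an arrow out of a product is determined by its value on the
  universal elements \<open>p1\<close> and \<open>p2\<close>.\<close>

lemma pair_p1_p2:
  assumes [simp]: "coc X" "coc Y" shows "pair (prodc X Y) (p1 X Y) (p2 X Y) = idt (Car X \<boxtimes> Car Y)"
proof -
  let ?c = "Car X" and ?d = "Car Y" and ?I = "Unit M"
  have n: "((idt ?c \<odot> ep Y) \<odot> (ep X \<odot> idt ?d)) \<bullet> itc ?c ?c ?d ?d = itc ?c ?I ?I ?d \<bullet> ((idt ?c \<odot> ep X) \<odot> (ep Y \<odot> idt ?d))"
    using nat_itc[of "idt ?c" "ep X" "ep Y" "idt ?d" ?c ?I ?I ?d] by simp
  have "pair (prodc X Y) (p1 X Y) (p2 X Y)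
      = (ru ?c \<odot> lu ?d) \<bullet> (((idt ?c \<odot> ep Y) \<odot> (ep X \<odot> idt ?d)) \<bullet> itc ?c ?c ?d ?d) \<bullet> (dl X \<odot> dl Y)"
    by (simp add: pair_def p1_def p2_def dl_prodc tens_cmp[THEN reduce])
  also have "\<dots> = (ru ?c \<bullet> (idt ?c \<odot> ep X) \<bullet> dl X) \<odot> (lu ?d \<bullet> (ep Y \<odot> idt ?d) \<bullet> dl Y)"
    unfolding n by (simp add: itc_unit_mid tens_cmp tens_cmp[THEN reduce])
  finally show ?thesis by (simp add: coc_counit_right)
qed

lemma pair_eta:
  assumes h: "cm T (prodc X Y) h" and [simp]: "coc X" "coc Y"
  shows "pair T (p1 X Y \<bullet> h) (p2 X Y \<bullet> h) = h"
  using pair_cmp[OF h, of "p1 X Y" "p2 X Y"] cmD[OF h] by (simp add: pair_p1_p2)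

text \<open>The terminal cocommutative comonoid; the unique morphism to it is the counit, see
  \<open>cm_unitc_iff\<close>.\<close>

definition unitc :: "('o, 'm) comonoid_data" where
  "unitc = \<lparr>Car = Unit M, Comult = rw (lui (Unit M)), Counit = rw (idt (Unit M))\<rparr>"

lemma unitc_simps [simp]: "Car unitc = Unit M" "dl unitc = lui (Unit M)" "ep unitc = idt (Unit M)"
  by (simp_all add: dl_def ep_def) (simp_all add: unitc_def)

lemma lui_pair: "coc X \<Longrightarrow> lui (Car X) = pair X (ep X) (idt (Car X))"
  by (rule mono_cancel[where e = "lu (Car X)" and d = "lui (Car X)"]) (simp_all add: lu_pair)

lemma coc_unitc [simp]: "coc unitc"
proof -
  let ?I = "Unit M"
  have t: "lu (?I \<boxtimes> ?I) = idt ?I \<odot> lu ?I"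
    by (rule mono_cancel[where e = "lu (Unit M)" and d = "lui (Unit M)"]) (simp_all add: nat_lu)
  have "(idt ?I \<odot> lu ?I) \<bullet> asc ?I ?I ?I \<bullet> (lui ?I \<odot> idt ?I) = idt (?I \<boxtimes> ?I)"
    by (simp add: tri[THEN reduce] tens_cmp flip: lu_ru_unit)
  also have "\<dots> = (idt ?I \<odot> lu ?I) \<bullet> (idt ?I \<odot> lui ?I)"
    by (simp add: tens_cmp)
  finally have "asc ?I ?I ?I \<bullet> (lui ?I \<odot> idt ?I) = idt ?I \<odot> lui ?I"
    by (rule mono_cancel[where d = "idt (Unit M) \<odot> lui (Unit M)"]) (simp_all add: tens_cmp)
  then have "asc ?I ?I ?I \<bullet> (lui ?I \<odot> idt ?I) \<bullet> lui ?I = (idt ?I \<odot> lui ?I) \<bullet> lui ?I"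
    by (simp flip: cmp_assoc)
  then show ?thesis by (intro cocI) (simp_all add: brd_unit)
qed

lemma cm_ep: assumes [simp]: "coc X" shows "cm X unitc (ep X)"
proof -
  have "lui (Unit M) \<bullet> ep X = (ep X \<odot> ep X) \<bullet> dl X"
    by (rule mono_cancel[where e = "lu (Unit M)" and d = "lui (Unit M)"]) (simp_all add: ep_ep_dl)
  then show ?thesis by (simp add: cm_def)
qed

lemma cm_unitc_iff: "cm X unitc f \<longleftrightarrow> coc X \<and> f = ep X"
  using cm_ep by (auto simp: cm_def)

lemma cm_tens:
  assumes f: "cm X Y f" and g: "cm Z W g" shows "cm (prodc X Z) (prodc Y W) (f \<odot> g)"
proof -
  note [simp] = cmD(1-5)[OF f] cmD(1-5)[OF g]
  have "f \<odot> g = (f \<odot> g) \<bullet> pair (prodc X Z) (p1 X Z) (p2 X Z)"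
    by (simp add: pair_p1_p2)
  also have "\<dots> = pair (prodc X Z) (f \<bullet> p1 X Z) (g \<bullet> p2 X Z)"
    by (simp add: tens_pair)
  finally show ?thesis
    using cm_pair[OF cm_cmp[OF cm_p1[of X Z] f] cm_cmp[OF cm_p2[of X Z] g]] by simp
qed


section \<open>Cocommutative Hopf monoids as internal groups\<close>

definition ml :: "('o, 'm, 'x) hopf_data_scheme \<Rightarrow> ('o, 'm) arrow" where
  "ml A = mk (Car A \<boxtimes> Car A) (Car A) (Mult A)"

definition un :: "('o, 'm, 'x) hopf_data_scheme \<Rightarrow> ('o, 'm) arrow" where
  "un A = mk (Unit M) (Car A) (One A)"

definition an :: "('o, 'm, 'x) hopf_data_scheme \<Rightarrow> ('o, 'm) arrow" where
  "an A = mk (Car A) (Car A) (Antipode A)"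

lemma ml_simps [simp]: "src (ml A) = Car A \<boxtimes> Car A" "trg (ml A) = Car A" "src (un A) = Unit M" "trg (un A) = Car A"
  "src (an A) = Car A" "trg (an A) = Car A"
  by (simp_all add: ml_def un_def an_def)

text \<open>A group object among cocommutative comonoids. The bimonoid equations are packaged as the
  requirement that multiplication and unit be comonoid morphisms; the antipode is just an arrow here
  and becomes a comonoid morphism in \<open>cm_an\<close>.\<close>

definition hopf :: "('o, 'm, 'x) hopf_data_scheme \<Rightarrow> bool" where
  "hopf A \<longleftrightarrow> coc A \<and> cm (prodc A A) A (ml A) \<and> cm unitc A (un A) \<and> arr (an A) \<and>
     ml A \<bullet> (ml A \<odot> idt (Car A)) = ml A \<bullet> (idt (Car A) \<odot> ml A) \<bullet> asc (Car A) (Car A) (Car A) \<and>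
     ml A \<bullet> (un A \<odot> idt (Car A)) = lu (Car A) \<and> ml A \<bullet> (idt (Car A) \<odot> un A) = ru (Car A) \<and>
     ml A \<bullet> (an A \<odot> idt (Car A)) \<bullet> dl A = un A \<bullet> ep A \<and> ml A \<bullet> (idt (Car A) \<odot> an A) \<bullet> dl A = un A \<bullet> ep A"

lemma hopfD: assumes "hopf A"
  shows "coc A" "cm (prodc A A) A (ml A)" "cm unitc A (un A)" "arr (ml A)" "arr (un A)" "arr (an A)"
    "ml A \<bullet> (ml A \<odot> idt (Car A)) = ml A \<bullet> (idt (Car A) \<odot> ml A) \<bullet> asc (Car A) (Car A) (Car A)"
    "ml A \<bullet> (un A \<odot> idt (Car A)) = lu (Car A)" "ml A \<bullet> (idt (Car A) \<odot> un A) = ru (Car A)"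
    "ml A \<bullet> (an A \<odot> idt (Car A)) \<bullet> dl A = un A \<bullet> ep A" "ml A \<bullet> (idt (Car A) \<odot> an A) \<bullet> dl A = un A \<bullet> ep A"
  using assms by (auto simp add: hopf_def dest: cmD)

lemmas hopf_simps [simp] = hopfD(1,4-6)

lemma hopf_iff: "hopf A \<longleftrightarrow> is_hopf_monoid M A \<and> is_cocommutative M A"
proof -
  let ?c = "Car A" and ?I = "Unit M"
  show ?thesis
  proof (cases "coc A \<and> Mult A \<in> Hom M (?c \<boxtimes> ?c) ?c \<and> One A \<in> Hom M ?I ?c \<and> Antipode A \<in> Hom M ?c ?c")
    case True
    then have [simp]: "coc A" "Mult A \<in> Hom M (?c \<boxtimes> ?c) ?c" "One A \<in> Hom M ?I ?c" "Antipode A \<in> Hom M ?c ?c"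
      by simp_all
    have [simp]: "Comult A \<in> Hom M ?c (?c \<boxtimes> ?c)" "Counit A \<in> Hom M ?c ?I"
      using coc_simps(2,3)[of A] by (simp_all add: dl_def ep_def)
    note [simp] = tensor_in_hom ident_in_hom braid_in_hom mk_eq_iff iso_hom[OF assoc_iso]
      iso_hom[OF lunit_iso] iso_hom[OF runit_iso] mk_Interchange(2)
    note defs = ml_def un_def an_def dl_def ep_def idt_def asc_def lu_def ru_def brd_def
    have h1: "Mult A \<cdot> (Ident M ?c \<otimes> Mult A) \<in> Hom M (?c \<boxtimes> (?c \<boxtimes> ?c)) ?c"
      by (rule comp_in_hom[of _ "?c \<boxtimes> ?c"]) simp_all
    have h1': "Mult A \<cdot> (Mult A \<otimes> Ident M ?c) \<in> Hom M ((?c \<boxtimes> ?c) \<boxtimes> ?c) ?c"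
      by (rule comp_in_hom[of _ "?c \<boxtimes> ?c"]) simp_all
    have e1: "ml A \<bullet> (ml A \<odot> idt ?c) = ml A \<bullet> (idt ?c \<odot> ml A) \<bullet> asc ?c ?c ?c \<longleftrightarrow>
        Mult A \<cdot> (Mult A \<otimes> Ident M ?c) = Mult A \<cdot> (Ident M ?c \<otimes> Mult A) \<cdot> Assoc M ?c ?c ?c"
      unfolding cmp_assoc[symmetric] using h1 h1'
      by (simp add: defs comp_in_hom[OF _ _ _ _ h1] del: cmp_assoc flip: mk_cmp mk_tens)
    have e2: "ml A \<bullet> (un A \<odot> idt ?c) = lu ?c \<longleftrightarrow> Mult A \<cdot> (One A \<otimes> Ident M ?c) = LUnit M ?c"
      by (simp add: defs comp_in_hom[of _ "?c \<boxtimes> ?c"] flip: mk_cmp mk_tens)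
    have e3: "ml A \<bullet> (idt ?c \<odot> un A) = ru ?c \<longleftrightarrow> Mult A \<cdot> (Ident M ?c \<otimes> One A) = RUnit M ?c"
      by (simp add: defs comp_in_hom[of _ "?c \<boxtimes> ?c"] flip: mk_cmp mk_tens)
    have h4: "Mult A \<cdot> (Antipode A \<otimes> Ident M ?c) \<in> Hom M (?c \<boxtimes> ?c) ?c"
      "Mult A \<cdot> (Ident M ?c \<otimes> Antipode A) \<in> Hom M (?c \<boxtimes> ?c) ?c" "One A \<cdot> Counit A \<in> Hom M ?c ?c"
      by (rule comp_in_hom[of _ "?c \<boxtimes> ?c"] comp_in_hom[of _ "?I"]; simp)+
    have e4: "ml A \<bullet> (an A \<odot> idt ?c) \<bullet> dl A = un A \<bullet> ep A \<longleftrightarrow> Mult A \<cdot> (Antipode A \<otimes> Ident M ?c) \<cdot> Comult A = One A \<cdot> Counit A"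
      unfolding cmp_assoc[symmetric] using h4
      by (simp add: defs comp_in_hom[OF _ _ _ _ h4(1)] del: cmp_assoc flip: mk_cmp mk_tens)
    have e5: "ml A \<bullet> (idt ?c \<odot> an A) \<bullet> dl A = un A \<bullet> ep A \<longleftrightarrow> Mult A \<cdot> (Ident M ?c \<otimes> Antipode A) \<cdot> Comult A = One A \<cdot> Counit A"
      unfolding cmp_assoc[symmetric] using h4
      by (simp add: defs comp_in_hom[OF _ _ _ _ h4(2)] del: cmp_assoc flip: mk_cmp mk_tens)
    have h6: "(Mult A \<otimes> Mult A) \<cdot> Interchange M ?c ?c ?c ?c \<in> Hom M ((?c \<boxtimes> ?c) \<boxtimes> (?c \<boxtimes> ?c)) (?c \<boxtimes> ?c)"
      by (rule comp_in_hom[of _ "(?c \<boxtimes> ?c) \<boxtimes> (?c \<boxtimes> ?c)"]) simp_all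
    have e6: "dl A \<bullet> ml A = (ml A \<odot> ml A) \<bullet> dl (prodc A A) \<longleftrightarrow>
        Comult A \<cdot> Mult A = (Mult A \<otimes> Mult A) \<cdot> Interchange M ?c ?c ?c ?c \<cdot> (Comult A \<otimes> Comult A)"
      unfolding dl_prodc[OF \<open>coc A\<close> \<open>coc A\<close>] unfolding cmp_assoc[symmetric] using h6
      by (simp add: ml_def dl_def mk_Interchange(1)[symmetric] comp_in_hom[OF _ _ _ _ h6]
          comp_in_hom[of "?c \<boxtimes> ?c" ?c "?c \<boxtimes> ?c"] del: cmp_assoc flip: mk_cmp mk_tens)
    have u: "LUnitInv M ?I \<in> Hom M ?I (?I \<boxtimes> ?I)" "mk ?I (?I \<boxtimes> ?I) (LUnitInv M ?I) = lui ?I"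
      using arr_str(5)[of ?I] by (simp_all add: lui_def)
    have e7: "dl A \<bullet> un A = (un A \<odot> un A) \<bullet> dl unitc \<longleftrightarrow> Comult A \<cdot> One A = (One A \<otimes> One A) \<cdot> LUnitInv M ?I"
      using u(1) by (simp add: dl_def[of A] un_def u(2)[symmetric] comp_in_hom[of ?I ?c "?c \<boxtimes> ?c"] comp_in_hom[of ?I "?I \<boxtimes> ?I" "?c \<boxtimes> ?c"]
          flip: mk_cmp mk_tens)
    have e8: "ep A \<bullet> ml A = ep (prodc A A) \<longleftrightarrow> Counit A \<cdot> Mult A = LUnit M ?I \<cdot> (Counit A \<otimes> Counit A)"
      unfolding ep_prodc[OF \<open>coc A\<close> \<open>coc A\<close>]
      by (simp add: ep_def ml_def lu_def comp_in_hom[of "?c \<boxtimes> ?c" ?c ?I] comp_in_hom[of "?c \<boxtimes> ?c" "?I \<boxtimes> ?I" ?I]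
          flip: mk_cmp mk_tens)
    have e9: "ep A \<bullet> un A = ep unitc \<longleftrightarrow> Counit A \<cdot> One A = Ident M ?I"
      by (simp add: ep_def[of A] un_def idt_def comp_in_hom[of ?I ?c ?I] flip: mk_cmp)
    have a: "arr (ml A)" "arr (un A)" "arr (an A)"
      by (simp_all add: ml_def un_def an_def)
    have c: "is_comonoid M A" "is_cocommutative M A" using coc_iff[of A] by simp_all
    have "is_hopf_monoid M A \<and> is_cocommutative M A \<longleftrightarrow>
       (Mult A \<cdot> (Mult A \<otimes> Ident M ?c) = Mult A \<cdot> (Ident M ?c \<otimes> Mult A) \<cdot> Assoc M ?c ?c ?c \<and>
        Mult A \<cdot> (One A \<otimes> Ident M ?c) = LUnit M ?c \<and> Mult A \<cdot> (Ident M ?c \<otimes> One A) = RUnit M ?c \<and>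
        Comult A \<cdot> Mult A = (Mult A \<otimes> Mult A) \<cdot> Interchange M ?c ?c ?c ?c \<cdot> (Comult A \<otimes> Comult A) \<and>
        Comult A \<cdot> One A = (One A \<otimes> One A) \<cdot> LUnitInv M ?I \<and>
        Counit A \<cdot> Mult A = LUnit M ?I \<cdot> (Counit A \<otimes> Counit A) \<and> Counit A \<cdot> One A = Ident M ?I \<and>
        Mult A \<cdot> (Antipode A \<otimes> Ident M ?c) \<cdot> Comult A = One A \<cdot> Counit A \<and>
        Mult A \<cdot> (Ident M ?c \<otimes> Antipode A) \<cdot> Comult A = One A \<cdot> Counit A)"
      unfolding is_hopf_monoid_def is_bimonoid_def is_monoid_def using c True coc_simps(1)[of A] by blast
    moreover have "hopf A \<longleftrightarrow>
       (ml A \<bullet> (ml A \<odot> idt ?c) = ml A \<bullet> (idt ?c \<odot> ml A) \<bullet> asc ?c ?c ?c \<and>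
        ml A \<bullet> (un A \<odot> idt ?c) = lu ?c \<and> ml A \<bullet> (idt ?c \<odot> un A) = ru ?c \<and>
        dl A \<bullet> ml A = (ml A \<odot> ml A) \<bullet> dl (prodc A A) \<and> dl A \<bullet> un A = (un A \<odot> un A) \<bullet> dl unitc \<and>
        ep A \<bullet> ml A = ep (prodc A A) \<and> ep A \<bullet> un A = ep unitc \<and>
        ml A \<bullet> (an A \<odot> idt ?c) \<bullet> dl A = un A \<bullet> ep A \<and> ml A \<bullet> (idt ?c \<odot> an A) \<bullet> dl A = un A \<bullet> ep A)"
      unfolding hopf_def cm_def using a True coc_prodc[of A A] coc_unitc ml_simps[of A] Car_prodc[of A A] unitc_simps(1) by metis
    ultimately show ?thesis unfolding e1 e2 e3 e4 e5 e6 e7 e8 e9 by blast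
  next
    case False
    have "hopf A \<Longrightarrow> coc A \<and> Mult A \<in> Hom M (?c \<boxtimes> ?c) ?c \<and> One A \<in> Hom M ?I ?c \<and> Antipode A \<in> Hom M ?c ?c"
      using hopfD(1,4,5,6)[of A] by (simp add: ml_def un_def an_def)
    moreover have "is_hopf_monoid M A \<and> is_cocommutative M A \<Longrightarrow>
        coc A \<and> Mult A \<in> Hom M (?c \<boxtimes> ?c) ?c \<and> One A \<in> Hom M ?I ?c \<and> Antipode A \<in> Hom M ?c ?c"
      by (simp add: coc_iff is_hopf_monoid_def is_bimonoid_def is_monoid_def)
    ultimately show ?thesis using False by blast
  qed
qed

section \<open>Convolution products\<close>

definition mu :: "('o, 'm, 'x) comonoid_data_scheme \<Rightarrow> ('o, 'm, 'y) hopf_data_scheme \<Rightarrow> ('o, 'm) arrow \<Rightarrow> ('o, 'm) arrow \<Rightarrow> ('o, 'm) arrow" where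
  "mu X A x y = ml A \<bullet> pair X x y"

definition e1 :: "('o, 'm, 'x) comonoid_data_scheme \<Rightarrow> ('o, 'm, 'y) hopf_data_scheme \<Rightarrow> ('o, 'm) arrow" where
  "e1 X A = un A \<bullet> ep X"

lemma mu_simps [simp]: "src (mu X A x y) = Car X" "trg (mu X A x y) = Car A" "src (e1 X A) = Car X" "trg (e1 X A) = Car A"
  "\<lbrakk>hopf A; coc X\<rbrakk> \<Longrightarrow> arr (e1 X A)"
  "\<lbrakk>hopf A; coc X; arr x; arr y; src x = Car X; src y = Car X; trg x = Car A; trg y = Car A\<rbrakk> \<Longrightarrow> arr (mu X A x y)"
  by (simp_all add: mu_def e1_def)

lemma mu_assoc:
  assumes [simp]: "hopf A" "coc X" "arr x" "arr y" "arr z" "src x = Car X" "src y = Car X" "src z = Car X"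
    "trg x = Car A" "trg y = Car A" "trg z = Car A"
  shows "mu X A (mu X A x y) z = mu X A x (mu X A y z)"
proof -
  have "mu X A (mu X A x y) z = ml A \<bullet> (ml A \<odot> idt (Car A)) \<bullet> pair X (pair X x y) z"
    by (simp add: mu_def tens_pair)
  also have "\<dots> = ml A \<bullet> (idt (Car A) \<odot> ml A) \<bullet> asc (Car A) (Car A) (Car A) \<bullet> pair X (pair X x y) z"
    by (simp add: hopfD(7)[THEN reduce])
  also have "\<dots> = mu X A x (mu X A y z)"
    by (simp add: mu_def tens_pair asc_pair)
  finally show ?thesis .
qed

lemma mu_unit:
  assumes [simp]: "hopf A" "coc X" "arr x" "src x = Car X" "trg x = Car A"
  shows "mu X A (e1 X A) x = x" "mu X A x (e1 X A) = x"
proof -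
  have "mu X A (e1 X A) x = ml A \<bullet> (un A \<odot> idt (Car A)) \<bullet> pair X (ep X) x"
    by (simp add: mu_def e1_def tens_pair)
  then show "mu X A (e1 X A) x = x"
    by (simp add: hopfD(8)[THEN reduce] lu_pair)
  have "mu X A x (e1 X A) = ml A \<bullet> (idt (Car A) \<odot> un A) \<bullet> pair X x (ep X)"
    by (simp add: mu_def e1_def tens_pair)
  then show "mu X A x (e1 X A) = x"
    by (simp add: hopfD(9)[THEN reduce] ru_pair)
qed

text \<open>The antipode identities of \<open>A\<close> evaluated at \<open>x\<close>: as
  \<open>x\<close> preserves the comultiplication, \<open>dl A \<bullet> x\<close> consists of two
  copies of \<open>x\<close>.\<close>

lemma mu_inv:
  assumes [simp]: "hopf A" and x: "cm X A x"
  shows "mu X A (an A \<bullet> x) x = e1 X A" "mu X A x (an A \<bullet> x) = e1 X A"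
proof -
  note [simp] = cmD(1-5)[OF x]
  have "mu X A (an A \<bullet> x) x = ml A \<bullet> (an A \<odot> idt (Car A)) \<bullet> dl A \<bullet> x"
    by (simp add: mu_def cm_dl[OF x] tens_pair)
  then show "mu X A (an A \<bullet> x) x = e1 X A"
    using hopfD(10)[OF assms(1), THEN arg_cong, of "\<lambda>f. f \<bullet> x"] by (simp add: e1_def cmD(7)[OF x])
  have "mu X A x (an A \<bullet> x) = ml A \<bullet> (idt (Car A) \<odot> an A) \<bullet> dl A \<bullet> x"
    by (simp add: mu_def cm_dl[OF x] tens_pair)
  then show "mu X A x (an A \<bullet> x) = e1 X A"
    using hopfD(11)[OF assms(1), THEN arg_cong, of "\<lambda>f. f \<bullet> x"] by (simp add: e1_def cmD(7)[OF x])
qed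

lemma mu_cmp: "\<lbrakk>cm X Y h; src x = Car Y; src y = Car Y\<rbrakk> \<Longrightarrow> mu Y A x y \<bullet> h = mu X A (x \<bullet> h) (y \<bullet> h)"
  by (simp add: mu_def pair_cmp)

lemma e1_cmp: "cm X Y h \<Longrightarrow> e1 Y A \<bullet> h = e1 X A"
  by (simp add: e1_def cmD)

lemma ml_eq_mu: "hopf A \<Longrightarrow> ml A = mu (prodc A A) A (p1 A A) (p2 A A)"
  by (simp add: mu_def pair_p1_p2)

lemma cm_mu: "\<lbrakk>hopf A; cm X A x; cm X A y\<rbrakk> \<Longrightarrow> cm X A (mu X A x y)"
  unfolding mu_def by (blast intro: cm_cmp cm_pair hopfD)

lemma cm_e1: "\<lbrakk>hopf A; coc X\<rbrakk> \<Longrightarrow> cm X A (e1 X A)"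
  unfolding e1_def by (blast intro: cm_cmp cm_ep hopfD)

lemma cm_inverse:
  assumes f: "cm X Y f" and g [simp]: "arr g" "src g = Car Y" "trg g = Car X"
    and i: "g \<bullet> f = idt (Car X)" "f \<bullet> g = idt (Car Y)"
  shows "cm Y X g"
proof -
  note [simp] = cmD(1-5)[OF f]
  have "(g \<odot> g) \<bullet> dl Y = (g \<odot> g) \<bullet> (dl Y \<bullet> f) \<bullet> g"
    by (simp add: i)
  also have "\<dots> = dl X \<bullet> g"
    unfolding cmD(6)[OF f] by (simp add: tens_cmp[THEN reduce] i)
  finally have "dl X \<bullet> g = (g \<odot> g) \<bullet> dl Y" by simp
  moreover have "ep X \<bullet> g = ep Y \<bullet> f \<bullet> g"
    using cmD(7)[OF f, THEN reduce, of g] by simp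
  ultimately show ?thesis by (simp add: cm_def i)
qed

text \<open>The antipode is recovered from the inverse of the shear map \<open>(x, y) \<mapsto> (x, x y)\<close>,
  which is a morphism of comonoids because the shear map is.\<close>

lemma cm_an:
  assumes [simp]: "hopf A"
  shows "cm A A (an A)"
proof -
  let ?T = "prodc A A" and ?p = "p1 A A" and ?q = "p2 A A"
  have cp: "cm ?T A ?p" "cm ?T A ?q" and cml: "cm ?T A (ml A)" by (simp_all add: hopfD(2))
  define sh where "sh = pair ?T ?p (ml A)"
  \<comment> \<open>In elements \<open>(x, y) \<mapsto> (x, x^{-1} y)\<close>, the inverse of the
    shear map.\<close>
  define si where "si = pair ?T ?p (mu ?T A (an A \<bullet> ?p) ?q)"
  have csh: "cm ?T ?T sh" unfolding sh_def by (rule cm_pair[OF cp(1) cml])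
  have a [simp]: "arr si" "arr sh" "src si = Car A \<boxtimes> Car A" "trg si = Car A \<boxtimes> Car A"
    "src sh = Car A \<boxtimes> Car A" "trg sh = Car A \<boxtimes> Car A"
    by (simp_all add: si_def sh_def)
  \<comment> \<open>Since \<open>si\<close> is not yet known to be a comonoid morphism,
    \<open>pair_cmp\<close> cannot be applied to it. Built from \<open>dl A\<close> and
    \<open>asc\<close>, the shear map acts on pairings whose second component is an arbitrary
    arrow.\<close>
  have F: "(idt (Car A) \<odot> ml A) \<bullet> asc (Car A) (Car A) (Car A) \<bullet> (dl A \<odot> idt (Car A)) \<bullet> pair ?T ?p y = pair ?T ?p (mu ?T A ?p y)"
    if "arr y" "src y = Car A \<boxtimes> Car A" "trg y = Car A" for y
    using that by (simp add: tens_pair cm_dl[OF cp(1)] asc_pair mu_def)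
  have "(idt (Car A) \<odot> ml A) \<bullet> asc (Car A) (Car A) (Car A) \<bullet> (dl A \<odot> idt (Car A)) = sh"
    using F[of ?q] by (simp add: pair_p1_p2 sh_def ml_eq_mu[symmetric])
  then have F': "sh \<bullet> pair ?T ?p y = pair ?T ?p (mu ?T A ?p y)"
    if "arr y" "src y = Car A \<boxtimes> Car A" "trg y = Car A" for y
    using F[OF that] by auto
  have "sh \<bullet> si = idt (Car ?T)"
    by (simp add: si_def F' mu_assoc[symmetric] mu_inv[OF _ cp(1)] mu_unit pair_p1_p2)
  moreover have "si \<bullet> sh = idt (Car ?T)"
  proof -
    have "?p \<bullet> sh = ?p" "?q \<bullet> sh = mu ?T A ?p ?q"
      unfolding sh_def using p1_pair[OF cml, of ?p A] p2_pair[OF cp(1), of "ml A" A]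
      by (simp_all add: ml_eq_mu[symmetric])
    then have "si \<bullet> sh = pair ?T ?p (mu ?T A (an A \<bullet> ?p) (mu ?T A ?p ?q))"
      unfolding si_def by (simp add: pair_cmp[OF csh] mu_cmp[OF csh])
    then show ?thesis
      by (simp add: mu_assoc[symmetric] mu_inv[OF _ cp(1)] mu_unit pair_p1_p2)
  qed
  ultimately have csi: "cm ?T ?T si" by (intro cm_inverse[OF csh]) simp_all
  \<comment> \<open>In elements \<open>x \<mapsto> (x, 1)\<close>, which \<open>si\<close> sends to
    \<open>(x, x^{-1})\<close>; the second projection then yields the antipode.\<close>
  let ?w = "pair A (idt (Car A)) (e1 A A)"
  have i: "cm A A (idt (Car A))" "cm A A (e1 A A)" by (simp_all add: cm_idt cm_e1)
  have cw: "cm A ?T ?w" by (rule cm_pair[OF i])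
  have "?p \<bullet> ?w = idt (Car A)" "?q \<bullet> ?w = e1 A A"
    using p1_pair[OF i(2), of "idt (Car A)" A] p2_pair[OF i(1), of "e1 A A" A] by simp_all
  then have "si \<bullet> ?w = pair A (idt (Car A)) (mu A A (an A) (e1 A A))"
    unfolding si_def by (simp add: pair_cmp[OF cw] mu_cmp[OF cw])
  then have "?q \<bullet> si \<bullet> ?w = an A"
    using p2_pair[OF i(1), of "an A" A] by (simp add: mu_unit)
  with cm_cmp[OF cm_cmp[OF cw csi] cp(2)] show ?thesis by simp
qed

section \<open>Convolution groups\<close>

definition grp :: "('o, 'm, 'x) comonoid_data_scheme \<Rightarrow> ('o, 'm, 'y) hopf_data_scheme \<Rightarrow> ('o, 'm) arrow monoid" where
  "grp X A = \<lparr>carrier = {f. cm X A f}, monoid.mult = mu X A, one = e1 X A\<rparr>"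

lemma grp_simps [simp]: "x \<in> carrier (grp X A) \<longleftrightarrow> cm X A x" "monoid.mult (grp X A) = mu X A" "one (grp X A) = e1 X A"
  by (simp_all add: grp_def)

lemma group_grp: assumes "hopf A" "coc X" shows "group (grp X A)"
proof (rule groupI)
  fix x assume "x \<in> carrier (grp X A)"
  then have "cm X A x" by simp
  then show "\<exists>y\<in>carrier (grp X A). monoid.mult (grp X A) y x = one (grp X A)"
    using assms mu_inv(1)[of A X x] cm_cmp[OF _ cm_an[of A], of X x] by auto
next
  fix x y z assume "x \<in> carrier (grp X A)" "y \<in> carrier (grp X A)" "z \<in> carrier (grp X A)"
  then have c: "cm X A x" "cm X A y" "cm X A z" by simp_all
  show "monoid.mult (grp X A) (monoid.mult (grp X A) x y) z = monoid.mult (grp X A) x (monoid.mult (grp X A) y z)"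
    using assms cmD(3-5)[OF c(1)] cmD(3-5)[OF c(2)] cmD(3-5)[OF c(3)] by (simp add: mu_assoc)
next
  fix x assume "x \<in> carrier (grp X A)"
  then have c: "cm X A x" by simp
  show "monoid.mult (grp X A) (one (grp X A)) x = x"
    using assms cmD(3-5)[OF c] by (simp add: mu_unit)
qed (use assms in \<open>simp_all add: cm_mu cm_e1\<close>)

lemma inv_grp: assumes [simp]: "hopf A" and x: "cm X A x" shows "inv\<^bsub>grp X A\<^esub> x = an A \<bullet> x"
  using group.inv_equality[OF group_grp[OF assms(1) cmD(1)[OF x]], of "an A \<bullet> x" x] x cm_cmp[OF x cm_an]
  by (simp add: mu_inv)

lemma mu_an:
  assumes [simp]: "hopf A" and x: "cm X A x" and y: "cm X A y"
  shows "an A \<bullet> mu X A x y = mu X A (an A \<bullet> y) (an A \<bullet> x)"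
  using group.inv_mult_group[OF group_grp[OF assms(1) cmD(1)[OF x]], of x y] x y
  by (simp add: inv_grp cm_mu)

text \<open>From \<open>x y^{-1} = 1\<close> to \<open>x = y\<close>. This is how triviality of a
  kernel leads to equality of two morphisms.\<close>

lemma mu_an_eq_e1:
  assumes h: "hopf A" and x: "cm X A x" and y: "cm X A y" and "mu X A x (an A \<bullet> y) = e1 X A"
  shows "x = y"
  using group.inv_equality[OF group_grp[OF h cmD(1)[OF x]], of x "an A \<bullet> y"] assms cm_cmp[OF y cm_an[OF h]]
    group.inv_inv[OF group_grp[OF h cmD(1)[OF x]], of y] by (simp add: inv_grp[OF h])

text \<open>As for homomorphisms of groups, unit and antipode are then preserved, by
  \<open>hm_un\<close> and \<open>hm_an\<close>; \<open>Hopf_coc_Hom\<close> makes the comparison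
  with the morphisms of \<open>Hopf_coc\<close>.\<close>

definition hm :: "('o, 'm, 'x) hopf_data_scheme \<Rightarrow> ('o, 'm, 'y) hopf_data_scheme \<Rightarrow> ('o, 'm) arrow \<Rightarrow> bool" where
  "hm A B f \<longleftrightarrow> hopf A \<and> hopf B \<and> cm A B f \<and> f \<bullet> ml A = ml B \<bullet> (f \<odot> f)"

lemma hmD: assumes "hm A B f"
  shows "hopf A" "hopf B" "cm A B f" "f \<bullet> ml A = ml B \<bullet> (f \<odot> f)" "arr f" "src f = Car A" "trg f = Car B"
  using assms by (auto simp: hm_def dest: cmD)

lemma hm_mu:
  assumes f: "hm A B f" and t: "trg x = Car A" "trg y = Car A"
  shows "f \<bullet> mu X A x y = mu X B (f \<bullet> x) (f \<bullet> y)"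
  using hmD(4)[OF f, THEN reduce, of "pair X x y"] t hmD[OF f] by (simp add: mu_def tens_pair)

text \<open>The image of the neutral element is idempotent in a convolution group, hence
  neutral.\<close>

lemma hm_e1:
  assumes f: "hm A B f" and X: "coc X"
  shows "f \<bullet> e1 X A = e1 X B"
proof -
  note [simp] = hmD(1,2,5-7)[OF f] X
  let ?x = "f \<bullet> e1 X A"
  have c: "cm X B ?x" by (rule cm_cmp[OF cm_e1 hmD(3)[OF f]]) simp_all
  have "mu X B ?x ?x = ?x"
    by (simp add: hm_mu[OF f, symmetric] mu_unit)
  then show ?thesis
    using group.l_cancel_one'[OF group_grp[of B X], of ?x ?x] c by simp
qed

lemma hm_un: assumes f: "hm A B f" shows "f \<bullet> un A = un B"
  using hm_e1[OF f coc_unitc] hmD[OF f] by (simp add: e1_def)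

text \<open>Both \<open>f \<bullet> an A\<close> and \<open>an B \<bullet> f\<close> are inverse to
  \<open>f\<close> in the convolution group of comonoid morphisms from \<open>A\<close> to
  \<open>B\<close>.\<close>

lemma hm_an: assumes f: "hm A B f" shows "f \<bullet> an A = an B \<bullet> f"
proof -
  note [simp] = hmD(1,2,5-7)[OF f]
  have i: "cm A A (idt (Car A))" by (simp add: cm_idt)
  have "mu A B (f \<bullet> an A) f = f \<bullet> mu A A (an A) (idt (Car A))"
    by (simp add: hm_mu[OF f])
  also have "\<dots> = e1 A B"
    using mu_inv(1)[OF _ i] by (simp add: hm_e1[OF f])
  finally show ?thesis
    using group.inv_equality[OF group_grp[of B A], of "f \<bullet> an A" f] cm_cmp[OF cm_an hmD(3)[OF f]] hmD(3)[OF f]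
    by (simp add: inv_grp)
qed

text \<open>Multiplicativity is tested on the universal elements \<open>p1 A A\<close> and
  \<open>p2 A A\<close>, whose pairing is the identity.\<close>

lemma hmI:
  assumes [simp]: "hopf A" "hopf B" and f: "cm A B f"
    and "f \<bullet> mu (prodc A A) A (p1 A A) (p2 A A) = mu (prodc A A) B (f \<bullet> p1 A A) (f \<bullet> p2 A A)"
  shows "hm A B f"
  using assms(4) cmD[OF f] by (simp add: hm_def f mu_def pair_p1_p2 tens_pair[symmetric])

lemma hm_idt: "hopf A \<Longrightarrow> hm A A (idt (Car A))"
  by (simp add: hm_def cm_idt)

lemma hm_cmp: assumes f: "hm A B f" and g: "hm B C g" shows "hm A C (g \<bullet> f)"
  using hmD(4)[OF g, THEN reduce, of "f \<odot> f"] hmD(4)[OF f] hmD[OF f] hmD[OF g]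
  by (simp add: hm_def cm_cmp[OF hmD(3)[OF f] hmD(3)[OF g]] tens_cmp)

lemma hm_inverse:
  assumes f: "hm A B f" and g [simp]: "arr g" "src g = Car B" "trg g = Car A"
    and i: "g \<bullet> f = idt (Car A)" "f \<bullet> g = idt (Car B)"
  shows "hm B A g"
proof -
  note [simp] = hmD(1,2,5-7)[OF f]
  have "g \<bullet> ml B = g \<bullet> (ml B \<bullet> (f \<odot> f)) \<bullet> (g \<odot> g)"
    by (simp add: tens_cmp i)
  also have "\<dots> = ml A \<bullet> (g \<odot> g)"
    unfolding hmD(4)[OF f, symmetric] using i(1)[THEN reduce] by simp
  finally show ?thesis using cm_inverse[OF hmD(3)[OF f] g i] by (simp add: hm_def)
qed

text \<open>Forgets additional structure, so that a Hopf monoid can serve as a test object where a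
  hypothesis quantifies over plain \<open>comonoid_data\<close>; the record type cannot vary inside
  a hypothesis.\<close>

definition cmd :: "('o, 'm, 'x) comonoid_data_scheme \<Rightarrow> ('o, 'm) comonoid_data" where
  "cmd X = \<lparr>Car = Car X, Comult = Comult X, Counit = Counit X\<rparr>"

lemma cmd_simps [simp]: "Car (cmd X) = Car X" "dl (cmd X) = dl X" "ep (cmd X) = ep X" "pair (cmd X) = pair X"
  "mu (cmd X) A = mu X A" "e1 (cmd X) A = e1 X A"
proof -
  show 1: "Car (cmd X) = Car X" "dl (cmd X) = dl X" "ep (cmd X) = ep X"
    by (simp_all add: cmd_def dl_def ep_def)
  then show 2: "pair (cmd X) = pair X" by (auto simp: pair_def fun_eq_iff)
  show "mu (cmd X) A = mu X A" "e1 (cmd X) A = e1 X A"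
    using 1 2 by (auto simp: mu_def e1_def fun_eq_iff)
qed

lemma coc_cmd [simp]: "coc (cmd X) \<longleftrightarrow> coc X"
  by (simp only: coc_def cmd_simps)

lemma cm_cmd [simp]: "cm (cmd X) Y f \<longleftrightarrow> cm X Y f" "cm Y (cmd X) f \<longleftrightarrow> cm Y X f"
  by (simp_all only: cm_def cmd_simps coc_cmd)

text \<open>A Yoneda argument: the identities between arrows are the group axioms at universal
  elements, namely the three projections of a threefold product for associativity and the identity
  of \<open>A\<close> for units and inverses.\<close>

lemma hopfI:
  assumes [simp]: "coc A" and m: "cm (prodc A A) A (ml A)" and u: "cm unitc A (un A)" and a: "arr (an A)"
    and assoc: "\<And>(T :: ('o, 'm) comonoid_data) x y z. \<lbrakk>cm T A x; cm T A y; cm T A z\<rbrakk>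
        \<Longrightarrow> mu T A (mu T A x y) z = mu T A x (mu T A y z)"
    and unit: "\<And>(T :: ('o, 'm) comonoid_data) x. cm T A x \<Longrightarrow> mu T A (e1 T A) x = x \<and> mu T A x (e1 T A) = x"
    and inv: "\<And>(T :: ('o, 'm) comonoid_data) x. cm T A x \<Longrightarrow> mu T A (an A \<bullet> x) x = e1 T A \<and> mu T A x (an A \<bullet> x) = e1 T A"
  shows "hopf A"
proof -
  note [simp] = cmD(3)[OF m] cmD(3)[OF u] a
  let ?c = "Car A"
  let ?T = "prodc (prodc A A) A"
  let ?q = "p1 (prodc A A) A"
  let ?x = "p1 A A \<bullet> ?q" and ?y = "p2 A A \<bullet> ?q" and ?z = "p2 (prodc A A) A"
  have q: "cm ?T (prodc A A) ?q" by simp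
  have c: "cm ?T A ?x" "cm ?T A ?y" "cm ?T A ?z"
    using cm_cmp[OF q cm_p1[of A A]] cm_cmp[OF q cm_p2[of A A]] by simp_all
  have "pair ?T (pair ?T ?x ?y) ?z = idt ((?c \<boxtimes> ?c) \<boxtimes> ?c)"
    using pair_eta[OF q] pair_p1_p2[of "prodc A A" A] by simp
  then have I: "f = f \<bullet> pair ?T (pair ?T ?x ?y) ?z" if "arr f" "src f = (?c \<boxtimes> ?c) \<boxtimes> ?c" for f
    using that by simp
  have "ml A \<bullet> (ml A \<odot> idt ?c) = mu ?T A (mu ?T A ?x ?y) ?z"
    by (subst I) (simp_all add: mu_def tens_pair)
  moreover have "ml A \<bullet> (idt ?c \<odot> ml A) \<bullet> asc ?c ?c ?c = mu ?T A ?x (mu ?T A ?y ?z)"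
    by (subst I) (simp_all add: mu_def asc_pair tens_pair)
  ultimately have 1: "ml A \<bullet> (ml A \<odot> idt ?c) = ml A \<bullet> (idt ?c \<odot> ml A) \<bullet> asc ?c ?c ?c"
    using assoc[OF c] by simp
  have i: "cm (cmd A) A (idt ?c)" by (simp add: cm_idt)
  have "ml A \<bullet> (un A \<odot> idt ?c) \<bullet> lui ?c = idt ?c"
    using unit[OF i] by (simp add: lui_pair tens_pair mu_def e1_def)
  then have "(ml A \<bullet> (un A \<odot> idt ?c)) \<bullet> lui ?c = lu ?c \<bullet> lui ?c" by simp
  then have 2: "ml A \<bullet> (un A \<odot> idt ?c) = lu ?c"
    by (rule epi_cancel[where d = "lu (Car A)"]) simp_all
  have r: "rui ?c = pair A (idt ?c) (ep A)"
    by (rule mono_cancel[where e = "ru (Car A)" and d = "rui (Car A)"]) (simp_all add: ru_pair)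
  have "ml A \<bullet> (idt ?c \<odot> un A) \<bullet> rui ?c = idt ?c"
    using unit[OF i] by (simp add: r tens_pair mu_def e1_def)
  then have "(ml A \<bullet> (idt ?c \<odot> un A)) \<bullet> rui ?c = ru ?c \<bullet> rui ?c" by simp
  then have 3: "ml A \<bullet> (idt ?c \<odot> un A) = ru ?c"
    by (rule epi_cancel[where d = "ru (Car A)"]) simp_all
  have 4: "ml A \<bullet> (an A \<odot> idt ?c) \<bullet> dl A = un A \<bullet> ep A" "ml A \<bullet> (idt ?c \<odot> an A) \<bullet> dl A = un A \<bullet> ep A"
    using inv[OF i] by (simp_all add: mu_def e1_def pair_def)
  show ?thesis using 1 2 3 4 m u a by (simp add: hopf_def)
qed

section \<open>Products of Hopf monoids and the zero object\<close>

definition prodh :: "('o, 'm, 'x) hopf_data_scheme \<Rightarrow> ('o, 'm, 'y) hopf_data_scheme \<Rightarrow> ('o, 'm) hopf_data" where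
  "prodh A B = (let P = prodc A B; T = prodc P P in
    \<lparr>Car = Car P, Comult = Comult P, Counit = Counit P,
     Mult = rw (pair T (mu T A (p1 A B \<bullet> p1 P P) (p1 A B \<bullet> p2 P P)) (mu T B (p2 A B \<bullet> p1 P P) (p2 A B \<bullet> p2 P P))),
     One = rw (pair unitc (un A) (un B)),
     Antipode = rw (pair P (an A \<bullet> p1 A B) (an B \<bullet> p2 A B))\<rparr>)"

lemma prodh_simps [simp]: "Car (prodh A B) = Car A \<boxtimes> Car B" "dl (prodh A B) = dl (prodc A B)" "ep (prodh A B) = ep (prodc A B)"
  by (simp_all add: prodh_def dl_def ep_def Let_def)

lemma prodc_prodh [simp]: "prodc (prodh A B) X = prodc (prodc A B) X" "prodc X (prodh A B) = prodc X (prodc A B)"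
  by (simp_all add: prodc_def[of "prodh A B"] prodc_def[of "prodc A B"] prodc_def[of X])

lemma coc_prodh [simp]: "\<lbrakk>coc A; coc B\<rbrakk> \<Longrightarrow> coc (prodh A B)"
  using coc_prodc[of A B] by (simp only: coc_def prodh_simps Car_prodc)

lemma cm_prodh: "\<lbrakk>coc A; coc B\<rbrakk> \<Longrightarrow> cm X (prodh A B) f \<longleftrightarrow> cm X (prodc A B) f"
  "\<lbrakk>coc A; coc B\<rbrakk> \<Longrightarrow> cm (prodh A B) X f \<longleftrightarrow> cm (prodc A B) X f"
  by (simp_all add: cm_def)

lemma pair_prodh: "pair (prodh A B) = pair (prodc A B)" "mu (prodh A B) C = mu (prodc A B) C" "e1 (prodh A B) C = e1 (prodc A B) C"
  by (auto simp: pair_def mu_def e1_def fun_eq_iff)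

text \<open>The componentwise product formula \<open>mu1\<close> comes first, while
  \<open>?H\<close> is not yet known to be a Hopf monoid; each group axiom is then checked in
  \<open>A\<close> and in \<open>B\<close>.\<close>

lemma hopf_prodh [simp]:
  assumes [simp]: "hopf A" "hopf B"
  shows "hopf (prodh A B)"
    and ml_prodh: "\<lbrakk>cm X (prodc A B) x; cm X (prodc A B) y\<rbrakk> \<Longrightarrow>
      mu X (prodh A B) x y = pair X (mu X A (p1 A B \<bullet> x) (p1 A B \<bullet> y)) (mu X B (p2 A B \<bullet> x) (p2 A B \<bullet> y))"
proof -
  let ?P = "prodc A B" and ?H = "prodh A B" and ?p = "p1 A B" and ?q = "p2 A B"
  let ?T = "prodc ?P ?P"
  let ?u = "p1 ?P ?P" and ?v = "p2 ?P ?P"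
  have cuv: "cm ?T ?P ?u" "cm ?T ?P ?v" by simp_all
  have cpq: "cm ?P A ?p" "cm ?P B ?q" by simp_all
  note c4 = cm_cmp[OF cuv(1) cpq(1)] cm_cmp[OF cuv(2) cpq(1)] cm_cmp[OF cuv(1) cpq(2)] cm_cmp[OF cuv(2) cpq(2)]
  let ?m = "pair ?T (mu ?T A (?p \<bullet> ?u) (?p \<bullet> ?v)) (mu ?T B (?q \<bullet> ?u) (?q \<bullet> ?v))"
  have cm1: "cm ?T ?P ?m"
    by (intro cm_pair cm_mu c4) simp_all
  have m: "ml ?H = ?m"
    using cmD(3-5)[OF cm1] unfolding ml_def by (simp add: prodh_def Let_def)
  have cu1: "cm unitc ?P (pair unitc (un A) (un B))"
    by (intro cm_pair) (simp_all add: hopfD(3))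
  have u: "un ?H = pair unitc (un A) (un B)"
    using cmD(3-5)[OF cu1] unfolding un_def[of ?H] by (simp add: prodh_def Let_def)
  have ca1: "cm ?P ?P (pair ?P (an A \<bullet> ?p) (an B \<bullet> ?q))"
    by (intro cm_pair cm_cmp[OF _ cm_an]) simp_all
  have a: "an ?H = pair ?P (an A \<bullet> ?p) (an B \<bullet> ?q)"
    using cmD(3-5)[OF ca1] unfolding an_def[of ?H] by (simp add: prodh_def Let_def)
  have mu1: "mu X ?H x y = pair X (mu X A (?p \<bullet> x) (?p \<bullet> y)) (mu X B (?q \<bullet> x) (?q \<bullet> y))"
    if x: "cm X ?P x" and y: "cm X ?P y" for x y and X :: "('o, 'm, 'w) comonoid_data_scheme"
  proof -
    have h: "cm X ?T (pair X x y)" by (rule cm_pair[OF x y])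
    note [simp] = cmD(1-5)[OF x] cmD(1-5)[OF y]
    have "?u \<bullet> pair X x y = x" "?v \<bullet> pair X x y = y"
      using p1_pair[OF y, of x ?P] p2_pair[OF x, of y ?P] by simp_all
    then show ?thesis
      unfolding mu_def[of X ?H] m by (simp add: pair_cmp[OF h] mu_cmp[OF h])
  qed
  show "\<lbrakk>cm X ?P x; cm X ?P y\<rbrakk> \<Longrightarrow>
      mu X ?H x y = pair X (mu X A (?p \<bullet> x) (?p \<bullet> y)) (mu X B (?q \<bullet> x) (?q \<bullet> y))" by (rule mu1)
  show "hopf ?H"
  proof (rule hopfI)
    show "coc ?H" by simp
    show "cm (prodc ?H ?H) ?H (ml ?H)" using cm1 by (simp add: m cm_prodh)
    show "cm unitc ?H (un ?H)" using cu1 by (simp add: u cm_prodh)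
    show "arr (an ?H)" using cmD(3)[OF ca1] by (simp add: a)
  next
    fix T :: "('o, 'm) comonoid_data" and x y z
    assume "cm T ?H x" "cm T ?H y" "cm T ?H z"
    then have c: "cm T ?P x" "cm T ?P y" "cm T ?P z" by (simp_all add: cm_prodh)
    have pc: "cm T A (?p \<bullet> x)" "cm T A (?p \<bullet> y)" "cm T A (?p \<bullet> z)" "cm T B (?q \<bullet> x)" "cm T B (?q \<bullet> y)" "cm T B (?q \<bullet> z)"
      using c cm_cmp[OF _ cpq(1)] cm_cmp[OF _ cpq(2)] by blast+
    have k: "cm T ?P (mu T ?H x' y')" "?p \<bullet> mu T ?H x' y' = mu T A (?p \<bullet> x') (?p \<bullet> y')" "?q \<bullet> mu T ?H x' y' = mu T B (?q \<bullet> x') (?q \<bullet> y')"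
      if "cm T ?P x'" "cm T ?P y'" for x' y'
    proof -
      have p: "cm T A (mu T A (?p \<bullet> x') (?p \<bullet> y'))" "cm T B (mu T B (?q \<bullet> x') (?q \<bullet> y'))"
        by (intro cm_mu cm_cmp[OF that(1) cpq(1)] cm_cmp[OF that(1) cpq(2)] cm_cmp[OF that(2) cpq(1)] cm_cmp[OF that(2) cpq(2)]; simp)+
      note [simp] = cmD(1-5)[OF p(1)] cmD(1-5)[OF p(2)]
      show "cm T ?P (mu T ?H x' y')" unfolding mu1[OF that] by (rule cm_pair[OF p])
      show "?p \<bullet> mu T ?H x' y' = mu T A (?p \<bullet> x') (?p \<bullet> y')" "?q \<bullet> mu T ?H x' y' = mu T B (?q \<bullet> x') (?q \<bullet> y')"
        unfolding mu1[OF that] by (simp_all add: p1_pair[OF p(2)] p2_pair[OF p(1)])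
    qed
    note [simp] = cmD(1-5)[OF c(1)] cmD(1-5)[OF c(2)] cmD(1-5)[OF c(3)]
    show "mu T ?H (mu T ?H x y) z = mu T ?H x (mu T ?H y z)"
      by (simp add: mu1[OF k(1)[OF c(1,2)] c(3)] mu1[OF c(1) k(1)[OF c(2,3)]] k(2,3)[OF c(1,2)] k(2,3)[OF c(2,3)] mu_assoc)
  next
    fix T :: "('o, 'm) comonoid_data" and x
    assume "cm T ?H x"
    then have c: "cm T ?P x" by (simp add: cm_prodh)
    have pc: "cm T A (?p \<bullet> x)" "cm T B (?q \<bullet> x)"
      by (rule cm_cmp[OF c cpq(1)], rule cm_cmp[OF c cpq(2)])
    note [simp] = cmD(1-5)[OF c] cmD(1-5)[OF pc(1)] cmD(1-5)[OF pc(2)]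
    have ce: "cm T A (e1 T A)" "cm T B (e1 T B)" by (simp_all add: cm_e1)
    have e: "e1 T ?H = pair T (e1 T A) (e1 T B)"
      unfolding e1_def u by (simp add: pair_cmp[OF cm_ep])
    have pe: "?p \<bullet> e1 T ?H = e1 T A" "?q \<bullet> e1 T ?H = e1 T B"
      unfolding e by (simp_all add: p1_pair[OF ce(2)] p2_pair[OF ce(1)])
    have ce': "cm T ?P (e1 T ?H)" unfolding e by (rule cm_pair[OF ce])
    show "mu T ?H (e1 T ?H) x = x \<and> mu T ?H x (e1 T ?H) = x"
      by (simp add: mu1[OF c ce'] mu1[OF ce' c] pe mu_unit pair_eta[OF c])
    have ca: "cm T A (an A \<bullet> ?p \<bullet> x)" "cm T B (an B \<bullet> ?q \<bullet> x)"
      by (rule cm_cmp[OF pc(1) cm_an], simp, rule cm_cmp[OF pc(2) cm_an], simp)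
    have ai: "an ?H \<bullet> x = pair T (an A \<bullet> ?p \<bullet> x) (an B \<bullet> ?q \<bullet> x)"
      unfolding a by (simp add: pair_cmp[OF c])
    have pa: "?p \<bullet> an ?H \<bullet> x = an A \<bullet> ?p \<bullet> x" "?q \<bullet> an ?H \<bullet> x = an B \<bullet> ?q \<bullet> x"
      unfolding ai by (simp_all add: p1_pair[OF ca(2)] p2_pair[OF ca(1)])
    have ca': "cm T ?P (an ?H \<bullet> x)" unfolding ai by (rule cm_pair[OF ca])
    show "mu T ?H (an ?H \<bullet> x) x = e1 T ?H \<and> mu T ?H x (an ?H \<bullet> x) = e1 T ?H"
      by (simp add: mu1[OF c ca'] mu1[OF ca' c] pa mu_inv[OF _ pc(1)] mu_inv[OF _ pc(2)] e)
  qed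
qed

lemma hm_p1: assumes [simp]: "hopf A" "hopf B" shows "hm (prodh A B) A (p1 A B)"
proof (rule hmI)
  let ?P = "prodc A B" let ?T = "prodc ?P ?P" let ?u = "p1 ?P ?P" and ?v = "p2 ?P ?P"
  have c: "cm ?T ?P ?u" "cm ?T ?P ?v" by simp_all
  have d: "cm ?T B (mu ?T B (p2 A B \<bullet> ?u) (p2 A B \<bullet> ?v))"
    by (intro cm_mu cm_cmp[OF c(1) cm_p2] cm_cmp[OF c(2) cm_p2]) simp_all
  have p: "p1 (prodh A B) (prodh A B) = ?u" "p2 (prodh A B) (prodh A B) = ?v"
    by (simp_all add: p1_def p2_def)
  show "p1 A B \<bullet> mu (prodc (prodh A B) (prodh A B)) (prodh A B) (p1 (prodh A B) (prodh A B)) (p2 (prodh A B) (prodh A B))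
    = mu (prodc (prodh A B) (prodh A B)) A (p1 A B \<bullet> p1 (prodh A B) (prodh A B)) (p1 A B \<bullet> p2 (prodh A B) (prodh A B))"
    by (simp add: p ml_prodh[OF _ _ c] p1_pair[OF d])
qed (simp_all add: cm_prodh)

lemma hm_p2: assumes [simp]: "hopf A" "hopf B" shows "hm (prodh A B) B (p2 A B)"
proof (rule hmI)
  let ?P = "prodc A B" let ?T = "prodc ?P ?P" let ?u = "p1 ?P ?P" and ?v = "p2 ?P ?P"
  have c: "cm ?T ?P ?u" "cm ?T ?P ?v" by simp_all
  have d: "cm ?T A (mu ?T A (p1 A B \<bullet> ?u) (p1 A B \<bullet> ?v))"
    by (intro cm_mu cm_cmp[OF c(1) cm_p1] cm_cmp[OF c(2) cm_p1]) simp_all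
  have p: "p1 (prodh A B) (prodh A B) = ?u" "p2 (prodh A B) (prodh A B) = ?v"
    by (simp_all add: p1_def p2_def)
  show "p2 A B \<bullet> mu (prodc (prodh A B) (prodh A B)) (prodh A B) (p1 (prodh A B) (prodh A B)) (p2 (prodh A B) (prodh A B))
    = mu (prodc (prodh A B) (prodh A B)) B (p2 A B \<bullet> p1 (prodh A B) (prodh A B)) (p2 A B \<bullet> p2 (prodh A B) (prodh A B))"
    by (simp add: p ml_prodh[OF _ _ c] p2_pair[OF d])
qed (simp_all add: cm_prodh)

lemma hm_pair:
  assumes f: "hm X A f" and g: "hm X B g"
  shows "hm X (prodh A B) (pair X f g)"
proof (rule hmI)
  note [simp] = hmD(1,2,5-7)[OF f] hmD(1,2,5-7)[OF g]
  have c: "cm X (prodc A B) (pair X f g)" by (rule cm_pair[OF hmD(3)[OF f] hmD(3)[OF g]])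
  then show "cm X (prodh A B) (pair X f g)" by (simp add: cm_prodh)
  show "hopf X" "hopf (prodh A B)" by simp_all
  let ?T = "prodc X X" let ?u = "p1 X X" and ?v = "p2 X X"
  have cu: "cm ?T X ?u" "cm ?T X ?v" and cm: "cm ?T X (mu ?T X ?u ?v)" by (simp_all add: cm_mu)
  have p: "p1 A B \<bullet> pair X f g = f" "p2 A B \<bullet> pair X f g = g"
    by (simp_all add: p1_pair[OF hmD(3)[OF g]] p2_pair[OF hmD(3)[OF f]])
  have cf: "cm ?T A (f \<bullet> w)" "cm ?T B (g \<bullet> w)" if "cm ?T X w" for w
    using cm_cmp[OF that] hmD(3)[OF f] hmD(3)[OF g] by blast+
  have q: "p1 A B \<bullet> pair X f g \<bullet> w = f \<bullet> w" "p2 A B \<bullet> pair X f g \<bullet> w = g \<bullet> w" for w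
    using p[THEN reduce] by simp_all
  show "pair X f g \<bullet> mu ?T X ?u ?v = mu ?T (prodh A B) (pair X f g \<bullet> ?u) (pair X f g \<bullet> ?v)"
    using ml_prodh[OF _ _ cm_cmp[OF cu(1) c] cm_cmp[OF cu(2) c]]
    by (simp add: q pair_cmp[OF cm] hm_mu[OF f] hm_mu[OF g])
qed

definition unith :: "('o, 'm) hopf_data" where
  "unith = \<lparr>Car = Unit M, Comult = Comult unitc, Counit = Counit unitc,
     Mult = rw (lu (Unit M)), One = rw (idt (Unit M)), Antipode = rw (idt (Unit M))\<rparr>"

lemma unith_simps [simp]: "Car unith = Unit M" "dl unith = lui (Unit M)" "ep unith = idt (Unit M)"
  "ml unith = lu (Unit M)" "un unith = idt (Unit M)" "an unith = idt (Unit M)"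
proof -
  show "Car unith = Unit M" "ml unith = lu (Unit M)" "un unith = idt (Unit M)" "an unith = idt (Unit M)"
    by (simp_all add: ml_def un_def an_def) (simp_all add: unith_def)
  show "dl unith = lui (Unit M)" "ep unith = idt (Unit M)"
    using unitc_simps by (simp_all add: dl_def ep_def unith_def unitc_simps(1)[simplified unitc_def])
qed

lemma coc_unith [simp]: "coc unith"
  using coc_unitc by (simp only: coc_def unith_simps unitc_simps)

lemma cm_unith_iff: "cm X unith f \<longleftrightarrow> coc X \<and> f = ep X"
  using cm_unitc_iff[of X f] by (simp add: cm_def)

lemma hopf_unith [simp]: "hopf unith"
proof -
  let ?I = "Unit M"
  have p: "prodc unith unith = prodc unitc unitc"
    by (simp add: prodc_def)
  have "lu ?I = ep (prodc unitc unitc)" by (simp add: ep_prodc)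
  then have 1: "cm (prodc unith unith) unith (ml unith)"
    by (simp add: cm_unith_iff p)
  have 2: "cm unitc unith (un unith)" by (simp add: cm_unith_iff)
  have 3: "lu (?I \<boxtimes> ?I) = idt ?I \<odot> lu ?I"
    by (rule mono_cancel[where e = "lu (Unit M)" and d = "lui (Unit M)"]) (simp_all add: nat_lu)
  have "lu ?I \<bullet> (lu ?I \<odot> idt ?I) = lu ?I \<bullet> (idt ?I \<odot> lu ?I) \<bullet> asc ?I ?I ?I"
    by (simp add: tri lu_ru_unit[symmetric])
  then show ?thesis using 1 2 by (simp add: hopf_def lu_ru_unit[symmetric])
qed

lemma hm_ep: assumes [simp]: "hopf A" shows "hm A unith (ep A)"
  using cmD(7)[OF hopfD(2)[OF assms]] by (simp add: hm_def cm_unith_iff ep_prodc)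

lemma hm_unith_iff: "hm A unith f \<longleftrightarrow> hopf A \<and> f = ep A"
  using hm_ep by (auto simp: hm_def cm_unith_iff)

lemma hm_un_unith: assumes [simp]: "hopf A" shows "hm unith A (un A)"
proof -
  have "ml A \<bullet> (un A \<odot> un A) = ml A \<bullet> (un A \<odot> idt (Car A)) \<bullet> (idt (Unit M) \<odot> un A)"
    by (simp add: tens_cmp)
  also have "\<dots> = un A \<bullet> lu (Unit M)"
    by (simp add: hopfD(8)[THEN reduce] nat_lu)
  finally show ?thesis
    using hopfD(3)[OF assms] by (simp add: hm_def cm_def)
qed

lemma hm_from_unith_iff: "hm unith A f \<longleftrightarrow> hopf A \<and> f = un A"
proof -
  have "f = un A" if "hm unith A f" using hm_un[OF that] hmD[OF that] by simp
  then show ?thesis using hm_un_unith by (auto dest: hmD)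
qed

text \<open>The neutral element factors through \<open>unith\<close> as counit followed by unit, so
  it is the zero morphism among Hopf monoids.\<close>

lemma hm_e1_zero: "\<lbrakk>hopf A; hopf B\<rbrakk> \<Longrightarrow> hm A B (e1 A B)"
  unfolding e1_def by (rule hm_cmp[OF hm_ep hm_un_unith])


section \<open>Monomorphisms, epimorphisms, equalizers and coequalizers\<close>

definition monic :: "('o, 'm) arrow \<Rightarrow> bool" where
  "monic e \<longleftrightarrow> arr e \<and> (\<forall>g h. arr g \<and> arr h \<and> src g = src h \<and> trg g = src e \<and> trg h = src e \<and> e \<bullet> g = e \<bullet> h \<longrightarrow> g = h)"

definition epic :: "('o, 'm) arrow \<Rightarrow> bool" where
  "epic e \<longleftrightarrow> arr e \<and> (\<forall>g h. arr g \<and> arr h \<and> trg g = trg h \<and> src g = trg e \<and> src h = trg e \<and> g \<bullet> e = h \<bullet> e \<longrightarrow> g = h)"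

definition iseq :: "('o, 'm) arrow \<Rightarrow> ('o, 'm) arrow \<Rightarrow> ('o, 'm) arrow \<Rightarrow> bool" where
  "iseq e f g \<longleftrightarrow> arr e \<and> arr f \<and> arr g \<and> trg e = src f \<and> src g = src f \<and> trg g = trg f \<and> f \<bullet> e = g \<bullet> e \<and>
     (\<forall>h. arr h \<and> trg h = src f \<and> f \<bullet> h = g \<bullet> h \<longrightarrow> (\<exists>!h'. arr h' \<and> src h' = src h \<and> trg h' = src e \<and> e \<bullet> h' = h))"

definition iscoeq :: "('o, 'm) arrow \<Rightarrow> ('o, 'm) arrow \<Rightarrow> ('o, 'm) arrow \<Rightarrow> bool" where
  "iscoeq q f g \<longleftrightarrow> arr q \<and> arr f \<and> arr g \<and> src q = trg f \<and> src g = src f \<and> trg g = trg f \<and> q \<bullet> f = q \<bullet> g \<and>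
     (\<forall>h. arr h \<and> src h = trg f \<and> h \<bullet> f = h \<bullet> g \<longrightarrow> (\<exists>!h'. arr h' \<and> trg h' = trg h \<and> src h' = trg q \<and> h' \<bullet> q = h))"

lemma mono_arr: "monic e \<Longrightarrow> arr e" by (simp add: monic_def)
lemma epi_arr: "epic e \<Longrightarrow> arr e" by (simp add: epic_def)

lemma monicD: "\<lbrakk>monic e; e \<bullet> g = e \<bullet> h; arr g; arr h; trg g = src e; trg h = src e; src g = src h\<rbrakk> \<Longrightarrow> g = h"
  unfolding monic_def by blast

lemma epicD: "\<lbrakk>epic e; g \<bullet> e = h \<bullet> e; arr g; arr h; src g = trg e; src h = trg e; trg g = trg h\<rbrakk> \<Longrightarrow> g = h"
  unfolding epic_def by blast

lemma monicI:
  assumes "arr e" "\<And>g h. \<lbrakk>arr g; arr h; src g = src h; trg g = src e; trg h = src e; e \<bullet> g = e \<bullet> h\<rbrakk> \<Longrightarrow> g = h"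
  shows "monic e"
  using assms unfolding monic_def by blast

lemma epicI:
  assumes "arr e" "\<And>g h. \<lbrakk>arr g; arr h; trg g = trg h; src g = trg e; src h = trg e; g \<bullet> e = h \<bullet> e\<rbrakk> \<Longrightarrow> g = h"
  shows "epic e"
  using assms unfolding epic_def by blast

lemma mono_cmp: assumes f: "monic f" and g: "monic g" and t: "trg f = src g" shows "monic (g \<bullet> f)"
proof (rule monicI)
  fix h k assume *: "arr h" "arr k" "src h = src k" "trg h = src (g \<bullet> f)" "trg k = src (g \<bullet> f)" "(g \<bullet> f) \<bullet> h = (g \<bullet> f) \<bullet> k"
  have "f \<bullet> h = f \<bullet> k"
    by (rule monicD[OF g]) (use * t mono_arr[OF f] in simp_all)
  then show "h = k"
    by (rule monicD[OF f]) (use * in simp_all)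
qed (use t mono_arr[OF f] mono_arr[OF g] in simp)

lemma epi_cmp: assumes f: "epic f" and g: "epic g" and t: "trg f = src g" shows "epic (g \<bullet> f)"
proof (rule epicI)
  fix h k assume *: "arr h" "arr k" "trg h = trg k" "src h = trg (g \<bullet> f)" "src k = trg (g \<bullet> f)" "h \<bullet> g \<bullet> f = k \<bullet> g \<bullet> f"
  have "h \<bullet> g = k \<bullet> g"
    by (rule epicD[OF f]) (use * t epi_arr[OF g] in simp_all)
  then show "h = k"
    by (rule epicD[OF g]) (use * in simp_all)
qed (use t epi_arr[OF f] epi_arr[OF g] in simp)

lemma mono_cancel_left: assumes m: "monic (g \<bullet> f)" shows "monic f"
proof (rule monicI)
  fix h k assume *: "arr h" "arr k" "src h = src k" "trg h = src f" "trg k = src f" "f \<bullet> h = f \<bullet> k"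
  show "h = k" by (rule monicD[OF m]) (use * in simp_all)
qed (use mono_arr[OF m] in simp)

lemma epi_cancel_right: assumes m: "epic (g \<bullet> f)" shows "epic g"
proof (rule epicI)
  fix h k assume *: "arr h" "arr k" "trg h = trg k" "src h = trg g" "src k = trg g" "h \<bullet> g = k \<bullet> g"
  have "h \<bullet> g \<bullet> f = k \<bullet> g \<bullet> f" using *(6)[THEN reduce] by simp
  then show "h = k" by (rule epicD[OF m]) (use * in simp_all)
qed (use epi_arr[OF m] in simp)

lemma iseqI:
  assumes "monic e" "arr f" "arr g" "trg e = src f" "src g = src f" "trg g = trg f" "f \<bullet> e = g \<bullet> e"
    and "\<And>h. \<lbrakk>arr h; trg h = src f; f \<bullet> h = g \<bullet> h\<rbrakk> \<Longrightarrow> \<exists>h'. arr h' \<and> src h' = src h \<and> trg h' = src e \<and> e \<bullet> h' = h"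
  shows "iseq e f g"
  using assms(1-7) unfolding iseq_def
  by (auto simp: mono_arr intro!: ex_ex1I assms(8)) (metis monicD)

lemma iscoeqI:
  assumes "epic e" "arr f" "arr g" "src e = trg f" "src g = src f" "trg g = trg f" "e \<bullet> f = e \<bullet> g"
    and "\<And>h. \<lbrakk>arr h; src h = trg f; h \<bullet> f = h \<bullet> g\<rbrakk> \<Longrightarrow> \<exists>h'. arr h' \<and> trg h' = trg h \<and> src h' = trg e \<and> h' \<bullet> e = h"
  shows "iscoeq e f g"
  using assms(1-7) unfolding iscoeq_def
  by (auto simp: epi_arr intro!: ex_ex1I assms(8)) (metis epicD)

lemma iseqD: assumes "iseq e f g"
  shows "arr e" "arr f" "arr g" "trg e = src f" "src g = src f" "trg g = trg f" "f \<bullet> e = g \<bullet> e"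
  using assms unfolding iseq_def by blast+

lemma iscoeqD: assumes "iscoeq e f g"
  shows "arr e" "arr f" "arr g" "src e = trg f" "src g = src f" "trg g = trg f" "e \<bullet> f = e \<bullet> g"
  using assms unfolding iscoeq_def by blast+

lemma iseqE:
  assumes "iseq e f g" "arr h" "trg h = src f" "f \<bullet> h = g \<bullet> h"
  obtains h' where "arr h'" "src h' = src h" "trg h' = src e" "e \<bullet> h' = h"
  using assms unfolding iseq_def by blast

lemma iscoeqE:
  assumes "iscoeq e f g" "arr h" "src h = trg f" "h \<bullet> f = h \<bullet> g"
  obtains h' where "arr h'" "trg h' = trg h" "src h' = trg e" "h' \<bullet> e = h"
  using assms unfolding iscoeq_def by blast

lemma iseq_ex1: "\<lbrakk>iseq e f g; arr h; trg h = src f; f \<bullet> h = g \<bullet> h\<rbrakk> \<Longrightarrow> \<exists>!h'. arr h' \<and> src h' = src h \<and> trg h' = src e \<and> e \<bullet> h' = h"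
  unfolding iseq_def by blast

lemma iscoeq_ex1: "\<lbrakk>iscoeq e f g; arr h; src h = trg f; h \<bullet> f = h \<bullet> g\<rbrakk> \<Longrightarrow> \<exists>!h'. arr h' \<and> trg h' = trg h \<and> src h' = trg e \<and> h' \<bullet> e = h"
  unfolding iscoeq_def by blast

lemma iseq_mono: assumes "iseq e f g" shows "monic e"
proof -
  note d = iseqD[OF assms]
  have "h = k" if "arr h" "arr k" "src h = src k" "trg h = src e" "trg k = src e" "e \<bullet> h = e \<bullet> k" for h k
  proof -
    have "f \<bullet> e \<bullet> h = g \<bullet> e \<bullet> h" using d(7)[THEN reduce, of h] by simp
    then have "\<exists>!h'. arr h' \<and> src h' = src (e \<bullet> h) \<and> trg h' = src e \<and> e \<bullet> h' = e \<bullet> h"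
      by (intro iseq_ex1[OF assms]) (use that d(1,4) in simp_all)
    then show ?thesis using that unfolding Ex1_def by (metis src_trg_cmp(1))
  qed
  then show ?thesis using d(1) unfolding monic_def by blast
qed

lemma iscoeq_epi: assumes "iscoeq e f g" shows "epic e"
proof -
  note d = iscoeqD[OF assms]
  have "h = k" if "arr h" "arr k" "trg h = trg k" "src h = trg e" "src k = trg e" "h \<bullet> e = k \<bullet> e" for h k
  proof -
    have "(h \<bullet> e) \<bullet> f = (h \<bullet> e) \<bullet> g" using d(7) by simp
    then have "\<exists>!h'. arr h' \<and> trg h' = trg (h \<bullet> e) \<and> src h' = trg e \<and> h' \<bullet> e = h \<bullet> e"
      by (intro iscoeq_ex1[OF assms]) (use that d(1,4) in simp_all)
    then show ?thesis using that unfolding Ex1_def by (metis src_trg_cmp(2))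
  qed
  then show ?thesis using d(1) unfolding epic_def by blast
qed

text \<open>An equalizer depends only on the set of arrows that equalize the pair. This is used to
  pass from \<open>f\<close>, \<open>g\<close> to their difference and zero, and between different
  pairs that describe the same object.\<close>

lemma iseq_cong:
  assumes "\<And>h. \<lbrakk>arr h; trg h = src f\<rbrakk> \<Longrightarrow> f \<bullet> h = g \<bullet> h \<longleftrightarrow> f' \<bullet> h = g' \<bullet> h"
    and "arr f" "arr g" "src g = src f" "trg g = trg f" "arr f'" "arr g'" "src f' = src f" "src g' = src f" "trg g' = trg f'"
  shows "iseq e f g \<longleftrightarrow> iseq e f' g'"
proof
  assume k: "iseq e f g"
  then show "iseq e f' g'"
    using assms iseqD[OF k] iseqE[OF k] by (intro iseqI) (metis iseq_mono)+
next
  assume k: "iseq e f' g'"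
  then show "iseq e f g"
    using assms iseqD[OF k] iseqE[OF k] by (intro iseqI) (metis iseq_mono)+
qed

lemma iscoeq_cong:
  assumes "\<And>h. \<lbrakk>arr h; src h = trg f\<rbrakk> \<Longrightarrow> h \<bullet> f = h \<bullet> g \<longleftrightarrow> h \<bullet> f' = h \<bullet> g'"
    and "arr f" "arr g" "src g = src f" "trg g = trg f" "arr f'" "arr g'" "trg f' = trg f" "trg g' = trg f" "src g' = src f'"
  shows "iscoeq e f g \<longleftrightarrow> iscoeq e f' g'"
proof
  assume k: "iscoeq e f g"
  then show "iscoeq e f' g'"
    using assms iscoeqD[OF k] iscoeqE[OF k] by (intro iscoeqI) (metis iscoeq_epi)+
next
  assume k: "iscoeq e f' g'"
  then show "iscoeq e f g"
    using assms iscoeqD[OF k] iscoeqE[OF k] by (intro iscoeqI) (metis iscoeq_epi)+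
qed

section \<open>Comparison with the predicates on raw morphisms\<close>

lemma ball_Hom_arr: "\<lbrakk>a \<in> Obj M; b \<in> Obj M\<rbrakk> \<Longrightarrow> (\<forall>h\<in>Hom M a b. P (mk a b h)) \<longleftrightarrow> (\<forall>h. arr h \<and> src h = a \<and> trg h = b \<longrightarrow> P h)"
  by (auto dest: arr_ex)

lemma ex1_Hom_arr: assumes o: "a \<in> Obj M" "b \<in> Obj M"
  shows "(\<exists>!h. h \<in> Hom M a b \<and> P (mk a b h)) \<longleftrightarrow> (\<exists>!h. arr h \<and> src h = a \<and> trg h = b \<and> P h)"
proof
  assume "\<exists>!h. h \<in> Hom M a b \<and> P (mk a b h)"
  then obtain h where h: "h \<in> Hom M a b" "P (mk a b h)" and u: "\<And>k. \<lbrakk>k \<in> Hom M a b; P (mk a b k)\<rbrakk> \<Longrightarrow> k = h" by blast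
  show "\<exists>!h. arr h \<and> src h = a \<and> trg h = b \<and> P h"
  proof (rule ex1I[of _ "mk a b h"])
    fix k assume k: "arr k \<and> src k = a \<and> trg k = b \<and> P k"
    then have "k = mk a b (rw k)" "rw k \<in> Hom M a b" by (simp_all add: rw_in_hom)
    with u[of "rw k"] k show "k = mk a b h" by metis
  qed (use h o in simp)
next
  assume "\<exists>!h. arr h \<and> src h = a \<and> trg h = b \<and> P h"
  then obtain h where h: "arr h" "src h = a" "trg h = b" "P h" and u: "\<And>k. \<lbrakk>arr k; src k = a; trg k = b; P k\<rbrakk> \<Longrightarrow> k = h" by blast
  show "\<exists>!h. h \<in> Hom M a b \<and> P (mk a b h)"
  proof (rule ex1I[of _ "rw h"])
    fix k assume k: "k \<in> Hom M a b \<and> P (mk a b k)"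
    then show "k = rw h" using u[of "mk a b k"] o by (metis arr_mk rw_mk src_trg_mk)
  qed (use h in \<open>simp add: rw_in_hom\<close>)
qed

lemma is_mono_iff:
  assumes [simp]: "a \<in> Obj M" "b \<in> Obj M" "f \<in> Hom M a b"
  shows "is_mono M a b f \<longleftrightarrow> monic (mk a b f)"
proof
  assume m: "is_mono M a b f"
  show "monic (mk a b f)"
  proof (rule monicI)
    fix g h assume *: "arr g" "arr h" "src g = src h" "trg g = src (mk a b f)" "trg h = src (mk a b f)" "mk a b f \<bullet> g = mk a b f \<bullet> h"
    then have r: "rw g \<in> Hom M (src h) a" "rw h \<in> Hom M (src h) a" "g = mk (src h) a (rw g)" "h = mk (src h) a (rw h)"
      by (simp_all add: rw_in_hom)
    have "mk (src h) b (f \<cdot> rw g) = mk (src h) b (f \<cdot> rw h)"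
      using * r(1,2) mk_cmp[of "src h" a b "rw g" f] mk_cmp[of "src h" a b "rw h" f] by simp
    then have "f \<cdot> rw g = f \<cdot> rw h"
      using * r by (simp add: mk_eq_iff comp_in_hom[of "src h" a b])
    then have "rw g = rw h" using m r(1,2) arr_obj(1)[OF *(2)] unfolding is_mono_def by blast
    then show "g = h" using r(3,4) by metis
  qed simp
next
  assume m: "monic (mk a b f)"
  have "g = h" if "x \<in> Obj M" "g \<in> Hom M x a" "h \<in> Hom M x a" "f \<cdot> g = f \<cdot> h" for x g h
  proof -
    have "mk x a g = mk x a h"
      by (rule monicD[OF m]) (use that in \<open>simp_all flip: mk_cmp\<close>)
    then show ?thesis using that by (simp add: mk_eq_iff)
  qed
  then show "is_mono M a b f" by (auto simp: is_mono_def)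
qed

lemma is_epi_iff:
  assumes [simp]: "a \<in> Obj M" "b \<in> Obj M" "f \<in> Hom M a b"
  shows "is_epi M a b f \<longleftrightarrow> epic (mk a b f)"
proof
  assume m: "is_epi M a b f"
  show "epic (mk a b f)"
  proof (rule epicI)
    fix g h assume *: "arr g" "arr h" "trg g = trg h" "src g = trg (mk a b f)" "src h = trg (mk a b f)" "g \<bullet> mk a b f = h \<bullet> mk a b f"
    then have r: "rw g \<in> Hom M b (trg h)" "rw h \<in> Hom M b (trg h)" "g = mk b (trg h) (rw g)" "h = mk b (trg h) (rw h)"
      by (simp_all add: rw_in_hom)
    have "mk a (trg h) (rw g \<cdot> f) = mk a (trg h) (rw h \<cdot> f)"
      using * r(1,2) mk_cmp[of a b "trg h" f "rw g"] mk_cmp[of a b "trg h" f "rw h"] by simp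
    then have "rw g \<cdot> f = rw h \<cdot> f"
      using * r by (simp add: mk_eq_iff comp_in_hom[of a b "trg h"])
    then have "rw g = rw h" using m r(1,2) arr_obj(2)[OF *(2)] unfolding is_epi_def by blast
    then show "g = h" using r(3,4) by metis
  qed simp
next
  assume m: "epic (mk a b f)"
  have "g = h" if "x \<in> Obj M" "g \<in> Hom M b x" "h \<in> Hom M b x" "g \<cdot> f = h \<cdot> f" for x g h
  proof -
    have "mk b x g = mk b x h"
      by (rule epicD[OF m]) (use that in \<open>simp_all flip: mk_cmp\<close>)
    then show ?thesis using that by (simp add: mk_eq_iff)
  qed
  then show "is_epi M a b f" by (auto simp: is_epi_def)
qed

lemma all_arr_by_src: "(\<forall>x\<in>Obj M. \<forall>h. arr h \<and> src h = x \<and> trg h = a \<longrightarrow> P x h) \<longleftrightarrow> (\<forall>h. arr h \<and> trg h = a \<longrightarrow> P (src h) h)"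
  by (auto dest: arr_obj)

lemma all_arr_by_trg: "(\<forall>x\<in>Obj M. \<forall>h. arr h \<and> src h = a \<and> trg h = x \<longrightarrow> P x h) \<longleftrightarrow> (\<forall>h. arr h \<and> src h = a \<longrightarrow> P (trg h) h)"
  by (auto dest: arr_obj)

lemma is_equalizer_iff: assumes [simp]: "E \<in> Obj M" "a \<in> Obj M" "b \<in> Obj M" "f \<in> Hom M a b" "g \<in> Hom M a b" "e \<in> Hom M E a"
  shows "is_equalizer M E e a b f g \<longleftrightarrow> iseq (mk E a e) (mk a b f) (mk a b g)"
proof -
  have 1: "f \<cdot> e = g \<cdot> e \<longleftrightarrow> mk a b f \<bullet> mk E a e = mk a b g \<bullet> mk E a e"
    by (simp add: mk_eq_iff comp_in_hom[of E a b] flip: mk_cmp)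
  have 2: "f \<cdot> h = g \<cdot> h \<longleftrightarrow> mk a b f \<bullet> mk x a h = mk a b g \<bullet> mk x a h" if "x \<in> Obj M" "h \<in> Hom M x a" for x h
    using that by (simp add: mk_eq_iff comp_in_hom[of x a b] flip: mk_cmp)
  have 3: "(\<exists>!h'. h' \<in> Hom M x E \<and> e \<cdot> h' = h) \<longleftrightarrow> (\<exists>!h'. arr h' \<and> src h' = x \<and> trg h' = E \<and> mk E a e \<bullet> h' = mk x a h)"
    if "x \<in> Obj M" "h \<in> Hom M x a" for x h
  proof -
    have "h' \<in> Hom M x E \<and> e \<cdot> h' = h \<longleftrightarrow> h' \<in> Hom M x E \<and> mk E a e \<bullet> mk x E h' = mk x a h" for h'
      using that by (auto simp: mk_eq_iff comp_in_hom[of x E a] simp flip: mk_cmp)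
    then show ?thesis using that ex1_Hom_arr[of x E "\<lambda>k. mk E a e \<bullet> k = mk x a h"] by simp
  qed
  have L: "(\<forall>h\<in>Hom M x a. f \<cdot> h = g \<cdot> h \<longrightarrow> (\<exists>!h'. h' \<in> Hom M x E \<and> e \<cdot> h' = h)) \<longleftrightarrow>
     (\<forall>h. arr h \<and> src h = x \<and> trg h = a \<longrightarrow> mk a b f \<bullet> h = mk a b g \<bullet> h \<longrightarrow>
       (\<exists>!h'. arr h' \<and> src h' = x \<and> trg h' = E \<and> mk E a e \<bullet> h' = h))" if x: "x \<in> Obj M" for x
    unfolding ball_Hom_arr[OF x assms(2), symmetric] by (intro ball_cong refl) (simp only: 2[OF x] 3[OF x])
  have "(\<forall>x\<in>Obj M. \<forall>h\<in>Hom M x a. f \<cdot> h = g \<cdot> h \<longrightarrow> (\<exists>!h'. h' \<in> Hom M x E \<and> e \<cdot> h' = h)) \<longleftrightarrow>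
     (\<forall>x\<in>Obj M. \<forall>h. arr h \<and> src h = x \<and> trg h = a \<longrightarrow> mk a b f \<bullet> h = mk a b g \<bullet> h \<longrightarrow>
       (\<exists>!h'. arr h' \<and> src h' = x \<and> trg h' = E \<and> mk E a e \<bullet> h' = h))"
    by (intro ball_cong refl L)
  also have "\<dots> \<longleftrightarrow> (\<forall>h. arr h \<and> trg h = a \<longrightarrow> mk a b f \<bullet> h = mk a b g \<bullet> h \<longrightarrow>
       (\<exists>!h'. arr h' \<and> src h' = src h \<and> trg h' = E \<and> mk E a e \<bullet> h' = h))"
    by (rule all_arr_by_src)
  finally show ?thesis
    unfolding is_equalizer_def iseq_def 1 using assms by (simp only: src_trg_mk arr_mk imp_conjL) simp
qed

lemma is_coequalizer_iff: assumes [simp]: "E \<in> Obj M" "a \<in> Obj M" "b \<in> Obj M" "f \<in> Hom M a b" "g \<in> Hom M a b" "e \<in> Hom M b E"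
  shows "is_coequalizer M E e a b f g \<longleftrightarrow> iscoeq (mk b E e) (mk a b f) (mk a b g)"
proof -
  have 1: "e \<cdot> f = e \<cdot> g \<longleftrightarrow> mk b E e \<bullet> mk a b f = mk b E e \<bullet> mk a b g"
    by (simp add: mk_eq_iff comp_in_hom[of a b E] flip: mk_cmp)
  have 2: "h \<cdot> f = h \<cdot> g \<longleftrightarrow> mk b x h \<bullet> mk a b f = mk b x h \<bullet> mk a b g" if "x \<in> Obj M" "h \<in> Hom M b x" for x h
    using that by (simp add: mk_eq_iff comp_in_hom[of a b x] flip: mk_cmp)
  have 3: "(\<exists>!h'. h' \<in> Hom M E x \<and> h' \<cdot> e = h) \<longleftrightarrow> (\<exists>!h'. arr h' \<and> src h' = E \<and> trg h' = x \<and> h' \<bullet> mk b E e = mk b x h)"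
    if "x \<in> Obj M" "h \<in> Hom M b x" for x h
  proof -
    have "h' \<in> Hom M E x \<and> h' \<cdot> e = h \<longleftrightarrow> h' \<in> Hom M E x \<and> mk E x h' \<bullet> mk b E e = mk b x h" for h'
      using that by (auto simp: mk_eq_iff comp_in_hom[of b E x] simp flip: mk_cmp)
    then show ?thesis using that ex1_Hom_arr[of E x "\<lambda>k. k \<bullet> mk b E e = mk b x h"] by simp
  qed
  have L: "(\<forall>h\<in>Hom M b x. h \<cdot> f = h \<cdot> g \<longrightarrow> (\<exists>!h'. h' \<in> Hom M E x \<and> h' \<cdot> e = h)) \<longleftrightarrow>
     (\<forall>h. arr h \<and> src h = b \<and> trg h = x \<longrightarrow> h \<bullet> mk a b f = h \<bullet> mk a b g \<longrightarrow>
       (\<exists>!h'. arr h' \<and> src h' = E \<and> trg h' = x \<and> h' \<bullet> mk b E e = h))" if x: "x \<in> Obj M" for x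
    unfolding ball_Hom_arr[OF assms(3) x, symmetric] by (intro ball_cong refl) (simp only: 2[OF x] 3[OF x])
  have "(\<forall>x\<in>Obj M. \<forall>h\<in>Hom M b x. h \<cdot> f = h \<cdot> g \<longrightarrow> (\<exists>!h'. h' \<in> Hom M E x \<and> h' \<cdot> e = h)) \<longleftrightarrow>
     (\<forall>x\<in>Obj M. \<forall>h. arr h \<and> src h = b \<and> trg h = x \<longrightarrow> h \<bullet> mk a b f = h \<bullet> mk a b g \<longrightarrow>
       (\<exists>!h'. arr h' \<and> src h' = E \<and> trg h' = x \<and> h' \<bullet> mk b E e = h))"
    by (intro ball_cong refl L)
  also have "\<dots> \<longleftrightarrow> (\<forall>h. arr h \<and> src h = b \<longrightarrow> h \<bullet> mk a b f = h \<bullet> mk a b g \<longrightarrow>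
       (\<exists>!h'. arr h' \<and> src h' = E \<and> trg h' = trg h \<and> h' \<bullet> mk b E e = h))"
    by (rule all_arr_by_trg)
  also have "\<dots> \<longleftrightarrow> (\<forall>h. arr h \<and> src h = b \<longrightarrow> h \<bullet> mk a b f = h \<bullet> mk a b g \<longrightarrow>
       (\<exists>!h'. arr h' \<and> trg h' = trg h \<and> src h' = E \<and> h' \<bullet> mk b E e = h))"
    by (simp only: conj_left_commute[of "src _ = E"])
  finally show ?thesis
    unfolding is_coequalizer_def iscoeq_def 1 using assms by (simp only: src_trg_mk arr_mk imp_conjL) simp
qed


end


section \<open>Abelian structure\<close>

context abelian_symmetric_monoidal_category
begin

lemma Add_in_hom: "\<lbrakk>a \<in> Obj M; b \<in> Obj M; f \<in> Hom M a b; g \<in> Hom M a b\<rbrakk> \<Longrightarrow> Add M f g \<in> Hom M a b"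
  using comm_group.axioms(2)[OF hom_comm_group, THEN group.is_monoid, THEN monoid.m_closed, of a b f g] by simp

lemma Zero_in_hom: "\<lbrakk>a \<in> Obj M; b \<in> Obj M\<rbrakk> \<Longrightarrow> Zero M a b \<in> Hom M a b"
  using comm_group.axioms(2)[OF hom_comm_group, THEN group.is_monoid, THEN monoid.one_closed, of a b] by simp

definition zr :: "'o \<Rightarrow> 'o \<Rightarrow> ('o, 'm) arrow" where "zr a b = mk a b (Zero M a b)"

definition sb :: "('o, 'm) arrow \<Rightarrow> ('o, 'm) arrow \<Rightarrow> ('o, 'm) arrow" where
  "sb f g = mk (src f) (trg f) (Add M (rw f)
     (inv\<^bsub>\<lparr>carrier = Hom M (src f) (trg f), monoid.mult = Add M, one = Zero M (src f) (trg f)\<rparr>\<^esub> (rw g)))"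

lemma zr_simps [simp]: "src (zr a b) = a" "trg (zr a b) = b" "\<lbrakk>a \<in> Obj M; b \<in> Obj M\<rbrakk> \<Longrightarrow> arr (zr a b)"
  "src (sb f g) = src f" "trg (sb f g) = trg f"
  by (simp_all add: zr_def sb_def Zero_in_hom)

text \<open>An additive map of hom-groups is a homomorphism of groups and so preserves zero and
  differences. Instances are composition with a fixed arrow on either side and tensoring with an
  identity.\<close>

lemma additive_map:
  assumes o: "a \<in> Obj M" "b \<in> Obj M" "c \<in> Obj M" "d \<in> Obj M"
    and \<phi>: "\<And>f. \<lbrakk>arr f; src f = a; trg f = b\<rbrakk> \<Longrightarrow> arr (\<phi> f) \<and> src (\<phi> f) = c \<and> trg (\<phi> f) = d"
    and add: "\<And>f g. \<lbrakk>f \<in> Hom M a b; g \<in> Hom M a b\<rbrakk> \<Longrightarrow> rw (\<phi> (mk a b (Add M f g))) = Add M (rw (\<phi> (mk a b f))) (rw (\<phi> (mk a b g)))"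
  shows "\<phi> (zr a b) = zr c d"
    and "\<lbrakk>arr f; arr g; src f = a; src g = a; trg f = b; trg g = b\<rbrakk> \<Longrightarrow> \<phi> (sb f g) = sb (\<phi> f) (\<phi> g)"
proof -
  let ?G = "\<lparr>carrier = Hom M a b, monoid.mult = Add M, one = Zero M a b\<rparr>"
  let ?H = "\<lparr>carrier = Hom M c d, monoid.mult = Add M, one = Zero M c d\<rparr>"
  let ?F = "\<lambda>f. rw (\<phi> (mk a b f))"
  have F: "?F f \<in> Hom M c d" if "f \<in> Hom M a b" for f
    using \<phi>[of "mk a b f"] that o by (simp add: rw_in_hom)
  have "group_hom ?G ?H ?F"
    using comm_group.axioms(2)[OF hom_comm_group] o
    by (simp add: group_hom_def group_hom_axioms_def hom_def F add)
  then interpret group_hom ?G ?H ?F .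
  have "?F (Zero M a b) = Zero M c d" using hom_one by simp
  then show "\<phi> (zr a b) = zr c d"
    using \<phi>[of "zr a b"] o by (metis zr_def mk_rw zr_simps)
  assume f: "arr f" "arr g" "src f = a" "src g = a" "trg f = b" "trg g = b"
  have m: "mk a b (rw f) = f" "mk a b (rw g) = g" using f by simp_all
  have h: "rw f \<in> Hom M a b" "rw g \<in> Hom M a b" using f by (simp_all add: rw_in_hom)
  have i: "inv\<^bsub>?G\<^esub> (rw g) \<in> Hom M a b" using G.inv_closed[of "rw g"] h by simp
  have "rw (\<phi> (sb f g)) = Add M (?F (rw f)) (?F (inv\<^bsub>?G\<^esub> (rw g)))"
    using f add[OF h(1) i] by (simp add: sb_def)
  also have "\<dots> = Add M (rw (\<phi> f)) (inv\<^bsub>?H\<^esub> (rw (\<phi> g)))"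
    using hom_inv[of "rw g"] h by (simp add: m)
  finally have 1: "rw (\<phi> (sb f g)) = Add M (rw (\<phi> f)) (inv\<^bsub>?H\<^esub> (rw (\<phi> g)))" .
  have "arr (sb f g)" using f o i h by (auto simp: sb_def intro: Add_in_hom)
  then have "\<phi> (sb f g) = mk c d (rw (\<phi> (sb f g)))"
    using \<phi>[of "sb f g"] f by simp
  then show "\<phi> (sb f g) = sb (\<phi> f) (\<phi> g)"
    using \<phi>[OF f(1,3,5)] by (simp add: 1 sb_def[of "\<phi> f"])
qed

lemma arr_sb [simp]: assumes "arr f" "arr g" "src g = src f" "trg g = trg f" shows "arr (sb f g)"
proof -
  interpret group "\<lparr>carrier = Hom M (src f) (trg f), monoid.mult = Add M, one = Zero M (src f) (trg f)\<rparr>"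
    using comm_group.axioms(2)[OF hom_comm_group] assms by simp
  show ?thesis using assms inv_closed[of "rw g"] by (simp add: sb_def Add_in_hom rw_in_hom)
qed

lemma sb_eq_zr: assumes "arr f" "arr g" "src g = src f" "trg g = trg f" shows "sb f g = zr (src f) (trg f) \<longleftrightarrow> f = g"
proof -
  let ?G = "\<lparr>carrier = Hom M (src f) (trg f), monoid.mult = Add M, one = Zero M (src f) (trg f)\<rparr>"
  interpret group ?G
    using comm_group.axioms(2)[OF hom_comm_group] assms by simp
  have h: "rw f \<in> Hom M (src f) (trg f)" "rw g \<in> Hom M (src f) (trg f)"
    using assms by (simp_all add: rw_in_hom)
  then have i: "inv\<^bsub>?G\<^esub> (rw g) \<in> Hom M (src f) (trg f)" using inv_closed[of "rw g"] by simp
  have "sb f g = zr (src f) (trg f) \<longleftrightarrow> Add M (rw f) (inv\<^bsub>?G\<^esub> (rw g)) = Zero M (src f) (trg f)"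
    using assms h i by (simp add: sb_def zr_def mk_eq_iff Add_in_hom Zero_in_hom)
  also have "\<dots> \<longleftrightarrow> rw f = rw g"
    using r_inv[of "rw g"] inv_equality[of "rw f" "inv\<^bsub>?G\<^esub> (rw g)"] inv_inv[of "rw g"] h i by auto
  also have "\<dots> \<longleftrightarrow> f = g" using assms by (metis mk_rw)
  finally show ?thesis .
qed

lemma cmp_zr [simp]: "\<lbrakk>arr h; src h = b; a \<in> Obj M\<rbrakk> \<Longrightarrow> h \<bullet> zr a b = zr a (trg h)"
  and cmp_sb: "\<lbrakk>arr h; arr f; arr g; src g = src f; trg g = trg f; src h = trg f\<rbrakk> \<Longrightarrow> h \<bullet> sb f g = sb (h \<bullet> f) (h \<bullet> g)"
proof -
  have *: "rw (h \<bullet> mk a b (Add M f g)) = Add M (rw (h \<bullet> mk a b f)) (rw (h \<bullet> mk a b g))"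
    if t: "arr h" "src h = b" "a \<in> Obj M" "f \<in> Hom M a b" "g \<in> Hom M a b" for a b f g
  proof -
    obtain c h' where "h = mk b c h'" "c \<in> Obj M" "h' \<in> Hom M b c" "b \<in> Obj M" using arr_ex[OF t(1)] t(2) by auto
    then show ?thesis using t by (simp add: Add_in_hom comp_in_hom comp_add_right flip: mk_cmp)
  qed
  show "\<lbrakk>arr h; src h = b; a \<in> Obj M\<rbrakk> \<Longrightarrow> h \<bullet> zr a b = zr a (trg h)"
    using additive_map(1)[of a b a "trg h" "(\<bullet>) h"] * by auto
  show "\<lbrakk>arr h; arr f; arr g; src g = src f; trg g = trg f; src h = trg f\<rbrakk> \<Longrightarrow> h \<bullet> sb f g = sb (h \<bullet> f) (h \<bullet> g)"
    using additive_map(2)[of "src f" "trg f" "src f" "trg h" "(\<bullet>) h" f g] * by auto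
qed

lemma zr_cmp [simp]: "\<lbrakk>arr h; trg h = a; b \<in> Obj M\<rbrakk> \<Longrightarrow> zr a b \<bullet> h = zr (src h) b"
  and sb_cmp: "\<lbrakk>arr h; arr f; arr g; src g = src f; trg g = trg f; trg h = src f\<rbrakk> \<Longrightarrow> sb f g \<bullet> h = sb (f \<bullet> h) (g \<bullet> h)"
proof -
  have *: "rw (mk a b (Add M f g) \<bullet> h) = Add M (rw (mk a b f \<bullet> h)) (rw (mk a b g \<bullet> h))"
    if t: "arr h" "trg h = a" "b \<in> Obj M" "f \<in> Hom M a b" "g \<in> Hom M a b" for a b f g
  proof -
    obtain c h' where "h = mk c a h'" "c \<in> Obj M" "h' \<in> Hom M c a" "a \<in> Obj M" using arr_ex[OF t(1)] t(2) by auto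
    then show ?thesis using t by (simp add: Add_in_hom comp_in_hom comp_add_left flip: mk_cmp)
  qed
  show "\<lbrakk>arr h; trg h = a; b \<in> Obj M\<rbrakk> \<Longrightarrow> zr a b \<bullet> h = zr (src h) b"
    using additive_map(1)[of a b "src h" b "\<lambda>f. f \<bullet> h"] * by auto
  show "\<lbrakk>arr h; arr f; arr g; src g = src f; trg g = trg f; trg h = src f\<rbrakk> \<Longrightarrow> sb f g \<bullet> h = sb (f \<bullet> h) (g \<bullet> h)"
    using additive_map(2)[of "src f" "trg f" "src h" "trg f" "\<lambda>f. f \<bullet> h" f g] * by auto
qed

lemma zero_hom_zr: assumes "is_zero_object M z" "arr f" "trg f = z \<or> src f = z"
  shows "f = zr (src f) (trg f)"
proof -
  have z: "z \<in> Obj M" "\<And>x. x \<in> Obj M \<Longrightarrow> \<exists>!f. f \<in> Hom M x z" "\<And>x. x \<in> Obj M \<Longrightarrow> \<exists>!f. f \<in> Hom M z x"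
    using assms(1) by (auto simp: is_zero_object_def is_terminal_def is_initial_def)
  have "rw f = Zero M (src f) (trg f)"
    using z(2)[of "src f"] z(3)[of "trg f"] rw_in_hom[OF assms(2) refl refl] Zero_in_hom[of "src f" "trg f"] assms(2,3) by auto
  then show ?thesis using assms(2) by (metis mk_rw zr_def)
qed

text \<open>Hom-sets into and out of a zero object are singletons, so a composite through one is a
  composite of additive zeros: the categorical and the additive notion of zero agree.\<close>

lemma is_zero_mor_iff: assumes [simp]: "a \<in> Obj M" "b \<in> Obj M" "f \<in> Hom M a b"
  shows "is_zero_mor M a b f \<longleftrightarrow> mk a b f = zr a b"
proof
  assume "is_zero_mor M a b f"
  then obtain z g h where z: "is_zero_object M z" and h: "g \<in> Hom M a z" "h \<in> Hom M z b" "f = h \<cdot> g"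
    by (auto simp: is_zero_mor_def)
  have [simp]: "z \<in> Obj M" using z by (simp add: is_zero_object_def is_terminal_def)
  have "mk a b f = mk z b h \<bullet> mk a z g" using h by (simp add: mk_cmp)
  also have "mk a z g = zr a z" using zero_hom_zr[OF z, of "mk a z g"] h by simp
  finally show "mk a b f = zr a b" using h by simp
next
  assume f: "mk a b f = zr a b"
  obtain z where z: "is_zero_object M z" using zero_object by (auto simp: pointed_def)
  have [simp]: "z \<in> Obj M" using z by (simp add: is_zero_object_def is_terminal_def)
  have "mk a b f = mk a b (Zero M z b \<cdot> Zero M a z)"
    unfolding f using mk_cmp[of a z b "Zero M a z" "Zero M z b"] by (simp add: Zero_in_hom flip: zr_def)
  then have "f = Zero M z b \<cdot> Zero M a z"
    by (simp add: mk_eq_iff Zero_in_hom comp_in_hom[of a z b])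
  then show "is_zero_mor M a b f"
    unfolding is_zero_mor_def using z Zero_in_hom[of a z] Zero_in_hom[of z b] by auto
qed

text \<open>Kernels are treated as equalizers with the additive zero, so that everything proved for
  \<open>iseq\<close> applies to them.\<close>

abbreviation iskr :: "('o, 'm) arrow \<Rightarrow> ('o, 'm) arrow \<Rightarrow> bool" where
  "iskr k f \<equiv> iseq k f (zr (src f) (trg f))"

abbreviation iscok :: "('o, 'm) arrow \<Rightarrow> ('o, 'm) arrow \<Rightarrow> bool" where
  "iscok k f \<equiv> iscoeq k f (zr (src f) (trg f))"

lemma is_kernel_iff: assumes [simp]: "K \<in> Obj M" "a \<in> Obj M" "b \<in> Obj M" "k \<in> Hom M K a" "f \<in> Hom M a b"
  shows "is_kernel M K k a b f \<longleftrightarrow> iskr (mk K a k) (mk a b f)"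
proof -
  have "is_zero_mor M x b (f \<cdot> h) \<longleftrightarrow> f \<cdot> h = Zero M a b \<cdot> h" if "x \<in> Obj M" "h \<in> Hom M x a" for x h
  proof -
    have "mk x b (Zero M a b \<cdot> h) = zr x b"
      using that mk_cmp[of x a b h "Zero M a b"] by (simp add: Zero_in_hom flip: zr_def)
    then show ?thesis
      using that mk_eq_iff[of x b "f \<cdot> h" "Zero M a b \<cdot> h"] by (simp add: is_zero_mor_iff comp_in_hom[of x a b] Zero_in_hom)
  qed
  then have "is_kernel M K k a b f \<longleftrightarrow> is_equalizer M K k a b f (Zero M a b)"
    unfolding is_kernel_def is_equalizer_def by (simp add: Zero_in_hom)
  then show ?thesis by (simp add: is_equalizer_iff Zero_in_hom zr_def)
qed

lemma is_cokernel_iff: assumes [simp]: "Q \<in> Obj M" "a \<in> Obj M" "b \<in> Obj M" "q \<in> Hom M b Q" "f \<in> Hom M a b"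
  shows "is_cokernel M Q q a b f \<longleftrightarrow> iscok (mk b Q q) (mk a b f)"
proof -
  have "is_zero_mor M a x (h \<cdot> f) \<longleftrightarrow> h \<cdot> f = h \<cdot> Zero M a b" if "x \<in> Obj M" "h \<in> Hom M b x" for x h
  proof -
    have "mk a x (h \<cdot> Zero M a b) = zr a x"
      using that mk_cmp[of a b x "Zero M a b" h] by (simp add: Zero_in_hom flip: zr_def)
    then show ?thesis
      using that mk_eq_iff[of a x "h \<cdot> f" "h \<cdot> Zero M a b"] by (simp add: is_zero_mor_iff comp_in_hom[of a b x] Zero_in_hom)
  qed
  then have "is_cokernel M Q q a b f \<longleftrightarrow> is_coequalizer M Q q a b f (Zero M a b)"
    unfolding is_cokernel_def is_coequalizer_def by (simp add: Zero_in_hom)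
  then show ?thesis by (simp add: is_coequalizer_iff Zero_in_hom zr_def)
qed

section \<open>Kernels, cokernels and images\<close>

lemma ex_kernel: assumes "arr f" shows "\<exists>k. iskr k f"
proof -
  obtain a b f' where f: "f = mk a b f'" "a \<in> Obj M" "b \<in> Obj M" "f' \<in> Hom M a b" using arr_ex[OF assms] by auto
  obtain K k where k: "is_kernel M K k a b f'" using kernels[OF f(2-4)] by blast
  then have "K \<in> Obj M" "k \<in> Hom M K a" by (auto simp: is_kernel_def)
  then show ?thesis using k f is_kernel_iff[of K a b k f'] by auto
qed

lemma ex_cokernel: assumes "arr f" shows "\<exists>k. iscok k f"
proof -
  obtain a b f' where f: "f = mk a b f'" "a \<in> Obj M" "b \<in> Obj M" "f' \<in> Hom M a b" using arr_ex[OF assms] by auto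
  obtain K k where k: "is_cokernel M K k a b f'" using cokernels[OF f(2-4)] by blast
  then have "K \<in> Obj M" "k \<in> Hom M b K" by (auto simp: is_cokernel_def)
  then show ?thesis using k f is_cokernel_iff[of K a b k f'] by auto
qed

lemma mono_is_kernel: assumes "monic f" shows "\<exists>g. iskr f g"
proof -
  obtain a b f' where f: "f = mk a b f'" "a \<in> Obj M" "b \<in> Obj M" "f' \<in> Hom M a b" using arr_ex[OF mono_arr[OF assms]] by auto
  then obtain c g where k: "is_kernel M a f' b c g" using mono_normal[OF f(2,3), of f'] assms is_mono_iff[OF f(2-4)] by auto
  then have "c \<in> Obj M" "g \<in> Hom M b c" by (auto simp: is_kernel_def)
  then show ?thesis using k f is_kernel_iff[of a b c f' g] by (intro exI[of _ "mk b c g"]) simp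
qed

lemma epi_is_cokernel: assumes "epic f" shows "\<exists>g. iscok f g"
proof -
  obtain a b f' where f: "f = mk a b f'" "a \<in> Obj M" "b \<in> Obj M" "f' \<in> Hom M a b" using arr_ex[OF epi_arr[OF assms]] by auto
  then obtain c g where k: "is_cokernel M b f' c a g" using epi_normal[OF f(2,3), of f'] assms is_epi_iff[OF f(2-4)] by auto
  then have "c \<in> Obj M" "g \<in> Hom M c a" by (auto simp: is_cokernel_def)
  then show ?thesis using k f is_cokernel_iff[of b c a f' g] by (intro exI[of _ "mk c a g"]) simp
qed

lemma iseq_iff_iskr: assumes [simp]: "arr f" "arr g" "src g = src f" "trg g = trg f"
  shows "iseq e f g \<longleftrightarrow> iskr e (sb f g)"
proof -
  have "f \<bullet> h = g \<bullet> h \<longleftrightarrow> sb f g \<bullet> h = zr (src f) (trg f) \<bullet> h" if "arr h" "trg h = src f" for h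
    using that sb_eq_zr[of "f \<bullet> h" "g \<bullet> h"] by (auto simp: sb_cmp)
  then show ?thesis by (subst iseq_cong[of f g "sb f g" "zr (src f) (trg f)"]) simp_all
qed

lemma iscoeq_iff_iscok: assumes [simp]: "arr f" "arr g" "src g = src f" "trg g = trg f"
  shows "iscoeq e f g \<longleftrightarrow> iscok e (sb f g)"
proof -
  have "h \<bullet> f = h \<bullet> g \<longleftrightarrow> h \<bullet> sb f g = h \<bullet> zr (src f) (trg f)" if "arr h" "src h = trg f" for h
    using that sb_eq_zr[of "h \<bullet> f" "h \<bullet> g"] by (auto simp: cmp_sb)
  then show ?thesis by (subst iscoeq_cong[of f g "sb f g" "zr (src f) (trg f)"]) simp_all
qed

lemma ex_equalizer: "\<lbrakk>arr f; arr g; src g = src f; trg g = trg f\<rbrakk> \<Longrightarrow> \<exists>e. iseq e f g"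
  using ex_kernel[of "sb f g"] by (auto simp: iseq_iff_iskr)

lemma ex_coequalizer: "\<lbrakk>arr f; arr g; src g = src f; trg g = trg f\<rbrakk> \<Longrightarrow> \<exists>e. iscoeq e f g"
  using ex_cokernel[of "sb f g"] by (auto simp: iscoeq_iff_iscok)

lemma iskrD: assumes "iskr k f" shows "arr k" "arr f" "trg k = src f" "f \<bullet> k = zr (src k) (trg f)"
  using iseqD[OF assms] by simp_all

lemma iscokD: assumes "iscok k f" shows "arr k" "arr f" "src k = trg f" "k \<bullet> f = zr (src f) (trg k)"
  using iscoeqD[OF assms] by simp_all

lemma iskrE:
  assumes "iskr k f" "arr h" "trg h = src f" "f \<bullet> h = zr (src h) (trg f)"
  obtains h' where "arr h'" "src h' = src h" "trg h' = src k" "k \<bullet> h' = h"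
  using iseqE[OF assms(1-3)] assms iskrD[OF assms(1)] by auto

lemma iscokE:
  assumes "iscok k f" "arr h" "src h = trg f" "h \<bullet> f = zr (src f) (trg h)"
  obtains h' where "arr h'" "trg h' = trg h" "src h' = trg k" "h' \<bullet> k = h"
  using iscoeqE[OF assms(1-3)] assms iscokD[OF assms(1)] by auto

text \<open>By normality \<open>f\<close> is the kernel of some \<open>g\<close>, and
  \<open>g\<close> factors through the cokernel \<open>c\<close>; hence whatever \<open>c\<close>
  kills is killed by \<open>g\<close> and factors through \<open>f\<close>.\<close>

lemma mono_kernel_cokernel: assumes f: "monic f" and c: "iscok c f" shows "iskr f c"
proof -
  obtain g where g: "iskr f g" using mono_is_kernel[OF f] by blast
  note gd = iskrD[OF g] and cd = iscokD[OF c]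
  obtain g' where g': "arr g'" "trg g' = trg g" "src g' = trg c" "g' \<bullet> c = g"
    using iscokE[OF c, of g] gd by metis
  show ?thesis
  proof (rule iseqI)
    fix h assume h: "arr h" "trg h = src c" "c \<bullet> h = zr (src c) (trg c) \<bullet> h"
    then have "g \<bullet> h = g' \<bullet> c \<bullet> h" using g'(4) by (metis cmp_assoc)
    also have "\<dots> = zr (src h) (trg g)" using h cd g' by simp
    finally show "\<exists>h'. arr h' \<and> src h' = src h \<and> trg h' = src f \<and> f \<bullet> h' = h"
      using iskrE[OF g h(1)] h(2) gd cd by metis
  qed (use f cd gd in auto)
qed

lemma epi_cokernel_kernel: assumes f: "epic f" and c: "iskr c f" shows "iscok f c"
proof -
  obtain g where g: "iscok f g" using epi_is_cokernel[OF f] by blast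
  note gd = iscokD[OF g] and cd = iskrD[OF c]
  obtain g' where g': "arr g'" "src g' = src g" "trg g' = src c" "c \<bullet> g' = g"
    using iskrE[OF c, of g] gd by metis
  show ?thesis
  proof (rule iscoeqI)
    fix h assume h: "arr h" "src h = trg c" "h \<bullet> c = h \<bullet> zr (src c) (trg c)"
    have "h \<bullet> g = (h \<bullet> c) \<bullet> g'" by (simp only: cmp_assoc g'(4))
    also have "\<dots> = zr (src g) (trg h)" using h(1,2) cd g' unfolding h(3) by simp
    finally show "\<exists>h'. arr h' \<and> trg h' = trg h \<and> src h' = trg f \<and> h' \<bullet> f = h"
      using iscokE[OF g h(1)] h(2) gd cd by metis
  qed (use f cd gd in auto)
qed

text \<open>By subtraction it is enough to cancel against zero.\<close>

lemma monoI_zero: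
  assumes f: "arr f" and z: "\<And>h. \<lbrakk>arr h; trg h = src f; f \<bullet> h = zr (src h) (trg f)\<rbrakk> \<Longrightarrow> h = zr (src h) (src f)"
  shows "monic f"
  unfolding monic_def
proof (intro conjI allI impI)
  fix g h assume g: "arr g \<and> arr h \<and> src g = src h \<and> trg g = src f \<and> trg h = src f \<and> f \<bullet> g = f \<bullet> h"
  then have "sb g h = zr (src g) (src f)"
    using z[of "sb g h"] f sb_eq_zr[of "f \<bullet> g" "f \<bullet> h"] by (simp add: cmp_sb)
  then show "g = h" using g sb_eq_zr[of g h] by simp
qed (rule f)

lemma epiI_zero:
  assumes f: "arr f" and z: "\<And>h. \<lbrakk>arr h; src h = trg f; h \<bullet> f = zr (src f) (trg h)\<rbrakk> \<Longrightarrow> h = zr (trg f) (trg h)"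
  shows "epic f"
  unfolding epic_def
proof (intro conjI allI impI)
  fix g h assume g: "arr g \<and> arr h \<and> trg g = trg h \<and> src g = trg f \<and> src h = trg f \<and> g \<bullet> f = h \<bullet> f"
  then have "sb g h = zr (trg f) (trg g)"
    using z[of "sb g h"] f sb_eq_zr[of "g \<bullet> f" "h \<bullet> f"] by (simp add: sb_cmp)
  then show "g = h" using g sb_eq_zr[of g h] by simp
qed (rule f)

text \<open>Let \<open>f\<close> be a kernel of \<open>c\<close>. Then \<open>c\<close> vanishes on
  the epimorphism \<open>f\<close>, so \<open>c\<close> is zero and the identity factors through
  \<open>f\<close>.\<close>

lemma mono_epi_iso: assumes m: "monic f" and e: "epic f"
  obtains g where "arr g" "src g = trg f" "trg g = src f" "g \<bullet> f = idt (src f)" "f \<bullet> g = idt (trg f)"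
proof -
  have f [simp]: "arr f" using m by (simp add: mono_arr)
  obtain c where g: "iskr f c" using mono_is_kernel[OF m] by blast
  note gd = iskrD[OF g]
  have "c = zr (src c) (trg c)" by (rule epicD[OF e]) (use gd in simp_all)
  then have "c \<bullet> idt (trg f) = zr (trg f) (trg c)" using gd by simp
  then obtain h where h: "arr h" "src h = trg f" "trg h = src f" "f \<bullet> h = idt (trg f)"
    using iskrE[OF g, of "idt (trg f)"] gd by auto
  have "h \<bullet> f = idt (src f)"
    by (rule monicD[OF m]) (use h(4)[THEN reduce, of f] h in simp_all)
  then show ?thesis using that h by blast
qed

text \<open>The image is the kernel of the cokernel; the work lies in showing that the remaining
  factor \<open>e\<close> is an epimorphism.\<close>

lemma image_factorization: assumes f [simp]: "arr f"
  obtains m e where "monic m" "epic e" "f = m \<bullet> e" "src e = src f" "trg m = trg f" "trg e = src m"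
proof -
  obtain c where c: "iscok c f" using ex_cokernel[OF f] by blast
  obtain m where m: "iskr m c" using ex_kernel iscokD(1)[OF c] by blast
  note cd [simp] = iscokD[OF c] and md [simp] = iskrD[OF m] and mm = iseq_mono[OF m]
  obtain e where e [simp]: "arr e" "src e = src f" "trg e = src m" and me: "m \<bullet> e = f"
    using iskrE[OF m f] by auto
  have "epic e"
  proof (rule epiI_zero)
    fix x assume x [simp]: "arr x" "src x = trg e" "x \<bullet> e = zr (src e) (trg x)"
    obtain k where k: "iskr k x" using ex_kernel[OF x(1)] by blast
    note kd = iskrD[OF k]
    note [simp] = kd(1,3)
    obtain e' where e': "arr e'" "src e' = src e" "trg e' = src k" "k \<bullet> e' = e" using iskrE[OF k, of e] by auto
    \<comment> \<open>A kernel cone \<open>g\<close> of this monomorphism kills \<open>f\<close>, so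
      \<open>g\<close> factors through the cokernel \<open>c\<close> and kills \<open>m\<close>.
      Thus \<open>m\<close> factors through \<open>m \<bullet> k\<close>, which splits
      \<open>k\<close> and forces \<open>x\<close> to be zero.\<close>
    have "monic (m \<bullet> k)" using mono_cmp[OF iseq_mono[OF k] mm] kd by simp
    then obtain g where g: "iskr (m \<bullet> k) g" using mono_is_kernel by blast
    note gd = iskrD[OF g]
    have "g \<bullet> f = (g \<bullet> m \<bullet> k) \<bullet> e'" using me e' by simp
    also have "\<dots> = zr (src f) (trg g)" unfolding gd(4) using gd(2) e' by simp
    finally obtain g' where g': "arr g'" "trg g' = trg g" "src g' = trg c" "g' \<bullet> c = g"
      using iscokE[OF c gd(2)] gd(3) by auto
    have "g \<bullet> m = zr (src m) (trg g)" using g'(4)[THEN reduce, of m] g'(1-3) md gd(2) by simp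
    then obtain t where t: "arr t" "src t = src m" "trg t = src k" "(m \<bullet> k) \<bullet> t = m"
      using iskrE[OF g, of m] gd(3) by auto
    have "k \<bullet> t = idt (src m)"
      by (rule monicD[OF mm]) (use t kd in simp_all)
    then have "x = x \<bullet> k \<bullet> t" using x by simp
    also have "\<dots> = zr (src x) (trg x)" using kd(4)[THEN reduce, of t] t kd by simp
    finally show "x = zr (trg e) (trg x)" by simp
  qed simp
  show ?thesis
  proof (rule that)
    show "monic m" by (rule mm)
    show "epic e" by fact
    show "f = m \<bullet> e" by (rule me[symmetric])
  qed simp_all
qed

text \<open>Abstracts the two functors given by tensoring with an object on either side. Exactness
  is stated for short exact sequences, as in the definition of an exact functor; arbitrary kernels,
  cokernels, equalizers and coequalizers are derived.\<close>

definition exact_endo :: "('o \<Rightarrow> 'o) \<Rightarrow> (('o, 'm) arrow \<Rightarrow> ('o, 'm) arrow) \<Rightarrow> bool" where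
  "exact_endo \<phi> \<Phi> \<longleftrightarrow> (\<forall>f. src (\<Phi> f) = \<phi> (src f) \<and> trg (\<Phi> f) = \<phi> (trg f)) \<and> (\<forall>f. arr f \<longrightarrow> arr (\<Phi> f)) \<and>
     (\<forall>f g. trg f = src g \<longrightarrow> \<Phi> (g \<bullet> f) = \<Phi> g \<bullet> \<Phi> f) \<and>
     (\<forall>a\<in>Obj M. \<forall>b\<in>Obj M. \<Phi> (zr a b) = zr (\<phi> a) (\<phi> b)) \<and>
     (\<forall>f g. arr f \<and> arr g \<and> src g = src f \<and> trg g = trg f \<longrightarrow> \<Phi> (sb f g) = sb (\<Phi> f) (\<Phi> g)) \<and>
     (\<forall>k f. iskr k f \<and> iscok f k \<longrightarrow> iskr (\<Phi> k) (\<Phi> f) \<and> iscok (\<Phi> f) (\<Phi> k))"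

lemma exact_endoD: assumes "exact_endo \<phi> \<Phi>"
  shows "src (\<Phi> f) = \<phi> (src f)" "trg (\<Phi> f) = \<phi> (trg f)" "arr f \<Longrightarrow> arr (\<Phi> f)"
    "trg f = src g \<Longrightarrow> \<Phi> (g \<bullet> f) = \<Phi> g \<bullet> \<Phi> f" "\<lbrakk>a \<in> Obj M; b \<in> Obj M\<rbrakk> \<Longrightarrow> \<Phi> (zr a b) = zr (\<phi> a) (\<phi> b)"
    "\<lbrakk>arr f; arr g; src g = src f; trg g = trg f\<rbrakk> \<Longrightarrow> \<Phi> (sb f g) = sb (\<Phi> f) (\<Phi> g)"
    "\<lbrakk>iskr k f; iscok f k\<rbrakk> \<Longrightarrow> iskr (\<Phi> k) (\<Phi> f)" "\<lbrakk>iskr k f; iscok f k\<rbrakk> \<Longrightarrow> iscok (\<Phi> f) (\<Phi> k)"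
  using assms unfolding exact_endo_def by blast+

lemma exact_endo_mono: assumes F: "exact_endo \<phi> \<Phi>" and f: "monic f" shows "monic (\<Phi> f)"
proof -
  obtain c where c: "iscok c f" using ex_cokernel[OF mono_arr[OF f]] by blast
  show ?thesis by (rule iseq_mono[OF exact_endoD(7)[OF F mono_kernel_cokernel[OF f c] c]])
qed

lemma exact_endo_epi: assumes F: "exact_endo \<phi> \<Phi>" and f: "epic f" shows "epic (\<Phi> f)"
proof -
  obtain c where c: "iskr c f" using ex_kernel[OF epi_arr[OF f]] by blast
  show ?thesis by (rule iscoeq_epi[OF exact_endoD(8)[OF F c epi_cokernel_kernel[OF f c]]])
qed

lemma iskr_cmp_mono: assumes m: "monic m" and e: "arr e" "trg e = src m"
  shows "iskr k (m \<bullet> e) \<longleftrightarrow> iskr k e"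
proof -
  have "m \<bullet> e \<bullet> h = zr (src e) (trg m) \<bullet> h \<longleftrightarrow> e \<bullet> h = zr (src e) (trg e) \<bullet> h" if "arr h" "trg h = src e" for h
    using monicD[OF m, of "e \<bullet> h" "zr (src h) (src m)"] that e mono_arr[OF m] by auto
  then show ?thesis using e mono_arr[OF m]
    by (subst iseq_cong[of "m \<bullet> e" "zr (src e) (trg m)" e "zr (src e) (trg e)", symmetric]) simp_all
qed

lemma iscok_cmp_epi: assumes e: "epic e" and m: "arr m" "trg e = src m"
  shows "iscok k (m \<bullet> e) \<longleftrightarrow> iscok k m"
proof -
  have "h \<bullet> m \<bullet> e = h \<bullet> zr (src e) (trg m) \<longleftrightarrow> h \<bullet> m = h \<bullet> zr (src m) (trg m)" if h: "arr h" "src h = trg m" for h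
  proof
    assume A: "h \<bullet> m \<bullet> e = h \<bullet> zr (src e) (trg m)"
    show "h \<bullet> m = h \<bullet> zr (src m) (trg m)"
      by (rule epicD[OF e, of "h \<bullet> m" "h \<bullet> zr (src m) (trg m)", rotated]) (use A h m epi_arr[OF e] in simp_all)
  next
    assume "h \<bullet> m = h \<bullet> zr (src m) (trg m)"
    from this[THEN reduce, of e] show "h \<bullet> m \<bullet> e = h \<bullet> zr (src e) (trg m)"
      using h m epi_arr[OF e] by simp
  qed
  then show ?thesis using m epi_arr[OF e]
    by (subst iscoeq_cong[of "m \<bullet> e" "zr (src e) (trg m)" m "zr (src m) (trg m)", symmetric]) simp_all
qed

text \<open>The kernel of \<open>f\<close> is the kernel of its epimorphic part \<open>e\<close>,
  and \<open>k\<close>, \<open>e\<close> form a short exact sequence, to which exactness applies.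
  Composing with the monomorphism \<open>\<Phi> m\<close> does not change the kernel.\<close>

lemma exact_endo_iskr: assumes F: "exact_endo \<phi> \<Phi>" and k: "iskr k f" shows "iskr (\<Phi> k) (\<Phi> f)"
proof -
  obtain m e where m: "monic m" "epic e" "f = m \<bullet> e" "src e = src f" "trg m = trg f" "trg e = src m"
    using image_factorization[OF iskrD(2)[OF k]] by metis
  have e: "arr e" using m by (simp add: epi_arr)
  have k': "iskr k e" using k iskr_cmp_mono[OF m(1) e m(6)] m(3) by simp
  have "iskr (\<Phi> k) (\<Phi> e)" by (rule exact_endoD(7)[OF F k' epi_cokernel_kernel[OF m(2) k']])
  then have "iskr (\<Phi> k) (\<Phi> m \<bullet> \<Phi> e)"
    using iskr_cmp_mono[OF exact_endo_mono[OF F m(1)], of "\<Phi> e"] exact_endoD(1-3)[OF F] e m(6) by simp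
  then show ?thesis using m exact_endoD(4)[OF F, of e m] by simp
qed

lemma exact_endo_iscok: assumes F: "exact_endo \<phi> \<Phi>" and k: "iscok k f" shows "iscok (\<Phi> k) (\<Phi> f)"
proof -
  obtain m e where m: "monic m" "epic e" "f = m \<bullet> e" "src e = src f" "trg m = trg f" "trg e = src m"
    using image_factorization[OF iscokD(2)[OF k]] by metis
  have e: "arr m" using m by (simp add: mono_arr)
  have k': "iscok k m" using k iscok_cmp_epi[OF m(2) e m(6)] m(3) by simp
  have "iscok (\<Phi> k) (\<Phi> m)" by (rule exact_endoD(8)[OF F mono_kernel_cokernel[OF m(1) k'] k'])
  then have "iscok (\<Phi> k) (\<Phi> m \<bullet> \<Phi> e)"
    using iscok_cmp_epi[OF exact_endo_epi[OF F m(2)], of "\<Phi> m"] exact_endoD(1-3)[OF F] e m(6) by simp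
  then show ?thesis using m exact_endoD(4)[OF F, of e m] by simp
qed

lemma exact_endo_iseq: assumes F: "exact_endo \<phi> \<Phi>" and k: "iseq e f g" shows "iseq (\<Phi> e) (\<Phi> f) (\<Phi> g)"
  using exact_endo_iskr[OF F, of e "sb f g"] k iseqD[OF k] by (simp add: iseq_iff_iskr exact_endoD[OF F])

lemma exact_endo_iscoeq: assumes F: "exact_endo \<phi> \<Phi>" and k: "iscoeq e f g" shows "iscoeq (\<Phi> e) (\<Phi> f) (\<Phi> g)"
  using exact_endo_iscok[OF F, of e "sb f g"] k iscoeqD[OF k] by (simp add: iscoeq_iff_iscok exact_endoD[OF F])

lemma short_exact_iff: "\<lbrakk>arr k; arr f; trg k = src f\<rbrakk> \<Longrightarrow>
    is_short_exact M (src k) (rw k) (trg k) (rw f) (trg f) \<longleftrightarrow> iskr k f \<and> iscok f k"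
  using is_kernel_iff[of "src k" "src f" "trg f" "rw k" "rw f"] is_cokernel_iff[of "trg f" "src k" "trg k" "rw f" "rw k"]
  by (simp add: is_short_exact_def rw_in_hom)

lemma exact_endo_tens_right: assumes [simp]: "x \<in> Obj M" shows "exact_endo (\<lambda>a. a \<boxtimes> x) (\<lambda>f. f \<odot> idt x)"
proof -
  have add: "f \<in> Hom M a b \<Longrightarrow> g \<in> Hom M a b \<Longrightarrow> Add M f g \<otimes> Ident M x = Add M (f \<otimes> Ident M x) (g \<otimes> Ident M x)"
    if "a \<in> Obj M" "b \<in> Obj M" for a b f g
    using tensor_right_additive[OF assms] that by (auto simp: is_additive_functor_def tensor_right_def)
  have rw: "rw (f \<odot> idt x) = rw f \<otimes> Ident M x" if "arr f" for f
    using arr_ex[OF that] by (auto simp: idt_def ident_in_hom tensor_in_hom simp flip: mk_tens)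
  have *: "rw (mk a b (Add M f g) \<odot> idt x) = Add M (rw (mk a b f \<odot> idt x)) (rw (mk a b g \<odot> idt x))"
    if "a \<in> Obj M" "b \<in> Obj M" "f \<in> Hom M a b" "g \<in> Hom M a b" for a b f g
    using that by (simp add: rw Add_in_hom add)
  have ex: "iskr (k \<odot> idt x) (f \<odot> idt x) \<and> iscok (f \<odot> idt x) (k \<odot> idt x)" if "iskr k f" "iscok f k" for k f
  proof -
    note d = iskrD[OF that(1)]
    have "is_short_exact M (src k) (rw k) (trg k) (rw f) (trg f)" using that d short_exact_iff[of k f] by simp
    then have "is_short_exact M (src k \<boxtimes> x) (rw k \<otimes> Ident M x) (trg k \<boxtimes> x) (rw f \<otimes> Ident M x) (trg f \<boxtimes> x)"
      using tensor_right_exact[OF assms] by (auto simp: is_exact_functor_def tensor_right_def)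
    then show ?thesis using short_exact_iff[of "k \<odot> idt x" "f \<odot> idt x"] d by (simp add: rw)
  qed
  show ?thesis
    unfolding exact_endo_def using ex
    by (auto simp: tens_r additive_map(1)[of _ _ _ _ "\<lambda>f. f \<odot> idt x", OF _ _ _ _ _ *]
        intro!: additive_map(2)[of _ _ _ _ "\<lambda>f. f \<odot> idt x", OF _ _ _ _ _ *])
qed

lemma exact_endo_tens_left: assumes [simp]: "x \<in> Obj M" shows "exact_endo (\<lambda>a. x \<boxtimes> a) (\<lambda>f. idt x \<odot> f)"
proof -
  have add: "f \<in> Hom M a b \<Longrightarrow> g \<in> Hom M a b \<Longrightarrow> Ident M x \<otimes> Add M f g = Add M (Ident M x \<otimes> f) (Ident M x \<otimes> g)"
    if "a \<in> Obj M" "b \<in> Obj M" for a b f g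
    using tensor_left_additive[OF assms] that by (auto simp: is_additive_functor_def tensor_left_def)
  have rw: "rw (idt x \<odot> f) = Ident M x \<otimes> rw f" if "arr f" for f
    using arr_ex[OF that] by (auto simp: idt_def ident_in_hom tensor_in_hom simp flip: mk_tens)
  have *: "rw (idt x \<odot> mk a b (Add M f g)) = Add M (rw (idt x \<odot> mk a b f)) (rw (idt x \<odot> mk a b g))"
    if "a \<in> Obj M" "b \<in> Obj M" "f \<in> Hom M a b" "g \<in> Hom M a b" for a b f g
    using that by (simp add: rw Add_in_hom add)
  have ex: "iskr (idt x \<odot> k) (idt x \<odot> f) \<and> iscok (idt x \<odot> f) (idt x \<odot> k)" if "iskr k f" "iscok f k" for k f
  proof -
    note d = iskrD[OF that(1)]
    have "is_short_exact M (src k) (rw k) (trg k) (rw f) (trg f)" using that d short_exact_iff[of k f] by simp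
    then have "is_short_exact M (x \<boxtimes> src k) (Ident M x \<otimes> rw k) (x \<boxtimes> trg k) (Ident M x \<otimes> rw f) (x \<boxtimes> trg f)"
      using tensor_left_exact[OF assms] by (auto simp: is_exact_functor_def tensor_left_def)
    then show ?thesis using short_exact_iff[of "idt x \<odot> k" "idt x \<odot> f"] d by (simp add: rw)
  qed
  show ?thesis
    unfolding exact_endo_def using ex
    by (auto simp: tens_l additive_map(1)[of _ _ _ _ "\<lambda>f. idt x \<odot> f", OF _ _ _ _ _ *]
        intro!: additive_map(2)[of _ _ _ _ "\<lambda>f. idt x \<odot> f", OF _ _ _ _ _ *])
qed

lemmas mono_tens_right = exact_endo_mono[OF exact_endo_tens_right]
lemmas mono_tens_left = exact_endo_mono[OF exact_endo_tens_left]
lemmas epi_tens_right = exact_endo_epi[OF exact_endo_tens_right]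
lemmas epi_tens_left = exact_endo_epi[OF exact_endo_tens_left]
lemmas iseq_tens_right = exact_endo_iseq[OF exact_endo_tens_right]
lemmas iseq_tens_left = exact_endo_iseq[OF exact_endo_tens_left]
lemmas iscoeq_tens_right = exact_endo_iscoeq[OF exact_endo_tens_right]
lemmas iscoeq_tens_left = exact_endo_iscoeq[OF exact_endo_tens_left]

lemma mono_tens: assumes "monic f" "monic g" shows "monic (f \<odot> g)"
proof -
  have [simp]: "arr f" "arr g" using assms by (simp_all add: mono_arr)
  have "monic ((f \<odot> idt (trg g)) \<bullet> (idt (src f) \<odot> g))"
    by (intro mono_cmp mono_tens_left mono_tens_right assms) simp_all
  then show ?thesis by (simp add: tens_cmp)
qed

lemma epi_tens: assumes "epic f" "epic g" shows "epic (f \<odot> g)"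
proof -
  have [simp]: "arr f" "arr g" using assms by (simp_all add: epi_arr)
  have "epic ((f \<odot> idt (trg g)) \<bullet> (idt (src f) \<odot> g))"
    by (intro epi_cmp epi_tens_left epi_tens_right assms) simp_all
  then show ?thesis by (simp add: tens_cmp)
qed

lemma zr_tens:
  assumes "a \<in> Obj M" "b \<in> Obj M" "x \<in> Obj M"
  shows "zr a b \<odot> idt x = zr (a \<boxtimes> x) (b \<boxtimes> x)" "idt x \<odot> zr a b = zr (x \<boxtimes> a) (x \<boxtimes> b)"
  using exact_endoD(5)[of "\<lambda>a. a \<boxtimes> x" "\<lambda>f. f \<odot> idt x" a b] exact_endoD(5)[of "\<lambda>a. x \<boxtimes> a" "\<lambda>f. idt x \<odot> f" a b]
    exact_endo_tens_right[of x] exact_endo_tens_left[of x] assms by blast+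


section \<open>Subobjects and quotients of Hopf monoids\<close>

lemma dl_eqI: "\<lbrakk>Comult X = rw d; arr d; src d = Car X; trg d = Car X \<boxtimes> Car X\<rbrakk> \<Longrightarrow> dl X = d"
  and ep_eqI: "\<lbrakk>Counit X = rw c; arr c; src c = Car X; trg c = Unit M\<rbrakk> \<Longrightarrow> ep X = c"
  by (simp_all add: dl_def ep_def)

lemma ml_eqI: "\<lbrakk>Mult A = rw m; arr m; src m = Car A \<boxtimes> Car A; trg m = Car A\<rbrakk> \<Longrightarrow> ml A = m"
  and un_eqI: "\<lbrakk>One A = rw u; arr u; src u = Unit M; trg u = Car A\<rbrakk> \<Longrightarrow> un A = u"
  and an_eqI: "\<lbrakk>Antipode A = rw s; arr s; src s = Car A; trg s = Car A\<rbrakk> \<Longrightarrow> an A = s"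
  by (simp_all add: ml_def un_def an_def)

text \<open>The equation for the comultiplications holds after composing with
  \<open>e \<odot> e\<close>, which is monic because the tensor product is exact.\<close>

lemma cm_factor_mono:
  assumes e: "cm E A e" "monic e" and X [simp]: "coc X"
    and h [simp]: "arr h" "src h = Car X" "trg h = Car E" and c: "cm X A (e \<bullet> h)"
  shows "cm X E h"
proof -
  note [simp] = cmD(1-5)[OF e(1)]
  have "(e \<odot> e) \<bullet> dl E \<bullet> h = dl A \<bullet> e \<bullet> h"
    using cmD(6)[OF e(1), THEN reduce, of h] by simp
  also have "\<dots> = (e \<odot> e) \<bullet> (h \<odot> h) \<bullet> dl X"
    using cmD(6)[OF c] by (simp add: tens_cmp[THEN reduce])
  finally have "dl E \<bullet> h = (h \<odot> h) \<bullet> dl X"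
    by (rule monicD[OF mono_tens[OF e(2,2)]]) simp_all
  moreover have "ep E \<bullet> h = ep X"
    using cmD(7)[OF c] cmD(7)[OF e(1), THEN reduce, of h] by simp
  ultimately show ?thesis by (simp add: cm_def)
qed

lemma cm_factor_epi:
  assumes q: "cm A Q q" "epic q" and X [simp]: "coc X"
    and h [simp]: "arr h" "src h = Car Q" "trg h = Car X" and c: "cm A X (h \<bullet> q)"
  shows "cm Q X h"
proof -
  note [simp] = cmD(1-5)[OF q(1)]
  have "(dl X \<bullet> h) \<bullet> q = (h \<odot> h) \<bullet> (q \<odot> q) \<bullet> dl A"
    using cmD(6)[OF c] by (simp add: tens_cmp[THEN reduce])
  also have "\<dots> = ((h \<odot> h) \<bullet> dl Q) \<bullet> q"
    using cmD(6)[OF q(1)] by simp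
  finally have "dl X \<bullet> h = (h \<odot> h) \<bullet> dl Q"
    by (rule epicD[OF q(2)]) simp_all
  moreover have "ep X \<bullet> h = ep Q"
    by (rule epicD[OF q(2)]) (use cmD(7)[OF c] cmD(7)[OF q(1)] in simp_all)
  ultimately show ?thesis by (simp add: cm_def)
qed

lemma hm_factor_mono:
  assumes e: "hm E A e" "monic e" and X [simp]: "hopf X"
    and h [simp]: "arr h" "src h = Car X" "trg h = Car E" and c: "hm X A (e \<bullet> h)"
  shows "hm X E h"
proof -
  note [simp] = hmD(1,2,5-7)[OF e(1)]
  have "e \<bullet> h \<bullet> ml X = ml A \<bullet> (e \<odot> e) \<bullet> (h \<odot> h)"
    using hmD(4)[OF c] by (simp add: tens_cmp)
  also have "\<dots> = e \<bullet> ml E \<bullet> (h \<odot> h)"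
    using hmD(4)[OF e(1), THEN reduce] by simp
  finally have "h \<bullet> ml X = ml E \<bullet> (h \<odot> h)"
    by (rule monicD[OF e(2)]) simp_all
  then show ?thesis
    using cm_factor_mono[OF hmD(3)[OF e(1)] e(2) _ h hmD(3)[OF c]] by (simp add: hm_def)
qed

lemma hm_factor_epi:
  assumes q: "hm A Q q" "epic q" and X [simp]: "hopf X"
    and h [simp]: "arr h" "src h = Car Q" "trg h = Car X" and c: "hm A X (h \<bullet> q)"
  shows "hm Q X h"
proof -
  note [simp] = hmD(1,2,5-7)[OF q(1)]
  have "(h \<bullet> ml Q) \<bullet> (q \<odot> q) = ml X \<bullet> ((h \<bullet> q) \<odot> (h \<bullet> q))"
    using hmD(4)[OF c] hmD(4)[OF q(1)] by simp
  also have "\<dots> = (ml X \<bullet> (h \<odot> h)) \<bullet> (q \<odot> q)"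
    by (simp add: tens_cmp)
  finally have "h \<bullet> ml Q = ml X \<bullet> (h \<odot> h)"
    by (rule epicD[OF epi_tens[OF q(2,2)]]) simp_all
  then show ?thesis
    using cm_factor_epi[OF hmD(3)[OF q(1)] q(2) _ h hmD(3)[OF c]] by (simp add: hm_def)
qed

text \<open>The axioms hold in \<open>A\<close> restricted along \<open>e\<close>, and tensor powers
  of the monomorphism \<open>e\<close> can be cancelled. Only the comultiplication has to be lifted;
  the counit is restricted.\<close>

lemma comon_sub:
  assumes A [simp]: "coc A" and e: "monic e" and t [simp]: "trg e = Car A"
    and d [simp]: "arr d" "src d = src e" "trg d = src e \<boxtimes> src e" and D: "dl A \<bullet> e = (e \<odot> e) \<bullet> d"
    and E [simp]: "Car E = src e" "dl E = d" "ep E = ep A \<bullet> e"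
  shows "cm E A e"
proof -
  note [simp] = mono_arr[OF e]
  let ?c = "src e" and ?a = "Car A"
  have cE: "coc E"
  proof (rule cocI; (simp only: \<open>Car E = src e\<close> \<open>dl E = d\<close> \<open>ep E = ep A \<bullet> e\<close>)?)
    have "asc ?a ?a ?a \<bullet> (dl A \<odot> idt ?a) \<bullet> dl A \<bullet> e = (idt ?a \<odot> dl A) \<bullet> dl A \<bullet> e"
      using arg_cong[OF coc_simps(6)[OF A], of "\<lambda>f. f \<bullet> e"] by (simp only: cmp_assoc)
    then have K: "asc ?a ?a ?a \<bullet> (((e \<odot> e) \<bullet> d) \<odot> e) \<bullet> d = (e \<odot> ((e \<odot> e) \<bullet> d)) \<bullet> d"
      by (simp add: D tens_cmp[THEN reduce])
    have "(e \<odot> (e \<odot> e)) \<bullet> asc ?c ?c ?c \<bullet> (d \<odot> idt ?c) \<bullet> d = (asc ?a ?a ?a \<bullet> ((e \<odot> e) \<odot> e)) \<bullet> (d \<odot> idt ?c) \<bullet> d"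
      by (simp add: nat_asc)
    also have "\<dots> = (e \<odot> (e \<odot> e)) \<bullet> (idt ?c \<odot> d) \<bullet> d"
      using K by (simp add: tens_cmp[THEN reduce])
    finally show "asc ?c ?c ?c \<bullet> (d \<odot> idt ?c) \<bullet> d = (idt ?c \<odot> d) \<bullet> d"
      by (rule monicD[OF mono_tens[OF e mono_tens[OF e e]]]) simp_all
  next
    have "e \<bullet> lu ?c \<bullet> ((ep A \<bullet> e) \<odot> idt ?c) \<bullet> d = lu ?a \<bullet> (idt (Unit M) \<odot> e) \<bullet> ((ep A \<bullet> e) \<odot> idt ?c) \<bullet> d"
      by (simp add: nat_lu[THEN reduce])
    also have "\<dots> = lu ?a \<bullet> (ep A \<odot> idt ?a) \<bullet> (e \<odot> e) \<bullet> d"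
      by (simp add: tens_cmp[THEN reduce])
    also have "\<dots> = e \<bullet> idt ?c"
      using arg_cong[OF coc_simps(5)[OF A], of "\<lambda>f. f \<bullet> e"] by (simp add: D del: coc_simps(5))
    finally show "lu ?c \<bullet> ((ep A \<bullet> e) \<odot> idt ?c) \<bullet> d = idt ?c"
      by (rule monicD[OF e]) simp_all
  next
    have "(e \<odot> e) \<bullet> brd ?c ?c \<bullet> d = brd ?a ?a \<bullet> (e \<odot> e) \<bullet> d"
      by (simp add: nat_brd[THEN reduce])
    also have "\<dots> = (e \<odot> e) \<bullet> d"
      using arg_cong[OF coc_simps(4)[OF A], of "\<lambda>f. f \<bullet> e"] by (simp add: D del: coc_simps(4))
    finally show "brd ?c ?c \<bullet> d = d"
      by (rule monicD[OF mono_tens[OF e e]]) simp_all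
  qed simp_all
  then show "cm E A e" by (simp add: cm_def D)
qed

text \<open>Given lifts of the comultiplication, multiplication, unit and antipode, composing with
  \<open>e\<close> turns products of elements in \<open>E\<close> into products in \<open>A\<close>,
  so the group axioms are inherited because \<open>e\<close> is monic.\<close>

lemma hopf_sub:
  assumes A [simp]: "hopf A" and e: "monic e" and t [simp]: "trg e = Car A"
    and d [simp]: "arr d" "src d = src e" "trg d = src e \<boxtimes> src e" and D: "dl A \<bullet> e = (e \<odot> e) \<bullet> d"
    and m [simp]: "arr m" "src m = src e \<boxtimes> src e" "trg m = src e" and m': "e \<bullet> m = ml A \<bullet> (e \<odot> e)"
    and u [simp]: "arr u" "src u = Unit M" "trg u = src e" and u': "e \<bullet> u = un A"
    and s [simp]: "arr s" "src s = src e" "trg s = src e" and s': "e \<bullet> s = an A \<bullet> e"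
  shows "\<exists>E :: ('o, 'm) hopf_data. hm E A e"
proof -
  note [simp] = mono_arr[OF e]
  define E :: "('o, 'm) hopf_data" where
    "E = \<lparr>Car = src e, Comult = rw d, Counit = rw (ep A \<bullet> e), Mult = rw m, One = rw u, Antipode = rw s\<rparr>"
  have [simp]: "Car E = src e" "dl E = d" "ep E = ep A \<bullet> e" "ml E = m" "un E = u" "an E = s"
    by (simp add: E_def, rule dl_eqI, simp_all add: E_def)
      (rule ep_eqI ml_eqI un_eqI an_eqI; simp)+
  have ce: "cm E A e"
    by (rule comon_sub[OF _ e t d D]) simp_all
  note [simp] = cmD(1)[OF ce]
  note cE = cmD(1)[OF ce]
  have cm: "cm (prodc E E) E (ml E)"
    by (rule cm_factor_mono[OF ce e]) (use cm_cmp[OF cm_tens[OF ce ce] hopfD(2)[OF A]] in \<open>simp_all add: m'\<close>)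
  have cu: "cm unitc E (un E)"
    by (rule cm_factor_mono[OF ce e]) (use hopfD(3)[OF A] in \<open>simp_all add: u'\<close>)
  have mu: "e \<bullet> mu T E x y = mu T A (e \<bullet> x) (e \<bullet> y)" if "cm T E x" "cm T E y" for T :: "('o, 'm) comonoid_data" and x y
    using m'[THEN reduce, of "pair T x y"] cmD[OF that(1)] cmD[OF that(2)] by (simp add: mu_def tens_pair)
  have e1: "e \<bullet> e1 T E = e1 T A" for T :: "('o, 'm) comonoid_data"
    using u'[THEN reduce, of "ep T"] by (simp add: e1_def)
  have mcm: "cm T E (mu T E x y)" if "cm T E x" "cm T E y" for T :: "('o, 'm) comonoid_data" and x y
    unfolding mu_def by (rule cm_cmp[OF cm_pair[OF that] cm])
  have hE: "hopf E"
  proof (rule hopfI[OF cE cm cu])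
    show "arr (an E)" by simp
  next
    fix T :: "('o, 'm) comonoid_data" and x y z
    assume c: "cm T E x" "cm T E y" "cm T E z"
    note [simp] = cmD(1-5)[OF c(1)] cmD(1-5)[OF c(2)] cmD(1-5)[OF c(3)]
    note [simp] = cmD(3-5)[OF mcm[OF c(1,2)]] cmD(3-5)[OF mcm[OF c(2,3)]]
      cmD(3-5)[OF mcm[OF mcm[OF c(1,2)] c(3)]] cmD(3-5)[OF mcm[OF c(1) mcm[OF c(2,3)]]]
    show "mu T E (mu T E x y) z = mu T E x (mu T E y z)"
      by (rule monicD[OF e]) (simp_all add: mu c mcm mu_assoc)
  next
    fix T :: "('o, 'm) comonoid_data" and x
    assume c: "cm T E x"
    note [simp] = cmD(1-5)[OF c]
    have ce: "cm T E (e1 T E)"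
      unfolding e1_def by (rule cm_cmp[OF cm_ep cu]) simp
    note [simp] = cmD(3-5)[OF mcm[OF c ce]] cmD(3-5)[OF mcm[OF ce c]]
    have "mu T E (e1 T E) x = x" by (rule monicD[OF e]) (simp_all add: mu[OF ce c] e1 mu_unit)
    moreover have "mu T E x (e1 T E) = x" by (rule monicD[OF e]) (simp_all add: mu[OF c ce] e1 mu_unit)
    ultimately show "mu T E (e1 T E) x = x \<and> mu T E x (e1 T E) = x" by simp
    have cex: "cm T A (e \<bullet> x)" by (rule cm_cmp[OF c \<open>cm E A e\<close>])
    have r: "e \<bullet> s \<bullet> x = an A \<bullet> e \<bullet> x" using s'[THEN reduce, of x] by simp
    have cs: "cm T E (an E \<bullet> x)"
      by (rule cm_factor_mono[OF \<open>cm E A e\<close> e]) (use cm_cmp[OF cex cm_an[OF A]] r in simp_all)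
    note [simp] = cmD(3-5)[OF mcm[OF c cs]] cmD(3-5)[OF mcm[OF cs c]] cmD(3-5)[OF ce]
    have "mu T E (an E \<bullet> x) x = e1 T E"
      by (rule monicD[OF e]) (use mu[OF cs c] cmD(3-5)[OF mcm[OF cs c]] in \<open>simp_all add: e1 r mu_inv[OF A cex]\<close>)
    moreover have "mu T E x (an E \<bullet> x) = e1 T E"
      by (rule monicD[OF e]) (use mu[OF c cs] cmD(3-5)[OF mcm[OF c cs]] in \<open>simp_all add: e1 r mu_inv[OF A cex]\<close>)
    ultimately show "mu T E (an E \<bullet> x) x = e1 T E \<and> mu T E x (an E \<bullet> x) = e1 T E" by simp
  qed
  then have "hm E A e" using ce m' by (simp add: hm_def)
  then show ?thesis by blast
qed

text \<open>Generalized elements of the quotient need not lift along \<open>q\<close>. The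
  identities are therefore checked in \<open>M\<close>, by cancelling tensor powers of
  \<open>q\<close>, and not on elements as in \<open>hopf_sub\<close>.\<close>

lemma hopf_quot:
  assumes A [simp]: "hopf A" and q: "epic q" and t [simp]: "src q = Car A"
    and d [simp]: "arr d" "src d = trg q" "trg d = trg q \<boxtimes> trg q" and D: "d \<bullet> q = (q \<odot> q) \<bullet> dl A"
    and c [simp]: "arr c" "src c = trg q" "trg c = Unit M" and c': "c \<bullet> q = ep A"
    and m [simp]: "arr m" "src m = trg q \<boxtimes> trg q" "trg m = trg q" and m': "m \<bullet> (q \<odot> q) = q \<bullet> ml A"
    and s [simp]: "arr s" "src s = trg q" "trg s = trg q" and s': "s \<bullet> q = q \<bullet> an A"
  shows "\<exists>Q :: ('o, 'm) hopf_data. hm A Q q"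
proof -
  note [simp] = epi_arr[OF q]
  define Q :: "('o, 'm) hopf_data" where
    "Q = \<lparr>Car = trg q, Comult = rw d, Counit = rw c, Mult = rw m, One = rw (q \<bullet> un A), Antipode = rw s\<rparr>"
  have [simp]: "Car Q = trg q" "dl Q = d" "ep Q = c" "ml Q = m" "un Q = q \<bullet> un A" "an Q = s"
    by (simp add: Q_def, rule dl_eqI, simp_all add: Q_def)
      (rule ep_eqI ml_eqI un_eqI an_eqI; simp)+
  let ?c = "trg q" and ?a = "Car A"
  have cQ: "coc Q"
  proof (rule cocI; (simp only: \<open>Car Q = trg q\<close> \<open>dl Q = d\<close> \<open>ep Q = c\<close>)?)
    have "(asc ?c ?c ?c \<bullet> (d \<odot> idt ?c) \<bullet> d) \<bullet> q = asc ?c ?c ?c \<bullet> ((q \<odot> q) \<odot> q) \<bullet> (dl A \<odot> idt ?a) \<bullet> dl A"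
      by (simp add: D tens_cmp tens_cmp[THEN reduce])
    also have "\<dots> = (q \<odot> (q \<odot> q)) \<bullet> (idt ?a \<odot> dl A) \<bullet> dl A"
      by (simp add: nat_asc[THEN reduce])
    also have "\<dots> = ((idt ?c \<odot> d) \<bullet> d) \<bullet> q"
      by (simp add: D tens_cmp tens_cmp[THEN reduce])
    finally show "asc ?c ?c ?c \<bullet> (d \<odot> idt ?c) \<bullet> d = (idt ?c \<odot> d) \<bullet> d"
      by (rule epicD[OF q]) simp_all
  next
    have "(lu ?c \<bullet> (c \<odot> idt ?c) \<bullet> d) \<bullet> q = lu ?c \<bullet> (idt (Unit M) \<odot> q) \<bullet> (ep A \<odot> idt ?a) \<bullet> dl A"
      by (simp add: D c' tens_cmp tens_cmp[THEN reduce])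
    also have "\<dots> = idt ?c \<bullet> q" by (simp add: nat_lu[THEN reduce])
    finally show "lu ?c \<bullet> (c \<odot> idt ?c) \<bullet> d = idt ?c"
      by (rule epicD[OF q]) simp_all
  next
    have "(brd ?c ?c \<bullet> d) \<bullet> q = d \<bullet> q"
      by (simp add: D nat_brd[THEN reduce])
    then show "brd ?c ?c \<bullet> d = d"
      by (rule epicD[OF q]) simp_all
  qed simp_all
  note [simp] = cQ
  have cq: "cm A Q q" by (simp add: cm_def D c')
  have cm: "cm (prodc Q Q) Q (ml Q)"
    by (rule cm_factor_epi[OF cm_tens[OF cq cq] epi_tens[OF q q]]) (use cm_cmp[OF hopfD(2)[OF A] cq] in \<open>simp_all add: m'\<close>)
  have cu: "cm unitc Q (un Q)"
    using cm_cmp[OF hopfD(3)[OF A] cq] by simp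
  have m'': "m \<bullet> ((q \<bullet> x) \<odot> (q \<bullet> y)) = q \<bullet> ml A \<bullet> (x \<odot> y)" if "trg x = ?a" "trg y = ?a" for x y
    using m'[THEN reduce, of "x \<odot> y"] that by (simp add: tens_cmp)
  have mr: "m \<bullet> ((q \<bullet> x) \<odot> q) = q \<bullet> ml A \<bullet> (x \<odot> idt ?a)" "m \<bullet> (q \<odot> (q \<bullet> x)) = q \<bullet> ml A \<bullet> (idt ?a \<odot> x)" if "trg x = ?a" for x
    using m''[of x "idt ?a"] m''[of "idt ?a" x] that by simp_all
  have "(m \<bullet> (m \<odot> idt ?c)) \<bullet> ((q \<odot> q) \<odot> q) = (m \<bullet> (idt ?c \<odot> m) \<bullet> asc ?c ?c ?c) \<bullet> ((q \<odot> q) \<odot> q)"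
    using hopfD(7)[OF A] by (simp add: nat_asc tens_cmp m' mr tens_cmp[THEN reduce] mr[THEN reduce])
  then have 1: "m \<bullet> (m \<odot> idt ?c) = m \<bullet> (idt ?c \<odot> m) \<bullet> asc ?c ?c ?c"
    by (rule epicD[OF epi_tens[OF epi_tens[OF q q] q]]) simp_all
  have "(m \<bullet> ((q \<bullet> un A) \<odot> idt ?c)) \<bullet> (idt (Unit M) \<odot> q) = lu ?c \<bullet> (idt (Unit M) \<odot> q)"
    by (simp add: tens_cmp mr hopfD(8)[OF A] nat_lu)
  then have 2: "m \<bullet> ((q \<bullet> un A) \<odot> idt ?c) = lu ?c"
    by (rule epicD[OF epi_tens_left[OF unit_obj q]]) simp_all
  have "(m \<bullet> (idt ?c \<odot> (q \<bullet> un A))) \<bullet> (q \<odot> idt (Unit M)) = ru ?c \<bullet> (q \<odot> idt (Unit M))"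
    by (simp add: tens_cmp mr hopfD(9)[OF A] nat_ru)
  then have 3: "m \<bullet> (idt ?c \<odot> (q \<bullet> un A)) = ru ?c"
    by (rule epicD[OF epi_tens_right[OF unit_obj q]]) simp_all
  have "(m \<bullet> (s \<odot> idt ?c) \<bullet> d) \<bullet> q = (q \<bullet> un A \<bullet> c) \<bullet> q"
    by (simp add: D c' tens_cmp[THEN reduce] s' mr[THEN reduce] hopfD(10)[OF A])
  then have 4: "m \<bullet> (s \<odot> idt ?c) \<bullet> d = q \<bullet> un A \<bullet> c"
    by (rule epicD[OF q]) simp_all
  have "(m \<bullet> (idt ?c \<odot> s) \<bullet> d) \<bullet> q = (q \<bullet> un A \<bullet> c) \<bullet> q"
    by (simp add: D c' tens_cmp[THEN reduce] s' mr[THEN reduce] hopfD(11)[OF A])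
  then have 5: "m \<bullet> (idt ?c \<odot> s) \<bullet> d = q \<bullet> un A \<bullet> c"
    by (rule epicD[OF q]) simp_all
  have "hopf Q" using cm cu 1 2 3 4 5 by (simp add: hopf_def)
  then have "hm A Q q" using cq m' by (simp add: hm_def)
  then show ?thesis by blast
qed

text \<open>The equalizer in the category of cocommutative comonoids is in general smaller than the one of
  \<open>f\<close> and \<open>g\<close> in \<open>M\<close>: it is the equalizer in \<open>M\<close> of \<open>x \<mapsto> (x, f x)\<close> and \<open>x \<mapsto> (x, g x)\<close>.\<close>

definition heq :: "('o, 'm) hopf_data \<Rightarrow> ('o, 'm) arrow \<Rightarrow> ('o, 'm) hopf_data \<Rightarrow> ('o, 'm) hopf_data \<Rightarrow> ('o, 'm) arrow \<Rightarrow> ('o, 'm) arrow \<Rightarrow> bool" where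
  "heq E e A B f g \<longleftrightarrow> hm A B f \<and> hm A B g \<and> hm E A e \<and> iseq e (pair A (idt (Car A)) f) (pair A (idt (Car A)) g)"

lemma heqD: assumes "heq E e A B f g"
  shows "hm A B f" "hm A B g" "hm E A e" "iseq e (pair A (idt (Car A)) f) (pair A (idt (Car A)) g)" "monic e" "f \<bullet> e = g \<bullet> e"
proof -
  show f: "hm A B f" and g: "hm A B g" and "hm E A e" and i: "iseq e (pair A (idt (Car A)) f) (pair A (idt (Car A)) g)"
    using assms by (simp_all add: heq_def)
  then show "monic e" using iseq_mono by blast
  have "p2 A B \<bullet> pair A (idt (Car A)) f = f" "p2 A B \<bullet> pair A (idt (Car A)) g = g"
    using p2_pair[OF cm_idt, of A f B] p2_pair[OF cm_idt, of A g B] hmD[OF f] hmD[OF g] by simp_all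
  then show "f \<bullet> e = g \<bullet> e" using iseqD(7)[OF i] by (metis cmp_assoc)
qed

lemma heq_factor:
  assumes E: "heq E e A B f g" and h: "cm X A h" and "f \<bullet> h = g \<bullet> h"
  obtains h' where "cm X E h'" "e \<bullet> h' = h"
proof -
  note d = heqD[OF E]
  note [simp] = hmD(1,2,5-7)[OF d(1)] hmD(5-7)[OF d(2)] hmD(1,5-7)[OF d(3)] cmD(1-5)[OF h]
  have "pair A (idt (Car A)) f \<bullet> h = pair A (idt (Car A)) g \<bullet> h"
    by (simp add: pair_cmp[OF h] assms(3))
  then obtain h' where "arr h'" "src h' = src h" "trg h' = src e" "e \<bullet> h' = h"
    using iseqE[OF d(4), of h] by auto
  moreover from this have "cm X E h'"
    by (intro cm_factor_mono[OF hmD(3)[OF d(3)] d(5)]) (use h in simp_all)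
  ultimately show ?thesis using that by blast
qed

text \<open>The equalizer in \<open>M\<close> has to be shown stable under the comultiplication.
  Coassociativity lets this be tested on one leg of \<open>dl A \<bullet> e\<close> at a time, and
  by exactness \<open>e\<close> tensored with an identity is again an equalizer.\<close>

lemma ex_heq: assumes f: "hm A B f" and g: "hm A B g" shows "\<exists>E e. heq E e A B f g"
proof -
  note [simp] = hmD(1,2,5-7)[OF f] hmD(5-7)[OF g]
  let ?a = "Car A"
  let ?F = "pair A (idt ?a) f" and ?G = "pair A (idt ?a) g"
  obtain e where e: "iseq e ?F ?G" using ex_equalizer[of ?F ?G] by auto
  note [simp] = iseqD(1)[OF e] iseqD(4)[OF e, simplified]
  let ?c = "src e"
  have me: "monic e" by (rule iseq_mono[OF e])
  have fe: "f \<bullet> e = g \<bullet> e"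
    using p2_pair[OF cm_idt, of A f B] p2_pair[OF cm_idt, of A g B] iseqD(7)[OF e] by simp (metis cmp_assoc)
  have P: "pair A (idt ?a) h = brd (Car B) ?a \<bullet> pair A h (idt ?a)" if "hm A B h" for h
    using hmD[OF that] by (simp add: brd_pair)
  have A1: "asc ?a ?a (Car B) \<bullet> (dl A \<odot> idt (Car B)) \<bullet> pair A (idt ?a) h = pair A (idt ?a) (pair A (idt ?a) h)"
    if "hm A B h" for h
    using hmD[OF that] by (simp add: tens_pair dl_eq_pair asc_pair)
  \<comment> \<open>The maps \<open>x \<mapsto> (x, (x, f x))\<close> and
    \<open>x \<mapsto> (x, (x, g x))\<close> agree on the source of \<open>e\<close>, being obtained
    from the equalized pair by duplicating the first component.\<close>
  have A2: "pair A (idt ?a) ?F \<bullet> e = pair A (idt ?a) ?G \<bullet> e"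
    unfolding A1[OF f, symmetric] A1[OF g, symmetric] using iseqD(7)[OF e] by simp
  have A3: "(?F \<odot> idt ?a) \<bullet> dl A = brd ?a (?a \<boxtimes> Car B) \<bullet> pair A (idt ?a) ?F"
    "(?G \<odot> idt ?a) \<bullet> dl A = brd ?a (?a \<boxtimes> Car B) \<bullet> pair A (idt ?a) ?G"
    by (simp_all add: brd_pair pair_def[of A _ "idt ?a"])
  have "(?F \<odot> idt ?a) \<bullet> dl A \<bullet> e = (?G \<odot> idt ?a) \<bullet> dl A \<bullet> e"
    using A3[THEN reduce, of e] A2 by simp
  \<comment> \<open>This is \<open>dl A \<bullet> e\<close> with its first leg lifted through
    \<open>e\<close>; the second leg is lifted below, in \<open>d\<close>.\<close>
  then obtain d1 where d1: "arr d1" "src d1 = ?c" "trg d1 = ?c \<boxtimes> ?a" "(e \<odot> idt ?a) \<bullet> d1 = dl A \<bullet> e"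
    using iseqE[OF iseq_tens_right[OF _ e, of ?a], of "dl A \<bullet> e"] by auto
  note [simp] = d1(1-3)
  have A4: "(idt ?a \<odot> ?F) \<bullet> dl A = pair A (idt ?a) ?F" "(idt ?a \<odot> ?G) \<bullet> dl A = pair A (idt ?a) ?G"
    by (simp_all add: pair_def[of A "idt ?a" "pair A (idt ?a) _"])
  have "(e \<odot> idt (?a \<boxtimes> Car B)) \<bullet> (idt ?c \<odot> ?F) \<bullet> d1 = (idt ?a \<odot> ?F) \<bullet> dl A \<bullet> e"
    using d1(4) by (simp add: tens_cmp[THEN reduce] flip: d1(4))
  also have "\<dots> = (idt ?a \<odot> ?G) \<bullet> dl A \<bullet> e"
    using A2 A4[THEN reduce, of e] by simp
  also have "\<dots> = (e \<odot> idt (?a \<boxtimes> Car B)) \<bullet> (idt ?c \<odot> ?G) \<bullet> d1"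
    using d1(4) by (simp add: tens_cmp[THEN reduce] flip: d1(4))
  finally have "(idt ?c \<odot> ?F) \<bullet> d1 = (idt ?c \<odot> ?G) \<bullet> d1"
    by (rule monicD[OF mono_tens_right[OF _ me], rotated]) simp_all
  then obtain d where d: "arr d" "src d = ?c" "trg d = ?c \<boxtimes> ?c" "(idt ?c \<odot> e) \<bullet> d = d1"
    using iseqE[OF iseq_tens_left[OF _ e, of ?c], of d1] by auto
  have D: "dl A \<bullet> e = (e \<odot> e) \<bullet> d"
    using d1(4) d(1-3) by (simp add: tens_cmp[THEN reduce] flip: d(4))
  \<comment> \<open>A comonoid morphism that equalizes \<open>f\<close> and \<open>g\<close> also
    equalizes the two pairings. Multiplication, unit and antipode of the equalizer are lifted from
    comonoid morphisms into \<open>A\<close>.\<close>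
  have fac: "\<exists>h'. arr h' \<and> src h' = src h \<and> trg h' = ?c \<and> e \<bullet> h' = h"
    if "cm X A h" "f \<bullet> h = g \<bullet> h" for X :: "('o, 'm) comonoid_data" and h
    using iseqE[OF e, of h] that cmD[OF that(1)] by (simp add: pair_cmp[OF that(1)]) blast
  define E :: "('o, 'm) comonoid_data" where "E = \<lparr>Car = ?c, Comult = rw d, Counit = rw (ep A \<bullet> e)\<rparr>"
  have E [simp]: "Car E = ?c" "dl E = d" "ep E = ep A \<bullet> e"
    using d(1-3) by (simp_all add: E_def dl_eqI ep_eqI)
  have ce: "cm E A e"
    by (rule comon_sub[OF _ me _ d(1-3) D E]) simp_all
  have cee: "cm (prodc E E) A (ml A \<bullet> (e \<odot> e))"
    by (rule cm_cmp[OF cm_tens[OF ce ce]]) (simp add: hopfD(2))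
  have "f \<bullet> ml A \<bullet> (e \<odot> e) = g \<bullet> ml A \<bullet> (e \<odot> e)"
    using hmD(4)[OF f, THEN reduce, of "e \<odot> e"] hmD(4)[OF g, THEN reduce, of "e \<odot> e"] fe by (simp add: tens_cmp)
  then obtain m where m: "arr m" "src m = ?c \<boxtimes> ?c" "trg m = ?c" "e \<bullet> m = ml A \<bullet> (e \<odot> e)"
    using fac[OF cee] by auto
  obtain u where u: "arr u" "src u = Unit M" "trg u = ?c" "e \<bullet> u = un A"
    using fac[of unitc "un A"] hopfD(3)[of A] hm_un[OF f] hm_un[OF g] by auto
  have cs: "cm E A (an A \<bullet> e)"
    by (rule cm_cmp[OF ce cm_an]) simp
  have "f \<bullet> an A \<bullet> e = g \<bullet> an A \<bullet> e"
    using hm_an[OF f, THEN reduce, of e] hm_an[OF g, THEN reduce, of e] fe by simp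
  then obtain s where s: "arr s" "src s = ?c" "trg s = ?c" "e \<bullet> s = an A \<bullet> e"
    using fac[OF cs] by auto
  obtain E :: "('o, 'm) hopf_data" where "hm E A e"
    using hopf_sub[OF _ me _ d(1-3) D m u s] by auto
  then show ?thesis using e f g unfolding heq_def by blast
qed

text \<open>An equalizer on the product, with the universal property of a pullback for all comonoid
  morphisms out of \<open>X\<close>, not just for Hopf morphisms.\<close>

lemma heq_pullback:
  assumes E: "heq E e (prodh A B) C (f \<bullet> p1 A B) (g \<bullet> p2 A B)" and h: "cm X A h" and k: "cm X B k"
    and "f \<bullet> h = g \<bullet> k" and [simp]: "hopf A" "hopf B"
  obtains l where "cm X E l" "(p1 A B \<bullet> e) \<bullet> l = h" "(p2 A B \<bullet> e) \<bullet> l = k"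
proof -
  have c: "cm X (prodh A B) (pair X h k)" using cm_pair[OF h k] by (simp add: cm_prodh)
  have p: "p1 A B \<bullet> pair X h k = h" "p2 A B \<bullet> pair X h k = k"
    using p1_pair[OF k, of h A] p2_pair[OF h, of k B] cmD[OF h] cmD[OF k] by simp_all
  then obtain l where "cm X E l" "e \<bullet> l = pair X h k"
    using heq_factor[OF E c] assms(4) by auto
  then show ?thesis using that p by simp
qed

text \<open>The epimorphism \<open>e\<close> is a cokernel of its kernel, and \<open>p\<close> kills
  this kernel because \<open>m \<bullet> p\<close> does.\<close>

lemma fill_in:
  assumes e: "epic e" and m: "monic m" and s: "m \<bullet> p = q \<bullet> e"
    and [simp]: "arr p" "arr q" "src p = src e" "trg p = src m" "src q = trg e" "trg q = trg m"
  obtains d where "arr d" "src d = trg e" "trg d = src m" "d \<bullet> e = p" "m \<bullet> d = q"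
proof -
  note [simp] = epi_arr[OF e] mono_arr[OF m]
  obtain k where k: "iskr k e" using ex_kernel epi_arr[OF e] by blast
  note kd [simp] = iskrD[OF k]
  have "m \<bullet> p \<bullet> k = m \<bullet> zr (src k) (src m)"
    using s[THEN reduce, of k] by simp
  then have "p \<bullet> k = zr (src k) (src m)"
    by (rule monicD[OF m]) simp_all
  then obtain d where d: "arr d" "trg d = trg p" "src d = trg e" "d \<bullet> e = p"
    using iscokE[OF epi_cokernel_kernel[OF e k], of p] by auto
  have "m \<bullet> d = q"
    by (rule epicD[OF e]) (use d s in simp_all)
  then show ?thesis using that d by simp
qed

text \<open>Comultiplication, multiplication and antipode of the image are diagonals of squares
  formed by tensor powers of \<open>e\<close> and \<open>m\<close>; the unit is
  \<open>e \<bullet> un A\<close>.\<close>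

lemma hm_image:
  assumes f: "hm A B f"
  obtains I :: "('o, 'm) hopf_data" and e m where "hm A I e" "hm I B m" "epic e" "monic m" "f = m \<bullet> e"
proof -
  note [simp] = hmD(1,2,5-7)[OF f]
  obtain m e where m: "monic m" and e: "epic e" and f': "f = m \<bullet> e" and t: "src e = src f" "trg m = trg f" "trg e = src m"
    by (rule image_factorization[OF hmD(5)[OF f]])
  note [simp] = mono_arr[OF m] epi_arr[OF e] t[unfolded hmD(6,7)[OF f]]
  have "(m \<odot> m) \<bullet> (e \<odot> e) \<bullet> dl A = (dl B \<bullet> m) \<bullet> e"
    using cmD(6)[OF hmD(3)[OF f]] by (simp add: f' tens_cmp[THEN reduce])
  then obtain d where d: "arr d" "src d = trg e" "trg d = src (m \<odot> m)" "d \<bullet> e = (e \<odot> e) \<bullet> dl A" "(m \<odot> m) \<bullet> d = dl B \<bullet> m"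
    by (rule fill_in[OF e mono_tens[OF m m]]) auto
  have "m \<bullet> e \<bullet> ml A = (ml B \<bullet> (m \<odot> m)) \<bullet> (e \<odot> e)"
    using hmD(4)[OF f] by (simp add: f' tens_cmp)
  then obtain t where t: "arr t" "src t = trg (e \<odot> e)" "trg t = src m" "t \<bullet> (e \<odot> e) = e \<bullet> ml A" "m \<bullet> t = ml B \<bullet> (m \<odot> m)"
    by (rule fill_in[OF epi_tens[OF e e] m]) auto
  have "m \<bullet> e \<bullet> an A = (an B \<bullet> m) \<bullet> e"
    using hm_an[OF f] by (simp add: f')
  then obtain s where s: "arr s" "src s = trg e" "trg s = src m" "s \<bullet> e = e \<bullet> an A" "m \<bullet> s = an B \<bullet> m"
    by (rule fill_in[OF e m]) auto
  obtain I :: "('o, 'm) hopf_data" where I: "hm I B m"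
    using hopf_sub[of B m d t "e \<bullet> un A" s] m d t s hm_un[OF f] by (auto simp: f')
  have "hm A I e"
    by (rule hm_factor_mono[OF I m]) (use f hmD(6)[OF I] in \<open>simp_all add: f'\<close>)
  then show ?thesis using that I e m f' by blast
qed

text \<open>The coequalizer in \<open>M\<close> carries the structure. The delicate part is the
  multiplication, which must respect the relation in both variables: the common section
  \<open>d\<close> allows it to be descended in one variable after the other.\<close>

lemma reflexive_coequalizer:
  assumes r: "hm R A r" and s: "hm R A s" and d: "hm A R d" and i: "r \<bullet> d = idt (Car A)" "s \<bullet> d = idt (Car A)"
  obtains Q :: "('o, 'm) hopf_data" and q where "hm A Q q" "iscoeq q r s"
proof -
  note [simp] = hmD(1,2,5-7)[OF r] hmD(5-7)[OF s] hmD(5-7)[OF d]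
  let ?a = "Car A" and ?r = "Car R"
  obtain q where q: "iscoeq q r s" using ex_coequalizer[of r s] by auto
  note eq = iscoeq_epi[OF q]
  note [simp] = iscoeqD(1)[OF q] iscoeqD(4)[OF q, simplified]
  let ?q = "trg q"
  have qr: "q \<bullet> r = q \<bullet> s" by (rule iscoeqD(7)[OF q])
  have "((q \<odot> q) \<bullet> dl A) \<bullet> r = ((q \<odot> q) \<bullet> dl A) \<bullet> s"
    using cmD(6)[OF hmD(3)[OF r]] cmD(6)[OF hmD(3)[OF s]] qr by (simp add: tens_cmp[THEN reduce])
  then obtain dq where dq: "arr dq" "trg dq = ?q \<boxtimes> ?q" "src dq = ?q" "dq \<bullet> q = (q \<odot> q) \<bullet> dl A"
    using iscoeqE[OF q, of "(q \<odot> q) \<bullet> dl A"] by auto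
  have "ep A \<bullet> r = ep A \<bullet> s"
    using cmD(7)[OF hmD(3)[OF r]] cmD(7)[OF hmD(3)[OF s]] by simp
  then obtain c where c: "arr c" "trg c = Unit M" "src c = ?q" "c \<bullet> q = ep A"
    using iscoeqE[OF q, of "ep A"] by auto
  have "(q \<bullet> an A) \<bullet> r = (q \<bullet> an A) \<bullet> s"
    using qr[THEN reduce, of "an R"] by (simp add: hm_an[OF r, symmetric] hm_an[OF s, symmetric])
  then obtain t where t: "arr t" "trg t = ?q" "src t = ?q" "t \<bullet> q = q \<bullet> an A"
    using iscoeqE[OF q, of "q \<bullet> an A"] by auto
  have mr: "q \<bullet> ml A \<bullet> (r \<odot> r) = q \<bullet> ml A \<bullet> (s \<odot> s)"
    using qr[THEN reduce, of "ml R"] by (simp add: hmD(4)[OF r] hmD(4)[OF s])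
  \<comment> \<open>Inserting \<open>d\<close> in one variable of \<open>r \<odot> r\<close> leaves
    that variable unchanged, so the relation acts on the other one alone.\<close>
  have rd: "r \<odot> idt ?a = (r \<odot> r) \<bullet> (idt ?r \<odot> d)" "s \<odot> idt ?a = (s \<odot> s) \<bullet> (idt ?r \<odot> d)"
    "idt ?a \<odot> r = (r \<odot> r) \<bullet> (d \<odot> idt ?r)" "idt ?a \<odot> s = (s \<odot> s) \<bullet> (d \<odot> idt ?r)"
    by (simp_all add: tens_cmp i)
  have m1: "(q \<bullet> ml A) \<bullet> (r \<odot> idt ?a) = (q \<bullet> ml A) \<bullet> (s \<odot> idt ?a)"
    "(q \<bullet> ml A) \<bullet> (idt ?a \<odot> r) = (q \<bullet> ml A) \<bullet> (idt ?a \<odot> s)"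
    unfolding rd using arg_cong[OF mr, of "\<lambda>f. f \<bullet> (idt ?r \<odot> d)"] arg_cong[OF mr, of "\<lambda>f. f \<bullet> (d \<odot> idt ?r)"]
    by (simp_all only: cmp_assoc)
  obtain n where n: "arr n" "trg n = ?q" "src n = ?q \<boxtimes> ?a" "n \<bullet> (q \<odot> idt ?a) = q \<bullet> ml A"
    using iscoeqE[OF iscoeq_tens_right[OF _ q, of ?a], of "q \<bullet> ml A"] m1(1) by auto
  have nq: "n \<bullet> (q \<odot> x) = q \<bullet> ml A \<bullet> (idt ?a \<odot> x)" if "trg x = ?a" "arr x" for x
    using n(4)[THEN reduce, of "idt ?a \<odot> x"] that by (simp add: tens_cmp)
  have "(n \<bullet> (idt ?q \<odot> r)) \<bullet> (q \<odot> idt ?r) = (n \<bullet> (idt ?q \<odot> s)) \<bullet> (q \<odot> idt ?r)"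
    using m1(2) by (simp add: tens_cmp nq)
  then have "n \<bullet> (idt ?q \<odot> r) = n \<bullet> (idt ?q \<odot> s)"
    by (rule epicD[OF epi_tens_right[OF _ eq], rotated]) (use n in simp_all)
  then obtain m where m: "arr m" "trg m = ?q" "src m = ?q \<boxtimes> ?q" "m \<bullet> (idt ?q \<odot> q) = n"
    using iscoeqE[OF iscoeq_tens_left[OF _ q, of ?q], of n] n by auto
  have "m \<bullet> (q \<odot> q) = n \<bullet> (q \<odot> idt ?a)"
    using m(4)[THEN reduce, of "q \<odot> idt ?a"] by (simp add: tens_cmp)
  then have "m \<bullet> (q \<odot> q) = q \<bullet> ml A" using n(4) by simp
  then obtain Q :: "('o, 'm) hopf_data" where "hm A Q q"
    using hopf_quot[of A q dq c m t] eq dq c m t by auto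
  then show ?thesis using that q by blast
qed


end


section \<open>Translation to the category of Hopf monoids, and comodules\<close>

context symmetric_monoidal_category
begin

lemma rw_inject: "\<lbrakk>arr f; arr g; src f = src g; trg f = trg g\<rbrakk> \<Longrightarrow> rw f = rw g \<longleftrightarrow> f = g"
  by (metis mk_rw)

lemma rw_cmp: "\<lbrakk>arr f; arr g; trg f = src g\<rbrakk> \<Longrightarrow> rw (g \<bullet> f) = rw g \<cdot> rw f"
  by (auto simp: rw_def cmp_def)

lemma rw_tens: "\<lbrakk>arr f; arr g\<rbrakk> \<Longrightarrow> rw (g \<odot> f) = rw g \<otimes> rw f"
  by (auto simp: rw_def tens_def)

lemma rw_str:
  "a \<in> Obj M \<Longrightarrow> rw (idt a) = Ident M a"
  "\<lbrakk>a \<in> Obj M; b \<in> Obj M; c \<in> Obj M\<rbrakk> \<Longrightarrow> rw (asc a b c) = Assoc M a b c"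
  "a \<in> Obj M \<Longrightarrow> rw (lu a) = LUnit M a" "a \<in> Obj M \<Longrightarrow> rw (ru a) = RUnit M a"
  "\<lbrakk>a \<in> Obj M; b \<in> Obj M; c \<in> Obj M; d \<in> Obj M\<rbrakk> \<Longrightarrow> rw (itc a b c d) = Interchange M a b c d"
  using mk_Interchange[of a b c d]
  by (simp_all add: idt_def asc_def lu_def ru_def ident_in_hom iso_hom[OF assoc_iso] iso_hom[OF lunit_iso] iso_hom[OF runit_iso]
      flip: mk_Interchange(1))

lemma rw_coc: "coc X \<Longrightarrow> rw (dl X) = Comult X" "coc X \<Longrightarrow> rw (ep X) = Counit X"
  using coc_simps(2,3)[of X] by (simp_all add: dl_def ep_def)

lemma rw_hopf: "hopf A \<Longrightarrow> rw (ml A) = Mult A" "hopf A \<Longrightarrow> rw (un A) = One A" "hopf A \<Longrightarrow> rw (an A) = Antipode A"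
  using hopf_simps(2-4)[of A] by (simp_all add: ml_def un_def an_def)

lemmas rw_simps = rw_cmp rw_tens rw_str rw_coc rw_hopf

lemma comonoid_morphism_iff:
  assumes [simp]: "coc X" "coc Y" "arr f" "src f = Car X" "trg f = Car Y"
  shows "is_comonoid_morphism M X Y (rw f) \<longleftrightarrow> cm X Y f"
proof -
  have "Comult Y \<cdot> rw f = (rw f \<otimes> rw f) \<cdot> Comult X \<longleftrightarrow> rw (dl Y \<bullet> f) = rw ((f \<odot> f) \<bullet> dl X)"
    "Counit Y \<cdot> rw f = Counit X \<longleftrightarrow> rw (ep Y \<bullet> f) = rw (ep X)"
    by (simp_all add: rw_simps)
  then show ?thesis
    by (simp add: is_comonoid_morphism_def cm_def rw_in_hom rw_inject)
qed

lemma Hopf_coc_Obj: "A \<in> Obj (Hopf_coc M) \<longleftrightarrow> hopf A"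
  by (simp add: Hopf_coc_def hopf_iff)

lemma Hopf_coc_Hom:
  assumes [simp]: "hopf A" "hopf B"
  shows "f \<in> Hom (Hopf_coc M) A B \<longleftrightarrow> f \<in> Hom M (Car A) (Car B) \<and> hm A B (mk (Car A) (Car B) f)"
proof (cases "f \<in> Hom M (Car A) (Car B)")
  case True
  define F where "F = mk (Car A) (Car B) f"
  have F [simp]: "arr F" "src F = Car A" "trg F = Car B" and f: "f = rw F"
    using True by (simp_all add: F_def)
  have "f \<cdot> Mult A = Mult B \<cdot> (f \<otimes> f) \<longleftrightarrow> rw (F \<bullet> ml A) = rw (ml B \<bullet> (F \<odot> F))"
    "f \<cdot> One A = One B \<longleftrightarrow> rw (F \<bullet> un A) = rw (un B)"
    "f \<cdot> Antipode A = Antipode B \<cdot> f \<longleftrightarrow> rw (F \<bullet> an A) = rw (an B \<bullet> F)"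
    by (simp_all add: rw_simps f)
  then have "is_hopf_morphism M A B f \<longleftrightarrow> cm A B F \<and> F \<bullet> ml A = ml B \<bullet> (F \<odot> F) \<and> F \<bullet> un A = un B \<and> F \<bullet> an A = an B \<bullet> F"
    using comonoid_morphism_iff[of A B F] unfolding f by (simp add: is_hopf_morphism_def rw_inject)
  also have "\<dots> \<longleftrightarrow> hm A B F"
    using hm_un[of A B F] hm_an[of A B F] by (auto simp: hm_def)
  finally show ?thesis using True by (simp add: Hopf_coc_def F_def)
qed (auto simp: Hopf_coc_def is_hopf_morphism_def is_comonoid_morphism_def)

section \<open>Comodules in terms of arrows\<close>

definition rcm :: "('o, 'm, 'x) comonoid_data_scheme \<Rightarrow> 'o \<Rightarrow> ('o, 'm) arrow \<Rightarrow> bool" where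
  "rcm Q V \<rho> \<longleftrightarrow> coc Q \<and> V \<in> Obj M \<and> arr \<rho> \<and> src \<rho> = V \<and> trg \<rho> = V \<boxtimes> Car Q \<and>
     asc V (Car Q) (Car Q) \<bullet> (\<rho> \<odot> idt (Car Q)) \<bullet> \<rho> = (idt V \<odot> dl Q) \<bullet> \<rho> \<and> ru V \<bullet> (idt V \<odot> ep Q) \<bullet> \<rho> = idt V"

lemma rcmD: assumes "rcm Q V \<rho>"
  shows "coc Q" "V \<in> Obj M" "arr \<rho>" "src \<rho> = V" "trg \<rho> = V \<boxtimes> Car Q"
    "asc V (Car Q) (Car Q) \<bullet> (\<rho> \<odot> idt (Car Q)) \<bullet> \<rho> = (idt V \<odot> dl Q) \<bullet> \<rho>" "ru V \<bullet> (idt V \<odot> ep Q) \<bullet> \<rho> = idt V"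
  using assms by (simp_all add: rcm_def)

lemma rcm_Obj: assumes "rcm Q V \<rho>" shows "(V, rw \<rho>) \<in> Obj (right_comodules M Q)"
proof -
  note [simp] = rcmD(1-5)[OF assms]
  have "Assoc M V (Car Q) (Car Q) \<cdot> (rw \<rho> \<otimes> Ident M (Car Q)) \<cdot> rw \<rho> = rw ((asc V (Car Q) (Car Q) \<bullet> (\<rho> \<odot> idt (Car Q))) \<bullet> \<rho>)"
    by (simp add: rw_simps del: cmp_assoc)
  also have "\<dots> = (Ident M V \<otimes> Comult Q) \<cdot> rw \<rho>"
    unfolding cmp_assoc rcmD(6)[OF assms] by (simp add: rw_simps)
  finally have 1: "Assoc M V (Car Q) (Car Q) \<cdot> (rw \<rho> \<otimes> Ident M (Car Q)) \<cdot> rw \<rho> = (Ident M V \<otimes> Comult Q) \<cdot> rw \<rho>" .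
  have "RUnit M V \<cdot> (Ident M V \<otimes> Counit Q) \<cdot> rw \<rho> = rw ((ru V \<bullet> (idt V \<odot> ep Q)) \<bullet> \<rho>)"
    by (simp add: rw_simps del: cmp_assoc)
  then have 2: "RUnit M V \<cdot> (Ident M V \<otimes> Counit Q) \<cdot> rw \<rho> = Ident M V"
    unfolding cmp_assoc rcmD(7)[OF assms] by (simp add: rw_simps)
  show ?thesis using 1 2 by (simp add: right_comodules_def rw_in_hom)
qed

lemma rcm_Hom:
  assumes V: "rcm Q V \<rho>" and V': "rcm Q V' \<rho>'" and f [simp]: "arr f" "src f = V" "trg f = V'"
    and c: "(f \<odot> idt (Car Q)) \<bullet> \<rho> = \<rho>' \<bullet> f"
  shows "rw f \<in> Hom (right_comodules M Q) (V, rw \<rho>) (V', rw \<rho>')"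
proof -
  note [simp] = rcmD(1-5)[OF V] rcmD(1-5)[OF V']
  have "(rw f \<otimes> Ident M (Car Q)) \<cdot> rw \<rho> = rw \<rho>' \<cdot> rw f"
    using arg_cong[OF c, of rw] by (simp add: rw_simps)
  then show ?thesis by (simp add: right_comodules_def rw_in_hom)
qed

text \<open>The coaction is \<open>x \<mapsto> (x, h x)\<close>: a comonoid over \<open>Q\<close> is
  a \<open>Q\<close>-comodule.\<close>

lemma rcm_cm: assumes h: "cm X Q h" shows "rcm Q (Car X) (pair X (idt (Car X)) h)"
proof -
  note [simp] = cmD(1-5)[OF h]
  show ?thesis
    by (simp add: rcm_def tens_pair asc_pair cm_dl[OF h] cmD(7)[OF h] ru_pair)
qed


end


section \<open>Coflatness\<close>

context abelian_symmetric_monoidal_category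
begin

text \<open>The cokernel \<open>k\<close> of \<open>f\<close> in \<open>M\<close> inherits a
  coaction, since the coaction of \<open>V'\<close> followed by \<open>k \<odot> idt ?q\<close>
  kills \<open>f\<close>. Then \<open>k\<close> and the zero arrow are comodule morphisms that agree
  on \<open>f\<close>, hence \<open>k\<close> is zero.\<close>

lemma comodule_epi:
  assumes V: "rcm Q V \<rho>" and V': "rcm Q V' \<rho>'" and f [simp]: "arr f" "src f = V" "trg f = V'"
    and c: "(f \<odot> idt (Car Q)) \<bullet> \<rho> = \<rho>' \<bullet> f"
    and e: "is_epi (right_comodules M Q) (V, rw \<rho>) (V', rw \<rho>') (rw f)"
  shows "epic f"
proof -
  note [simp] = rcmD(1-5)[OF V] rcmD(1-5)[OF V']
  let ?q = "Car Q"
  obtain k where k: "iscok k f" using ex_cokernel f(1) by blast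
  note [simp] = iscokD(1)[OF k] iscokD(3)[OF k, unfolded f]
  note ek = iscoeq_epi[OF k]
  let ?C = "trg k"
  have "((k \<odot> idt ?q) \<bullet> \<rho>') \<bullet> f = (k \<odot> idt ?q) \<bullet> (f \<odot> idt ?q) \<bullet> \<rho>"
    using c by simp
  also have "\<dots> = zr V (?C \<boxtimes> ?q)"
    using iscokD(4)[OF k] by (simp add: tens_cmp[THEN reduce] zr_tens)
  finally obtain r where r: "arr r" "trg r = ?C \<boxtimes> ?q" "src r = ?C" "r \<bullet> k = (k \<odot> idt ?q) \<bullet> \<rho>'"
    using iscokE[OF k, of "(k \<odot> idt ?q) \<bullet> \<rho>'"] by auto
  note [simp] = r(1-3)
  have "(asc ?C ?q ?q \<bullet> (r \<odot> idt ?q) \<bullet> r) \<bullet> k = (asc ?C ?q ?q \<bullet> ((k \<odot> idt ?q) \<odot> idt ?q)) \<bullet> (\<rho>' \<odot> idt ?q) \<bullet> \<rho>'"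
    by (simp add: r(4) tens_cmp[THEN reduce])
  also have "\<dots> = (k \<odot> idt (?q \<boxtimes> ?q)) \<bullet> asc V' ?q ?q \<bullet> (\<rho>' \<odot> idt ?q) \<bullet> \<rho>'"
    by (simp add: nat_asc_r)
  also have "\<dots> = ((idt ?C \<odot> dl Q) \<bullet> r) \<bullet> k"
    by (simp add: rcmD(6)[OF V'] r(4) tens_cmp[THEN reduce])
  finally have 1: "asc ?C ?q ?q \<bullet> (r \<odot> idt ?q) \<bullet> r = (idt ?C \<odot> dl Q) \<bullet> r"
    by (rule epicD[OF ek]) simp_all
  have "(ru ?C \<bullet> (idt ?C \<odot> ep Q) \<bullet> r) \<bullet> k = ru ?C \<bullet> (k \<odot> idt (Unit M)) \<bullet> (idt V' \<odot> ep Q) \<bullet> \<rho>'"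
    by (simp add: r(4) tens_cmp[THEN reduce])
  also have "\<dots> = idt ?C \<bullet> k"
    using rcmD(7)[OF V'] by (simp add: nat_ru[THEN reduce])
  finally have 2: "ru ?C \<bullet> (idt ?C \<odot> ep Q) \<bullet> r = idt ?C"
    by (rule epicD[OF ek]) simp_all
  have C: "rcm Q ?C r" using 1 2 by (simp add: rcm_def)
  have k1: "rw k \<in> Hom (right_comodules M Q) (V', rw \<rho>') (?C, rw r)"
    by (rule rcm_Hom[OF V' C]) (simp_all add: r(4))
  have k2: "rw (zr V' ?C) \<in> Hom (right_comodules M Q) (V', rw \<rho>') (?C, rw r)"
    by (rule rcm_Hom[OF V' C]) (simp_all add: zr_tens)
  have "rw k \<cdot> rw f = rw (zr V' ?C) \<cdot> rw f"
    using arg_cong[OF iscokD(4)[OF k], of rw] by (simp add: rw_cmp[symmetric])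
  then have "rw k \<cdot>\<^bsub>right_comodules M Q\<^esub> rw f = rw (zr V' ?C) \<cdot>\<^bsub>right_comodules M Q\<^esub> rw f"
    by (simp add: right_comodules_def)
  then have "rw k = rw (zr V' ?C)"
    by (rule e[unfolded is_epi_def, THEN conjunct2, rule_format, OF rcm_Obj[OF C] k1 k2])
  then have kz: "k = zr V' ?C" by (simp add: rw_inject)
  show ?thesis
  proof (rule epiI_zero)
    fix h assume h: "arr h" "src h = trg f" "h \<bullet> f = zr (src f) (trg h)"
    obtain h' where h': "arr h'" "trg h' = trg h" "src h' = ?C" "h' \<bullet> k = h"
      using iscokE[OF k h] by auto
    then show "h = zr (trg f) (trg h)" using arg_cong[OF kz, of "\<lambda>x. h' \<bullet> x"] by simp
  qed simp
qed

lemma epicI_section: "\<lbrakk>f \<bullet> g = idt (trg f); arr f\<rbrakk> \<Longrightarrow> epic f"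
  by (rule epicI) (auto intro: epi_cancel[of _ f _ g])

text \<open>The universal property for raw morphisms, in the shape of the definite description in
  \<open>cotensor_functor\<close>.\<close>

lemma ex1_through_equalizer:
  assumes e: "iseq e f g" and h: "arr h" "trg h = src f" "f \<bullet> h = g \<bullet> h"
  shows "\<exists>!k. k \<in> Hom M (src h) (src e) \<and> rw e \<cdot> k = rw h"
proof -
  note d = iseqD[OF e]
  obtain k where k: "arr k" "src k = src h" "trg k = src e" "e \<bullet> k = h" using iseqE[OF e h] .
  show ?thesis
  proof (rule ex1I[of _ "rw k"])
    show "rw k \<in> Hom M (src h) (src e) \<and> rw e \<cdot> rw k = rw h"
      using k d(1,4) rw_cmp[of k e] by (simp add: rw_in_hom)
    fix l assume l: "l \<in> Hom M (src h) (src e) \<and> rw e \<cdot> l = rw h"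
    have "rw (e \<bullet> mk (src h) (src e) l) = rw h"
      using l d h by (simp add: rw_cmp)
    then have "e \<bullet> mk (src h) (src e) l = h"
      using l d h by (subst (asm) rw_inject) simp_all
    then have "e \<bullet> mk (src h) (src e) l = e \<bullet> k" using k(4) by simp
    then have "mk (src h) (src e) l = k"
      by (rule monicD[OF iseq_mono[OF e]]) (use l k d h in simp_all)
    from arg_cong[OF this, of rw] show "l = rw k"
      using l arr_obj(1)[OF h(1)] arr_obj(1)[OF d(1)] by simp
  qed
qed

text \<open>The cotensor product is formed with an arbitrary choice of equalizers; the hypothesis transfers
  along the comparison isomorphisms.\<close>

lemma coflat_reflect:
  fixes A Q :: "('o, 'm) hopf_data"
  assumes fc: "faithful_coflatness M" and p: "hm A Q \<pi>" and ep: "epic \<pi>"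
    and V: "rcm Q V \<rho>" and V': "rcm Q V' \<rho>'" and f [simp]: "arr f" "src f = V" "trg f = V'"
    and c: "(f \<odot> idt (Car Q)) \<bullet> \<rho> = \<rho>' \<bullet> f"
    and e: "iseq e (asc V (Car Q) (Car A) \<bullet> (\<rho> \<odot> idt (Car A))) (idt V \<odot> pair A \<pi> (idt (Car A)))"
    and e': "iseq e' (asc V' (Car Q) (Car A) \<bullet> (\<rho>' \<odot> idt (Car A))) (idt V' \<odot> pair A \<pi> (idt (Car A)))"
    and g: "epic g" "src g = src e" "trg g = src e'" "e' \<bullet> g = (f \<odot> idt (Car A)) \<bullet> e"
  shows "epic f"
proof -
  note [simp] = hmD(1,2,5-7)[OF p] rcmD(2-5)[OF V] rcmD(2-5)[OF V']
  let ?q = "Car Q" and ?a = "Car A"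
  \<comment> \<open>\<open>A\<close> acts on \<open>Q\<close> by multiplication through
    \<open>\<pi>\<close>, which makes \<open>\<pi>\<close> linear. The record \<open>R\<close> below
    is \<open>Q\<close> with this action, an object of \<open>Comon_coc M A\<close>.\<close>
  let ?\<mu> = "ml Q \<bullet> (\<pi> \<odot> idt ?q)"
  define R :: "('o, 'm) acted_comonoid_data" where
    "R = \<lparr>Car = ?q, Comult = Comult Q, Counit = Counit Q, Act = rw ?\<mu>\<rparr>"
  have RR [simp]: "Car R = ?q" "Comult R = Comult Q" "Counit R = Counit Q" "Act R = rw ?\<mu>" "dl R = dl Q" "ep R = ep Q"
    by (simp_all add: R_def dl_def ep_def)
  have cR: "coc R" using coc_iff[of Q] coc_iff[of R] by (simp add: is_comonoid_def is_cocommutative_def)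
  note [simp] = cR
  have T1: "?\<mu> \<bullet> (ml A \<odot> idt ?q) = (?\<mu> \<bullet> (idt ?a \<odot> ?\<mu>)) \<bullet> asc ?a ?a ?q"
  proof -
    have "?\<mu> \<bullet> (ml A \<odot> idt ?q) = ml Q \<bullet> (ml Q \<odot> idt ?q) \<bullet> ((\<pi> \<odot> \<pi>) \<odot> idt ?q)"
      by (simp add: tens_cmp hmD(4)[OF p])
    also have "\<dots> = ml Q \<bullet> (idt ?q \<odot> ml Q) \<bullet> (\<pi> \<odot> (\<pi> \<odot> idt ?q)) \<bullet> asc ?a ?a ?q"
      using hopfD(7)[of Q, THEN reduce] by (simp add: nat_asc)
    finally show ?thesis by (simp add: tens_cmp tens_cmp[THEN reduce])
  qed
  have T2: "?\<mu> \<bullet> (un A \<odot> idt ?q) = lu ?q"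
    by (simp add: tens_cmp hm_un[OF p] hopfD(8))
  have T3: "dl Q \<bullet> ?\<mu> = (((?\<mu> \<odot> ?\<mu>) \<bullet> itc ?a ?a ?q ?q) \<bullet> (dl A \<odot> idt (?q \<boxtimes> ?q))) \<bullet> (idt ?a \<odot> dl Q)"
  proof -
    have "dl Q \<bullet> ?\<mu> = (ml Q \<odot> ml Q) \<bullet> itc ?q ?q ?q ?q \<bullet> (dl Q \<odot> dl Q) \<bullet> (\<pi> \<odot> idt ?q)"
      using cmD(6)[OF hopfD(2)[of Q], THEN reduce, of "\<pi> \<odot> idt ?q"] by (simp add: dl_prodc)
    also have "\<dots> = (ml Q \<odot> ml Q) \<bullet> (itc ?q ?q ?q ?q \<bullet> ((\<pi> \<odot> \<pi>) \<odot> (idt ?q \<odot> idt ?q))) \<bullet> (dl A \<odot> dl Q)"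
      using cmD(6)[OF hmD(3)[OF p]] by (simp add: tens_cmp)
    also have "\<dots> = (ml Q \<odot> ml Q) \<bullet> ((\<pi> \<odot> idt ?q) \<odot> (\<pi> \<odot> idt ?q)) \<bullet> itc ?a ?a ?q ?q \<bullet> (dl A \<odot> dl Q)"
      by (subst nat_itc) simp_all
    finally show ?thesis by (simp add: tens_cmp tens_cmp[THEN reduce])
  qed
  have T4: "ep Q \<bullet> ?\<mu> = (ep A \<bullet> ru ?a) \<bullet> (idt ?a \<odot> ep Q)"
  proof -
    have "ep Q \<bullet> ?\<mu> = lu (Unit M) \<bullet> (ep A \<odot> ep Q)"
      using cmD(7)[OF hopfD(2)[of Q], THEN reduce, of "\<pi> \<odot> idt ?q"] cmD(7)[OF hmD(3)[OF p]] by (simp add: ep_prodc tens_cmp)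
    also have "\<dots> = ru (Unit M) \<bullet> (ep A \<odot> idt (Unit M)) \<bullet> (idt ?a \<odot> ep Q)"
      by (simp add: lu_ru_unit tens_cmp)
    finally show ?thesis by (simp add: nat_ru[THEN reduce])
  qed
  have act: "is_acted_comonoid M A R"
    unfolding is_acted_comonoid_def is_left_action_def
    using coc_iff[of R] arg_cong[OF T1, of rw] arg_cong[OF T2, of rw] arg_cong[OF T3, of rw] arg_cong[OF T4, of rw]
      rw_in_hom[of "?\<mu>" "?a \<boxtimes> ?q" ?q]
    by (simp add: rw_simps del: cmp_assoc)
  have creg: "coc (regular_acted_comonoid A)" "cm (regular_acted_comonoid A) R \<pi>"
  proof -
    have [simp]: "dl (regular_acted_comonoid A) = dl A" "ep (regular_acted_comonoid A) = ep A" "Car (regular_acted_comonoid A) = ?a"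
      by (simp_all add: regular_acted_comonoid_def dl_def ep_def)
    show "coc (regular_acted_comonoid A)"
      by (rule cocI) simp_all
    then show "cm (regular_acted_comonoid A) R \<pi>"
      using hmD(3)[OF p] by (simp add: cm_def)
  qed
  have Am: "rw \<pi> \<cdot> Mult A = Act R \<cdot> (Ident M ?a \<otimes> rw \<pi>)"
  proof -
    have "\<pi> \<bullet> ml A = ?\<mu> \<bullet> (idt ?a \<odot> \<pi>)"
      by (simp add: hmD(4)[OF p] tens_cmp)
    from arg_cong[OF this, of rw] show ?thesis by (simp add: rw_simps del: cmp_assoc)
  qed
  have pi: "rw \<pi> \<in> Hom (Comon_coc M A) (regular_acted_comonoid A) R"
    using comonoid_morphism_iff[of "regular_acted_comonoid A" R \<pi>] creg Am
    by (simp add: Comon_coc_def) (simp add: regular_acted_comonoid_def)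
  have epi: "is_epi M ?a (Car R) (rw \<pi>)"
    using ep is_epi_iff[of ?a ?q "rw \<pi>"] by (simp add: rw_in_hom)
  let ?L = "pair A \<pi> (idt ?a)"
  have lam: "(rw \<pi> \<otimes> Ident M ?a) \<cdot> Comult A = rw ?L"
    by (simp add: pair_def rw_simps)
  let ?W = "(?a, rw ?L)"
  let ?F = "cotensor_functor M ?q ?W"
  have refl: "reflects_epis (right_comodules M R) M ?F"
  proof -
    have "A \<in> Obj (Hopf_coc M)" "R \<in> Obj (Comon_coc M A)"
      using act by (simp_all add: Hopf_coc_Obj Comon_coc_def)
    from fc[unfolded faithful_coflatness_def Let_def, rule_format, OF this pi epi] show ?thesis
      by (simp add: lam)
  qed
  \<comment> \<open>The choice in \<open>cotensor\<close> is made by \<open>SOME\<close>; existence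
    of equalizers in \<open>M\<close> ensures that the chosen pair is one.\<close>
  have cot: "\<exists>e0. iseq e0 (asc U ?q ?a \<bullet> (r \<odot> idt ?a)) (idt U \<odot> ?L) \<and> cotensor M ?q ?W (U, rw r) = (src e0, rw e0)"
    if r: "rcm Q U r" for U r
  proof -
    note [simp] = rcmD(1-5)[OF r]
    let ?f = "asc U ?q ?a \<bullet> (r \<odot> idt ?a)" and ?g = "idt U \<odot> ?L"
    have h: "Assoc M U ?q ?a \<cdot> (rw r \<otimes> Ident M ?a) = rw ?f" "Ident M U \<otimes> rw ?L = rw ?g"
      by (simp_all add: rw_simps)
    let ?P = "\<lambda>(E, e). is_equalizer M E e (U \<boxtimes> ?a) (U \<boxtimes> (?q \<boxtimes> ?a)) (rw ?f) (rw ?g)"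
    have m: "rw ?f \<in> Hom M (U \<boxtimes> ?a) (U \<boxtimes> (?q \<boxtimes> ?a))" "rw ?g \<in> Hom M (U \<boxtimes> ?a) (U \<boxtimes> (?q \<boxtimes> ?a))"
      by (simp_all add: rw_in_hom)
    obtain e1 where e1: "iseq e1 ?f ?g" using ex_equalizer[of ?f ?g] by auto
    have "?P (src e1, rw e1)"
      using e1 iseqD(1,4)[OF e1] m is_equalizer_iff[of "src e1" "U \<boxtimes> ?a" "U \<boxtimes> (?q \<boxtimes> ?a)" "rw ?f" "rw ?g" "rw e1"]
      by (simp add: rw_in_hom)
    then have "?P (SOME x. ?P x)" by (rule someI)
    moreover obtain E e0 where x: "(SOME x. ?P x) = (E, e0)" by fastforce
    ultimately have P: "is_equalizer M E e0 (U \<boxtimes> ?a) (U \<boxtimes> (?q \<boxtimes> ?a)) (rw ?f) (rw ?g)" by simp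
    then have E: "E \<in> Obj M" "e0 \<in> Hom M E (U \<boxtimes> ?a)" by (auto simp: is_equalizer_def)
    have "cotensor M ?q ?W (U, rw r) = (E, e0)"
      unfolding cotensor_def using x by (simp add: h)
    moreover have "iseq (mk E (U \<boxtimes> ?a) e0) ?f ?g"
      using P E m is_equalizer_iff[of E "U \<boxtimes> ?a" "U \<boxtimes> (?q \<boxtimes> ?a)" "rw ?f" "rw ?g" e0] by simp
    ultimately show ?thesis using E by (intro exI[of _ "mk E (U \<boxtimes> ?a) e0"]) simp
  qed
  obtain k where k: "iseq k (asc V ?q ?a \<bullet> (\<rho> \<odot> idt ?a)) (idt V \<odot> ?L)" "cotensor M ?q ?W (V, rw \<rho>) = (src k, rw k)"
    using cot[OF V] by blast
  obtain k' where k': "iseq k' (asc V' ?q ?a \<bullet> (\<rho>' \<odot> idt ?a)) (idt V' \<odot> ?L)" "cotensor M ?q ?W (V', rw \<rho>') = (src k', rw k')"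
    using cot[OF V'] by blast
  note [simp] = iseqD(1)[OF k(1)] iseqD(1)[OF k'(1)] iseqD(1)[OF e] iseqD(1)[OF e']
    iseqD(4)[OF k(1), simplified] iseqD(4)[OF k'(1), simplified] iseqD(4)[OF e, simplified] iseqD(4)[OF e', simplified]
  obtain i where i: "arr i" "src i = src k" "trg i = src e" "e \<bullet> i = k"
    using iseqE[OF e, of k] iseqD(7)[OF k(1)] by auto
  obtain j where j: "arr j" "src j = src e" "trg j = src k" "k \<bullet> j = e"
    using iseqE[OF k(1), of e] iseqD(7)[OF e] by auto
  obtain j' where j': "arr j'" "src j' = src e'" "trg j' = src k'" "k' \<bullet> j' = e'"
    using iseqE[OF k'(1), of e'] iseqD(7)[OF e'] by auto
  obtain i' where i': "arr i'" "src i' = src k'" "trg i' = src e'" "e' \<bullet> i' = k'"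
    using iseqE[OF e', of k'] iseqD(7)[OF k'(1)] by auto
  have ij: "i \<bullet> j = idt (src e)"
    by (rule monicD[OF iseq_mono[OF e]]) (use i j i(4)[THEN reduce, of j] in simp_all)
  have ji': "j' \<bullet> i' = idt (src k')"
    by (rule monicD[OF iseq_mono[OF k'(1)]]) (use i' j' j'(4)[THEN reduce, of i'] in simp_all)
  have ge: "epic i" "epic j'"
    using epicI_section[of i j] ij i epicI_section[of j' i'] ji' j' by simp_all
  \<comment> \<open>The arrow \<open>g\<close> transported to the chosen equalizers; by uniqueness
    it is the value of the functor at \<open>f\<close>.\<close>
  let ?G = "j' \<bullet> g \<bullet> i"
  have G2: "epic ?G"
    by (rule epi_cmp[OF epi_cmp[OF ge(1) g(1)] ge(2)]) (use g i j' in simp_all)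
  note G = epi_arr[OF G2] G2
  have kG: "k' \<bullet> ?G = (f \<odot> idt ?a) \<bullet> k"
    using j'(4)[THEN reduce, of "g \<bullet> i"] g(4)[THEN reduce, of i] i by simp
  have eq: "(asc V' ?q ?a \<bullet> (\<rho>' \<odot> idt ?a)) \<bullet> (f \<odot> idt ?a) \<bullet> k = (idt V' \<odot> ?L) \<bullet> (f \<odot> idt ?a) \<bullet> k"
    using iseqD(7)[OF k'(1), THEN reduce, of ?G] kG by simp
  have "\<exists>!l. l \<in> Hom M (src k) (src k') \<and> rw k' \<cdot> l = rw ((f \<odot> idt ?a) \<bullet> k)"
    using ex1_through_equalizer[OF k'(1) _ _ eq] by simp
  moreover have "rw ?G \<in> Hom M (src k) (src k') \<and> rw k' \<cdot> rw ?G = rw ((f \<odot> idt ?a) \<bullet> k)"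
    using arg_cong[OF kG, of rw] rw_cmp[of ?G k'] G(1) i j' rw_in_hom[OF G(1), of "src k" "src k'"] by simp
  ultimately have the: "(THE l. l \<in> Hom M (src k) (src k') \<and> rw k' \<cdot> l = rw ((f \<odot> idt ?a) \<bullet> k)) = rw ?G"
    by (rule the1_equality)
  have "ArMap ?F (V, rw \<rho>) (V', rw \<rho>') (rw f) = rw ?G"
    using the k k' by (simp add: cotensor_functor_def rw_cmp rw_tens rw_str)
  moreover have "is_epi M (src k) (src k') (rw ?G)"
    using is_epi_iff[of "src k" "src k'" "rw ?G"] G i j' by (simp add: rw_in_hom)
  moreover have VR: "rcm R V \<rho>" "rcm R V' \<rho>'" using V V' by (simp_all add: rcm_def)
  ultimately have "is_epi (right_comodules M R) (V, rw \<rho>) (V', rw \<rho>') (rw f)"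
    using refl[unfolded reflects_epis_def, rule_format, OF rcm_Obj[OF VR(1)] rcm_Obj[OF VR(2)] rcm_Hom[OF VR f]] c k(2) k'(2)
    by (simp add: cotensor_functor_def)
  then show ?thesis using comodule_epi[OF VR f] c by simp
qed


section \<open>Pullbacks and kernel pairs\<close>

lemma monicI_retraction: "\<lbrakk>g \<bullet> f = idt (src f); arr f\<rbrakk> \<Longrightarrow> monic f"
  by (rule monicI) (auto intro: mono_cancel[of f _ _ g])

text \<open>The pair behind \<open>heq\<close> sends \<open>(x, y)\<close> to
  \<open>((x, y), f x)\<close> and \<open>((x, y), g y)\<close>, the pair behind the cotensor
  product sends it to \<open>(x, (f x, y))\<close> and \<open>(x, (g y, y))\<close>. They differ by
  the invertible \<open>?\<theta>\<close>, which moves the \<open>Q\<close>-component to the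
  middle.\<close>

lemma heq_cotensor:
  assumes E: "heq P e (prodh L A) Q (f \<bullet> p1 L A) (g \<bullet> p2 L A)" and f: "hm L Q f" and g: "hm A Q g"
  shows "iseq e (asc (Car L) (Car Q) (Car A) \<bullet> (pair L (idt (Car L)) f \<odot> idt (Car A)))
    (idt (Car L) \<odot> pair A g (idt (Car A)))"
proof -
  note [simp] = hmD(1,2,5-7)[OF f] hmD(1,5-7)[OF g]
  let ?T = "prodc L A" and ?p = "p1 L A" and ?q = "p2 L A"
  let ?l = "Car L" and ?a = "Car A" and ?c = "Car Q"
  let ?F = "pair ?T (idt (?l \<boxtimes> ?a)) (f \<bullet> ?p)" and ?G = "pair ?T (idt (?l \<boxtimes> ?a)) (g \<bullet> ?q)"
  let ?F' = "asc ?l ?c ?a \<bullet> (pair L (idt ?l) f \<odot> idt ?a)" and ?G' = "idt ?l \<odot> pair A g (idt ?a)"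
  let ?\<theta> = "(idt ?l \<odot> brd ?a ?c) \<bullet> asc ?l ?a ?c"
  have c: "cm ?T L ?p" "cm ?T A ?q" by simp_all
  have i: "idt (?l \<boxtimes> ?a) = pair ?T ?p ?q" by (simp add: pair_p1_p2)
  have F: "?\<theta> \<bullet> ?F = ?F'"
  proof -
    have "?\<theta> \<bullet> ?F = pair ?T ?p (pair ?T (f \<bullet> ?p) ?q)"
      unfolding i by (simp add: asc_pair tens_pair brd_pair)
    also have "\<dots> = ?F' \<bullet> pair ?T ?p ?q"
      by (simp add: tens_pair pair_cmp[OF c(1)] asc_pair)
    finally show ?thesis by (simp flip: i)
  qed
  have G: "?\<theta> \<bullet> ?G = ?G'"
  proof -
    have "?\<theta> \<bullet> ?G = pair ?T ?p (pair ?T (g \<bullet> ?q) ?q)"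
      unfolding i by (simp add: asc_pair tens_pair brd_pair)
    also have "\<dots> = ?G' \<bullet> pair ?T ?p ?q"
      by (simp add: tens_pair pair_cmp[OF c(2)])
    finally show ?thesis by (simp flip: i)
  qed
  have "monic ?\<theta>"
    by (rule monicI_retraction[of "asci ?l ?a ?c \<bullet> (idt ?l \<odot> brd ?c ?a)"]) (simp_all add: tens_cmp[THEN reduce])
  then have "?F \<bullet> h = ?G \<bullet> h \<longleftrightarrow> ?F' \<bullet> h = ?G' \<bullet> h" if "arr h" "trg h = ?l \<boxtimes> ?a" for h
    using that monicD[of ?\<theta> "?F \<bullet> h" "?G \<bullet> h"] F[THEN reduce, of h] G[THEN reduce, of h] by auto
  moreover have "iseq e ?F ?G" using heqD(4)[OF E] by (simp add: pair_prodh)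
  ultimately show ?thesis
    by (subst (asm) iseq_cong[of ?F ?G ?F' ?G']) simp_all
qed

lemma heq_projections:
  assumes E: "heq E e (prodh A B) C f g" and [simp]: "hopf A" "hopf B"
  shows "hm E A (p1 A B \<bullet> e)" "hm E B (p2 A B \<bullet> e)"
  by (rule hm_cmp[OF heqD(3)[OF E] hm_p1]; simp) (rule hm_cmp[OF heqD(3)[OF E] hm_p2]; simp)

text \<open>The projection from \<open>P\<close> to \<open>L\<close> is a morphism of
  \<open>Q\<close>-comodules. Cotensored with \<open>A\<close> it becomes an arrow \<open>g\<close>
  from the pullback of \<open>P\<close> and \<open>A\<close> over \<open>Q\<close> to the pullback
  of \<open>L\<close> and \<open>A\<close>, which is \<open>P\<close> itself. This arrow has a
  section, so coflatness applies.\<close>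

lemma pullback_epi:
  fixes A L Q P :: "('o, 'm) hopf_data"
  assumes fc: "faithful_coflatness M" and p: "hm A Q \<pi>" and ep: "epic \<pi>" and f: "hm L Q f"
    and E: "heq P e (prodh L A) Q (f \<bullet> p1 L A) (\<pi> \<bullet> p2 L A)"
  shows "epic (p1 L A \<bullet> e)"
proof -
  note [simp] = hmD(1,2,5-7)[OF f] hmD(1,5-7)[OF p] hmD(1,5-7)[OF heqD(3)[OF E]]
  let ?q = "p1 L A \<bullet> e" and ?r = "p2 L A \<bullet> e"
  let ?l = "Car L" and ?a = "Car A" and ?c = "Car Q"
  have hq: "hm P L ?q" and hr: "hm P A ?r"
    by (simp_all add: heq_projections[OF E])
  have fq: "f \<bullet> ?q = \<pi> \<bullet> ?r" using heqD(6)[OF E] by simp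
  have cfq: "cm P Q (f \<bullet> ?q)" by (rule cm_cmp[OF hmD(3)[OF hq] hmD(3)[OF f]])
  let ?\<rho> = "pair P (idt (Car P)) (f \<bullet> ?q)"
  have c: "(?q \<odot> idt ?c) \<bullet> ?\<rho> = pair L (idt ?l) f \<bullet> ?q"
    by (simp add: tens_pair pair_cmp[OF hmD(3)[OF hq]])
  note e' = heq_cotensor[OF E f p]
  let ?F = "asc (Car P) ?c ?a \<bullet> (?\<rho> \<odot> idt ?a)" and ?G = "idt (Car P) \<odot> pair A \<pi> (idt ?a)"
  obtain e2 where e2: "iseq e2 ?F ?G" using ex_equalizer[of ?F ?G] by auto
  note [simp] = iseqD(1)[OF e2] iseqD(4)[OF e2, simplified]
  have cP: "(?q \<odot> idt (?c \<boxtimes> ?a)) \<bullet> ?F = (asc ?l ?c ?a \<bullet> (pair L (idt ?l) f \<odot> idt ?a)) \<bullet> (?q \<odot> idt ?a)"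
  proof -
    have "(?q \<odot> idt (?c \<boxtimes> ?a)) \<bullet> ?F = asc ?l ?c ?a \<bullet> ((?q \<odot> idt ?c) \<odot> idt ?a) \<bullet> (?\<rho> \<odot> idt ?a)"
      using nat_asc_r[of ?q ?l ?c ?a, THEN reduce] by simp
    also have "\<dots> = asc ?l ?c ?a \<bullet> (((?q \<odot> idt ?c) \<bullet> ?\<rho>) \<odot> idt ?a)"
      by (simp add: tens_cmp)
    finally show ?thesis unfolding c by (simp add: tens_cmp)
  qed
  have "(asc ?l ?c ?a \<bullet> (pair L (idt ?l) f \<odot> idt ?a)) \<bullet> (?q \<odot> idt ?a) \<bullet> e2 = (?q \<odot> idt (?c \<boxtimes> ?a)) \<bullet> ?F \<bullet> e2"
    using cP[THEN reduce, of e2] by simp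
  also have "\<dots> = (?q \<odot> idt (?c \<boxtimes> ?a)) \<bullet> ?G \<bullet> e2"
    using iseqD(7)[OF e2] by simp
  also have "\<dots> = (idt ?l \<odot> pair A \<pi> (idt ?a)) \<bullet> (?q \<odot> idt ?a) \<bullet> e2"
    by (simp add: tens_cmp[THEN reduce])
  finally obtain g where g: "arr g" "src g = src e2" "trg g = src e" "e \<bullet> g = (?q \<odot> idt ?a) \<bullet> e2"
    using iseqE[OF e', of "(?q \<odot> idt ?a) \<bullet> e2"] by auto
  \<comment> \<open>The section is \<open>p \<mapsto> (p, ?r p)\<close>; it lands in the equalizer
    because \<open>f \<bullet> ?q = \<pi> \<bullet> ?r\<close>.\<close>
  have "?F \<bullet> pair P (idt (Car P)) ?r = ?G \<bullet> pair P (idt (Car P)) ?r"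
    using fq hmD(3)[OF hr]
    by (simp add: tens_pair asc_pair pair_cmp[OF hmD(3)[OF hr]])
  then obtain t where t: "arr t" "src t = Car P" "trg t = src e2" "e2 \<bullet> t = pair P (idt (Car P)) ?r"
    using iseqE[OF e2, of "pair P (idt (Car P)) ?r"] by auto
  have "e \<bullet> g \<bullet> t = (?q \<odot> idt ?a) \<bullet> pair P (idt (Car P)) ?r"
    using g(4)[THEN reduce, of t] t by simp
  also have "\<dots> = e \<bullet> idt (Car P)"
    using pair_eta[of P L A e] hmD(3)[OF heqD(3)[OF E]] by (simp add: tens_pair cm_prodh)
  finally have "g \<bullet> t = idt (Car P)"
    by (rule monicD[OF heqD(5)[OF E]]) (use g t in simp_all)
  then have "epic g" using epicI_section[of g t] g by simp
  note eg = this
  show ?thesis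
    by (rule coflat_reflect[OF fc p ep rcm_cm[OF cfq] rcm_cm[OF hmD(3)[OF f]], of ?q e2 e g]) (use c e2 e' g eg in simp_all)
qed

text \<open>The kernel \<open>N\<close> of \<open>u\<close> in \<open>M\<close> is a \<open>B\<close>-comodule. Its cotensor product with \<open>A\<close> embeds into the kernel
  pair of \<open>u\<close>, which is the diagonal, and vanishes there because the counit kills \<open>N\<close>. As the
  functor reflects the epimorphism from the zero object, \<open>N\<close> is zero.\<close>

lemma monic_if_cancels_hopf_morphisms:
  fixes A B :: "('o, 'm) hopf_data"
  assumes fc: "faithful_coflatness M" and u: "hm A B u" and eu: "epic u"
    and inj: "\<And>(X :: ('o, 'm) hopf_data) g h. \<lbrakk>hm X A g; hm X A h; u \<bullet> g = u \<bullet> h\<rbrakk> \<Longrightarrow> g = h"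
  shows "monic u"
proof -
  note [simp] = hmD(1,2,5-7)[OF u]
  let ?a = "Car A" and ?b = "Car B"
  have hu: "hm (prodh A A) B (u \<bullet> p1 A A)" "hm (prodh A A) B (u \<bullet> p2 A A)"
    using hm_cmp[OF hm_p1[of A A] u] hm_cmp[OF hm_p2[of A A] u] by simp_all
  obtain P e where E: "heq P e (prodh A A) B (u \<bullet> p1 A A) (u \<bullet> p2 A A)"
    using ex_heq[OF hu] by blast
  note [simp] = hmD(1,5-7)[OF heqD(3)[OF E]]
  let ?x = "p1 A A \<bullet> e"
  have hx: "hm P A ?x" "hm P A (p2 A A \<bullet> e)"
    by (simp_all add: heq_projections[OF E])
  have "?x = p2 A A \<bullet> e"
    using inj[OF hx] heqD(6)[OF E] by simp
  then have ex: "e = dl A \<bullet> ?x"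
    using pair_eta[of P A A e] hmD(3)[OF heqD(3)[OF E]] cm_dl[OF hmD(3)[OF hx(1)]] by (simp add: cm_prodh)
  let ?\<rho> = "pair A (idt ?a) u"
  note rA = rcm_cm[OF hmD(3)[OF u]]
  obtain n where n: "iskr n u" using ex_kernel[of u] by auto
  note [simp] = iskrD(1)[OF n] iskrD(3)[OF n, simplified]
  note mn = iseq_mono[OF n]
  have un: "u \<bullet> n = zr (src n) ?b" using iskrD(4)[OF n] by simp
  let ?n = "src n"
  \<comment> \<open>The coaction restricts to \<open>N\<close>: by exactness
    \<open>n \<odot> idt ?b\<close> is the kernel of \<open>u \<odot> idt ?b\<close>, and the
    composite \<open>(u \<odot> idt ?b) \<bullet> ?\<rho> = dl B \<bullet> u\<close> kills
    \<open>n\<close>.\<close>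
  have "(u \<odot> idt ?b) \<bullet> ?\<rho> \<bullet> n = (dl B \<bullet> u) \<bullet> n"
    unfolding cm_dl[OF hmD(3)[OF u]] by (simp add: tens_pair[THEN reduce])
  also have "\<dots> = zr ?n (?b \<boxtimes> ?b)" by (simp add: un)
  finally obtain r where r: "arr r" "src r = ?n" "trg r = ?n \<boxtimes> ?b" "(n \<odot> idt ?b) \<bullet> r = ?\<rho> \<bullet> n"
    using iseqE[OF iseq_tens_right[OF _ n, of ?b], of "?\<rho> \<bullet> n"] by (auto simp: zr_tens)
  note [simp] = r(1-3)
  have rN: "rcm B ?n r"
  proof -
    have "(n \<odot> idt (?b \<boxtimes> ?b)) \<bullet> asc ?n ?b ?b \<bullet> (r \<odot> idt ?b) \<bullet> r = asc ?a ?b ?b \<bullet> ((n \<odot> idt ?b) \<odot> idt ?b) \<bullet> (r \<odot> idt ?b) \<bullet> r"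
      using nat_asc_r[of n ?a ?b ?b, THEN reduce] by simp
    also have "\<dots> = asc ?a ?b ?b \<bullet> (((n \<odot> idt ?b) \<bullet> r) \<odot> idt ?b) \<bullet> r"
      by (simp add: tens_cmp[THEN reduce])
    also have "\<dots> = asc ?a ?b ?b \<bullet> (?\<rho> \<odot> idt ?b) \<bullet> (n \<odot> idt ?b) \<bullet> r"
      unfolding r(4) by (simp add: r(4)[symmetric] tens_cmp[THEN reduce])
    also have "\<dots> = (idt ?a \<odot> dl B) \<bullet> (n \<odot> idt ?b) \<bullet> r"
      using arg_cong[OF rcmD(6)[OF rA], of "\<lambda>f. f \<bullet> n"] by (simp add: r(4) del: coc_simps(6))
    also have "\<dots> = (n \<odot> idt (?b \<boxtimes> ?b)) \<bullet> (idt ?n \<odot> dl B) \<bullet> r"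
      by (simp add: tens_cmp[THEN reduce])
    finally have 1: "asc ?n ?b ?b \<bullet> (r \<odot> idt ?b) \<bullet> r = (idt ?n \<odot> dl B) \<bullet> r"
      by (rule monicD[OF mono_tens_right[OF _ mn], rotated]) simp_all
    have "n \<bullet> ru ?n \<bullet> (idt ?n \<odot> ep B) \<bullet> r = ru ?a \<bullet> (n \<odot> idt (Unit M)) \<bullet> (idt ?n \<odot> ep B) \<bullet> r"
      by (simp add: nat_ru[THEN reduce])
    also have "\<dots> = ru ?a \<bullet> (idt ?a \<odot> ep B) \<bullet> (n \<odot> idt ?b) \<bullet> r"
      by (simp add: tens_cmp[THEN reduce])
    also have "\<dots> = n \<bullet> idt ?n"
      using arg_cong[OF rcmD(7)[OF rA], of "\<lambda>f. f \<bullet> n"] by (simp add: r(4))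
    finally have 2: "ru ?n \<bullet> (idt ?n \<odot> ep B) \<bullet> r = idt ?n"
      by (rule monicD[OF mn]) simp_all
    show ?thesis using 1 2 by (simp add: rcm_def)
  qed
  let ?F = "asc ?n ?b ?a \<bullet> (r \<odot> idt ?a)" and ?G = "idt ?n \<odot> pair A u (idt ?a)"
  obtain k where k: "iseq k ?F ?G" using ex_equalizer[of ?F ?G] by auto
  note [simp] = iseqD(1)[OF k] iseqD(4)[OF k, simplified]
  have cN: "(n \<odot> idt (?b \<boxtimes> ?a)) \<bullet> ?F = (asc ?a ?b ?a \<bullet> (?\<rho> \<odot> idt ?a)) \<bullet> (n \<odot> idt ?a)"
  proof -
    have "(n \<odot> idt (?b \<boxtimes> ?a)) \<bullet> ?F = asc ?a ?b ?a \<bullet> ((n \<odot> idt ?b) \<odot> idt ?a) \<bullet> (r \<odot> idt ?a)"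
      using nat_asc_r[of n ?a ?b ?a, THEN reduce] by simp
    also have "\<dots> = asc ?a ?b ?a \<bullet> (((n \<odot> idt ?b) \<bullet> r) \<odot> idt ?a)"
      by (simp add: tens_cmp)
    finally show ?thesis unfolding r(4) by (simp add: tens_cmp)
  qed
  have "(asc ?a ?b ?a \<bullet> (?\<rho> \<odot> idt ?a)) \<bullet> (n \<odot> idt ?a) \<bullet> k = (n \<odot> idt (?b \<boxtimes> ?a)) \<bullet> ?F \<bullet> k"
    using cN[THEN reduce, of k] by simp
  also have "\<dots> = (n \<odot> idt (?b \<boxtimes> ?a)) \<bullet> ?G \<bullet> k"
    using iseqD(7)[OF k] by simp
  also have "\<dots> = (idt ?a \<odot> pair A u (idt ?a)) \<bullet> (n \<odot> idt ?a) \<bullet> k"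
    by (simp add: tens_cmp[THEN reduce])
  finally obtain l where l: "arr l" "src l = src k" "trg l = src e" "e \<bullet> l = (n \<odot> idt ?a) \<bullet> k"
    using iseqE[OF heq_cotensor[OF E u u], of "(n \<odot> idt ?a) \<bullet> k"] by auto
  have el: "e \<bullet> l = (dl A \<bullet> ?x) \<bullet> l"
    by (rule arg_cong[OF ex, of "\<lambda>f. f \<bullet> l"])
  have xl: "dl A \<bullet> ?x \<bullet> l = (n \<odot> idt ?a) \<bullet> k"
    unfolding l(4)[symmetric] el by (simp only: cmp_assoc)
  \<comment> \<open>Applying the counit to the first leg recovers \<open>?x \<bullet> l\<close>,
    while on the other description it produces
    \<open>ep A \<bullet> n = ep B \<bullet> u \<bullet> n\<close>, which is zero.\<close>
  have "?x \<bullet> l = lu ?a \<bullet> (ep A \<odot> idt ?a) \<bullet> dl A \<bullet> ?x \<bullet> l"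
    using arg_cong[OF coc_simps(5)[of A], of "\<lambda>f. f \<bullet> ?x \<bullet> l"] l by (simp del: coc_simps(5))
  also have "\<dots> = lu ?a \<bullet> (ep A \<odot> idt ?a) \<bullet> (n \<odot> idt ?a) \<bullet> k"
    by (simp only: xl)
  also have "\<dots> = lu ?a \<bullet> ((ep B \<bullet> u \<bullet> n) \<odot> idt ?a) \<bullet> k"
    using cmD(7)[OF hmD(3)[OF u], THEN reduce, of n] by (simp add: tens_cmp[THEN reduce])
  also have "\<dots> = zr (src k) ?a"
    by (simp add: un zr_tens)
  finally have "(n \<odot> idt ?a) \<bullet> k = (n \<odot> idt ?a) \<bullet> zr (src k) (?n \<boxtimes> ?a)"
    using xl by simp
  then have kz: "k = zr (src k) (?n \<boxtimes> ?a)"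
    by (rule monicD[OF mono_tens_right[OF _ mn], rotated]) simp_all
  have K0: "idt (src k) = zr (src k) (src k)"
    by (rule monicD[OF iseq_mono[OF k]]) (use kz in simp_all)
  obtain z where z: "is_zero_object M z" using zero_object by (auto simp: pointed_def)
  have [simp]: "z \<in> Obj M" using z by (simp add: is_zero_object_def is_terminal_def)
  have zz: "f = zr (src f) (trg f)" if "arr f" "src f = z" for f
    using zero_hom_zr[OF z] that by blast
  have rz: "rcm B z (zr z (z \<boxtimes> ?b))"
    using zz[of "asc z ?b ?b \<bullet> (zr z (z \<boxtimes> ?b) \<odot> idt ?b) \<bullet> zr z (z \<boxtimes> ?b)"] zz[of "idt z"] by (simp add: rcm_def)
  let ?F0 = "asc z ?b ?a \<bullet> (zr z (z \<boxtimes> ?b) \<odot> idt ?a)" and ?G0 = "idt z \<odot> pair A u (idt ?a)"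
  obtain k0 where k0: "iseq k0 ?F0 ?G0" using ex_equalizer[of ?F0 ?G0] by auto
  note [simp] = iseqD(1)[OF k0] iseqD(4)[OF k0, simplified]
  \<comment> \<open>Every arrow out of \<open>src k\<close> is zero by \<open>K0\<close>, so the map
    induced on cotensor products by the zero arrow from \<open>z\<close> to \<open>?n\<close> is an
    epimorphism.\<close>
  have eg: "epic (zr (src k0) (src k))"
  proof (rule epicI)
    fix g h assume *: "arr g" "arr h" "trg g = trg h" "src g = trg (zr (src k0) (src k))" "src h = trg (zr (src k0) (src k))"
    have "f = zr (src k) (trg f)" if "arr f" "src f = src k" for f
      using arg_cong[OF K0, of "\<lambda>x. f \<bullet> x"] that by simp
    from this[of g] this[of h] * show "g = h" by simp
  qed simp
  have "epic (zr z ?n)"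
    by (rule coflat_reflect[OF fc u eu rz rN, of _ k0 k "zr (src k0) (src k)"]) (use k0 k eg in \<open>simp_all add: zr_tens\<close>)
  then have idz: "idt ?n = zr ?n ?n"
    by (rule epicD) simp_all
  have "n = n \<bullet> idt ?n" by simp
  also have "\<dots> = n \<bullet> zr ?n ?n" by (simp only: idz)
  finally have nz: "n = zr ?n ?a" by simp
  show ?thesis
  proof (rule monoI_zero)
    fix h assume h: "arr h" "trg h = src u" "u \<bullet> h = zr (src h) (trg u)"
    obtain h' where h': "arr h'" "src h' = src h" "trg h' = src n" "n \<bullet> h' = h"
      using iskrE[OF n h] .
    then show "h = zr (src h) (src u)"
      using arg_cong[OF nz, of "\<lambda>x. x \<bullet> h'"] by simp
  qed simp
qed

text \<open>Reduced to an epimorphism by the image factorization: cancellation for \<open>f\<close>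
  gives cancellation for its epimorphic part \<open>e\<close>.\<close>

lemma monic_if_left_cancellable:
  fixes A B :: "('o, 'm) hopf_data"
  assumes fc: "faithful_coflatness M" and f: "hm A B f"
    and inj: "\<And>(X :: ('o, 'm) hopf_data) g h. \<lbrakk>hm X A g; hm X A h; f \<bullet> g = f \<bullet> h\<rbrakk> \<Longrightarrow> g = h"
  shows "monic f"
proof -
  obtain I :: "('o, 'm) hopf_data" and e m where I: "hm A I e" "hm I B m" "epic e" "monic m" and f': "f = m \<bullet> e"
    using hm_image[OF f] .
  have "monic e"
    by (rule monic_if_cancels_hopf_morphisms[OF fc I(1,3)]) (use inj f' in auto)
  then show ?thesis unfolding f' using mono_cmp[OF _ I(4)] hmD[OF I(1)] hmD[OF I(2)] by simp
qed

text \<open>If \<open>f = u \<bullet> q\<close> with \<open>q\<close> the coequalizer of the kernel pair, then an element of the kernel of \<open>u\<close> lifts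
  along \<open>q\<close>, after a pullback that is again an epimorphism, to the kernel of \<open>f\<close>, which \<open>q\<close> kills.\<close>

lemma epic_coequalizer_of_kernel_pair:
  fixes A B P :: "('o, 'm) hopf_data"
  assumes fc: "faithful_coflatness M" and f: "hm A B f" and ef: "epic f"
    and E: "heq P e (prodh A A) B (f \<bullet> p1 A A) (f \<bullet> p2 A A)"
  shows "iscoeq f (p1 A A \<bullet> e) (p2 A A \<bullet> e)"
proof -
  note [simp] = hmD(1,2,5-7)[OF f] hmD(1,5-7)[OF heqD(3)[OF E]]
  let ?r = "p1 A A \<bullet> e" and ?s = "p2 A A \<bullet> e"
  let ?a = "Car A"
  have hrs: "hm P A ?r" "hm P A ?s"
    by (simp_all add: heq_projections[OF E])
  have i: "cm A A (idt ?a)" by (simp add: cm_idt)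
  \<comment> \<open>The diagonal is a common section of the two projections, so the coequalizer in
    \<open>M\<close> is again a Hopf monoid.\<close>
  obtain d where d: "cm A P d" "?r \<bullet> d = idt ?a" "?s \<bullet> d = idt ?a"
    using heq_pullback[OF E i i] by auto
  have hd: "hm A P d"
  proof (rule hm_factor_mono[OF heqD(3)[OF E] heqD(5)[OF E]])
    have "e \<bullet> d = pair A (idt ?a) (idt ?a)"
      using pair_eta[of A A A "e \<bullet> d"] cm_cmp[OF d(1) hmD(3)[OF heqD(3)[OF E]]] d(2,3) by (simp add: cm_prodh)
    then show "hm A (prodh A A) (e \<bullet> d)" using hm_pair[OF hm_idt hm_idt, of A] by simp
  qed (use cmD[OF d(1)] in simp_all)
  obtain Q :: "('o, 'm) hopf_data" and q where q: "hm A Q q" "iscoeq q ?r ?s"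
    using reflexive_coequalizer[OF hrs hd d(2,3)] .
  note [simp] = hmD(2,5-7)[OF q(1)]
  note eq = iscoeq_epi[OF q(2)]
  have frs: "f \<bullet> ?r = f \<bullet> ?s" using heqD(6)[OF E] by simp
  then obtain u where u: "arr u" "trg u = Car B" "src u = Car Q" "u \<bullet> q = f"
    using iscoeqE[OF q(2), of f] by auto
  note [simp] = u(1-3)
  have hu: "hm Q B u" by (rule hm_factor_epi[OF q(1) eq]) (use f u in simp_all)
  have eu: "epic u" using epi_cancel_right[of u q] ef u by simp
  obtain L l where L: "heq L l Q B u (e1 Q B)" using ex_heq[OF hu hm_e1_zero[of Q B]] by auto
  note hl = heqD(3)[OF L]
  note [simp] = hmD(1,5-7)[OF hl]
  obtain R k where R: "heq R k (prodh L A) Q (l \<bullet> p1 L A) (q \<bullet> p2 L A)"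
    using ex_heq[OF hm_cmp[OF hm_p1[of L A] hl] hm_cmp[OF hm_p2[of L A] q(1)]] by auto
  note [simp] = hmD(1,5-7)[OF heqD(3)[OF R]]
  let ?x = "p1 L A \<bullet> k" and ?y = "p2 L A \<bullet> k"
  have hxy: "hm R L ?x" "hm R A ?y"
    by (simp_all add: heq_projections[OF R])
  have exx: "epic ?x" by (rule pullback_epi[OF fc q(1) eq hl R])
  have lx: "l \<bullet> ?x = q \<bullet> ?y" using heqD(6)[OF R] by simp
  have "f \<bullet> ?y = u \<bullet> l \<bullet> ?x" using u(4)[THEN reduce, of ?y] lx by simp
  also have "\<dots> = e1 R B"
    using heqD(6)[OF L, THEN reduce, of ?x] e1_cmp[OF hmD(3)[OF hl], of B] e1_cmp[OF hmD(3)[OF hxy(1)], of B] by simp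
  also have "\<dots> = f \<bullet> e1 R A" using hm_e1[OF f, of R] by simp
  finally obtain c where c: "cm R P c" "?r \<bullet> c = ?y" "?s \<bullet> c = e1 R A"
    using heq_pullback[OF E hmD(3)[OF hxy(2)] cm_e1[of A R]] by auto
  have "q \<bullet> ?y = q \<bullet> e1 R A"
    using iscoeqD(7)[OF q(2), THEN reduce, of c] c by simp
  then have "l \<bullet> ?x = e1 L Q \<bullet> ?x"
    using lx hm_e1[OF q(1), of R] e1_cmp[OF hmD(3)[OF hxy(1)], of Q] by simp
  then have l0: "l = e1 L Q"
    by (rule epicD[OF exx]) simp_all
  have mu: "monic u"
  proof (rule monic_if_cancels_hopf_morphisms[OF fc hu eu])
    fix X :: "('o, 'm) hopf_data" and g h
    assume g: "hm X Q g" and h: "hm X Q h" and gh: "u \<bullet> g = u \<bullet> h"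
    note [simp] = hmD(1,5-7)[OF g] hmD(5-7)[OF h]
    have ch: "cm X Q (an Q \<bullet> h)" by (rule cm_cmp[OF hmD(3)[OF h] cm_an]) simp
    \<comment> \<open>In elements \<open>g h^{-1}\<close>; it lies in the kernel \<open>L\<close> of
      \<open>u\<close>, which is trivial by \<open>l0\<close>.\<close>
    let ?w = "mu X Q g (an Q \<bullet> h)"
    have cw: "cm X Q ?w" by (rule cm_mu[OF _ hmD(3)[OF g] ch]) simp
    have "u \<bullet> ?w = mu X B (u \<bullet> h) (an B \<bullet> u \<bullet> h)"
      using hm_an[OF hu, THEN reduce, of h] by (simp add: hm_mu[OF hu] gh)
    also have "\<dots> = e1 X B"
      using mu_inv(2)[OF _ cm_cmp[OF hmD(3)[OF h] hmD(3)[OF hu]]] by simp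
    also have "\<dots> = e1 Q B \<bullet> ?w" using e1_cmp[OF cw, of B] by simp
    finally obtain w' where w': "cm X L w'" "l \<bullet> w' = ?w" using heq_factor[OF L cw] by metis
    then have "?w = e1 X Q" using l0 e1_cmp[OF w'(1), of Q] by simp
    then show "g = h" by (rule mu_an_eq_e1[OF _ hmD(3)[OF g] hmD(3)[OF h], rotated]) simp
  qed
  \<comment> \<open>Now \<open>u\<close> is an isomorphism, so \<open>f\<close> inherits the
    universal property of \<open>q\<close>.\<close>
  obtain v where v: "arr v" "src v = Car B" "trg v = Car Q" "v \<bullet> u = idt (Car Q)" "u \<bullet> v = idt (Car B)"
    using mono_epi_iso[OF mu eu] by auto
  show ?thesis
  proof (rule iscoeqI[OF ef])
    fix h assume h: "arr h" "src h = trg ?r" "h \<bullet> ?r = h \<bullet> ?s"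
    then obtain h' where h': "arr h'" "trg h' = trg h" "src h' = Car Q" "h' \<bullet> q = h"
      using iscoeqE[OF q(2), of h] by auto
    have "(h' \<bullet> v) \<bullet> f = h' \<bullet> (v \<bullet> u) \<bullet> q" using u(4) by simp
    also have "\<dots> = h" using v h' by simp
    finally show "\<exists>h'. arr h' \<and> trg h' = trg h \<and> src h' = trg f \<and> h' \<bullet> f = h"
      using v h' by (intro exI[of _ "h' \<bullet> v"]) simp
  qed (use frs in simp_all)
qed


section \<open>Flatness\<close>

definition rmd :: "('o, 'm) hopf_data \<Rightarrow> 'o \<Rightarrow> ('o, 'm) arrow \<Rightarrow> bool" where
  "rmd K V \<nu> \<longleftrightarrow> hopf K \<and> V \<in> Obj M \<and> arr \<nu> \<and> src \<nu> = V \<boxtimes> Car K \<and> trg \<nu> = V \<and>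
     \<nu> \<bullet> (\<nu> \<odot> idt (Car K)) = \<nu> \<bullet> (idt V \<odot> ml K) \<bullet> asc V (Car K) (Car K) \<and> \<nu> \<bullet> (idt V \<odot> un K) = ru V"

lemma rmdD: assumes "rmd K V \<nu>"
  shows "hopf K" "V \<in> Obj M" "arr \<nu>" "src \<nu> = V \<boxtimes> Car K" "trg \<nu> = V"
    "\<nu> \<bullet> (\<nu> \<odot> idt (Car K)) = \<nu> \<bullet> (idt V \<odot> ml K) \<bullet> asc V (Car K) (Car K)" "\<nu> \<bullet> (idt V \<odot> un K) = ru V"
  using assms by (simp_all add: rmd_def)

lemma rmd_Obj: assumes "rmd K V \<nu>" shows "(V, rw \<nu>) \<in> Obj (right_modules M (Car K) (Mult K) (One K))"
proof -
  note [simp] = rmdD(1-5)[OF assms]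
  have "rw \<nu> \<cdot> (rw \<nu> \<otimes> Ident M (Car K)) = rw (\<nu> \<bullet> (\<nu> \<odot> idt (Car K)))"
    by (simp add: rw_simps)
  also have "\<dots> = rw ((\<nu> \<bullet> (idt V \<odot> ml K)) \<bullet> asc V (Car K) (Car K))"
    unfolding rmdD(6)[OF assms] by simp
  also have "\<dots> = rw \<nu> \<cdot> (Ident M V \<otimes> Mult K) \<cdot> Assoc M V (Car K) (Car K)"
    by (simp add: rw_simps del: cmp_assoc)
  finally have 1: "rw \<nu> \<cdot> (rw \<nu> \<otimes> Ident M (Car K)) = rw \<nu> \<cdot> (Ident M V \<otimes> Mult K) \<cdot> Assoc M V (Car K) (Car K)" .
  have 2: "rw \<nu> \<cdot> (Ident M V \<otimes> One K) = RUnit M V"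
    using arg_cong[OF rmdD(7)[OF assms], of rw] by (simp add: rw_simps)
  show ?thesis using 1 2 by (simp add: right_modules_def rw_in_hom)
qed

lemma rmd_Hom:
  assumes V: "rmd K V \<nu>" and V': "rmd K V' \<nu>'" and f [simp]: "arr f" "src f = V" "trg f = V'"
    and c: "f \<bullet> \<nu> = \<nu>' \<bullet> (f \<odot> idt (Car K))"
  shows "rw f \<in> Hom (right_modules M (Car K) (Mult K) (One K)) (V, rw \<nu>) (V', rw \<nu>')"
proof -
  note [simp] = rmdD(1-5)[OF V] rmdD(1-5)[OF V']
  have "rw f \<cdot> rw \<nu> = rw \<nu>' \<cdot> (rw f \<otimes> Ident M (Car K))"
    using arg_cong[OF c, of rw] by (simp add: rw_simps)
  then show ?thesis by (simp add: right_modules_def rw_in_hom)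
qed

lemma rmd_hm: assumes j: "hm K A j" shows "rmd K (Car A) (ml A \<bullet> (idt (Car A) \<odot> j))"
proof -
  note [simp] = hmD(1,2,5-7)[OF j]
  let ?a = "Car A" and ?k = "Car K"
  let ?\<nu> = "ml A \<bullet> (idt ?a \<odot> j)"
  have "?\<nu> \<bullet> (?\<nu> \<odot> idt ?k) = ml A \<bullet> (ml A \<odot> idt ?a) \<bullet> ((idt ?a \<odot> j) \<odot> j)"
    by (simp add: tens_cmp)
  also have "\<dots> = ml A \<bullet> (idt ?a \<odot> ml A) \<bullet> (idt ?a \<odot> (j \<odot> j)) \<bullet> asc ?a ?k ?k"
    using hopfD(7)[of A, THEN reduce] by (simp add: nat_asc)
  also have "\<dots> = ?\<nu> \<bullet> (idt ?a \<odot> ml K) \<bullet> asc ?a ?k ?k"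
    using hmD(4)[OF j] by (simp add: tens_cmp[THEN reduce])
  finally have 1: "?\<nu> \<bullet> (?\<nu> \<odot> idt ?k) = ?\<nu> \<bullet> (idt ?a \<odot> ml K) \<bullet> asc ?a ?k ?k" .
  have "?\<nu> \<bullet> (idt ?a \<odot> un K) = ru ?a"
    by (simp add: tens_cmp hm_un[OF j] hopfD(9))
  then show ?thesis using 1 by (simp add: rmd_def)
qed

lemma rmd_quotient:
  assumes V: "rmd K V \<nu>" and e: "epic c" and c [simp]: "src c = V" "trg c = C"
    and n [simp]: "arr \<nu>'" "src \<nu>' = C \<boxtimes> Car K" "trg \<nu>' = C" and cn: "\<nu>' \<bullet> (c \<odot> idt (Car K)) = c \<bullet> \<nu>"
  shows "rmd K C \<nu>'"
proof -
  note [simp] = rmdD(1-5)[OF V] epi_arr[OF e]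
  let ?k = "Car K"
  have [simp]: "C \<in> Obj M" using arr_obj(2)[of c] by simp
  have "(\<nu>' \<bullet> (\<nu>' \<odot> idt ?k)) \<bullet> ((c \<odot> idt ?k) \<odot> idt ?k) = \<nu>' \<bullet> (c \<odot> idt ?k) \<bullet> (\<nu> \<odot> idt ?k)"
    by (simp add: tens_cmp cn)
  also have "\<dots> = c \<bullet> \<nu> \<bullet> (idt V \<odot> ml K) \<bullet> asc V ?k ?k"
    using cn[THEN reduce, of "\<nu> \<odot> idt ?k"] rmdD(6)[OF V] by simp
  also have "\<dots> = \<nu>' \<bullet> (idt C \<odot> ml K) \<bullet> (c \<odot> idt (?k \<boxtimes> ?k)) \<bullet> asc V ?k ?k"
    using cn[THEN reduce, of "(idt V \<odot> ml K) \<bullet> asc V ?k ?k"] by (simp add: tens_cmp[THEN reduce])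
  also have "\<dots> = (\<nu>' \<bullet> (idt C \<odot> ml K) \<bullet> asc C ?k ?k) \<bullet> ((c \<odot> idt ?k) \<odot> idt ?k)"
    by (simp add: nat_asc_r)
  finally have 1: "\<nu>' \<bullet> (\<nu>' \<odot> idt ?k) = \<nu>' \<bullet> (idt C \<odot> ml K) \<bullet> asc C ?k ?k"
    by (rule epicD[OF epi_tens_right[OF _ epi_tens_right[OF _ e]], rotated 2]) simp_all
  have "(\<nu>' \<bullet> (idt C \<odot> un K)) \<bullet> (c \<odot> idt (Unit M)) = \<nu>' \<bullet> (c \<odot> idt ?k) \<bullet> (idt V \<odot> un K)"
    by (simp add: tens_cmp)
  also have "\<dots> = ru C \<bullet> (c \<odot> idt (Unit M))"
    using cn[THEN reduce, of "idt V \<odot> un K"] rmdD(7)[OF V] by (simp add: nat_ru)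
  finally have 2: "\<nu>' \<bullet> (idt C \<odot> un K) = ru C"
    by (rule epicD[OF epi_tens_right[OF _ e], rotated]) simp_all
  show ?thesis using 1 2 by (simp add: rmd_def)
qed

definition btp :: "('o, 'm) hopf_data \<Rightarrow> ('o, 'm) hopf_data \<Rightarrow> ('o, 'm) arrow \<Rightarrow> 'o \<Rightarrow> ('o, 'm) arrow \<Rightarrow> ('o, 'm) arrow \<Rightarrow> bool" where
  "btp K A i V \<nu> t \<longleftrightarrow> iscoeq t (\<nu> \<odot> idt (Car A)) ((idt V \<odot> (ml A \<bullet> (i \<odot> idt (Car A)))) \<bullet> asc V (Car K) (Car A))"

lemma btpD: assumes "btp K A i V \<nu> t" "rmd K V \<nu>" "hm K A i"
  shows "arr t" "src t = V \<boxtimes> Car A" "epic t"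
    "t \<bullet> (\<nu> \<odot> idt (Car A)) = t \<bullet> (idt V \<odot> (ml A \<bullet> (i \<odot> idt (Car A)))) \<bullet> asc V (Car K) (Car A)"
  using iscoeqD[OF assms(1)[unfolded btp_def]] iscoeq_epi[OF assms(1)[unfolded btp_def]] rmdD[OF assms(2)] by simp_all

lemma btp_map:
  assumes i: "hm K A i" and V: "rmd K V \<nu>" and V': "rmd K V' \<nu>'" and f [simp]: "arr f" "src f = V" "trg f = V'"
    and c: "f \<bullet> \<nu> = \<nu>' \<bullet> (f \<odot> idt (Car K))" and t: "btp K A i V \<nu> t" and t': "btp K A i V' \<nu>' t'"
  obtains g where "arr g" "src g = trg t" "trg g = trg t'" "g \<bullet> t = t' \<bullet> (f \<odot> idt (Car A))"
proof -
  note [simp] = hmD(1,2,5-7)[OF i] rmdD(2-5)[OF V] rmdD(2-5)[OF V'] btpD(1,2)[OF t V i] btpD(1,2)[OF t' V' i]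
  let ?a = "Car A" and ?k = "Car K" let ?l = "ml A \<bullet> (i \<odot> idt ?a)"
  have "(t' \<bullet> (f \<odot> idt ?a)) \<bullet> (\<nu> \<odot> idt ?a) = t' \<bullet> (\<nu>' \<odot> idt ?a) \<bullet> ((f \<odot> idt ?k) \<odot> idt ?a)"
    by (simp add: tens_cmp c)
  also have "\<dots> = t' \<bullet> (idt V' \<odot> ?l) \<bullet> (asc V' ?k ?a \<bullet> ((f \<odot> idt ?k) \<odot> idt ?a))"
    using btpD(4)[OF t' V' i, THEN reduce] by simp
  also have "\<dots> = (t' \<bullet> (f \<odot> idt ?a)) \<bullet> ((idt V \<odot> ?l) \<bullet> asc V ?k ?a)"
    by (simp add: nat_asc_r tens_cmp[THEN reduce])
  finally show ?thesis
    using iscoeqE[OF t[unfolded btp_def], of "t' \<bullet> (f \<odot> idt ?a)"] that by auto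
qed

lemma ex_btp: assumes "hm K A i" "rmd K V \<nu>" shows "\<exists>t. btp K A i V \<nu> t"
  unfolding btp_def by (rule ex_coequalizer) (use hmD[OF assms(1)] rmdD[OF assms(2)] in simp_all)

lemma ex1_through_coequalizer:
  assumes e: "iscoeq e f g" and h: "arr h" "src h = trg f" "h \<bullet> f = h \<bullet> g"
  shows "\<exists>!k. k \<in> Hom M (trg e) (trg h) \<and> k \<cdot> rw e = rw h"
proof -
  note d = iscoeqD[OF e]
  obtain k where k: "arr k" "trg k = trg h" "src k = trg e" "k \<bullet> e = h" using iscoeqE[OF e h] .
  show ?thesis
  proof (rule ex1I[of _ "rw k"])
    show "rw k \<in> Hom M (trg e) (trg h) \<and> rw k \<cdot> rw e = rw h"
      using k d(1,4) rw_cmp[of e k] by (simp add: rw_in_hom)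
    fix l assume l: "l \<in> Hom M (trg e) (trg h) \<and> l \<cdot> rw e = rw h"
    have "rw (mk (trg e) (trg h) l \<bullet> e) = rw h"
      using l d h by (simp add: rw_cmp)
    then have "mk (trg e) (trg h) l \<bullet> e = h"
      using l d h by (subst (asm) rw_inject) simp_all
    then have "mk (trg e) (trg h) l \<bullet> e = k \<bullet> e" using k(4) by simp
    then have "mk (trg e) (trg h) l = k"
      by (rule epicD[OF iscoeq_epi[OF e]]) (use l k d h in simp_all)
    from arg_cong[OF this, of rw] show "l = rw k"
      using l arr_obj(2)[OF h(1)] arr_obj(2)[OF d(1)] by simp
  qed
qed

text \<open>Resolves the choice of coequalizers and the definite description in
  \<open>balanced_tensor_functor\<close>: the functor is described by presentations
  \<open>t\<close>, \<open>t'\<close> and the induced arrow \<open>g\<close>.\<close>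

lemma balanced_tensor_functor_eq:
  assumes i: "hm K A i" and V: "rmd K V \<nu>" and V': "rmd K V' \<nu>'" and f [simp]: "arr f" "src f = V" "trg f = V'"
    and c: "f \<bullet> \<nu> = \<nu>' \<bullet> (f \<odot> idt (Car K))"
  obtains t t' g where "btp K A i V \<nu> t" "btp K A i V' \<nu>' t'" "arr g" "src g = trg t" "trg g = trg t'"
    "g \<bullet> t = t' \<bullet> (f \<odot> idt (Car A))"
    "ObMap (balanced_tensor_functor M (Car K) (Car A, Mult A \<cdot> (rw i \<otimes> Ident M (Car A)))) (V, rw \<nu>) = trg t"
    "ObMap (balanced_tensor_functor M (Car K) (Car A, Mult A \<cdot> (rw i \<otimes> Ident M (Car A)))) (V', rw \<nu>') = trg t'"
    "ArMap (balanced_tensor_functor M (Car K) (Car A, Mult A \<cdot> (rw i \<otimes> Ident M (Car A)))) (V, rw \<nu>) (V', rw \<nu>') (rw f) = rw g"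
proof -
  note [simp] = hmD(1,2,5-7)[OF i] rmdD(2-5)[OF V] rmdD(2-5)[OF V']
  let ?a = "Car A" and ?k = "Car K" let ?l = "ml A \<bullet> (i \<odot> idt ?a)"
  let ?W = "(?a, Mult A \<cdot> (rw i \<otimes> Ident M ?a))"
  have lr: "Mult A \<cdot> (rw i \<otimes> Ident M ?a) = rw ?l"
    by (simp add: rw_simps)
  have bal: "\<exists>t. btp K A i U r t \<and> balanced_tensor M ?k ?W (U, rw r) = (trg t, rw t)"
    if r: "rmd K U r" for U r
  proof -
    note [simp] = rmdD(1-5)[OF r]
    let ?f = "r \<odot> idt ?a" and ?g = "(idt U \<odot> ?l) \<bullet> asc U ?k ?a"
    have h: "rw r \<otimes> Ident M ?a = rw ?f" "(Ident M U \<otimes> rw ?l) \<cdot> Assoc M U ?k ?a = rw ?g"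
      by (simp_all add: rw_simps)
    let ?P = "\<lambda>(E, e). is_coequalizer M E e ((U \<boxtimes> ?k) \<boxtimes> ?a) (U \<boxtimes> ?a) (rw ?f) (rw ?g)"
    have m: "rw ?f \<in> Hom M ((U \<boxtimes> ?k) \<boxtimes> ?a) (U \<boxtimes> ?a)" "rw ?g \<in> Hom M ((U \<boxtimes> ?k) \<boxtimes> ?a) (U \<boxtimes> ?a)"
      by (simp_all add: rw_in_hom)
    obtain e1 where e1: "iscoeq e1 ?f ?g" using ex_coequalizer[of ?f ?g] by auto
    have "?P (trg e1, rw e1)"
      using e1 iscoeqD(1,4)[OF e1] m is_coequalizer_iff[of "trg e1" "(U \<boxtimes> ?k) \<boxtimes> ?a" "U \<boxtimes> ?a" "rw ?f" "rw ?g" "rw e1"]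
      by (simp add: rw_in_hom)
    then have "?P (SOME x. ?P x)" by (rule someI)
    moreover obtain E e0 where x: "(SOME x. ?P x) = (E, e0)" by fastforce
    ultimately have P: "is_coequalizer M E e0 ((U \<boxtimes> ?k) \<boxtimes> ?a) (U \<boxtimes> ?a) (rw ?f) (rw ?g)" by simp
    then have E: "E \<in> Obj M" "e0 \<in> Hom M (U \<boxtimes> ?a) E" by (auto simp: is_coequalizer_def)
    have "balanced_tensor M ?k ?W (U, rw r) = (E, e0)"
      unfolding balanced_tensor_def using x by (simp only: lr h prod.case)
    moreover have "iscoeq (mk (U \<boxtimes> ?a) E e0) ?f ?g"
      using P E m is_coequalizer_iff[of E "(U \<boxtimes> ?k) \<boxtimes> ?a" "U \<boxtimes> ?a" "rw ?f" "rw ?g" e0] by simp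
    ultimately show ?thesis using E unfolding btp_def by (intro exI[of _ "mk (U \<boxtimes> ?a) E e0"]) simp
  qed
  obtain t where t: "btp K A i V \<nu> t" "balanced_tensor M ?k ?W (V, rw \<nu>) = (trg t, rw t)"
    using bal[OF V] by blast
  obtain t' where t': "btp K A i V' \<nu>' t'" "balanced_tensor M ?k ?W (V', rw \<nu>') = (trg t', rw t')"
    using bal[OF V'] by blast
  obtain g where g: "arr g" "src g = trg t" "trg g = trg t'" "g \<bullet> t = t' \<bullet> (f \<odot> idt ?a)"
    using btp_map[OF i V V' f c t(1) t'(1)] .
  note [simp] = btpD(1,2)[OF t(1) V i] btpD(1,2)[OF t'(1) V' i] g(1-3)
  let ?h = "t' \<bullet> (f \<odot> idt ?a)"
  have "?h \<bullet> (\<nu> \<odot> idt ?a) = ?h \<bullet> ((idt V \<odot> ?l) \<bullet> asc V ?k ?a)"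
    unfolding g(4)[symmetric] using btpD(4)[OF t(1) V i] by simp
  then have "\<exists>!k. k \<in> Hom M (trg t) (trg t') \<and> k \<cdot> rw t = rw ?h"
    using ex1_through_coequalizer[OF t(1)[unfolded btp_def], of ?h] by simp
  moreover have "rw g \<in> Hom M (trg t) (trg t') \<and> rw g \<cdot> rw t = rw ?h"
    using arg_cong[OF g(4), of rw] rw_cmp[of t g] by (simp add: rw_in_hom)
  ultimately have the: "(THE k. k \<in> Hom M (trg t) (trg t') \<and> k \<cdot> rw t = rw ?h) = rw g"
    by (rule the1_equality)
  have "ArMap (balanced_tensor_functor M ?k ?W) (V, rw \<nu>) (V', rw \<nu>') (rw f) = rw g"
    using the t(2) t'(2) by (simp add: balanced_tensor_functor_def rw_cmp rw_tens rw_str)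
  moreover have "ObMap (balanced_tensor_functor M ?k ?W) (V, rw \<nu>) = trg t" "ObMap (balanced_tensor_functor M ?k ?W) (V', rw \<nu>') = trg t'"
    using t(2) t'(2) by (simp_all add: balanced_tensor_functor_def)
  ultimately show ?thesis using that t(1) t'(1) g by blast
qed

lemma flatness:
  fixes A K :: "('o, 'm) hopf_data"
  assumes ff: "faithful_flatness M" and i: "hm K A i" and mi: "monic i"
  shows "preserves_monos (right_modules M (Car K) (Mult K) (One K)) M
      (balanced_tensor_functor M (Car K) (Car A, Mult A \<cdot> (rw i \<otimes> Ident M (Car A))))"
    and "reflects_monos (right_modules M (Car K) (Mult K) (One K)) M
      (balanced_tensor_functor M (Car K) (Car A, Mult A \<cdot> (rw i \<otimes> Ident M (Car A))))"
proof -
  note [simp] = hmD(1,2,5-7)[OF i]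
  have "A \<in> Obj (Hopf_coc M)" "K \<in> Obj (Hopf_coc M)" by (simp_all add: Hopf_coc_Obj)
  moreover have "rw i \<in> Hom (Hopf_coc M) K A" using i by (simp add: Hopf_coc_Hom rw_in_hom)
  moreover have "is_mono M (Car K) (Car A) (rw i)"
    using mi is_mono_iff[of "Car K" "Car A" "rw i"] by (simp add: rw_in_hom)
  ultimately show "preserves_monos (right_modules M (Car K) (Mult K) (One K)) M
      (balanced_tensor_functor M (Car K) (Car A, Mult A \<cdot> (rw i \<otimes> Ident M (Car A))))"
    and "reflects_monos (right_modules M (Car K) (Mult K) (One K)) M
      (balanced_tensor_functor M (Car K) (Car A, Mult A \<cdot> (rw i \<otimes> Ident M (Car A))))"
    using ff unfolding faithful_flatness_def Let_def by blast+
qed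

lemma btp_iso:
  assumes i: "hm K A i" and V: "rmd K V \<nu>" and t: "btp K A i V \<nu> t" and t': "btp K A i V \<nu> t'"
  obtains u v where "arr u" "src u = trg t" "trg u = trg t'" "u \<bullet> t = t'"
    "arr v" "src v = trg t'" "trg v = trg t" "v \<bullet> t' = t" "v \<bullet> u = idt (trg t)" "u \<bullet> v = idt (trg t')"
proof -
  note [simp] = hmD(1,2,5-7)[OF i] rmdD(2-5)[OF V] btpD(1,2)[OF t V i] btpD(1,2)[OF t' V i]
  have c: "idt V \<bullet> \<nu> = \<nu> \<bullet> (idt V \<odot> idt (Car K))" by simp
  obtain u where u: "arr u" "src u = trg t" "trg u = trg t'" "u \<bullet> t = t' \<bullet> (idt V \<odot> idt (Car A))"
    by (rule btp_map[OF i V V _ _ _ c t t']) simp_all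
  obtain v where v: "arr v" "src v = trg t'" "trg v = trg t" "v \<bullet> t' = t \<bullet> (idt V \<odot> idt (Car A))"
    by (rule btp_map[OF i V V _ _ _ c t' t]) simp_all
  have e: "u \<bullet> t = t'" "v \<bullet> t' = t" using u(4) v(4) by simp_all
  have "v \<bullet> u = idt (trg t)"
    by (rule epicD[OF btpD(3)[OF t V i]]) (use u(1-3) v(1-3) e in simp_all)
  moreover have "u \<bullet> v = idt (trg t')"
    by (rule epicD[OF btpD(3)[OF t' V i]]) (use u(1-3) v(1-3) e in simp_all)
  ultimately show ?thesis using that u(1-3) v(1-3) e by blast
qed

text \<open>A module morphism that is monic in \<open>M\<close> is a monomorphism of modules and
  hence preserved; \<open>btp_iso\<close> carries the conclusion from the chosen presentations to
  the given ones.\<close>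

lemma flat_preserves_mono:
  fixes A K :: "('o, 'm) hopf_data"
  assumes ff: "faithful_flatness M" and i: "hm K A i" and mi: "monic i"
    and V: "rmd K V \<nu>" and V': "rmd K V' \<nu>'" and f: "src f = V" "trg f = V'" "monic f"
    and c: "f \<bullet> \<nu> = \<nu>' \<bullet> (f \<odot> idt (Car K))" and t: "btp K A i V \<nu> t" and t': "btp K A i V' \<nu>' t'"
    and g [simp]: "arr g" "src g = trg t" "trg g = trg t'" and gt: "g \<bullet> t = t' \<bullet> (f \<odot> idt (Car A))"
  shows "monic g"
proof -
  note [simp] = hmD(1,2,5-7)[OF i] rmdD(2-5)[OF V] rmdD(2-5)[OF V'] mono_arr[OF f(3)] f(1,2)
  let ?C = "right_modules M (Car K) (Mult K) (One K)"
  let ?F = "balanced_tensor_functor M (Car K) (Car A, Mult A \<cdot> (rw i \<otimes> Ident M (Car A)))"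
  obtain s s' h where s: "btp K A i V \<nu> s" "btp K A i V' \<nu>' s'" and h [simp]: "arr h" "src h = trg s" "trg h = trg s'"
    and hs: "h \<bullet> s = s' \<bullet> (f \<odot> idt (Car A))"
    and F: "ObMap ?F (V, rw \<nu>) = trg s" "ObMap ?F (V', rw \<nu>') = trg s'" "ArMap ?F (V, rw \<nu>) (V', rw \<nu>') (rw f) = rw h"
    by (rule balanced_tensor_functor_eq[OF i V V' _ _ _ c]) simp_all
  note [simp] = btpD(1,2)[OF s(1) V i] btpD(1,2)[OF s(2) V' i] btpD(1,2)[OF t V i] btpD(1,2)[OF t' V' i]
  have fH: "rw f \<in> Hom ?C (V, rw \<nu>) (V', rw \<nu>')" by (rule rmd_Hom[OF V V' _ _ _ c]) simp_all
  have "is_mono ?C (V, rw \<nu>) (V', rw \<nu>') (rw f)"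
    unfolding is_mono_def
  proof (intro conjI ballI impI fH)
    fix x g1 g2 assume x: "x \<in> Obj ?C" and g12: "g1 \<in> Hom ?C x (V, rw \<nu>)" "g2 \<in> Hom ?C x (V, rw \<nu>)"
      and e: "rw f \<cdot>\<^bsub>?C\<^esub> g1 = rw f \<cdot>\<^bsub>?C\<^esub> g2"
    obtain U r where U: "x = (U, r)" "U \<in> Obj M" using x by (auto simp: right_modules_def)
    have m: "g1 \<in> Hom M U V" "g2 \<in> Hom M U V" using g12 U by (auto simp: right_modules_def)
    have "is_mono M V V' (rw f)" using f(3) is_mono_iff[of V V' "rw f"] by (simp add: rw_in_hom)
    moreover have "rw f \<cdot> g1 = rw f \<cdot> g2" using e by (simp add: right_modules_def)
    ultimately show "g1 = g2" using m U(2) unfolding is_mono_def by blast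
  qed
  then have "is_mono M (trg s) (trg s') (rw h)"
    using flatness(1)[OF ff i mi, unfolded preserves_monos_def, rule_format, OF rmd_Obj[OF V] rmd_Obj[OF V'] fH] F by simp
  then have mh: "monic h"
    using is_mono_iff[of "trg s" "trg s'" "rw h"] by (simp add: rw_in_hom)
  obtain u v where u: "arr u" "src u = trg t" "trg u = trg s" "u \<bullet> t = s" "v \<bullet> u = idt (trg t)"
    using btp_iso[OF i V t s(1)] by metis
  obtain u' v' where v': "arr v'" "src v' = trg s'" "trg v' = trg t'" "v' \<bullet> s' = t'" "u' \<bullet> v' = idt (trg s')"
    using btp_iso[OF i V' t' s(2)] by metis
  have "(v' \<bullet> h \<bullet> u) \<bullet> t = v' \<bullet> s' \<bullet> (f \<odot> idt (Car A))" using u(4) hs by simp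
  also have "\<dots> = g \<bullet> t" using v'(4)[THEN reduce] gt by simp
  finally have "v' \<bullet> h \<bullet> u = g"
    by (rule epicD[OF btpD(3)[OF t V i]]) (use u v' in simp_all)
  moreover have "monic u" "monic v'"
    using monicI_retraction[of v u] monicI_retraction[of u' v'] u v' by simp_all
  ultimately show ?thesis
    using mono_cmp[OF mono_cmp[OF _ mh] , of u v'] u v' by simp
qed

text \<open>If the balanced tensor product with \<open>A\<close> vanishes, the morphism from
  \<open>V\<close> to the zero module becomes a monomorphism. By reflection it is one already, and
  the identity and the zero endomorphism of \<open>V\<close> have equal composites with it.\<close>

lemma flat_reflects_zero:
  fixes A K :: "('o, 'm) hopf_data"
  assumes ff: "faithful_flatness M" and i: "hm K A i" and mi: "monic i"
    and V: "rmd K V \<nu>" and t: "btp K A i V \<nu> t" and tz: "idt (trg t) = zr (trg t) (trg t)"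
  shows "idt V = zr V V"
proof -
  note [simp] = hmD(1,2,5-7)[OF i] rmdD(2-5)[OF V]
  let ?C = "right_modules M (Car K) (Mult K) (One K)"
  let ?F = "balanced_tensor_functor M (Car K) (Car A, Mult A \<cdot> (rw i \<otimes> Ident M (Car A)))"
  obtain z where z: "is_zero_object M z" using zero_object by (auto simp: pointed_def)
  have [simp]: "z \<in> Obj M" using z by (simp add: is_zero_object_def is_terminal_def)
  have zz: "f = g" if "arr f" "trg f = z" "arr g" "trg g = z" "src f = src g" for f g
    using zero_hom_zr[OF z, of f] zero_hom_zr[OF z, of g] that by simp
  have Z: "rmd K z (zr (z \<boxtimes> Car K) z)"
    unfolding rmd_def by (intro conjI zz) simp_all
  let ?f = "zr V z"
  have c: "?f \<bullet> \<nu> = zr (z \<boxtimes> Car K) z \<bullet> (?f \<odot> idt (Car K))" by (rule zz) simp_all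
  obtain s s' h where s: "btp K A i V \<nu> s" "btp K A i z (zr (z \<boxtimes> Car K) z) s'" and h [simp]: "arr h" "src h = trg s" "trg h = trg s'"
    and F: "ObMap ?F (V, rw \<nu>) = trg s" "ObMap ?F (z, rw (zr (z \<boxtimes> Car K) z)) = trg s'"
      "ArMap ?F (V, rw \<nu>) (z, rw (zr (z \<boxtimes> Car K) z)) (rw ?f) = rw h"
    by (rule balanced_tensor_functor_eq[OF i V Z _ _ _ c]) simp_all
  note [simp] = btpD(1,2)[OF s(1) V i] btpD(1,2)[OF s(2) Z i] btpD(1,2)[OF t V i]
  obtain u v where u: "arr u" "src u = trg t" "trg u = trg s" "arr v" "src v = trg s" "trg v = trg t" "u \<bullet> v = idt (trg s)"
    using btp_iso[OF i V t s(1)] by metis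
  have "u \<bullet> idt (trg t) \<bullet> v = u \<bullet> zr (trg t) (trg t) \<bullet> v" by (simp only: tz)
  then have sz: "idt (trg s) = zr (trg s) (trg s)" using u by simp
  have "monic h"
  proof (rule monoI_zero)
    fix x assume "arr x" "trg x = src h"
    then show "x = zr (src x) (src h)"
      using arg_cong[OF sz, of "\<lambda>y. y \<bullet> x"] by simp
  qed simp
  then have "is_mono M (trg s) (trg s') (rw h)"
    using is_mono_iff[of "trg s" "trg s'" "rw h"] by (simp add: rw_in_hom)
  moreover have fH: "rw ?f \<in> Hom ?C (V, rw \<nu>) (z, rw (zr (z \<boxtimes> Car K) z))" by (rule rmd_Hom[OF V Z _ _ _ c]) simp_all
  ultimately have m: "is_mono ?C (V, rw \<nu>) (z, rw (zr (z \<boxtimes> Car K) z)) (rw ?f)"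
    using flatness(2)[OF ff i mi, unfolded reflects_monos_def, rule_format, OF rmd_Obj[OF V] rmd_Obj[OF Z] fH] F by simp
  have "rw (idt V) \<in> Hom ?C (V, rw \<nu>) (V, rw \<nu>)" by (rule rmd_Hom[OF V V]) simp_all
  moreover have "rw (zr V V) \<in> Hom ?C (V, rw \<nu>) (V, rw \<nu>)" by (rule rmd_Hom[OF V V]) (simp_all add: zr_tens)
  moreover have "rw ?f \<cdot>\<^bsub>?C\<^esub> rw (idt V) = rw ?f \<cdot>\<^bsub>?C\<^esub> rw (zr V V)"
    by (simp add: right_modules_def flip: rw_cmp)
  ultimately have "rw (idt V) = rw (zr V V)"
    using m rmd_Obj[OF V] unfolding is_mono_def by blast
  then show ?thesis by (subst (asm) rw_inject) simp_all
qed


section \<open>Kernels of quotients\<close>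

text \<open>The element \<open>k h^{-1}\<close> plays the part of a difference: it lies in the
  kernel of \<open>q\<close>, and multiplying it by \<open>h\<close> gives back
  \<open>k\<close>.\<close>

lemma mu_diff_kernel:
  assumes q: "hm A Q q" and h: "cm X A h" and k: "cm X A k" and e: "q \<bullet> h = q \<bullet> k"
  shows "cm X A (mu X A k (an A \<bullet> h))" "q \<bullet> mu X A k (an A \<bullet> h) = e1 X Q"
    "mu X A (mu X A k (an A \<bullet> h)) h = k"
proof -
  note [simp] = hmD(1,2,5-7)[OF q] cmD(1-5)[OF h] cmD(1-5)[OF k]
  have a: "cm X A (an A \<bullet> h)" by (rule cm_cmp[OF h cm_an]) simp
  show "cm X A (mu X A k (an A \<bullet> h))" by (rule cm_mu[OF _ k a]) simp
  have "q \<bullet> mu X A k (an A \<bullet> h) = mu X Q (q \<bullet> k) (an Q \<bullet> q \<bullet> k)"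
    using hm_an[OF q, THEN reduce, of h] e by (simp add: hm_mu[OF q])
  then show "q \<bullet> mu X A k (an A \<bullet> h) = e1 X Q"
    using mu_inv(2)[OF hmD(2)[OF q] cm_cmp[OF k hmD(3)[OF q]]] by simp
  have "mu X A (an A \<bullet> h) h = e1 X A" by (rule mu_inv(1)[OF hmD(1)[OF q] h])
  then show "mu X A (mu X A k (an A \<bullet> h)) h = k"
    by (simp add: mu_assoc mu_unit)
qed

text \<open>For a reflexive relation \<open>R\<close> with quotient \<open>q\<close>, the normal subobject \<open>N\<close> (the class of the
  neutral element) exhausts the kernel \<open>K\<close> of \<open>q\<close>. In elements, with \<open>[k, a]\<close> a balanced tensor over \<open>N\<close>,
  the morphism \<open>(x, y) \<mapsto> [x y\<^sup>-\<^sup>1, y]\<close> to the balanced tensor square of \<open>A\<close> factors through \<open>id \<odot> q\<close>,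
  and so \<open>[k, a] = [1, k a]\<close> for \<open>k\<close> in \<open>K\<close>. This equation also holds in the balanced tensor product
  of \<open>K\<close> and \<open>A\<close>, because the passage to \<open>A\<close> is a monomorphism. Hence the balanced tensor product of
  the cokernel of \<open>N \<rightarrow> K\<close> with \<open>A\<close> vanishes.\<close>

lemma kernel_of_quotient:
  fixes A R Q N K :: "('o, 'm) hopf_data"
  assumes ff: "faithful_flatness M" and r: "hm R A r" and s: "hm R A s" and d: "hm A R d"
    and rd: "r \<bullet> d = idt (Car A)" "s \<bullet> d = idt (Car A)"
    and q: "hm A Q q" "iscoeq q r s"
    and N: "heq N \<kappa> R A r (e1 R A)" and mi: "monic (s \<bullet> \<kappa>)"
    and K: "heq K \<iota> A Q q (e1 A Q)" and j: "hm N K j" "\<iota> \<bullet> j = s \<bullet> \<kappa>"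
  shows "epic j"
proof -
  note [simp] = hmD(1,2,5-7)[OF r] hmD(5-7)[OF s] hmD(5-7)[OF d] hmD(2,5-7)[OF q(1)]
    hmD(1,5-7)[OF heqD(3)[OF N]] hmD(1,5-7)[OF heqD(3)[OF K]] hmD(5-7)[OF j(1)]
  define i where "i = s \<bullet> \<kappa>"
  have hi: "hm N A i" unfolding i_def by (rule hm_cmp[OF heqD(3)[OF N] s])
  note [simp] = hmD(5-7)[OF hi]
  have mi: "monic i" using mi by (simp add: i_def)
  have ij: "\<iota> \<bullet> j = i" using j by (simp add: i_def)
  let ?a = "Car A" and ?n = "Car N" and ?k = "Car K" and ?r = "Car R" and ?q = "Car Q"
  let ?l = "ml A \<bullet> (i \<odot> idt ?a)"
  note hk = heqD(3)[OF K]
  have cq: "q \<bullet> r = q \<bullet> s" by (rule iscoeqD(7)[OF q(2)])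

  \<comment> \<open>Dividing the generic element \<open>(x, y)\<close> of \<open>R\<close> by the
    diagonal element \<open>(x, x)\<close> gives \<open>(1, y x^{-1})\<close>, an element of
    \<open>N\<close>; its image under \<open>i\<close> is \<open>s r^{-1}\<close>.\<close>
  obtain n where n: "cm R N n" "i \<bullet> n = mu R A s (an A \<bullet> r)"
  proof -
    have ir: "cm R R (idt ?r)" by (simp add: cm_idt)
    have dr: "cm R R (d \<bullet> r)" by (rule cm_cmp[OF hmD(3)[OF r] hmD(3)[OF d]])
    have "r \<bullet> d \<bullet> r = r \<bullet> idt ?r" using rd(1)[THEN reduce, of r] by simp
    note w = mu_diff_kernel[OF r dr ir this]
    have "r \<bullet> mu R R (idt ?r) (an R \<bullet> d \<bullet> r) = e1 R A \<bullet> mu R R (idt ?r) (an R \<bullet> d \<bullet> r)"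
      using w(2) e1_cmp[OF w(1), of A] by simp
    then obtain n where n: "cm R N n" "\<kappa> \<bullet> n = mu R R (idt ?r) (an R \<bullet> d \<bullet> r)"
      by (rule heq_factor[OF N w(1)])
    have "i \<bullet> n = mu R A s (s \<bullet> an R \<bullet> d \<bullet> r)"
      using n(2) by (simp add: i_def hm_mu[OF s])
    also have "s \<bullet> an R \<bullet> d \<bullet> r = an A \<bullet> r"
      using hm_an[OF s, THEN reduce, of "d \<bullet> r"] rd(2)[THEN reduce, of r] by simp
    finally show ?thesis using that n(1) by blast
  qed
  have sr: "s = mu R A (i \<bullet> n) r"
    using n mu_inv(1)[OF hmD(2)[OF r] hmD(3)[OF r]] by (simp add: mu_assoc mu_unit)

  have MA: "rmd N ?a (ml A \<bullet> (idt ?a \<odot> i))" by (rule rmd_hm[OF hi])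
  obtain t where t: "btp N A i ?a (ml A \<bullet> (idt ?a \<odot> i)) t" using ex_btp[OF hi MA] by blast
  note [simp] = btpD(1,2)[OF t MA hi]
  \<comment> \<open>The balancing relation on elements: a factor from \<open>N\<close> passes from
    the left component to the right one.\<close>
  have move: "t \<bullet> pair X (mu X A y (i \<bullet> x)) z = t \<bullet> pair X y (mu X A (i \<bullet> x) z)"
    if c: "cm X N x" "cm X A y" "cm X A z" for X :: "('o, 'm) comonoid_data" and x y z
  proof -
    note [simp] = cmD(1-5)[OF c(1)] cmD(3-5)[OF c(2)] cmD(3-5)[OF c(3)]
    have "t \<bullet> ((ml A \<bullet> (idt ?a \<odot> i)) \<odot> idt ?a) \<bullet> pair X (pair X y x) z
        = t \<bullet> (idt ?a \<odot> ?l) \<bullet> asc ?a ?n ?a \<bullet> pair X (pair X y x) z"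
      using btpD(4)[OF t MA hi, THEN reduce, of "pair X (pair X y x) z"] by simp
    then show ?thesis by (simp add: tens_pair asc_pair mu_def)
  qed
  let ?AA = "prodc A A"
  let ?\<phi> = "t \<bullet> pair ?AA (mu ?AA A (p1 A A) (an A \<bullet> p2 A A)) (p2 A A)"
  have phi: "?\<phi> \<bullet> pair X x y = t \<bullet> pair X (mu X A x (an A \<bullet> y)) y"
    if c: "cm X A x" "cm X A y" for X :: "('o, 'm) comonoid_data" and x y
  proof -
    have h: "cm X ?AA (pair X x y)" by (rule cm_pair[OF c])
    have "p1 A A \<bullet> pair X x y = x" "p2 A A \<bullet> pair X x y = y"
      using p1_pair[OF c(2), of x A] p2_pair[OF c(1), of y A] cmD[OF c(1)] cmD[OF c(2)] by simp_all
    then show ?thesis by (simp add: pair_cmp[OF h] mu_cmp[OF h])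
  qed
  \<comment> \<open>With \<open>s\<close> written as \<open>(i n) r\<close>, the balancing relation
    gives \<open>[x r^{-1} (i n)^{-1}, (i n) r] = [x r^{-1}, r]\<close>.\<close>
  have "?\<phi> \<bullet> (idt ?a \<odot> r) = ?\<phi> \<bullet> (idt ?a \<odot> s)"
  proof -
    let ?P = "prodc A R"
    let ?x = "p1 A R" and ?y = "p2 A R"
    have cx: "cm ?P A ?x" and cy: "cm ?P R ?y" by simp_all
    have cry: "cm ?P A (r \<bullet> ?y)" and csy: "cm ?P A (s \<bullet> ?y)" and cny: "cm ?P N (n \<bullet> ?y)"
      using cm_cmp[OF cy hmD(3)[OF r]] cm_cmp[OF cy hmD(3)[OF s]] cm_cmp[OF cy n(1)] by blast+
    have ciny: "cm ?P A (i \<bullet> n \<bullet> ?y)" by (rule cm_cmp[OF cny hmD(3)[OF hi]])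
    have cm: "cm ?P N (an N \<bullet> n \<bullet> ?y)" by (rule cm_cmp[OF cny cm_an]) simp
    note [simp] = cmD(3-5)[OF n(1)]
    have sy: "s \<bullet> ?y = mu ?P A (i \<bullet> n \<bullet> ?y) (r \<bullet> ?y)"
      using arg_cong[OF sr, of "\<lambda>f. f \<bullet> ?y"] by (simp add: mu_cmp[OF cy])
    have cw: "cm ?P A (mu ?P A ?x (an A \<bullet> r \<bullet> ?y))"
      by (rule cm_mu[OF _ cx cm_cmp[OF cry cm_an]]) simp_all
    have "an A \<bullet> s \<bullet> ?y = mu ?P A (an A \<bullet> r \<bullet> ?y) (i \<bullet> an N \<bullet> n \<bullet> ?y)"
      unfolding sy using mu_an[OF hmD(2)[OF r] ciny cry] hm_an[OF hi, THEN reduce, of "n \<bullet> ?y"] by simp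
    then have "?\<phi> \<bullet> pair ?P ?x (s \<bullet> ?y) = t \<bullet> pair ?P (mu ?P A (mu ?P A ?x (an A \<bullet> r \<bullet> ?y)) (i \<bullet> an N \<bullet> n \<bullet> ?y)) (s \<bullet> ?y)"
      unfolding phi[OF cx csy] by (simp add: mu_assoc)
    also have "\<dots> = t \<bullet> pair ?P (mu ?P A ?x (an A \<bullet> r \<bullet> ?y)) (mu ?P A (i \<bullet> an N \<bullet> n \<bullet> ?y) (s \<bullet> ?y))"
      by (rule move[OF cm cw csy])
    also have "mu ?P A (i \<bullet> an N \<bullet> n \<bullet> ?y) (s \<bullet> ?y) = r \<bullet> ?y"
      unfolding sy using mu_inv(1)[OF hmD(2)[OF r] ciny] hm_an[OF hi, THEN reduce, of "n \<bullet> ?y"]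
      by (simp add: mu_assoc[symmetric] mu_unit)
    finally have "?\<phi> \<bullet> pair ?P ?x (s \<bullet> ?y) = ?\<phi> \<bullet> pair ?P ?x (r \<bullet> ?y)"
      using phi[OF cx cry] by simp
    moreover have "pair ?P ?x (r \<bullet> ?y) = idt ?a \<odot> r" "pair ?P ?x (s \<bullet> ?y) = idt ?a \<odot> s"
      using tens_pair[of ?x "idt ?a" ?y r ?P] tens_pair[of ?x "idt ?a" ?y s ?P] by (simp_all add: pair_p1_p2)
    ultimately show ?thesis by simp
  qed
  then obtain \<psi> where psi: "arr \<psi>" "trg \<psi> = trg t" "src \<psi> = ?a \<boxtimes> ?q" "\<psi> \<bullet> (idt ?a \<odot> q) = ?\<phi>"
    using iscoeqE[OF iscoeq_tens_left[OF _ q(2), of ?a], of ?\<phi>] by auto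

  let ?KA = "prodc K A"
  let ?u = "p1 K A" and ?v = "p2 K A"
  have cu: "cm ?KA K ?u" and cv: "cm ?KA A ?v" by simp_all
  have ciu: "cm ?KA A (\<iota> \<bullet> ?u)" by (rule cm_cmp[OF cu hmD(3)[OF hk]])
  let ?w = "mu ?KA A (\<iota> \<bullet> ?u) ?v"
  have cw: "cm ?KA A ?w" by (rule cm_mu[OF _ ciu cv]) simp
  have ce: "cm ?KA A (e1 ?KA A)" by (simp add: cm_e1)
  have "q \<bullet> \<iota> \<bullet> ?u = e1 ?KA Q"
    using heqD(6)[OF K, THEN reduce, of ?u] e1_cmp[OF ciu, of Q] by simp
  then have qw: "q \<bullet> ?w = q \<bullet> ?v" by (simp add: hm_mu[OF q(1)] mu_unit)
  \<comment> \<open>Since \<open>q (k a) = q a\<close> for \<open>k\<close> in the kernel,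
    \<open>[k, a] = \<psi> (k a, q a) = \<psi> (k a, q (k a)) = [1, k a]\<close>.\<close>
  have "t \<bullet> pair ?KA (\<iota> \<bullet> ?u) ?v = ?\<phi> \<bullet> pair ?KA ?w ?v"
    unfolding phi[OF cw cv] using mu_inv(2)[OF hmD(2)[OF r] cv] by (simp add: mu_assoc mu_unit)
  also have "\<dots> = \<psi> \<bullet> pair ?KA ?w (q \<bullet> ?v)"
    unfolding psi(4)[symmetric] by (simp add: tens_pair)
  also have "\<dots> = ?\<phi> \<bullet> pair ?KA ?w ?w"
    unfolding psi(4)[symmetric] by (simp add: tens_pair qw)
  also have "\<dots> = t \<bullet> pair ?KA (e1 ?KA A) ?w"
    unfolding phi[OF cw cw] using mu_inv(2)[OF hmD(2)[OF r] cw] by simp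
  finally have tA: "t \<bullet> pair ?KA (\<iota> \<bullet> ?u) ?v = t \<bullet> pair ?KA (e1 ?KA A) ?w" .

  have MK: "rmd N ?k (ml K \<bullet> (idt ?k \<odot> j))" by (rule rmd_hm[OF j(1)])
  obtain tK where tK: "btp N A i ?k (ml K \<bullet> (idt ?k \<odot> j)) tK" using ex_btp[OF hi MK] by blast
  note [simp] = btpD(1,2)[OF tK MK hi]
  have c1: "\<iota> \<bullet> (ml K \<bullet> (idt ?k \<odot> j)) = (ml A \<bullet> (idt ?a \<odot> i)) \<bullet> (\<iota> \<odot> idt ?n)"
    using hmD(4)[OF hk, THEN reduce, of "idt ?k \<odot> j"] ij by (simp add: tens_cmp)
  obtain g where g: "arr g" "src g = trg tK" "trg g = trg t" "g \<bullet> tK = t \<bullet> (\<iota> \<odot> idt ?a)"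
    by (rule btp_map[OF hi MK MA _ _ _ c1 tK t]) simp_all
  have mg: "monic g"
    by (rule flat_preserves_mono[OF ff hi mi MK MA _ _ heqD(5)[OF K] c1 tK t g]) simp_all
  have "g \<bullet> tK \<bullet> pair ?KA ?u ?v = t \<bullet> pair ?KA (\<iota> \<bullet> ?u) ?v"
    using g(4)[THEN reduce, of "pair ?KA ?u ?v"] by (simp add: tens_pair)
  also have "\<dots> = g \<bullet> tK \<bullet> pair ?KA (e1 ?KA K) ?w"
    unfolding tA using g(4)[THEN reduce, of "pair ?KA (e1 ?KA K) ?w"] hm_e1[OF hk, of ?KA] by (simp add: tens_pair)
  finally have "tK \<bullet> pair ?KA ?u ?v = tK \<bullet> pair ?KA (e1 ?KA K) ?w"
    by (rule monicD[OF mg]) (use g in simp_all)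
  then have tK1: "tK = tK \<bullet> pair ?KA (e1 ?KA K) ?w"
    by (simp add: pair_p1_p2)

  obtain c where c: "iscok c j" using ex_cokernel[of j] by auto
  note ec = iscoeq_epi[OF c]
  note [simp] = iscokD(1)[OF c] iscokD(3)[OF c, simplified]
  have cj: "c \<bullet> j = zr ?n (trg c)" using iscokD(4)[OF c] by simp
  let ?C = "trg c"
  \<comment> \<open>The action of \<open>N\<close> descends to the cokernel, because products of
    elements of \<open>N\<close> stay in \<open>N\<close>, where \<open>c\<close> vanishes.\<close>
  have "(c \<bullet> (ml K \<bullet> (idt ?k \<odot> j))) \<bullet> (j \<odot> idt ?n) = c \<bullet> j \<bullet> ml N"
    by (simp add: hmD(4)[OF j(1)] tens_cmp)
  also have "\<dots> = zr (?n \<boxtimes> ?n) ?C"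
    using cj[THEN reduce, of "ml N"] by simp
  finally obtain m where m: "arr m" "trg m = ?C" "src m = ?C \<boxtimes> ?n" "m \<bullet> (c \<odot> idt ?n) = c \<bullet> (ml K \<bullet> (idt ?k \<odot> j))"
    using iscoeqE[OF iscoeq_tens_right[OF _ c, of ?n], of "c \<bullet> (ml K \<bullet> (idt ?k \<odot> j))"] by (auto simp: zr_tens)
  have MC: "rmd N ?C m"
    by (rule rmd_quotient[OF MK ec _ _ _ _ _ m(4)]) (simp_all add: m)
  obtain tC where tC: "btp N A i ?C m tC" using ex_btp[OF hi MC] by blast
  note [simp] = btpD(1,2)[OF tC MC hi]
  obtain h where h: "arr h" "src h = trg tK" "trg h = trg tC" "h \<bullet> tK = tC \<bullet> (c \<odot> idt ?a)"
    by (rule btp_map[OF hi MK MC _ _ _ m(4)[symmetric] tK tC]) simp_all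
  have "c \<bullet> un K = zr (Unit M) ?C"
    using cj[THEN reduce, of "un N"] hm_un[OF j(1)] by simp
  then have ce0: "c \<bullet> e1 ?KA K = zr (?k \<boxtimes> ?a) ?C"
    using reduce[of c "un K" _ "ep ?KA"] by (simp add: e1_def)
  \<comment> \<open>By \<open>tK1\<close> the tensor \<open>[c k, a]\<close> equals
    \<open>[c 1, k a]\<close>, and \<open>c 1\<close> is zero because the unit of \<open>K\<close>
    comes from \<open>N\<close>.\<close>
  have "tC \<bullet> (c \<odot> idt ?a) = (h \<bullet> tK) \<bullet> pair ?KA (e1 ?KA K) ?w"
    unfolding h(4)[symmetric] by (subst tK1) simp
  also have "\<dots> = tC \<bullet> pair ?KA (zr (?k \<boxtimes> ?a) ?C) ?w"
    unfolding h(4) by (simp add: tens_pair ce0)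
  also have "pair ?KA (zr (?k \<boxtimes> ?a) ?C) ?w = (zr ?k ?C \<odot> idt ?a) \<bullet> pair ?KA ?u ?w"
    by (simp add: tens_pair)
  also have "\<dots> = zr (?k \<boxtimes> ?a) (?C \<boxtimes> ?a)" by (simp add: zr_tens)
  finally have "tC \<bullet> (c \<odot> idt ?a) = zr (?C \<boxtimes> ?a) (trg tC) \<bullet> (c \<odot> idt ?a)" by simp
  then have "tC = zr (?C \<boxtimes> ?a) (trg tC)"
    by (rule epicD[OF epi_tens_right[OF _ ec], rotated]) simp_all
  then have "idt (trg tC) \<bullet> tC = zr (trg tC) (trg tC) \<bullet> tC" by simp
  then have "idt (trg tC) = zr (trg tC) (trg tC)"
    by (rule epicD[OF btpD(3)[OF tC MC hi]]) simp_all
  then have C0: "idt ?C = zr ?C ?C"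
    by (rule flat_reflects_zero[OF ff hi mi MC tC])
  have "idt ?C \<bullet> c = zr ?C ?C \<bullet> c" by (simp only: C0)
  then have c0: "c = zr ?k ?C" by simp
  show ?thesis
  proof (rule epiI_zero)
    fix x assume x: "arr x" "src x = trg j" "x \<bullet> j = zr (src j) (trg x)"
    obtain x' where x': "arr x'" "trg x' = trg x" "src x' = ?C" "x' \<bullet> c = x"
      using iscokE[OF c x] .
    then show "x = zr (trg j) (trg x)" using arg_cong[OF c0, of "\<lambda>y. x' \<bullet> y"] by simp
  qed simp
qed

text \<open>If \<open>h\<close> and \<open>k\<close> have the same image in the quotient,
  \<open>k h^{-1}\<close> lies in the kernel of \<open>q\<close>, which is \<open>N\<close> by
  \<open>kernel_of_quotient\<close>; its product with the diagonal element of \<open>h\<close> is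
  the required element of \<open>R\<close>. Coflatness makes the jointly cancellable pair
  \<open>r\<close>, \<open>s\<close> monic in \<open>M\<close>.\<close>

lemma reflexive_relation_effective:
  fixes A R Q :: "('o, 'm) hopf_data"
  assumes fc: "faithful_coflatness M" and ff: "faithful_flatness M"
    and r: "hm R A r" and s: "hm R A s" and d: "hm A R d"
    and rd: "r \<bullet> d = idt (Car A)" "s \<bullet> d = idt (Car A)"
    and jm: "\<And>(X :: ('o, 'm) hopf_data) g h. \<lbrakk>hm X R g; hm X R h; r \<bullet> g = r \<bullet> h; s \<bullet> g = s \<bullet> h\<rbrakk> \<Longrightarrow> g = h"
    and q: "hm A Q q" "iscoeq q r s"
  shows "monic (pair R r s)"
    and "\<lbrakk>cm X A h; cm X A k; q \<bullet> h = q \<bullet> k\<rbrakk> \<Longrightarrow> \<exists>l. cm X R l \<and> r \<bullet> l = h \<and> s \<bullet> l = k"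
proof -
  note [simp] = hmD(1,2,5-7)[OF r] hmD(5-7)[OF s] hmD(5-7)[OF d] hmD(2,5-7)[OF q(1)]
  have prs: "p1 A A \<bullet> pair R r s = r" "p2 A A \<bullet> pair R r s = s"
    using p1_pair[OF hmD(3)[OF s], of r A] p2_pair[OF hmD(3)[OF r], of s A] by simp_all
  show "monic (pair R r s)"
  proof (rule monic_if_left_cancellable[OF fc hm_pair[OF r s]])
    fix X :: "('o, 'm) hopf_data" and g h
    assume "hm X R g" "hm X R h" "pair R r s \<bullet> g = pair R r s \<bullet> h"
    then show "g = h" using jm prs by (metis cmp_assoc)
  qed
  obtain N \<kappa> where N: "heq N \<kappa> R A r (e1 R A)" using ex_heq[OF r hm_e1_zero] by fastforce
  note [simp] = hmD(1,5-7)[OF heqD(3)[OF N]]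
  let ?i = "s \<bullet> \<kappa>"
  have hi: "hm N A ?i" by (rule hm_cmp[OF heqD(3)[OF N] s])
  have rk: "r \<bullet> \<kappa> = e1 N A" using heqD(6)[OF N] e1_cmp[OF hmD(3)[OF heqD(3)[OF N]], of A] by simp
  \<comment> \<open>As \<open>r \<bullet> \<kappa>\<close> is trivial, elements of \<open>N\<close>
    are determined by their second component.\<close>
  have mi: "monic ?i"
  proof (rule monic_if_left_cancellable[OF fc hi])
    fix X :: "('o, 'm) hopf_data" and g h
    assume g: "hm X N g" and h: "hm X N h" and e: "?i \<bullet> g = ?i \<bullet> h"
    have "r \<bullet> \<kappa> \<bullet> g = r \<bullet> \<kappa> \<bullet> h"
      using rk[THEN reduce, of g] rk[THEN reduce, of h] e1_cmp[OF hmD(3)[OF g], of A] e1_cmp[OF hmD(3)[OF h], of A] by simp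
    then have "\<kappa> \<bullet> g = \<kappa> \<bullet> h"
      using jm[OF hm_cmp[OF g heqD(3)[OF N]] hm_cmp[OF h heqD(3)[OF N]]] e by simp
    then show "g = h"
      by (rule monicD[OF heqD(5)[OF N]]) (use hmD[OF g] hmD[OF h] in simp_all)
  qed
  obtain K \<iota> where K: "heq K \<iota> A Q q (e1 A Q)" using ex_heq[OF q(1) hm_e1_zero] by fastforce
  note [simp] = hmD(1,5-7)[OF heqD(3)[OF K]]
  have "q \<bullet> ?i = q \<bullet> r \<bullet> \<kappa>"
    using iscoeqD(7)[OF q(2), THEN reduce, of \<kappa>] by simp
  also have "\<dots> = e1 A Q \<bullet> ?i"
    using rk hm_e1[OF q(1), of N] e1_cmp[OF hmD(3)[OF hi], of Q] by simp
  finally obtain j where j: "cm N K j" "\<iota> \<bullet> j = ?i"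
    by (rule heq_factor[OF K hmD(3)[OF hi]])
  note [simp] = cmD(3-5)[OF j(1)]
  have hj: "hm N K j"
    by (rule hm_factor_mono[OF heqD(3)[OF K] heqD(5)[OF K]]) (use hi j in simp_all)
  have ej: "epic j" by (rule kernel_of_quotient[OF ff r s d rd q N mi K hj j(2)])
  have mj: "monic j" using mono_cancel_left[of \<iota> j] mi j(2) by simp
  obtain v where v: "arr v" "src v = Car K" "trg v = Car N" "v \<bullet> j = idt (Car N)" "j \<bullet> v = idt (Car K)"
    using mono_epi_iso[OF mj ej] by auto
  have cv: "cm K N v" by (rule cm_inverse[OF j(1) v])
  assume h: "cm X A h" and k: "cm X A k" and e: "q \<bullet> h = q \<bullet> k"
  note [simp] = cmD(1-5)[OF h] cmD(3-5)[OF k]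
  note w = mu_diff_kernel[OF q(1) h k e]
  let ?w = "mu X A k (an A \<bullet> h)"
  have "q \<bullet> ?w = e1 A Q \<bullet> ?w" using w(2) e1_cmp[OF w(1), of Q] by simp
  then obtain w' where w': "cm X K w'" "\<iota> \<bullet> w' = ?w" by (rule heq_factor[OF K w(1)])
  have c0: "cm X N (v \<bullet> w')" by (rule cm_cmp[OF w'(1) cv])
  have iw: "?i \<bullet> v \<bullet> w' = ?w"
    using v(5)[THEN reduce, of w'] w' j(2) cmD[OF w'(1)] by (metis cmp_assoc cmp_idt(1))
  have c1: "cm X R (\<kappa> \<bullet> v \<bullet> w')" by (rule cm_cmp[OF c0 hmD(3)[OF heqD(3)[OF N]]])
  have c2: "cm X R (d \<bullet> h)" by (rule cm_cmp[OF h hmD(3)[OF d]])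
  \<comment> \<open>In elements \<open>(1, k h^{-1}) (h, h) = (h, k)\<close>.\<close>
  let ?l = "mu X R (\<kappa> \<bullet> v \<bullet> w') (d \<bullet> h)"
  have "cm X R ?l" by (rule cm_mu[OF _ c1 c2]) simp
  moreover have "r \<bullet> ?l = h"
    using rk[THEN reduce, of "v \<bullet> w'"] e1_cmp[OF c0, of A] rd(1)[THEN reduce, of h] cmD(3-5)[OF c1] v
    by (simp add: hm_mu[OF r] mu_unit)
  moreover have "s \<bullet> ?l = k"
    using iw rd(2)[THEN reduce, of h] w(3) v by (simp add: hm_mu[OF s])
  ultimately show "\<exists>l. cm X R l \<and> r \<bullet> l = h \<and> s \<bullet> l = k" by blast
qed


end


section \<open>Finite limits\<close>

context category
begin

text \<open>Induction on the index set: the terminal object is the empty product, and a binary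
  product adjoins one more factor.\<close>

lemma finite_product:
  assumes T: "\<exists>t. is_terminal C t"
    and P: "\<And>a b. \<lbrakk>a \<in> Obj C; b \<in> Obj C\<rbrakk> \<Longrightarrow> \<exists>p\<in>Obj C. \<exists>f\<in>Hom C p a. \<exists>g\<in>Hom C p b.
      \<forall>x\<in>Obj C. \<forall>h\<in>Hom C x a. \<forall>k\<in>Hom C x b. \<exists>!l. l \<in> Hom C x p \<and> f \<cdot> l = h \<and> g \<cdot> l = k"
    and "finite S" and F: "\<And>j. j \<in> S \<Longrightarrow> F j \<in> Obj C"
  shows "\<exists>p\<in>Obj C. \<exists>\<pi>. (\<forall>j\<in>S. \<pi> j \<in> Hom C p (F j)) \<and>
    (\<forall>x\<in>Obj C. \<forall>h. (\<forall>j\<in>S. h j \<in> Hom C x (F j)) \<longrightarrow> (\<exists>!l. l \<in> Hom C x p \<and> (\<forall>j\<in>S. \<pi> j \<cdot> l = h j)))"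
  using \<open>finite S\<close> F
proof (induction S)
  case empty
  then show ?case using T by (auto simp: is_terminal_def)
next
  case (insert i S)
  have "\<exists>p\<in>Obj C. \<exists>\<pi>. (\<forall>j\<in>S. \<pi> j \<in> Hom C p (F j)) \<and>
      (\<forall>x\<in>Obj C. \<forall>h. (\<forall>j\<in>S. h j \<in> Hom C x (F j)) \<longrightarrow> (\<exists>!l. l \<in> Hom C x p \<and> (\<forall>j\<in>S. \<pi> j \<cdot> l = h j)))"
    by (rule insert.IH) (rule insert.prems, simp)
  then obtain p \<pi> where p: "p \<in> Obj C" and pp: "(\<forall>j\<in>S. \<pi> j \<in> Hom C p (F j)) \<and>
      (\<forall>x\<in>Obj C. \<forall>h. (\<forall>j\<in>S. h j \<in> Hom C x (F j)) \<longrightarrow> (\<exists>!l. l \<in> Hom C x p \<and> (\<forall>j\<in>S. \<pi> j \<cdot> l = h j)))"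
    by (elim bexE exE)
  note p = p conjunct1[OF pp] and up = pp[THEN conjunct2, THEN bspec, THEN spec, THEN mp]
  have Fi: "F i \<in> Obj C" by (rule insert.prems) simp
  obtain r f g where r: "r \<in> Obj C" "f \<in> Hom C r p" "g \<in> Hom C r (F i)"
    and rr: "\<forall>x\<in>Obj C. \<forall>h\<in>Hom C x p. \<forall>k\<in>Hom C x (F i). \<exists>!l. l \<in> Hom C x r \<and> f \<cdot> l = h \<and> g \<cdot> l = k"
    using P[OF p(1) Fi] by (elim bexE)
  note ur = rr[THEN bspec, THEN bspec, THEN bspec]
  let ?\<rho> = "\<lambda>j. if j = i then g else \<pi> j \<cdot> f"
  have as: "(\<pi> j \<cdot> f) \<cdot> l = \<pi> j \<cdot> (f \<cdot> l)" if "j \<in> S" "x \<in> Obj C" "l \<in> Hom C x r" for j x l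
    by (rule comp_assoc[of x r p "F j"]) (use that r p insert.prems in auto)
  show ?case
  proof (intro bexI[of _ r] exI[of _ ?\<rho>] conjI ballI allI impI)
    show "?\<rho> j \<in> Hom C r (F j)" if "j \<in> insert i S" for j
      using that r p comp_in_hom[OF r(1) p(1) _ r(2)] insert.prems by auto
  next
    fix x h assume x: "x \<in> Obj C" and h: "\<forall>j\<in>insert i S. h j \<in> Hom C x (F j)"
    obtain l where l: "l \<in> Hom C x p" "\<forall>j\<in>S. \<pi> j \<cdot> l = h j"
      and ul: "\<And>l'. \<lbrakk>l' \<in> Hom C x p; \<forall>j\<in>S. \<pi> j \<cdot> l' = h j\<rbrakk> \<Longrightarrow> l' = l"
      using up[OF x, of h] h by blast
    obtain k where k: "k \<in> Hom C x r" "f \<cdot> k = l" "g \<cdot> k = h i"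
      and uk: "\<And>k'. \<lbrakk>k' \<in> Hom C x r; f \<cdot> k' = l; g \<cdot> k' = h i\<rbrakk> \<Longrightarrow> k' = k"
      using ur[OF x l(1), of "h i"] h by blast
    show "\<exists>!l. l \<in> Hom C x r \<and> (\<forall>j\<in>insert i S. ?\<rho> j \<cdot> l = h j)"
    proof (rule ex1I[of _ k])
      show "k \<in> Hom C x r \<and> (\<forall>j\<in>insert i S. ?\<rho> j \<cdot> k = h j)"
        using k l as[OF _ x k(1)] by auto
      fix k' assume k': "k' \<in> Hom C x r \<and> (\<forall>j\<in>insert i S. ?\<rho> j \<cdot> k' = h j)"
      have "f \<cdot> k' = l"
      proof (rule ul)
        show "f \<cdot> k' \<in> Hom C x p" using comp_in_hom[OF x r(1) p(1) _ r(2)] k' by blast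
        show "\<forall>j\<in>S. \<pi> j \<cdot> (f \<cdot> k') = h j"
        proof
          fix j assume j: "j \<in> S"
          then have "j \<noteq> i" using insert.hyps by auto
          then have "(\<pi> j \<cdot> f) \<cdot> k' = h j" using k' j by (metis insertCI)
          then show "\<pi> j \<cdot> (f \<cdot> k') = h j" using as[OF j x] k' by simp
        qed
      qed
      moreover have "g \<cdot> k' = h i" using k' by auto
      ultimately show "k' = k" using uk k' by blast
    qed
  qed (rule r(1))
qed

text \<open>Induction on the set of pairs: each further pair is restricted to the object found so
  far and equalized there.\<close>

lemma joint_equalizer:
  assumes E: "\<And>a b f g. \<lbrakk>a \<in> Obj C; b \<in> Obj C; f \<in> Hom C a b; g \<in> Hom C a b\<rbrakk> \<Longrightarrow> \<exists>E e. is_equalizer C E e a b f g"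
    and "finite S" and p: "p \<in> Obj C"
    and S: "\<And>s. s \<in> S \<Longrightarrow> B s \<in> Obj C \<and> f s \<in> Hom C p (B s) \<and> g s \<in> Hom C p (B s)"
  shows "\<exists>L\<in>Obj C. \<exists>e\<in>Hom C L p. (\<forall>s\<in>S. f s \<cdot> e = g s \<cdot> e) \<and>
    (\<forall>x\<in>Obj C. \<forall>h\<in>Hom C x p. (\<forall>s\<in>S. f s \<cdot> h = g s \<cdot> h) \<longrightarrow> (\<exists>!l. l \<in> Hom C x L \<and> e \<cdot> l = h))"
  using \<open>finite S\<close> S
proof (induction S)
  case empty
  show ?case
  proof (intro bexI[OF _ p] bexI[OF _ ident_in_hom[OF p]] conjI ballI impI)
    fix x h assume x: "x \<in> Obj C" "h \<in> Hom C x p"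
    show "\<exists>!l. l \<in> Hom C x p \<and> Ident C p \<cdot> l = h"
      by (rule ex1I[of _ h]) (use x p comp_ident_left[OF x(1) p] in auto)
  qed simp
next
  case (insert i S)
  have "\<exists>L\<in>Obj C. \<exists>e\<in>Hom C L p. (\<forall>s\<in>S. f s \<cdot> e = g s \<cdot> e) \<and>
      (\<forall>x\<in>Obj C. \<forall>h\<in>Hom C x p. (\<forall>s\<in>S. f s \<cdot> h = g s \<cdot> h) \<longrightarrow> (\<exists>!l. l \<in> Hom C x L \<and> e \<cdot> l = h))"
    by (rule insert.IH) (rule insert.prems, simp)
  then obtain L e where L: "L \<in> Obj C" "e \<in> Hom C L p" and Le: "(\<forall>s\<in>S. f s \<cdot> e = g s \<cdot> e) \<and>
      (\<forall>x\<in>Obj C. \<forall>h\<in>Hom C x p. (\<forall>s\<in>S. f s \<cdot> h = g s \<cdot> h) \<longrightarrow> (\<exists>!l. l \<in> Hom C x L \<and> e \<cdot> l = h))"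
    by (elim bexE)
  note L = L conjunct1[OF Le] and uL = Le[THEN conjunct2, THEN bspec, THEN bspec, THEN mp]
  have i: "B i \<in> Obj C" "f i \<in> Hom C p (B i)" "g i \<in> Hom C p (B i)" using insert.prems[of i] by auto
  obtain K k where "is_equalizer C K k L (B i) (f i \<cdot> e) (g i \<cdot> e)"
    using E[OF L(1) i(1) comp_in_hom[OF L(1) p i(1) L(2) i(2)] comp_in_hom[OF L(1) p i(1) L(2) i(3)]] by blast
  then have K: "K \<in> Obj C" "k \<in> Hom C K L" "(f i \<cdot> e) \<cdot> k = (g i \<cdot> e) \<cdot> k"
    and uK: "\<And>x h. \<lbrakk>x \<in> Obj C; h \<in> Hom C x L; (f i \<cdot> e) \<cdot> h = (g i \<cdot> e) \<cdot> h\<rbrakk> \<Longrightarrow> \<exists>!l. l \<in> Hom C x K \<and> k \<cdot> l = h"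
    unfolding is_equalizer_def by blast+
  have ek: "e \<cdot> k \<in> Hom C K p" by (rule comp_in_hom[OF K(1) L(1) p K(2) L(2)])
  have as: "(f s \<cdot> e) \<cdot> h = f s \<cdot> (e \<cdot> h)" "(g s \<cdot> e) \<cdot> h = g s \<cdot> (e \<cdot> h)"
    if "s \<in> insert i S" "x \<in> Obj C" "h \<in> Hom C x L" for s x h
    using comp_assoc[OF that(2) L(1) p _ that(3) L(2)] insert.prems[OF that(1)] by blast+
  show ?case
  proof (intro bexI[OF _ K(1)] bexI[OF _ ek] conjI ballI impI)
    fix s assume s: "s \<in> insert i S"
    show "f s \<cdot> (e \<cdot> k) = g s \<cdot> (e \<cdot> k)"
      using as[OF s K(1,2)] K(3) L(3) s by auto
  next
    fix x h assume x: "x \<in> Obj C" and h: "h \<in> Hom C x p" and e: "\<forall>s\<in>insert i S. f s \<cdot> h = g s \<cdot> h"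
    obtain l where l: "l \<in> Hom C x L" "e \<cdot> l = h" and ul: "\<And>l'. \<lbrakk>l' \<in> Hom C x L; e \<cdot> l' = h\<rbrakk> \<Longrightarrow> l' = l"
      using uL[OF x h] e by blast
    have "(f i \<cdot> e) \<cdot> l = (g i \<cdot> e) \<cdot> l" using as[of i x l] x l e by simp
    then obtain m where m: "m \<in> Hom C x K" "k \<cdot> m = l" and um: "\<And>m'. \<lbrakk>m' \<in> Hom C x K; k \<cdot> m' = l\<rbrakk> \<Longrightarrow> m' = m"
      using uK[OF x l(1)] by blast
    have a: "(e \<cdot> k) \<cdot> m' = e \<cdot> (k \<cdot> m')" if "m' \<in> Hom C x K" for m'
      by (rule comp_assoc[OF x K(1) L(1) p that K(2) L(2)])
    show "\<exists>!l. l \<in> Hom C x K \<and> (e \<cdot> k) \<cdot> l = h"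
    proof (rule ex1I[of _ m])
      show "m \<in> Hom C x K \<and> (e \<cdot> k) \<cdot> m = h" using m l a[OF m(1)] by simp
      fix m' assume m': "m' \<in> Hom C x K \<and> (e \<cdot> k) \<cdot> m' = h"
      then have "k \<cdot> m' \<in> Hom C x L" using comp_in_hom[OF x K(1) L(1) _ K(2)] by blast
      moreover have "e \<cdot> (k \<cdot> m') = h" using m' a[of m'] by simp
      ultimately show "m' = m" using ul um m' by blast
    qed
  qed
qed

lemma finite_limits_from_products_equalizers:
  assumes T: "\<exists>t. is_terminal C t"
    and P: "\<And>a b. \<lbrakk>a \<in> Obj C; b \<in> Obj C\<rbrakk> \<Longrightarrow> \<exists>p\<in>Obj C. \<exists>f\<in>Hom C p a. \<exists>g\<in>Hom C p b.
      \<forall>x\<in>Obj C. \<forall>h\<in>Hom C x a. \<forall>k\<in>Hom C x b. \<exists>!l. l \<in> Hom C x p \<and> f \<cdot> l = h \<and> g \<cdot> l = k"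
    and E: "\<And>a b f g. \<lbrakk>a \<in> Obj C; b \<in> Obj C; f \<in> Hom C a b; g \<in> Hom C a b\<rbrakk> \<Longrightarrow> \<exists>E e. is_equalizer C E e a b f g"
  shows "has_finite_limits C"
  unfolding has_finite_limits_def
proof (intro allI impI)
  fix J :: "(nat, nat) category" and F assume J: "finite_category J \<and> is_functor J C F"
  then have fin: "finite (Obj J)" "\<And>i j. \<lbrakk>i \<in> Obj J; j \<in> Obj J\<rbrakk> \<Longrightarrow> finite (Hom J i j)"
    and F: "\<And>j. j \<in> Obj J \<Longrightarrow> ObMap F j \<in> Obj C"
      "\<And>i j u. \<lbrakk>i \<in> Obj J; j \<in> Obj J; u \<in> Hom J i j\<rbrakk> \<Longrightarrow> ArMap F i j u \<in> Hom C (ObMap F i) (ObMap F j)"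
    by (auto simp: finite_category_def is_functor_def)
  obtain p \<pi> where p: "p \<in> Obj C" and pp: "(\<forall>j\<in>Obj J. \<pi> j \<in> Hom C p (ObMap F j)) \<and>
      (\<forall>x\<in>Obj C. \<forall>h. (\<forall>j\<in>Obj J. h j \<in> Hom C x (ObMap F j)) \<longrightarrow> (\<exists>!l. l \<in> Hom C x p \<and> (\<forall>j\<in>Obj J. \<pi> j \<cdot> l = h j)))"
    by (rule bexE[OF finite_product[OF T P fin(1), of "ObMap F"]]) (assumption | rule F(1) | elim exE)+
  note p = p conjunct1[OF pp, THEN bspec] and up = pp[THEN conjunct2, THEN bspec, THEN spec, THEN mp]
  \<comment> \<open>Morphisms are indexed together with their endpoints, since hom-sets of
    \<open>J\<close> may overlap.\<close>
  let ?S = "SIGMA i:Obj J. SIGMA j:Obj J. Hom J i j"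
  let ?f = "\<lambda>(i, j, u). ArMap F i j u \<cdot> \<pi> i" and ?g = "\<lambda>(i, j, u). \<pi> j"
  have fS: "finite ?S" using fin by auto
  have S: "ObMap F (fst (snd s)) \<in> Obj C \<and> ?f s \<in> Hom C p (ObMap F (fst (snd s))) \<and> ?g s \<in> Hom C p (ObMap F (fst (snd s)))"
    if sS: "s \<in> ?S" for s
  proof -
    obtain i j u where s: "s = (i, j, u)" "i \<in> Obj J" "j \<in> Obj J" "u \<in> Hom J i j" using sS by blast
    then show ?thesis using comp_in_hom[OF p(1) F(1) F(1) p(2) F(2)] p(2) F(1) by simp
  qed
  have "\<exists>L\<in>Obj C. \<exists>e\<in>Hom C L p. (\<forall>s\<in>?S. ?f s \<cdot> e = ?g s \<cdot> e) \<and>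
      (\<forall>x\<in>Obj C. \<forall>h\<in>Hom C x p. (\<forall>s\<in>?S. ?f s \<cdot> h = ?g s \<cdot> h) \<longrightarrow> (\<exists>!l. l \<in> Hom C x L \<and> e \<cdot> l = h))"
    by (rule joint_equalizer[where B = "\<lambda>s. ObMap F (fst (snd s))"]) (erule (3) E, rule fS, rule p(1), erule S)
  then obtain L e where L: "L \<in> Obj C" "e \<in> Hom C L p" and Le: "(\<forall>s\<in>?S. ?f s \<cdot> e = ?g s \<cdot> e) \<and>
      (\<forall>x\<in>Obj C. \<forall>h\<in>Hom C x p. (\<forall>s\<in>?S. ?f s \<cdot> h = ?g s \<cdot> h) \<longrightarrow> (\<exists>!l. l \<in> Hom C x L \<and> e \<cdot> l = h))"
    by (elim bexE)
  note L = L conjunct1[OF Le] and uL = Le[THEN conjunct2, THEN bspec, THEN bspec, THEN mp]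
  have as: "(ArMap F i j u \<cdot> \<pi> i) \<cdot> h = ArMap F i j u \<cdot> (\<pi> i \<cdot> h)"
    if "i \<in> Obj J" "j \<in> Obj J" "u \<in> Hom J i j" "x \<in> Obj C" "h \<in> Hom C x p" for i j u x h
    by (rule comp_assoc[of x p "ObMap F i" "ObMap F j"]) (use that p F in auto)
  have pe: "(\<pi> j \<cdot> e) \<cdot> h = \<pi> j \<cdot> (e \<cdot> h)" if "j \<in> Obj J" "x \<in> Obj C" "h \<in> Hom C x L" for j x h
    by (rule comp_assoc[of x L p "ObMap F j"]) (use that p F L in auto)
  have "is_limit J C F L (\<lambda>j. \<pi> j \<cdot> e)"
    unfolding is_limit_def
  proof (intro conjI allI impI)
    show "is_cone J C F L (\<lambda>j. \<pi> j \<cdot> e)"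
      unfolding is_cone_def
    proof (intro conjI ballI)
      fix i j u assume i: "i \<in> Obj J" "j \<in> Obj J" "u \<in> Hom J i j"
      then have "(ArMap F i j u \<cdot> \<pi> i) \<cdot> e = \<pi> j \<cdot> e" using L(3) by auto
      then show "ArMap F i j u \<cdot> (\<pi> i \<cdot> e) = \<pi> j \<cdot> e" using as[OF i L(1,2)] by simp
    qed (use L p F comp_in_hom[OF L(1) p(1) _ L(2)] in auto)
  next
    fix x h assume "is_cone J C F x h"
    then have x: "x \<in> Obj C" "\<forall>j\<in>Obj J. h j \<in> Hom C x (ObMap F j)"
      "\<And>i j u. \<lbrakk>i \<in> Obj J; j \<in> Obj J; u \<in> Hom J i j\<rbrakk> \<Longrightarrow> ArMap F i j u \<cdot> h i = h j"
      by (auto simp: is_cone_def)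
    obtain l where l: "l \<in> Hom C x p" "\<forall>j\<in>Obj J. \<pi> j \<cdot> l = h j"
      and ul: "\<And>l'. \<lbrakk>l' \<in> Hom C x p; \<forall>j\<in>Obj J. \<pi> j \<cdot> l' = h j\<rbrakk> \<Longrightarrow> l' = l"
      using up[OF x(1,2)] by blast
    have "\<forall>s\<in>?S. ?f s \<cdot> l = ?g s \<cdot> l"
      using as[OF _ _ _ x(1) l(1)] l(2) x(3) by auto
    then obtain k where k: "k \<in> Hom C x L" "e \<cdot> k = l" and uk: "\<And>k'. \<lbrakk>k' \<in> Hom C x L; e \<cdot> k' = l\<rbrakk> \<Longrightarrow> k' = k"
      using uL[OF x(1) l(1)] by blast
    show "\<exists>!k. k \<in> Hom C x L \<and> (\<forall>j\<in>Obj J. (\<pi> j \<cdot> e) \<cdot> k = h j)"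
    proof (rule ex1I[of _ k])
      show "k \<in> Hom C x L \<and> (\<forall>j\<in>Obj J. (\<pi> j \<cdot> e) \<cdot> k = h j)"
        using k l pe[OF _ x(1) k(1)] by simp
      fix k' assume k': "k' \<in> Hom C x L \<and> (\<forall>j\<in>Obj J. (\<pi> j \<cdot> e) \<cdot> k' = h j)"
      then have "\<forall>j\<in>Obj J. \<pi> j \<cdot> (e \<cdot> k') = h j" using pe[OF _ x(1), of _ k'] by simp
      then have "e \<cdot> k' = l" using ul comp_in_hom[OF x(1) L(1) p(1) _ L(2)] k' by blast
      then show "k' = k" using uk k' by blast
    qed
  qed
  then show "\<exists>L l. is_limit J C F L l" by blast
qed


end


section \<open>The category of cocommutative Hopf monoids\<close>

context abelian_symmetric_monoidal_category
begin

abbreviation G :: "(('o, 'm) hopf_data, 'm) category" where "G \<equiv> Hopf_coc M"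

lemma Comp_G [simp]: "Comp G = Comp M" "Ident G A = Ident M (Car A)"
  by (simp_all add: Hopf_coc_def)

lemma hm_Hom: "hm A B f \<Longrightarrow> rw f \<in> Hom G A B"
  using hmD[of A B f] by (simp add: Hopf_coc_Hom rw_in_hom)

lemma G_HomE:
  assumes "A \<in> Obj G" "B \<in> Obj G" "f \<in> Hom G A B"
  obtains f' where "hm A B f'" "f = rw f'"
  using assms Hopf_coc_Hom[of A B f] that[of "mk (Car A) (Car B) f"] by (simp add: Hopf_coc_Obj)

lemma rw_hm_cmp: "\<lbrakk>hm A B f; hm B C g\<rbrakk> \<Longrightarrow> rw g \<cdot> rw f = rw (g \<bullet> f)"
  using hmD[of A B f] hmD[of B C g] by (simp add: rw_cmp)

lemma rw_hm_inject: "\<lbrakk>hm A B f; hm A B g\<rbrakk> \<Longrightarrow> rw f = rw g \<longleftrightarrow> f = g"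
  using hmD[of A B f] hmD[of A B g] by (simp add: rw_inject)

lemma hm_Obj: "hm A B f \<Longrightarrow> A \<in> Obj G" "hm A B f \<Longrightarrow> B \<in> Obj G"
  by (simp_all add: Hopf_coc_Obj hmD)

lemma rw_idt: "hopf A \<Longrightarrow> Ident M (Car A) = rw (idt (Car A))"
  by (simp add: rw_str)

lemma Hopf_coc_category: "category G"
proof
  fix A B C D :: "('o, 'm) hopf_data" and f g h :: 'm
  show "Ident G A \<in> Hom G A A" if "A \<in> Obj G"
    using that hm_Hom[OF hm_idt[of A]] by (simp add: Hopf_coc_Obj rw_str)
  show "g \<cdot>\<^bsub>G\<^esub> f \<in> Hom G A C" if "A \<in> Obj G" "B \<in> Obj G" "C \<in> Obj G" "f \<in> Hom G A B" "g \<in> Hom G B C"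
    by (rule G_HomE[OF that(1,2,4)], rule G_HomE[OF that(2,3,5)]) (auto simp: rw_hm_cmp intro: hm_Hom hm_cmp)
  show "Ident G B \<cdot>\<^bsub>G\<^esub> f = f" if "A \<in> Obj G" "B \<in> Obj G" "f \<in> Hom G A B"
    using that comp_ident_left[of "Car A" "Car B" f] by (simp add: Hopf_coc_Obj Hopf_coc_Hom)
  show "f \<cdot>\<^bsub>G\<^esub> Ident G A = f" if "A \<in> Obj G" "B \<in> Obj G" "f \<in> Hom G A B"
    using that comp_ident_right[of "Car A" "Car B" f] by (simp add: Hopf_coc_Obj Hopf_coc_Hom)
  show "h \<cdot>\<^bsub>G\<^esub> g \<cdot>\<^bsub>G\<^esub> f = h \<cdot>\<^bsub>G\<^esub> (g \<cdot>\<^bsub>G\<^esub> f)"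
    if "A \<in> Obj G" "B \<in> Obj G" "C \<in> Obj G" "D \<in> Obj G" "f \<in> Hom G A B" "g \<in> Hom G B C" "h \<in> Hom G C D"
    using that comp_assoc[of "Car A" "Car B" "Car C" "Car D" f g h] by (simp add: Hopf_coc_Obj Hopf_coc_Hom)
qed

lemma zero_object_unith: "is_zero_object G unith"
  unfolding is_zero_object_def is_initial_def is_terminal_def
proof (intro conjI ballI)
  fix A assume A: "A \<in> Obj G"
  then have a: "hopf A" by (simp add: Hopf_coc_Obj)
  have u: "unith \<in> Obj G" by (simp add: Hopf_coc_Obj)
  show "\<exists>!f. f \<in> Hom G unith A"
  proof (rule ex1I[of _ "rw (un A)"])
    show "rw (un A) \<in> Hom G unith A" by (rule hm_Hom) (simp add: hm_from_unith_iff a)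
    show "f = rw (un A)" if "f \<in> Hom G unith A" for f
      by (rule G_HomE[OF u A that]) (simp add: hm_from_unith_iff a)
  qed
  show "\<exists>!f. f \<in> Hom G A unith"
  proof (rule ex1I[of _ "rw (ep A)"])
    show "rw (ep A) \<in> Hom G A unith" by (rule hm_Hom) (simp add: hm_unith_iff a)
    show "f = rw (ep A)" if "f \<in> Hom G A unith" for f
      by (rule G_HomE[OF A u that]) (simp add: hm_unith_iff a)
  qed
qed (simp_all add: Hopf_coc_Obj)

text \<open>Initiality of the intermediate zero object forces the second factor to be a neutral
  element, which absorbs the first factor. Conversely, \<open>e1\<close> factors through
  \<open>unith\<close> by definition.\<close>

lemma zero_mor_iff:
  assumes f: "hm A B f"
  shows "is_zero_mor G A B (rw f) \<longleftrightarrow> f = e1 A B"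
proof
  note [simp] = hmD(1,2,5-7)[OF f]
  assume "is_zero_mor G A B (rw f)"
  then obtain z g h where z: "is_zero_object G z" and g: "g \<in> Hom G A z" "h \<in> Hom G z B" "rw f = h \<cdot> g"
    by (auto simp: is_zero_mor_def)
  have zO: "z \<in> Obj G" using z by (simp add: is_zero_object_def is_terminal_def)
  then have hz: "hopf z" by (simp add: Hopf_coc_Obj)
  obtain g' where g': "hm A z g'" "g = rw g'" using G_HomE[OF hm_Obj(1)[OF f] zO g(1)] .
  have "rw (e1 z B) \<in> Hom G z B" by (rule hm_Hom[OF hm_e1_zero]) (simp_all add: hz)
  then have "h = rw (e1 z B)"
    using z g(2) hm_Obj(2)[OF f] unfolding is_zero_object_def is_initial_def by blast
  then have "rw f = rw (e1 z B \<bullet> g')"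
    using g(3) g' rw_hm_cmp[OF g'(1) hm_e1_zero[of z B]] hz by simp
  then have "rw f = rw (e1 A B)" using e1_cmp[OF hmD(3)[OF g'(1)], of B] by simp
  then show "f = e1 A B" using rw_hm_inject[OF f hm_e1_zero] by simp
next
  assume f': "f = e1 A B"
  have h: "hopf A" "hopf B" using hmD[OF f] by simp_all
  have "rw f = rw (un B) \<cdot> rw (ep A)"
    using rw_hm_cmp[OF hm_ep[OF h(1)] hm_un_unith[OF h(2)]] by (simp add: f' e1_def)
  then show "is_zero_mor G A B (rw f)"
    unfolding is_zero_mor_def using zero_object_unith hm_Hom[OF hm_ep[OF h(1)]] hm_Hom[OF hm_un_unith[OF h(2)]] by auto
qed

lemma G_products:
  assumes "A \<in> Obj G" "B \<in> Obj G"
  shows "\<exists>p\<in>Obj G. \<exists>f\<in>Hom G p A. \<exists>g\<in>Hom G p B.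
      \<forall>x\<in>Obj G. \<forall>h\<in>Hom G x A. \<forall>k\<in>Hom G x B. \<exists>!l. l \<in> Hom G x p \<and> f \<cdot>\<^bsub>G\<^esub> l = h \<and> g \<cdot>\<^bsub>G\<^esub> l = k"
proof -
  have [simp]: "hopf A" "hopf B" using assms by (simp_all add: Hopf_coc_Obj)
  have P: "prodh A B \<in> Obj G" by (simp add: Hopf_coc_Obj)
  show ?thesis
  proof (rule bexI[OF _ P], rule bexI[OF _ hm_Hom[OF hm_p1]], rule bexI[OF _ hm_Hom[OF hm_p2]], intro ballI)
    fix X h k assume X: "X \<in> Obj G" and hk: "h \<in> Hom G X A" "k \<in> Hom G X B"
    obtain h' k' where h': "hm X A h'" "h = rw h'" and k': "hm X B k'" "k = rw k'"
      using G_HomE[OF X assms(1) hk(1)] G_HomE[OF X assms(2) hk(2)] by metis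
    note hp = hm_pair[OF h'(1) k'(1)]
    have p: "p1 A B \<bullet> pair X h' k' = h'" "p2 A B \<bullet> pair X h' k' = k'"
      using p1_pair[OF hmD(3)[OF k'(1)], of h' A] p2_pair[OF hmD(3)[OF h'(1)], of k' B] hmD[OF h'(1)] hmD[OF k'(1)] by simp_all
    show "\<exists>!l. l \<in> Hom G X (prodh A B) \<and> rw (p1 A B) \<cdot>\<^bsub>G\<^esub> l = h \<and> rw (p2 A B) \<cdot>\<^bsub>G\<^esub> l = k"
    proof (rule ex1I[of _ "rw (pair X h' k')"])
      show "rw (pair X h' k') \<in> Hom G X (prodh A B) \<and> rw (p1 A B) \<cdot>\<^bsub>G\<^esub> rw (pair X h' k') = h \<and> rw (p2 A B) \<cdot>\<^bsub>G\<^esub> rw (pair X h' k') = k"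
        using hm_Hom[OF hp] rw_hm_cmp[OF hp hm_p1] rw_hm_cmp[OF hp hm_p2] p h' k' by simp
      fix l assume l: "l \<in> Hom G X (prodh A B) \<and> rw (p1 A B) \<cdot>\<^bsub>G\<^esub> l = h \<and> rw (p2 A B) \<cdot>\<^bsub>G\<^esub> l = k"
      obtain l' where l': "hm X (prodh A B) l'" "l = rw l'" using G_HomE[OF X P] l by blast
      have "p1 A B \<bullet> l' = h'" "p2 A B \<bullet> l' = k'"
        using l l' h' k' rw_hm_cmp[OF l'(1) hm_p1] rw_hm_cmp[OF l'(1) hm_p2]
          rw_hm_inject[OF hm_cmp[OF l'(1) hm_p1] h'(1)] rw_hm_inject[OF hm_cmp[OF l'(1) hm_p2] k'(1)] by simp_all
      then have "l' = pair X h' k'"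
        using pair_eta[of X A B l'] hmD(3)[OF l'(1)] by (simp add: cm_prodh)
      then show "l = rw (pair X h' k')" using l' by simp
    qed
  qed simp_all
qed

lemma G_equalizers:
  assumes "A \<in> Obj G" "B \<in> Obj G" "f \<in> Hom G A B" "g \<in> Hom G A B"
  shows "\<exists>E e. is_equalizer G E e A B f g"
proof -
  obtain f' g' where f: "hm A B f'" "f = rw f'" and g: "hm A B g'" "g = rw g'"
    using G_HomE[OF assms(1,2,3)] G_HomE[OF assms(1,2,4)] by metis
  obtain E e where E: "heq E e A B f' g'" using ex_heq[OF f(1) g(1)] by blast
  note e = heqD(3)[OF E]
  have "is_equalizer G E (rw e) A B f g"
    unfolding is_equalizer_def
  proof (intro conjI ballI impI)
    show "f \<cdot>\<^bsub>G\<^esub> rw e = g \<cdot>\<^bsub>G\<^esub> rw e"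
      using heqD(6)[OF E] f g rw_hm_cmp[OF e f(1)] rw_hm_cmp[OF e g(1)] by simp
  next
    fix X h assume X: "X \<in> Obj G" and h: "h \<in> Hom G X A" and fg: "f \<cdot>\<^bsub>G\<^esub> h = g \<cdot>\<^bsub>G\<^esub> h"
    obtain h' where h': "hm X A h'" "h = rw h'" using G_HomE[OF X assms(1) h] .
    have "f' \<bullet> h' = g' \<bullet> h'"
      using fg f g h' rw_hm_cmp[OF h'(1) f(1)] rw_hm_cmp[OF h'(1) g(1)]
        rw_hm_inject[OF hm_cmp[OF h'(1) f(1)] hm_cmp[OF h'(1) g(1)]] by simp
    then obtain l where l: "cm X E l" "e \<bullet> l = h'" by (rule heq_factor[OF E hmD(3)[OF h'(1)]])
    have hl: "hm X E l"
      by (rule hm_factor_mono[OF e heqD(5)[OF E]]) (use h' l cmD[OF l(1)] hmD(1)[OF h'(1)] in simp_all)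
    show "\<exists>!l. l \<in> Hom G X E \<and> rw e \<cdot>\<^bsub>G\<^esub> l = h"
    proof (rule ex1I[of _ "rw l"])
      show "rw l \<in> Hom G X E \<and> rw e \<cdot>\<^bsub>G\<^esub> rw l = h"
        using hm_Hom[OF hl] rw_hm_cmp[OF hl e] l h' by simp
      fix k assume k: "k \<in> Hom G X E \<and> rw e \<cdot>\<^bsub>G\<^esub> k = h"
      obtain k' where k': "hm X E k'" "k = rw k'" using G_HomE[OF X hm_Obj(1)[OF e]] k by blast
      have "e \<bullet> k' = e \<bullet> l"
        using k k' h' l rw_hm_cmp[OF k'(1) e] rw_hm_inject[OF hm_cmp[OF k'(1) e] h'(1)] by simp
      then have "k' = l"
        by (rule monicD[OF heqD(5)[OF E]]) (use hmD[OF k'(1)] hmD[OF hl] hmD[OF e] in simp_all)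
      then show "k = rw l" using k' by simp
    qed
  qed (use assms e hm_Obj[OF e] hm_Hom[OF e] in simp_all)
  then show ?thesis by blast
qed

lemma G_finite_limits: "has_finite_limits G"
proof -
  interpret G: category G by (rule Hopf_coc_category)
  show ?thesis
    by (rule G.finite_limits_from_products_equalizers[OF _ G_products G_equalizers])
      (use zero_object_unith in \<open>auto simp: is_zero_object_def\<close>)
qed

text \<open>By \<open>epic_coequalizer_of_kernel_pair\<close> the universal property holds in
  \<open>M\<close>, and the factorizations it provides are Hopf morphisms by
  \<open>hm_factor_epi\<close>.\<close>

lemma epic_regular_epi:
  assumes fc: "faithful_coflatness M" and f: "hm A B f" and ef: "epic f"
  shows "is_regular_epi G A B (rw f)"
proof -
  note [simp] = hmD(1,2,5-7)[OF f]
  have "\<exists>P e. heq P e (prodh A A) B (f \<bullet> p1 A A) (f \<bullet> p2 A A)"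
    by (rule ex_heq; rule hm_cmp[OF _ f]; simp add: hm_p1 hm_p2)
  then obtain P e where E: "heq P e (prodh A A) B (f \<bullet> p1 A A) (f \<bullet> p2 A A)" by blast
  let ?r = "p1 A A \<bullet> e" and ?s = "p2 A A \<bullet> e"
  note rs = heq_projections[OF E hmD(1)[OF f] hmD(1)[OF f]]
  have q: "iscoeq f ?r ?s" by (rule epic_coequalizer_of_kernel_pair[OF fc f ef E])
  have "is_coequalizer G B (rw f) P A (rw ?r) (rw ?s)"
    unfolding is_coequalizer_def
  proof (intro conjI ballI impI)
    show "rw f \<cdot>\<^bsub>G\<^esub> rw ?r = rw f \<cdot>\<^bsub>G\<^esub> rw ?s"
      using iscoeqD(7)[OF q] rw_hm_cmp[OF rs(1) f] rw_hm_cmp[OF rs(2) f] by simp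
  next
    fix X h assume X: "X \<in> Obj G" and h: "h \<in> Hom G A X" and e: "h \<cdot>\<^bsub>G\<^esub> rw ?r = h \<cdot>\<^bsub>G\<^esub> rw ?s"
    obtain h' where h': "hm A X h'" "h = rw h'" using G_HomE[OF hm_Obj(1)[OF f] X h] .
    have "h' \<bullet> ?r = h' \<bullet> ?s"
      using e h' rw_hm_cmp[OF rs(1) h'(1)] rw_hm_cmp[OF rs(2) h'(1)]
        rw_hm_inject[OF hm_cmp[OF rs(1) h'(1)] hm_cmp[OF rs(2) h'(1)]] by simp
    then obtain l where l: "arr l" "trg l = trg h'" "src l = trg f" "l \<bullet> f = h'"
      using iscoeqE[OF q, of h'] hmD[OF h'(1)] by auto
    have hl: "hm B X l"
      by (rule hm_factor_epi[OF f ef]) (use h' l hmD[OF h'(1)] in simp_all)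
    show "\<exists>!l. l \<in> Hom G B X \<and> l \<cdot>\<^bsub>G\<^esub> rw f = h"
    proof (rule ex1I[of _ "rw l"])
      show "rw l \<in> Hom G B X \<and> rw l \<cdot>\<^bsub>G\<^esub> rw f = h"
        using hm_Hom[OF hl] rw_hm_cmp[OF f hl] l h' by simp
      fix k assume k: "k \<in> Hom G B X \<and> k \<cdot>\<^bsub>G\<^esub> rw f = h"
      obtain k' where k': "hm B X k'" "k = rw k'" using G_HomE[OF hm_Obj(2)[OF f] X] k by blast
      have "k' \<bullet> f = l \<bullet> f"
        using k k' h' l rw_hm_cmp[OF f k'(1)] rw_hm_inject[OF hm_cmp[OF f k'(1)] h'(1)] by simp
      then have "k' = l"
        by (rule epicD[OF ef]) (use hmD[OF k'(1)] hmD[OF hl] in simp_all)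
      then show "k = rw l" using k' by simp
    qed
  qed (use f rs in \<open>auto intro: hm_Obj hm_Hom\<close>)
  then show ?thesis unfolding is_regular_epi_def by blast
qed

text \<open>Write \<open>f = m \<bullet> e\<close> as in \<open>hm_image\<close>. Since
  \<open>m\<close> is monic, \<open>e\<close> also coequalizes the pair and so factors as
  \<open>t' \<bullet> f\<close>. Uniqueness gives \<open>m \<bullet> t' = idt (Car B)\<close>, hence
  \<open>m\<close> is an epimorphism.\<close>

lemma regular_epi_epic:
  fixes A B :: "('o, 'm) hopf_data"
  assumes f: "hm A B f" and reg: "is_regular_epi G A B (rw f)"
  shows "epic f"
proof -
  note [simp] = hmD(1,2,5-7)[OF f]
  obtain R g h where q: "is_coequalizer G B (rw f) R A g h" using reg by (auto simp: is_regular_epi_def)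
  then have R: "R \<in> Obj G" "g \<in> Hom G R A" "h \<in> Hom G R A" by (simp_all add: is_coequalizer_def)
  obtain g' h' where g': "hm R A g'" "g = rw g'" and h': "hm R A h'" "h = rw h'"
    using G_HomE[OF R(1) hm_Obj(1)[OF f] R(2)] G_HomE[OF R(1) hm_Obj(1)[OF f] R(3)] by metis
  have univ: "\<exists>!l. l \<in> Hom G B X \<and> l \<cdot> rw f = rw k" if k: "hm A X k" and e: "k \<bullet> g' = k \<bullet> h'" for X :: "('o, 'm) hopf_data" and k
  proof -
    have "rw k \<cdot>\<^bsub>G\<^esub> g = rw k \<cdot>\<^bsub>G\<^esub> h"
      using e g' h' rw_hm_cmp[OF g'(1) k] rw_hm_cmp[OF h'(1) k] by simp
    then show ?thesis using q hm_Hom[OF k] hm_Obj(2)[OF k] unfolding is_coequalizer_def by simp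
  qed
  have fgh: "f \<bullet> g' = f \<bullet> h'"
  proof -
    have "rw f \<cdot> g = rw f \<cdot> h" using q by (simp add: is_coequalizer_def)
    then show ?thesis
      using g' h' rw_hm_cmp[OF g'(1) f] rw_hm_cmp[OF h'(1) f] rw_hm_inject[OF hm_cmp[OF g'(1) f] hm_cmp[OF h'(1) f]] by simp
  qed
  obtain I :: "('o, 'm) hopf_data" and e m where I: "hm A I e" "hm I B m" "epic e" "monic m" "f = m \<bullet> e"
    using hm_image[OF f] .
  note [simp] = hmD(2,5-7)[OF I(1)] hmD(5-7)[OF I(2)]
  have "m \<bullet> e \<bullet> g' = m \<bullet> e \<bullet> h'" using fgh I(5) by simp
  then have "e \<bullet> g' = e \<bullet> h'"
    by (rule monicD[OF I(4)]) (use hmD[OF g'(1)] hmD[OF h'(1)] in simp_all)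
  then obtain t where "t \<in> Hom G B I" "t \<cdot> rw f = rw e" using univ[OF I(1)] by blast
  then obtain t' where t': "hm B I t'" "rw t' \<cdot> rw f = rw e"
    using G_HomE[OF hm_Obj(2)[OF f] hm_Obj(2)[OF I(1)]] by metis
  have tf: "t' \<bullet> f = e"
    using t' rw_hm_cmp[OF f t'(1)] rw_hm_inject[OF hm_cmp[OF f t'(1)] I(1)] by simp
  have mt: "hm B B (m \<bullet> t')" by (rule hm_cmp[OF t'(1) I(2)])
  have "rw (m \<bullet> t') \<cdot> rw f = rw f"
    using rw_hm_cmp[OF f mt] tf I(5) by simp
  moreover have "rw (idt (Car B)) \<cdot> rw f = rw f"
    using rw_hm_cmp[OF f hm_idt[of B]] by simp
  ultimately have "rw (m \<bullet> t') = rw (idt (Car B))"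
    using univ[OF f fgh] hm_Hom[OF mt] hm_Hom[OF hm_idt[of B]] by auto
  then have "m \<bullet> t' = idt (Car B)" using rw_hm_inject[OF mt hm_idt] by simp
  then have "epic m" by (intro epicI_section[of m t']) simp_all
  then show ?thesis unfolding I(5) using epi_cmp[OF I(3)] by simp
qed

lemma monic_is_mono:
  assumes m: "hm A B m" and mm: "monic m"
  shows "is_mono G A B (rw m)"
  unfolding is_mono_def
proof (intro conjI ballI impI)
  fix X g h assume X: "X \<in> Obj G" and gh: "g \<in> Hom G X A" "h \<in> Hom G X A" and e: "rw m \<cdot>\<^bsub>G\<^esub> g = rw m \<cdot>\<^bsub>G\<^esub> h"
  obtain g' h' where g': "hm X A g'" "g = rw g'" and h': "hm X A h'" "h = rw h'"
    using G_HomE[OF X hm_Obj(1)[OF m] gh(1)] G_HomE[OF X hm_Obj(1)[OF m] gh(2)] by metis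
  have "m \<bullet> g' = m \<bullet> h'"
    using e g' h' rw_hm_cmp[OF g'(1) m] rw_hm_cmp[OF h'(1) m] rw_hm_inject[OF hm_cmp[OF g'(1) m] hm_cmp[OF h'(1) m]] by simp
  then have "g' = h'"
    by (rule monicD[OF mm]) (use hmD[OF g'(1)] hmD[OF h'(1)] hmD[OF m] in simp_all)
  then show "g = h" using g' h' by simp
qed (rule hm_Hom[OF m])

lemma G_regular: assumes fc: "faithful_coflatness M" shows "is_regular_category G"
  unfolding is_regular_category_def
proof (intro conjI ballI allI impI)
  show "category G" by (rule Hopf_coc_category)
  show "has_finite_limits G" by (rule G_finite_limits)
next
  fix A B f assume o: "A \<in> Obj G" "B \<in> Obj G" "f \<in> Hom G A B"
  obtain f' where f: "hm A B f'" "f = rw f'" using G_HomE[OF o] .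
  obtain I :: "('o, 'm) hopf_data" and e m where I: "hm A I e" "hm I B m" "epic e" "monic m" "f' = m \<bullet> e"
    using hm_image[OF f(1)] .
  show "\<exists>c\<in>Obj G. \<exists>e m. is_regular_epi G A c e \<and> is_mono G c B m \<and> f = m \<cdot>\<^bsub>G\<^esub> e"
    using epic_regular_epi[OF fc I(1,3)] monic_is_mono[OF I(2,4)] I(5) f rw_hm_cmp[OF I(1,2)] hm_Obj(2)[OF I(1)]
    by (intro bexI[of _ I] exI[of _ "rw e"] exI[of _ "rw m"]) simp_all
next
  fix P p q A B C f g assume pb: "is_pullback G P p q A B C f g \<and> is_regular_epi G A C f"
  then have o: "P \<in> Obj G" "A \<in> Obj G" "B \<in> Obj G" "C \<in> Obj G" "f \<in> Hom G A C" "g \<in> Hom G B C" "q \<in> Hom G P B"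
    by (simp_all add: is_pullback_def)
  obtain f' g' q' where f: "hm A C f'" "f = rw f'" and g: "hm B C g'" "g = rw g'" and q: "hm P B q'" "q = rw q'"
    using G_HomE[OF o(2,4,5)] G_HomE[OF o(3,4,6)] G_HomE[OF o(1,3,7)] by metis
  have h: "hopf A" "hopf B" using o by (simp_all add: Hopf_coc_Obj)
  have ef: "epic f'" using regular_epi_epic[OF f(1)] pb f by simp
  have "\<exists>E e. heq E e (prodh B A) C (g' \<bullet> p1 B A) (f' \<bullet> p2 B A)"
    by (rule ex_heq) (rule hm_cmp[OF hm_p1 g(1)] hm_cmp[OF hm_p2 f(1)]; simp add: h)+
  then obtain E e where E: "heq E e (prodh B A) C (g' \<bullet> p1 B A) (f' \<bullet> p2 B A)" by blast
  let ?x = "p1 B A \<bullet> e" and ?y = "p2 B A \<bullet> e"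
  note xy = heq_projections[OF E h(2,1)]
  have ex: "epic ?x" by (rule pullback_epi[OF fc f(1) ef g(1) E])
  have "f \<cdot>\<^bsub>G\<^esub> rw ?y = g \<cdot>\<^bsub>G\<^esub> rw ?x"
    using heqD(6)[OF E] f g rw_hm_cmp[OF xy(1) g(1)] rw_hm_cmp[OF xy(2) f(1)] by simp
  \<comment> \<open>The constructed pullback maps to the given one, so the epimorphism
    \<open>?x\<close> factors through \<open>q\<close>, which is then an epimorphism in
    \<open>M\<close> as well.\<close>
  then obtain l where l: "l \<in> Hom G E P" "q \<cdot> l = rw ?x"
    using pb hm_Obj(1)[OF xy(1)] hm_Hom[OF xy(1)] hm_Hom[OF xy(2)] unfolding is_pullback_def by (metis Comp_G(1))
  obtain l' where l': "hm E P l'" "l = rw l'" using G_HomE[OF hm_Obj(1)[OF xy(1)] o(1) l(1)] .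
  have "q' \<bullet> l' = ?x"
    using l l' q rw_hm_cmp[OF l'(1) q(1)] rw_hm_inject[OF hm_cmp[OF l'(1) q(1)] xy(1)] by simp
  then have "epic q'" using epi_cancel_right[of q' l'] ex by simp
  then show "is_regular_epi G P B q" using epic_regular_epi[OF fc q(1)] q by simp
qed

section \<open>Effectiveness of equivalence relations\<close>

lemma G_exact: assumes fc: "faithful_coflatness M" and ff: "faithful_flatness M" shows "is_exact_category G"
  unfolding is_exact_category_def
proof (intro conjI allI impI)
  show "is_regular_category G" by (rule G_regular[OF fc])
next
  fix R r s A assume er: "is_equivalence_relation G R r s A"
  then have o: "R \<in> Obj G" "A \<in> Obj G" "r \<in> Hom G R A" "s \<in> Hom G R A" by (simp_all add: is_equivalence_relation_def)
  obtain d where d: "d \<in> Hom G A R" "r \<cdot> d = Ident M (Car A)" "s \<cdot> d = Ident M (Car A)"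
    using er by (auto simp: is_equivalence_relation_def)
  obtain r' s' d' where r: "hm R A r'" "r = rw r'" and s: "hm R A s'" "s = rw s'" and d': "hm A R d'" "d = rw d'"
    using G_HomE[OF o(1,2,3)] G_HomE[OF o(1,2,4)] G_HomE[OF o(2,1) d(1)] by metis
  have h: "hopf A" "hopf R" using o by (simp_all add: Hopf_coc_Obj)
  have rd: "r' \<bullet> d' = idt (Car A)" "s' \<bullet> d' = idt (Car A)"
    using d r s d' rw_hm_cmp[OF d'(1) r(1)] rw_hm_cmp[OF d'(1) s(1)] rw_hm_inject[OF hm_cmp[OF d'(1) r(1)] hm_idt]
      rw_hm_inject[OF hm_cmp[OF d'(1) s(1)] hm_idt] h by (simp_all add: rw_idt)
  have jm: "g = k" if gk: "hm X R g" "hm X R k" "r' \<bullet> g = r' \<bullet> k" "s' \<bullet> g = s' \<bullet> k" for X :: "('o, 'm) hopf_data" and g k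
  proof -
    have "r \<cdot>\<^bsub>G\<^esub> rw g = r \<cdot>\<^bsub>G\<^esub> rw k \<and> s \<cdot>\<^bsub>G\<^esub> rw g = s \<cdot>\<^bsub>G\<^esub> rw k"
      using gk r s rw_hm_cmp[OF gk(1) r(1)] rw_hm_cmp[OF gk(1) s(1)] rw_hm_cmp[OF gk(2) r(1)] rw_hm_cmp[OF gk(2) s(1)] by simp
    then have "rw g = rw k"
      using er hm_Obj(1)[OF gk(1)] hm_Hom[OF gk(1)] hm_Hom[OF gk(2)] unfolding is_equivalence_relation_def by blast
    then show ?thesis using rw_hm_inject[OF gk(1,2)] by simp
  qed
  obtain Q :: "('o, 'm) hopf_data" and q where q: "hm A Q q" "iscoeq q r' s'"
    using reflexive_coequalizer[OF r(1) s(1) d'(1) rd] .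
  have eff: "monic (pair R r' s')"
    by (rule reflexive_relation_effective(1)[OF fc ff r(1) s(1) d'(1) rd _ q]) (erule (3) jm)
  have eff': "\<exists>l. cm X R l \<and> r' \<bullet> l = a \<and> s' \<bullet> l = b"
    if "cm X A a" "cm X A b" "q \<bullet> a = q \<bullet> b" for X :: "('o, 'm) hopf_data" and a b
    by (rule reflexive_relation_effective(2)[OF fc ff r(1) s(1) d'(1) rd _ q that]) (erule (3) jm)
  have "is_pullback G R r s A A Q (rw q) (rw q)"
    unfolding is_pullback_def
  proof (intro conjI ballI impI)
    show "rw q \<cdot>\<^bsub>G\<^esub> r = rw q \<cdot>\<^bsub>G\<^esub> s"
      using r s iscoeqD(7)[OF q(2)] rw_hm_cmp[OF r(1) q(1)] rw_hm_cmp[OF s(1) q(1)] by simp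
  next
    fix X a b assume X: "X \<in> Obj G" and ab: "a \<in> Hom G X A" "b \<in> Hom G X A" and e: "rw q \<cdot>\<^bsub>G\<^esub> a = rw q \<cdot>\<^bsub>G\<^esub> b"
    obtain a' b' where a: "hm X A a'" "a = rw a'" and b: "hm X A b'" "b = rw b'"
      using G_HomE[OF X o(2) ab(1)] G_HomE[OF X o(2) ab(2)] by metis
    have "q \<bullet> a' = q \<bullet> b'"
      using e a b rw_hm_cmp[OF a(1) q(1)] rw_hm_cmp[OF b(1) q(1)] rw_hm_inject[OF hm_cmp[OF a(1) q(1)] hm_cmp[OF b(1) q(1)]] by simp
    then obtain l where l: "cm X R l" "r' \<bullet> l = a'" "s' \<bullet> l = b'"
      using eff'[OF hmD(3)[OF a(1)] hmD(3)[OF b(1)]] by blast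
    have "pair R r' s' \<bullet> l = pair X a' b'"
      using pair_cmp[OF l(1), of r' s'] hmD[OF r(1)] hmD[OF s(1)] l by simp
    then have hl: "hm X R l"
      by (intro hm_factor_mono[OF hm_pair[OF r(1) s(1)] eff]) (use hm_pair[OF a(1) b(1)] hmD(1)[OF a(1)] cmD[OF l(1)] in simp_all)
    show "\<exists>!l. l \<in> Hom G X R \<and> r \<cdot>\<^bsub>G\<^esub> l = a \<and> s \<cdot>\<^bsub>G\<^esub> l = b"
    proof (rule ex1I[of _ "rw l"])
      show "rw l \<in> Hom G X R \<and> r \<cdot>\<^bsub>G\<^esub> rw l = a \<and> s \<cdot>\<^bsub>G\<^esub> rw l = b"
        using hm_Hom[OF hl] rw_hm_cmp[OF hl r(1)] rw_hm_cmp[OF hl s(1)] l a b r s by simp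
      fix k assume k: "k \<in> Hom G X R \<and> r \<cdot>\<^bsub>G\<^esub> k = a \<and> s \<cdot>\<^bsub>G\<^esub> k = b"
      obtain k' where k': "hm X R k'" "k = rw k'" using G_HomE[OF X o(1)] k by blast
      have "r' \<bullet> k' = a'" "s' \<bullet> k' = b'"
        using k k' a b r s rw_hm_cmp[OF k'(1) r(1)] rw_hm_cmp[OF k'(1) s(1)]
          rw_hm_inject[OF hm_cmp[OF k'(1) r(1)] a(1)] rw_hm_inject[OF hm_cmp[OF k'(1) s(1)] b(1)] by simp_all
      then have "k' = l" using jm[OF k'(1) hl] l by simp
      then show "k = rw l" using k' by simp
    qed
  qed (use o q in \<open>auto intro: hm_Obj hm_Hom\<close>)
  then show "\<exists>y f. is_pullback G R r s A A y f f" by blast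
qed

text \<open>Comparison with the kernel constructed by \<open>heq\<close> shows that a kernel among
  Hopf monoids is monic in \<open>M\<close> and universal for all comonoid morphisms. Elements such
  as \<open>k h^{-1}\<close> need the latter.\<close>

lemma kernel_universal:
  fixes A B K :: "('o, 'm) hopf_data"
  assumes f: "hm A B f" and k: "hm K A k" and ker: "is_kernel G K (rw k) A B (rw f)"
  shows "monic k" and "f \<bullet> k = e1 K B"
    and "\<lbrakk>cm X A h; f \<bullet> h = e1 X B\<rbrakk> \<Longrightarrow> \<exists>h'. cm X K h' \<and> k \<bullet> h' = h"
proof -
  note [simp] = hmD(1,2,5-7)[OF f] hmD(1,5-7)[OF k]
  have "is_zero_mor G K B (rw f \<cdot> rw k)" using ker by (simp add: is_kernel_def)
  then show fk: "f \<bullet> k = e1 K B"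
    using zero_mor_iff[OF hm_cmp[OF k f]] rw_hm_cmp[OF k f] by simp
  obtain L l where L: "heq L l A B f (e1 A B)" using ex_heq[OF f hm_e1_zero] by fastforce
  note hl = heqD(3)[OF L]
  note [simp] = hmD(1,5-7)[OF hl]
  have "f \<bullet> l = e1 L B" using heqD(6)[OF L] e1_cmp[OF hmD(3)[OF hl], of B] by simp
  then have "is_zero_mor G L B (rw f \<cdot> rw l)"
    using zero_mor_iff[OF hm_cmp[OF hl f]] rw_hm_cmp[OF hl f] by simp
  then have "\<exists>!c. c \<in> Hom G L K \<and> rw k \<cdot> c = rw l"
    using ker hm_Obj(1)[OF hl] hm_Hom[OF hl] unfolding is_kernel_def by simp
  then obtain c where "c \<in> Hom G L K" "rw k \<cdot> c = rw l" by blast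
  then obtain c where c: "hm L K c" "rw k \<cdot> rw c = rw l"
    using G_HomE[OF hm_Obj(1)[OF hl] hm_Obj(1)[OF k]] by metis
  have kc: "k \<bullet> c = l" using c rw_hm_cmp[OF c(1) k] rw_hm_inject[OF hm_cmp[OF c(1) k] hl] by simp
  have "f \<bullet> k = e1 A B \<bullet> k" using fk e1_cmp[OF hmD(3)[OF k], of B] by simp
  then obtain b where b: "cm K L b" "l \<bullet> b = k" by (rule heq_factor[OF L hmD(3)[OF k]])
  have hb: "hm K L b"
    by (rule hm_factor_mono[OF hl heqD(5)[OF L]]) (use k b cmD[OF b(1)] in simp_all)
  have cb: "hm K K (c \<bullet> b)" by (rule hm_cmp[OF hb c(1)])
  have "is_zero_mor G K B (rw f \<cdot> rw k)" using ker by (simp add: is_kernel_def)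
  then have u: "\<exists>!h. h \<in> Hom G K K \<and> rw k \<cdot> h = rw k"
    using ker hm_Obj(1)[OF k] hm_Hom[OF k] unfolding is_kernel_def by simp
  have "k \<bullet> c \<bullet> b = k" using kc[THEN reduce, of b] b by simp
  then have "rw k \<cdot> rw (c \<bullet> b) = rw k" "rw k \<cdot> rw (idt (Car K)) = rw k"
    using rw_hm_cmp[OF cb k] rw_hm_cmp[OF hm_idt k] by simp_all
  then have "rw (c \<bullet> b) = rw (idt (Car K))" using u hm_Hom[OF cb] hm_Hom[OF hm_idt[of K]] by auto
  then have "c \<bullet> b = idt (Car K)" using rw_hm_inject[OF cb hm_idt] by simp
  then have "monic b" using monicI_retraction[of c b] hmD[OF hb] by simp
  then have "monic (l \<bullet> b)" by (rule mono_cmp[OF _ heqD(5)[OF L]]) (use hmD[OF hb] in simp)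
  then show "monic k" using b by simp
  assume h: "cm X A h" and fh: "f \<bullet> h = e1 X B"
  have "f \<bullet> h = e1 A B \<bullet> h" using fh e1_cmp[OF h, of B] by simp
  then obtain h0 where h0: "cm X L h0" "l \<bullet> h0 = h" by (rule heq_factor[OF L h])
  show "\<exists>h'. cm X K h' \<and> k \<bullet> h' = h"
    using cm_cmp[OF h0(1) hmD(3)[OF c(1)]] kc[THEN reduce, of h0] h0 by (intro exI[of _ "c \<bullet> h0"]) simp
qed

lemma G_isoE:
  fixes A B :: "('o, 'm) hopf_data"
  assumes f: "hm A B f" and i: "is_iso G A B (rw f)"
  obtains g where "hm B A g" "g \<bullet> f = idt (Car A)" "f \<bullet> g = idt (Car B)"
proof -
  have h: "hopf A" "hopf B" using hmD[OF f] by simp_all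
  obtain g where g: "g \<in> Hom G B A" "g \<cdot> rw f = rw (idt (Car A))" "rw f \<cdot> g = rw (idt (Car B))"
    using i h by (auto simp: is_iso_def is_inverse_def rw_idt)
  obtain g' where g': "hm B A g'" "g = rw g'" using G_HomE[OF hm_Obj(2)[OF f] hm_Obj(1)[OF f] g(1)] .
  show ?thesis
    using that[OF g'(1)] g g' rw_hm_cmp[OF f g'(1)] rw_hm_cmp[OF g'(1) f] rw_hm_inject[OF hm_cmp[OF f g'(1)] hm_idt[OF h(1)]]
      rw_hm_inject[OF hm_cmp[OF g'(1) f] hm_idt[OF h(2)]] by simp
qed

text \<open>An element \<open>a\<close> of \<open>A'\<close> is \<open>(a y^{-1}) y\<close> with
  \<open>y = s' (f' a)\<close>, where the first factor lies in the kernel. The inverse of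
  \<open>v\<close> applies the inverses of \<open>u\<close> and \<open>w\<close> to the two factors.
  As constructed it is a comonoid morphism; being inverse to a Hopf morphism, it is one itself by
  \<open>hm_inverse\<close>.\<close>

lemma split_short_five:
  fixes A B K A' B' K' :: "('o, 'm) hopf_data"
  assumes f: "hm A B f" and s: "hm B A s" and fs: "f \<bullet> s = idt (Car B)" and k: "hm K A k" and ker: "is_kernel G K (rw k) A B (rw f)"
    and f': "hm A' B' f'" and s': "hm B' A' s'" and fs': "f' \<bullet> s' = idt (Car B')" and k': "hm K' A' k'" and ker': "is_kernel G K' (rw k') A' B' (rw f')"
    and u: "hm K K' u" and v: "hm A A' v" and w: "hm B B' w"
    and vk: "v \<bullet> k = k' \<bullet> u" and wf: "w \<bullet> f = f' \<bullet> v" and vs: "v \<bullet> s = s' \<bullet> w"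
    and ui: "hm K' K ui" "ui \<bullet> u = idt (Car K)" "u \<bullet> ui = idt (Car K')"
    and wi: "hm B' B wi" "wi \<bullet> w = idt (Car B)" "w \<bullet> wi = idt (Car B')"
  shows "\<exists>g. hm A' A g \<and> g \<bullet> v = idt (Car A) \<and> v \<bullet> g = idt (Car A')"
proof -
  note [simp] = hmD(1,2,5-7)[OF f] hmD(5-7)[OF s] hmD(1,5-7)[OF k] hmD(1,2,5-7)[OF f'] hmD(5-7)[OF s'] hmD(1,5-7)[OF k']
    hmD(5-7)[OF u] hmD(5-7)[OF v] hmD(5-7)[OF w] hmD(5-7)[OF ui(1)] hmD(5-7)[OF wi(1)]
  note K = kernel_universal[OF f k ker] and K' = kernel_universal[OF f' k' ker']
  let ?y = "s' \<bullet> f'" and ?i = "idt (Car A')"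
  have cy: "cm A' A' ?y" by (rule cm_cmp[OF hmD(3)[OF f'] hmD(3)[OF s']])
  have ci: "cm A' A' ?i" by (simp add: cm_idt)
  have "f' \<bullet> ?y = f' \<bullet> ?i" using fs'[THEN reduce, of f'] by simp
  note z = mu_diff_kernel[OF f' cy ci this]
  obtain y where y: "cm A' K' y" "k' \<bullet> y = mu A' A' ?i (an A' \<bullet> ?y)" using K'(3)[OF z(1,2)] by blast
  note [simp] = cmD(3-5)[OF y(1)]
  let ?g = "mu A' A (k \<bullet> ui \<bullet> y) (s \<bullet> wi \<bullet> f')"
  have cg: "cm A' A ?g"
    by (intro cm_mu cm_cmp[OF cm_cmp[OF y(1) hmD(3)[OF ui(1)]] hmD(3)[OF k]] cm_cmp[OF cm_cmp[OF hmD(3)[OF f'] hmD(3)[OF wi(1)]] hmD(3)[OF s]]) simp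
  have "v \<bullet> ?g = mu A' A' (k' \<bullet> y) ?y"
    using vk[THEN reduce, of "ui \<bullet> y"] vs[THEN reduce, of "wi \<bullet> f'"] ui(3)[THEN reduce, of y] wi(3)[THEN reduce, of f']
    by (simp add: hm_mu[OF v])
  then have vg: "v \<bullet> ?g = ?i" using y(2) z(3) by simp
  \<comment> \<open>It remains to see that the composite in the other order is the identity: the
    element \<open>?h ?j^{-1}\<close> lies in the kernel of \<open>f\<close>, and \<open>u\<close>
    sends it to the neutral element.\<close>
  let ?h = "?g \<bullet> v" and ?j = "idt (Car A)"
  have ch: "cm A A ?h" and cj: "cm A A ?j" using cm_cmp[OF hmD(3)[OF v] cg] by (simp_all add: cm_idt)
  have vh: "v \<bullet> ?h = v" using vg[THEN reduce, of v] by simp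
  have "w \<bullet> f \<bullet> ?h = w \<bullet> f \<bullet> ?j"
    using wf[THEN reduce, of ?h] wf vh by simp
  then have "wi \<bullet> w \<bullet> f \<bullet> ?h = wi \<bullet> w \<bullet> f \<bullet> ?j" by simp
  then have "f \<bullet> ?h = f \<bullet> ?j" using wi(2)[THEN reduce, of "f \<bullet> ?h"] wi(2)[THEN reduce, of f] by simp
  note d = mu_diff_kernel[OF f cj ch this[symmetric]]
  let ?d = "mu A A ?h (an A \<bullet> ?j)"
  obtain x where x: "cm A K x" "k \<bullet> x = ?d" using K(3)[OF d(1,2)] by blast
  note [simp] = cmD(3-5)[OF x(1)]
  have "k' \<bullet> u \<bullet> x = v \<bullet> ?d" using vk[THEN reduce, of x] x by simp
  also have "\<dots> = mu A A' v (an A' \<bullet> v)"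
    using hm_an[OF v] vh by (simp add: hm_mu[OF v])
  also have "\<dots> = k' \<bullet> e1 A K'"
    using mu_inv(2)[OF _ hmD(3)[OF v]] hm_e1[OF k', of A] by simp
  finally have "u \<bullet> x = e1 A K'"
    by (rule monicD[OF K'(1)]) simp_all
  then have "ui \<bullet> u \<bullet> x = e1 A K" using hm_e1[OF ui(1), of A] by simp
  then have "x = e1 A K" using ui(2)[THEN reduce, of x] by simp
  then have "?d = e1 A A" using x hm_e1[OF k, of A] by simp
  then have "?h = ?j" by (rule mu_an_eq_e1[OF _ ch cj, rotated]) simp
  then show ?thesis
    using hm_inverse[OF v cmD(3-5)[OF cg] _ vg] vg by blast
qed

lemma G_split_short_five: "split_short_five_lemma G"
  unfolding split_short_five_lemma_def
proof (intro allI impI, elim conjE)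
  fix K k A f s B K' k' A' f' s' B' u v w
  assume ker: "is_kernel G K k A B f" and s: "s \<in> Hom G B A" and fs: "f \<cdot>\<^bsub>G\<^esub> s = Ident G B"
    and ker': "is_kernel G K' k' A' B' f'" and s': "s' \<in> Hom G B' A'" and fs': "f' \<cdot>\<^bsub>G\<^esub> s' = Ident G B'"
    and uvw: "u \<in> Hom G K K'" "v \<in> Hom G A A'" "w \<in> Hom G B B'"
    and c: "v \<cdot>\<^bsub>G\<^esub> k = k' \<cdot>\<^bsub>G\<^esub> u" "w \<cdot>\<^bsub>G\<^esub> f = f' \<cdot>\<^bsub>G\<^esub> v" "v \<cdot>\<^bsub>G\<^esub> s = s' \<cdot>\<^bsub>G\<^esub> w"
    and i: "is_iso G K K' u" "is_iso G B B' w"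
  have o: "K \<in> Obj G" "A \<in> Obj G" "B \<in> Obj G" "K' \<in> Obj G" "A' \<in> Obj G" "B' \<in> Obj G"
    and kf: "k \<in> Hom G K A" "f \<in> Hom G A B" "k' \<in> Hom G K' A'" "f' \<in> Hom G A' B'"
    using ker ker' by (simp_all add: is_kernel_def)
  then have h: "hopf A" "hopf B" "hopf A'" "hopf B'" by (simp_all add: Hopf_coc_Obj)
  obtain k1 where k: "hm K A k1" "k = rw k1" using G_HomE[OF o(1,2) kf(1)] .
  obtain f1 where f: "hm A B f1" "f = rw f1" using G_HomE[OF o(2,3) kf(2)] .
  obtain s1 where s: "hm B A s1" "s = rw s1" using G_HomE[OF o(3,2) s] .
  obtain k1' where k': "hm K' A' k1'" "k' = rw k1'" using G_HomE[OF o(4,5) kf(3)] .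
  obtain f1' where f': "hm A' B' f1'" "f' = rw f1'" using G_HomE[OF o(5,6) kf(4)] .
  obtain s1' where s': "hm B' A' s1'" "s' = rw s1'" using G_HomE[OF o(6,5) s'] .
  obtain u1 where u: "hm K K' u1" "u = rw u1" using G_HomE[OF o(1,4) uvw(1)] .
  obtain v1 where v: "hm A A' v1" "v = rw v1" using G_HomE[OF o(2,5) uvw(2)] .
  obtain w1 where w: "hm B B' w1" "w = rw w1" using G_HomE[OF o(3,6) uvw(3)] .
  obtain ui where ui: "hm K' K ui" "ui \<bullet> u1 = idt (Car K)" "u1 \<bullet> ui = idt (Car K')"
    using G_isoE[OF u(1)] i u by blast
  obtain wi where wi: "hm B' B wi" "wi \<bullet> w1 = idt (Car B)" "w1 \<bullet> wi = idt (Car B')"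
    using G_isoE[OF w(1)] i w by blast
  have e: "f1 \<bullet> s1 = idt (Car B)" "f1' \<bullet> s1' = idt (Car B')"
    using fs fs' f s f' s' h rw_hm_cmp[OF s(1) f(1)] rw_hm_cmp[OF s'(1) f'(1)]
      rw_hm_inject[OF hm_cmp[OF s(1) f(1)] hm_idt] rw_hm_inject[OF hm_cmp[OF s'(1) f'(1)] hm_idt] by (simp_all add: rw_idt)
  have c': "v1 \<bullet> k1 = k1' \<bullet> u1" "w1 \<bullet> f1 = f1' \<bullet> v1" "v1 \<bullet> s1 = s1' \<bullet> w1"
    using c k f s k' f' s' u v w rw_hm_cmp[OF k(1) v(1)] rw_hm_cmp[OF u(1) k'(1)] rw_hm_cmp[OF f(1) w(1)] rw_hm_cmp[OF v(1) f'(1)]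
      rw_hm_cmp[OF s(1) v(1)] rw_hm_cmp[OF w(1) s'(1)]
      rw_hm_inject[OF hm_cmp[OF k(1) v(1)] hm_cmp[OF u(1) k'(1)]] rw_hm_inject[OF hm_cmp[OF f(1) w(1)] hm_cmp[OF v(1) f'(1)]]
      rw_hm_inject[OF hm_cmp[OF s(1) v(1)] hm_cmp[OF w(1) s'(1)]] by simp_all
  obtain g where g: "hm A' A g" "g \<bullet> v1 = idt (Car A)" "v1 \<bullet> g = idt (Car A')"
    using split_short_five[OF f(1) s(1) e(1) k(1) _ f'(1) s'(1) e(2) k'(1) _ u(1) v(1) w(1) c' ui wi]
      ker ker' k f k' f' by blast
  then have "is_inverse G A A' v (rw g)"
    using v rw_hm_cmp[OF v(1) g(1)] rw_hm_cmp[OF g(1) v(1)] hm_Hom[OF g(1)] h by (simp add: is_inverse_def rw_idt)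
  then show "is_iso G A A' v" using uvw(2) by (auto simp: is_iso_def)
qed


end

theorem theorem8p3:
  fixes M :: "('o, 'm, 'z) monoidal_category_scheme"
  assumes "abelian_symmetric_monoidal_category M"
    and "faithful_coflatness M"
    and "faithful_flatness M"
  shows "is_exact_category (Hopf_coc M) \<and> is_homological (Hopf_coc M) \<and>
    (has_binary_coproducts (Hopf_coc M) \<longrightarrow> is_semi_abelian (Hopf_coc M))"
proof -
  interpret abelian_symmetric_monoidal_category M by fact
  have p: "pointed (Hopf_coc M)"
    using zero_object_unith by (auto simp: pointed_def)
  moreover have "is_pointed_protomodular (Hopf_coc M)"
    using p Hopf_coc_category G_finite_limits G_split_short_five by (simp add: is_pointed_protomodular_def)
  moreover note G_exact[OF assms(2,3)] G_regular[OF assms(2)]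
  ultimately show ?thesis by (simp add: is_homological_def is_semi_abelian_def)
qed

end
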